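(* Let $d\in\{1,2,3\}$, $\Omega=[0,1]^d$, $T>0$, and assume $\alpha>7$. Let $\boldsymbol m_e\in C^4([0,T];C^0)\cap C^3([0,T];C^1)\cap L^\infty([0,T];C^6)$ (spatial spaces over $\overline\Omega$), with $|\boldsymbol m_e|\equiv 1$, be the exact solution on $\Omega\times[0,T]$ of the Landau-Lifshitz-Gilbert equation $$\boldsymbol m_t=-\boldsymbol m\times\Delta\boldsymbol m-\alpha\,\boldsymbol m\times(\boldsymbol m\times\Delta\boldsymbol m),\qquad \frac{\partial \boldsymbol m}{\partial\nu}\Big|_{\partial\Omega}=0,$$ with initial data $\boldsymbol m_e(\boldsymbol x,0)=\boldsymbol m_e^0(\boldsymbol x)$. For mesh size $h=1/N$ and time step $k>0$, put $t^n=nk$, and let $\boldsymbol m_{e,h}^n$ denote the point-wise restriction of $\boldsymbol m_e(\cdot,t^n)$ to the cell-centered grid. Let $\boldsymbol m_h^n$ be the numerical solution, with the initial data $\boldsymbol m_h^0=\boldsymbol m_{e,h}^0$, $\boldsymbol m_h^1=\boldsymbol m_{e,h}^1$ and $\boldsymbol m_h^2=\boldsymbol m_{e,h}^2$, of the following linear third-order BDF projection scheme, in which $\tilde{\boldsymbol m}_h^n$ denotes the intermediate (pre-projection) field: for $n\ge 0$, $$\hat{\boldsymbol m}_h^{n+3}=3\boldsymbol m_h^{n+2}-3\boldsymbol m_h^{n+1}+\boldsymbol m_h^n,\qquad \hat{\tilde{\boldsymbol m}}_h^{n+3}=3\tilde{\boldsymbol m}_h^{n+2}-3\tilde{\boldsymbol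 m}_h^{n+1}+\tilde{\boldsymbol m}_h^n,$$ $$\frac{\frac{11}{6}\tilde{\boldsymbol m}_h^{n+3}-3\tilde{\boldsymbol m}_h^{n+2}+\frac32\tilde{\boldsymbol m}_h^{n+1}-\frac13\tilde{\boldsymbol m}_h^n}{k}=-\hat{\boldsymbol m}_h^{n+3}\times\Delta_{h,(4)}\hat{\tilde{\boldsymbol m}}_h^{n+3}+\alpha\Delta_{h,(4)}\tilde{\boldsymbol m}_h^{n+3}+\alpha\,|\tilde\nabla_{h,(4)}\hat{\boldsymbol m}_h^{n+3}|^2\,\hat{\boldsymbol m}_h^{n+3},$$ $$\boldsymbol m_h^{n+3}=\frac{\tilde{\boldsymbol m}_h^{n+3}}{|\tilde{\boldsymbol m}_h^{n+3}|}\quad\text{(point-wise)},$$ with the discrete Neumann (symmetric ghost-point) boundary condition. Suppose that the initial error satisfies $$\|\boldsymbol m_{e,h}^\ell-\boldsymbol m_h^\ell\|_2+\|\nabla_h(\boldsymbol m_{e,h}^\ell-\boldsymbol m_h^\ell)\|_2=\mathcal O(k^3+h^4),\qquad \ell=0,1,2,$$ and that $k\le \mathcal C_0h$, where $\mathcal C_0>0$ is a fixed constant. Then the following convergence result holds as $h$ and $k$ go to zero: $$\|\boldsymbol m_{e,h}^n-\boldsymbol m_h^n\|_2+\|\nabla_h(\boldsymbol m_{e,h}^n-\boldsymbol m_h^n)\|_2\le \mathcal C\,(k^3+h^4)\qquad\text{for all } n\ge 3 \text{ with } n\le\lfloor T/k\rfloor,$$ in which the constant $\mathcal C>0$ is independent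 of $k$ and $h$.
   Context: Grid. $N$ is a positive integer, $h=1/N$ (the same in every coordinate direction). Grid functions are defined at the cell centers with coordinates $\hat x_i=(i-\frac12)h$, $1\le i\le N$, in each of the $d$ directions; values at the ghost indices $-1,0,N+1,N+2$ in each direction are defined by symmetric extension. For $d=3$, a grid function is written $f_{i,j,l}$ and in the $z$ direction the discrete boundary condition reads $$f_{i,j,0}=f_{i,j,1},\quad f_{i,j,-1}=f_{i,j,2},\quad f_{i,j,N+1}=f_{i,j,N},\quad f_{i,j,N+2}=f_{i,j,N-1},$$ and analogously in the other directions. This condition is imposed on $\tilde{\boldsymbol m}_h^{n+3}$ in the scheme, and ghost values of the other grid functions are given by the same extension. Difference operators. In the $x$ direction (suppressing the other indices), $$\mathcal D^1_{x,(4)}f_i=\frac{f_{i-2}-8f_{i-1}+8f_{i+1}-f_{i+2}}{12h},\qquad \mathcal D^2_{x,(4)}f_i=\frac{-f_{i-2}+16f_{i-1}-30f_i+16f_{i+1}-f_{i+2}}{12h^2},$$ and similarly in the other directions. $\Delta_{h,(4)}$ is the sum of the operators $\mathcal D^2_{\cdot,(4)}$ over the $d$ coordinate directions (for $d=3$: $\mathcal D^2_{x,(4)}+\mathcal D^2_{y,(4)}+\mathcal D^2_{z,(4)}$), applied componentwise to vector grid functions. For $\boldsymbol f_h=(f_1,f_2,f_3)^T$, $$|\tilde\nabla_{h,(4)}\boldsymbol f_h|^2=\sum_{\ell=1}^3\Big((\mathcal D^1_{x,(4)}f_\ell)^2+(\mathcal D^1_{y,(4)}f_\ell)^2+(\mathcal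 D^1_{z,(4)}f_\ell)^2\Big)$$ (with only the existing coordinate directions when $d<3$). Norms. $\langle \boldsymbol f_h,\boldsymbol g_h\rangle=h^d\sum_{\mathcal I\in\Lambda_d}\boldsymbol f_{\mathcal I}\cdot\boldsymbol g_{\mathcal I}$, where $\Lambda_d=\{1,\dots,N\}^d$ is the index set of the grid points, and $\|\boldsymbol f_h\|_2=\langle\boldsymbol f_h,\boldsymbol f_h\rangle^{1/2}$. $\nabla_h$ is the standard second-order discrete gradient, whose components are the nearest-neighbour differences, e.g. $(D_xf)_{i+1/2}=(f_{i+1}-f_i)/h$, located at cell faces; $\|\nabla_h\boldsymbol f_h\|_2^2$ is $h^d$ times the sum of the squares of all these differences over all faces, directions and vector components (differences across boundary faces vanish by the symmetric extension). $\nu$ is the unit outward normal on $\partial\Omega$, $|\cdot|$ is the Euclidean norm on $\mathbb R^3$, and $\times$ is the cross product in $\mathbb R^3$. *)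

theory Defs
  imports "HOL-Analysis.Analysis"
begin

section \<open>The domain and the function spaces\<close>

text \<open>
  The spatial dimension is the cardinality of the index type \<open>'d\<close>.
\<close>

definition unit_cube :: "(real^'d) set" where
  "unit_cube = {x. \<forall>i. 0 \<le> x $ i \<and> x $ i \<le> 1}"

text \<open>
  Partial derivatives are taken within the closed cube, so they are one-sided at the
  boundary, and depend only on the values on the cube.
\<close>

definition line_dom :: "'d \<Rightarrow> real^'d \<Rightarrow> real set" where
  "line_dom i x = {s. x + s *\<^sub>R axis i 1 \<in> unit_cube}"

definition partial :: "'d \<Rightarrow> (real^'d \<Rightarrow> real^3) \<Rightarrow> real^'d \<Rightarrow> real^3" where
  "partial i f x = vector_derivative (\<lambda>s. f (x + s *\<^sub>R axis i 1)) (at 0 within line_dom i x)"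

abbreviation partials :: "'d list \<Rightarrow> (real^'d \<Rightarrow> real^3) \<Rightarrow> real^'d \<Rightarrow> real^3" where
  "partials is f \<equiv> foldr partial is f"

text \<open>
  \<open>C_space j f\<close>: \<open>f\<close> belongs to \<open>C\<^sup>j\<close> of the closed cube, i.e. all partial derivatives up
  to order \<open>j\<close> exist and are continuous on the closed cube; \<open>C_norm j\<close> is the norm of that space.
\<close>

definition C_space :: "nat \<Rightarrow> (real^'d \<Rightarrow> real^3) \<Rightarrow> bool" where
  "C_space j f \<longleftrightarrow>
     (\<forall>is. length is < j \<longrightarrow> (\<forall>i. \<forall>x\<in>unit_cube.
        (\<lambda>s. partials is f (x + s *\<^sub>R axis i 1)) differentiable (at 0 within line_dom i x))) \<and>
     (\<forall>is. length is \<le> j \<longrightarrow> continuous_on unit_cube (partials is f))"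

definition C_norm :: "nat \<Rightarrow> (real^'d \<Rightarrow> real^3) \<Rightarrow> real" where
  "C_norm j f = Max ((\<lambda>is. SUP x\<in>unit_cube. norm (partials is f x)) ` {is. length is \<le> j})"

text \<open>
  \<open>C_time T p j u\<close>: \<open>u \<in> C\<^sup>p([0,T]; C\<^sup>j)\<close>; \<open>v q\<close> is the \<open>q\<close>-th time derivative of \<open>u\<close>, the
  limits of the difference quotients being taken in the norm of \<open>C\<^sup>j\<close>.
\<close>

definition C_time :: "real \<Rightarrow> nat \<Rightarrow> nat \<Rightarrow> (real \<Rightarrow> real^'d \<Rightarrow> real^3) \<Rightarrow> bool" where
  "C_time T p j u \<longleftrightarrow> (\<exists>v :: nat \<Rightarrow> real \<Rightarrow> real^'d \<Rightarrow> real^3.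
     (\<forall>t\<in>{0..T}. \<forall>x\<in>unit_cube. v 0 t x = u t x) \<and>
     (\<forall>q\<le>p. \<forall>t\<in>{0..T}. C_space j (v q t)) \<and>
     (\<forall>q<p. \<forall>t\<in>{0..T}.
        ((\<lambda>s. C_norm j (\<lambda>x. (1 / (s - t)) *\<^sub>R (v q s x - v q t x) - v (Suc q) t x)) \<longlongrightarrow> 0)
          (at t within {0..T})) \<and>
     (\<forall>t\<in>{0..T}. ((\<lambda>s. C_norm j (\<lambda>x. v p s x - v p t x)) \<longlongrightarrow> 0) (at t within {0..T})))"

text \<open>
  \<open>Linf_time T j u\<close>: \<open>u \<in> L\<^sup>\<infinity>([0,T]; C\<^sup>j)\<close>, in the sense of Bochner: essentially bounded, and
  strongly measurable, i.e. almost everywhere the limit in \<open>C\<^sup>j\<close> of simple functions.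
\<close>

definition Linf_time :: "real \<Rightarrow> nat \<Rightarrow> (real \<Rightarrow> real^'d \<Rightarrow> real^3) \<Rightarrow> bool" where
  "Linf_time T j u \<longleftrightarrow>
     (\<exists>B. AE t in lebesgue. t \<in> {0..T} \<longrightarrow> C_space j (u t) \<and> C_norm j (u t) \<le> B) \<and>
     (\<exists>\<sigma> :: nat \<Rightarrow> real \<Rightarrow> real^'d \<Rightarrow> real^3.
        (\<forall>r. finite (\<sigma> r ` {0..T}) \<and> (\<forall>t\<in>{0..T}. C_space j (\<sigma> r t)) \<and>
             (\<forall>g. {t\<in>{0..T}. \<sigma> r t = g} \<in> sets lebesgue)) \<and>
        (AE t in lebesgue. t \<in> {0..T} \<longrightarrow>
             (\<lambda>r. C_norm j (\<lambda>x. \<sigma> r t x - u t x)) \<longlonglongrightarrow> 0))"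

section \<open>The Landau-Lifshitz-Gilbert equation\<close>

definition laplacian :: "(real^'d \<Rightarrow> real^3) \<Rightarrow> real^'d \<Rightarrow> real^3" where
  "laplacian f x = (\<Sum>i\<in>UNIV. partial i (partial i f) x)"

text \<open>
  On an edge or at a corner, the normals of all the faces containing the point are taken.
\<close>

definition outward_normals :: "real^'d \<Rightarrow> (real^'d) set" where
  "outward_normals x = {axis i 1 |i. x $ i = 1} \<union> {- axis i 1 |i. x $ i = 0}"

definition normal_derivative :: "real^'d \<Rightarrow> (real^'d \<Rightarrow> real^3) \<Rightarrow> real^'d \<Rightarrow> real^3" where
  "normal_derivative \<nu> f x = (\<Sum>i\<in>UNIV. \<nu> $ i *\<^sub>R partial i f x)"

definition LLG_solution :: "real \<Rightarrow> real \<Rightarrow> (real^'d \<Rightarrow> real^3) \<Rightarrow> (real \<Rightarrow> real^'d \<Rightarrow> real^3) \<Rightarrow> bool"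
  where
  "LLG_solution T \<alpha> u0 u \<longleftrightarrow>
     (\<forall>t\<in>{0..T}. C_space 2 (u t)) \<and>
     (\<forall>t\<in>{0..T}. \<forall>x\<in>unit_cube.
        ((\<lambda>s. u s x) has_vector_derivative
           (- cross3 (u t x) (laplacian (u t) x)
            - \<alpha> *\<^sub>R cross3 (u t x) (cross3 (u t x) (laplacian (u t) x))))
        (at t within {0..T})) \<and>
     (\<forall>t\<in>{0..T}. \<forall>x\<in>unit_cube. \<forall>\<nu>\<in>outward_normals x. normal_derivative \<nu> (u t) x = 0) \<and>
     (\<forall>x\<in>unit_cube. u 0 x = u0 x)"

section \<open>Grid functions and difference operators\<close>

text \<open>
  A grid function is a function on all of \<open>\<int>\<^sup>d\<close>, of which only the values on \<open>grid N\<close> matter: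
  the operators below are applied to its symmetric extension \<open>ext N f\<close>.
\<close>

definition mesh :: "nat \<Rightarrow> real" where
  "mesh N = 1 / real N"

definition grid :: "nat \<Rightarrow> (int^'d) set" where
  "grid N = {I. \<forall>i. 1 \<le> I $ i \<and> I $ i \<le> int N}"

definition cell_center :: "nat \<Rightarrow> int^'d \<Rightarrow> real^'d" where
  "cell_center N I = (\<chi> i. (real_of_int (I $ i) - 1/2) * mesh N)"

definition restrict_grid :: "nat \<Rightarrow> (real^'d \<Rightarrow> real^3) \<Rightarrow> int^'d \<Rightarrow> real^3" where
  "restrict_grid N u I = u (cell_center N I)"

text \<open>
  \<open>reflect N\<close> is the \<open>2N\<close>-periodic index map that is the identity on \<open>{1..N}\<close> and symmetric
  about \<open>1/2\<close> and \<open>N + 1/2\<close>; the lemmas below give the ghost-point relations.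
\<close>

definition reflect :: "nat \<Rightarrow> int \<Rightarrow> int" where
  "reflect N j = (let r = (j - 1) mod (2 * int N) in if r < int N then r + 1 else 2 * int N - r)"

definition ext :: "nat \<Rightarrow> (int^'d \<Rightarrow> real^3) \<Rightarrow> int^'d \<Rightarrow> real^3" where
  "ext N f I = f (\<chi> i. reflect N (I $ i))"

lemma reflect_interior: "1 \<le> j \<Longrightarrow> j \<le> int N \<Longrightarrow> reflect N j = j"
  by (simp add: reflect_def)

lemma reflect_range:
  assumes "N \<ge> 1" shows "1 \<le> reflect N j \<and> reflect N j \<le> int N"
proof -
  have "0 \<le> (j - 1) mod (2 * int N)" "(j - 1) mod (2 * int N) < 2 * int N"
    using assms by simp_all
  then show ?thesis by (simp add: reflect_def Let_def)
qed

lemma reflect_left: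
  assumes "N \<ge> 1" shows "reflect N (1 - j) = reflect N j"
proof -
  define M where "M = 2 * int N"
  define r where "r = (j - 1) mod M"
  have M: "M > 0" and r: "0 \<le> r" "r < M" using assms by (simp_all add: M_def r_def)
  have "(1 - j - 1) mod M = (- 1 - (j - 1)) mod M" by simp
  also have "\<dots> = (- 1 - r) mod M" unfolding r_def by (simp only: mod_diff_right_eq)
  also have "\<dots> = (M - 1 - r) mod M"
    using mod_add_self2[of "- 1 - r" M] by (simp add: algebra_simps)
  also have "\<dots> = M - 1 - r" using r by (intro mod_pos_pos_trivial) auto
  finally show ?thesis
    unfolding reflect_def M_def[symmetric] r_def[symmetric] Let_def by (auto simp: M_def)
qed

lemma reflect_right:
  assumes "N \<ge> 1" shows "reflect N (int N + j) = reflect N (int N + 1 - j)"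
proof -
  have "reflect N (int N + j) = reflect N (1 - (int N + j))"
    using reflect_left[OF assms] by simp
  also have "\<dots> = reflect N (int N + 1 - j)"
  proof -
    have "(int N + 1 - j - 1) mod (2 * int N) = ((1 - (int N + j) - 1) + 2 * int N) mod (2 * int N)"
      by (simp add: algebra_simps)
    also have "\<dots> = (1 - (int N + j) - 1) mod (2 * int N)" by (rule mod_add_self2)
    finally show ?thesis by (simp only: reflect_def)
  qed
  finally show ?thesis .
qed

lemma reflect_ghost:
  assumes "N \<ge> 1"
  shows "reflect N 0 = reflect N 1" "reflect N (- 1) = reflect N 2"
    "reflect N (int N + 1) = reflect N (int N)" "reflect N (int N + 2) = reflect N (int N - 1)"
  using reflect_left[OF assms, of 1] reflect_left[OF assms, of 2]
    reflect_right[OF assms, of 1] reflect_right[OF assms, of 2] by simp_all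

definition D1_4 :: "nat \<Rightarrow> 'd \<Rightarrow> (int^'d \<Rightarrow> real^3) \<Rightarrow> int^'d \<Rightarrow> real^3" where
  "D1_4 N i f I = (1 / (12 * mesh N)) *\<^sub>R
     (ext N f (I - axis i 2) - 8 *\<^sub>R ext N f (I - axis i 1)
      + 8 *\<^sub>R ext N f (I + axis i 1) - ext N f (I + axis i 2))"

definition D2_4 :: "nat \<Rightarrow> 'd \<Rightarrow> (int^'d \<Rightarrow> real^3) \<Rightarrow> int^'d \<Rightarrow> real^3" where
  "D2_4 N i f I = (1 / (12 * (mesh N)\<^sup>2)) *\<^sub>R
     (- ext N f (I - axis i 2) + 16 *\<^sub>R ext N f (I - axis i 1) - 30 *\<^sub>R ext N f I
      + 16 *\<^sub>R ext N f (I + axis i 1) - ext N f (I + axis i 2))"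

definition Lap_4 :: "nat \<Rightarrow> (int^'d \<Rightarrow> real^3) \<Rightarrow> int^'d \<Rightarrow> real^3" where
  "Lap_4 N f I = (\<Sum>i\<in>UNIV. D2_4 N i f I)"

definition grad_sq_4 :: "nat \<Rightarrow> (int^'d \<Rightarrow> real^3) \<Rightarrow> int^'d \<Rightarrow> real" where
  "grad_sq_4 N f I = (\<Sum>l\<in>UNIV. \<Sum>i\<in>UNIV. (D1_4 N i f I $ l)\<^sup>2)"

definition grid_inner :: "nat \<Rightarrow> (int^'d \<Rightarrow> real^3) \<Rightarrow> (int^'d \<Rightarrow> real^3) \<Rightarrow> real" where
  "grid_inner N f g = mesh N ^ CARD('d) * (\<Sum>I\<in>grid N. f I \<bullet> g I)"

definition grid_norm :: "nat \<Rightarrow> (int^'d \<Rightarrow> real^3) \<Rightarrow> real" where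
  "grid_norm N f = sqrt (grid_inner N f f)"

text \<open>
  The face in direction \<open>i\<close> between the cells \<open>I\<close> and \<open>I + e\<^sub>i\<close> is indexed by \<open>I\<close>.
\<close>

definition faces :: "nat \<Rightarrow> 'd \<Rightarrow> (int^'d) set" where
  "faces N i = {I. 0 \<le> I $ i \<and> I $ i \<le> int N \<and> (\<forall>j. j \<noteq> i \<longrightarrow> 1 \<le> I $ j \<and> I $ j \<le> int N)}"

definition grad_norm :: "nat \<Rightarrow> (int^'d \<Rightarrow> real^3) \<Rightarrow> real" where
  "grad_norm N f = sqrt (mesh N ^ CARD('d) *
     (\<Sum>i\<in>UNIV. \<Sum>I\<in>faces N i. \<Sum>l\<in>UNIV.
        (((ext N f (I + axis i 1) $ l) - (ext N f I $ l)) / mesh N)\<^sup>2))"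

section \<open>The third-order BDF projection scheme\<close>

definition extrap :: "(nat \<Rightarrow> int^'d \<Rightarrow> real^3) \<Rightarrow> nat \<Rightarrow> int^'d \<Rightarrow> real^3" where
  "extrap f n I = 3 *\<^sub>R f (n + 2) I - 3 *\<^sub>R f (n + 1) I + f n I"

text \<open>
  \<open>m\<close> is the numerical solution and \<open>mt\<close> the intermediate field. No projection takes place at
  the three starting levels, so there \<open>mt\<close> is \<open>m\<close>. In the projection step, \<open>m\<close> is \<open>0\<close> at a point
  where \<open>mt\<close> happens to vanish (division by zero), so a solution in this sense exists without
  a non-degeneracy hypothesis.
\<close>

definition BDF3_solution ::
  "nat \<Rightarrow> real \<Rightarrow> real \<Rightarrow> (nat \<Rightarrow> int^'d \<Rightarrow> real^3) \<Rightarrow> (nat \<Rightarrow> int^'d \<Rightarrow> real^3) \<Rightarrow> bool" where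
  "BDF3_solution N k \<alpha> m mt \<longleftrightarrow>
     (\<forall>n\<le>2. \<forall>I\<in>grid N. mt n I = m n I) \<and>
     (\<forall>n. \<forall>I\<in>grid N.
        (1 / k) *\<^sub>R ((11/6) *\<^sub>R mt (n + 3) I - 3 *\<^sub>R mt (n + 2) I
                    + (3/2) *\<^sub>R mt (n + 1) I - (1/3) *\<^sub>R mt n I)
        = - cross3 (extrap m n I) (Lap_4 N (extrap mt n) I)
          + \<alpha> *\<^sub>R Lap_4 N (mt (n + 3)) I
          + (\<alpha> * grad_sq_4 N (extrap m n) I) *\<^sub>R extrap m n I) \<and>
     (\<forall>n. \<forall>I\<in>grid N. m (n + 3) I = (1 / norm (mt (n + 3) I)) *\<^sub>R mt (n + 3) I)"

text \<open>The error at time level \<open>n\<close>, with \<open>t\<^sup>n = n k\<close>.\<close>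

definition error ::
  "nat \<Rightarrow> real \<Rightarrow> (real \<Rightarrow> real^'d \<Rightarrow> real^3) \<Rightarrow> (nat \<Rightarrow> int^'d \<Rightarrow> real^3) \<Rightarrow> nat \<Rightarrow> real" where
  "error N k u m n =
     (let e = (\<lambda>I. restrict_grid N (u (real n * k)) I - m n I)
      in grid_norm N e + grad_norm N e)"

end

theory Submission
  imports Defs
begin

text \<open>
  The symmetric ghost-point extension turns grid functions into even, \<open>2N\<close>-periodic functions on
  \<open>\<int>\<^sup>d\<close>, where summation by parts is invariance of a sum under shifts. The error \<open>e\<close> of the
  unprojected field is tested with \<open>(I - \<Delta>\<^sub>h) (e\<^sup>n\<^sup>+\<^sup>3 - 1/2 e\<^sup>n\<^sup>+\<^sup>2)\<close>: for this multiplier BDF3 is G-stable, and,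
  with \<open>a\<close> the discrete Laplacian of \<open>e\<close>, the explicit cross product term is absorbed because
  \<open>7 a\<^sub>3 \<bullet> (a\<^sub>3 - 1/2 a\<^sub>2) - \<bar>3 a\<^sub>2 - 3 a\<^sub>1 + a\<^sub>0\<bar> \<bar>a\<^sub>3 - 1/2 a\<^sub>2\<bar>\<close> dominates a telescoping difference.
  This is where \<open>\<alpha> > 7\<close> enters. The projection is stable in the discrete \<open>H\<^sup>1\<close> norm as long as the
  errors are pointwise small, which an inverse inequality and \<open>k \<le> C\<^sub>0 h\<close> propagate along the
  induction in time, and a discrete Gronwall inequality concludes.

  For the consistency error, solving the equation for \<open>\<Delta> m\<close> (the map \<open>w \<mapsto> \<alpha> w - m \<times> w\<close> is invertible)
  shows that \<open>\<Delta> m\<close> is as smooth in time as \<open>m\<^sub>t\<close> and \<open>\<nabla> m\<close>. Fourth order up to the boundary needs the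
  normal derivatives of orders 1, 3 and 5 of \<open>m\<close> to vanish on the faces, so that the even extension
  of \<open>m\<close> is smooth across them. The third one follows from the equation and the Neumann condition for
  \<open>m\<close> and \<open>m\<^sub>t\<close>; the fifth one also needs the third one of \<open>m\<^sub>t\<close>, which is obtained by
  differentiating a third-order difference quotient of \<open>m\<close> in time. All this holds at almost every
  time, where \<open>m\<close> is of class \<open>C\<^sup>6\<close> in space; the estimates extend to all times by continuity.
\<close>

section \<open>Multiplier estimates and a Gronwall inequality\<close>

text \<open>BDF3 is not A-stable, so by Dahlquist's equivalence it is not G-stable: tested with the
  new level alone no quadratic form telescopes, and the multiplier has to contain a share of the
  previous level. Control of the gradient is needed because the squared gradient term and the
  projection both feed first differences of the error back into the scheme. The explicit cross
  product has as many derivatives as the implicit diffusion, so Gronwall cannot handle it. It is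
  beaten by the size of \<alpha> = 7 (1 + \<epsilon>) + \<beta>: the first share pays for a cross
  product with a field of length up to 1 + \<epsilon>, the second leaves true dissipation for the
  remaining terms. Pointwise smallness can be propagated because the error is O(h^3) in the H^1 norm
  while the inverse inequality costs only h^(-3/2) for d <= 3. It is required at old levels only,
  the scheme being linear in the new one. At the boundary the obstacle is that the third normal
  derivative of m is at hand only at almost every time, so its vanishing cannot simply be
  differentiated in time. A difference quotient makes sense at every time and replaces it.\<close>

definition bdf3 :: "'a::real_vector \<Rightarrow> 'a \<Rightarrow> 'a \<Rightarrow> 'a \<Rightarrow> 'a" where
  "bdf3 x3 x2 x1 x0 = (11/6) *\<^sub>R x3 - 3 *\<^sub>R x2 + (3/2) *\<^sub>R x1 - (1/3) *\<^sub>R x0"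

text \<open>
  \<open>G_form\<close> and \<open>H_form\<close> are read off factorisations \<open>p(z) + p(1/z) = q(z) q(1/z) + \<dots>\<close> of the symbols of the
  quadratic forms in \<open>bdf3_G_stable\<close> and \<open>extrapolation_dissipation\<close>; the remainders are the
  squares that appear in the proofs.
\<close>

definition G_form :: "'a::real_inner \<Rightarrow> 'a \<Rightarrow> 'a \<Rightarrow> real" where
  "G_form x y z = ((norm (2 *\<^sub>R z + 4 *\<^sub>R x - 5 *\<^sub>R y))\<^sup>2 + (norm (2 *\<^sub>R y - 3 *\<^sub>R x))\<^sup>2 + 4 * (norm x)\<^sup>2) / 24"

definition H_form :: "'a::real_inner \<Rightarrow> 'a \<Rightarrow> 'a \<Rightarrow> real" where
  "H_form x y z = ((norm (3 *\<^sub>R z + 9 *\<^sub>R x - 9 *\<^sub>R y))\<^sup>2 + (norm (6 *\<^sub>R y - (9/2) *\<^sub>R x))\<^sup>2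
     + (819/4) * (norm x)\<^sup>2) / 84"

lemma G_form_lower: "(norm x)\<^sup>2 / 6 \<le> G_form x y z"
  by (simp add: G_form_def)

lemma H_form_nonneg: "0 \<le> H_form x y z"
  by (simp add: H_form_def)

text \<open>The two sides differ by two squares, with weights 1/6 and 11/24. This is G-stability
  with a multiplier in the manner of Nevanlinna and Odeh.\<close>

lemma bdf3_G_stable:
  fixes x0 x1 x2 x3 :: "'a::real_inner"
  shows "G_form x3 x2 x1 - G_form x2 x1 x0 \<le> bdf3 x3 x2 x1 x0 \<bullet> (x3 - (1/2) *\<^sub>R x2)"
proof -
  have "bdf3 x3 x2 x1 x0 \<bullet> (x3 - (1/2) *\<^sub>R x2) = G_form x3 x2 x1 - G_form x2 x1 x0
     + (1/6) * (norm (x3 - (5/2) *\<^sub>R x2 + (5/2) *\<^sub>R x1 - x0))\<^sup>2 + (11/24) * (norm (x3 - x2))\<^sup>2"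
    unfolding bdf3_def G_form_def power2_norm_eq_inner
    by (simp add: inner_simps inner_commute field_simps)
  then show ?thesis by simp
qed

text \<open>
  The weights \<open>3/28\<close> and \<open>7/3\<close>, with \<open>4 \<cdot> 3/28 \<cdot> 7/3 = 1\<close>, are those of Young's inequality for the
  product \<open>\<bar>3 a\<^sub>2 - 3 a\<^sub>1 + a\<^sub>0\<bar> \<bar>a\<^sub>3 - 1/2 a\<^sub>2\<bar>\<close>.
\<close>

lemma extrapolation_dissipation:
  fixes a0 a1 a2 a3 :: "'a::real_inner"
  shows "H_form a3 a2 a1 - H_form a2 a1 a0
    \<le> 7 * (a3 \<bullet> (a3 - (1/2) *\<^sub>R a2)) - (3/28) * (norm (3 *\<^sub>R a2 - 3 *\<^sub>R a1 + a0))\<^sup>2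
       - (7/3) * (norm (a3 - (1/2) *\<^sub>R a2))\<^sup>2"
proof -
  have "7 * (a3 \<bullet> (a3 - (1/2) *\<^sub>R a2)) - (3/28) * (norm (3 *\<^sub>R a2 - 3 *\<^sub>R a1 + a0))\<^sup>2
       - (7/3) * (norm (a3 - (1/2) *\<^sub>R a2))\<^sup>2 = H_form a3 a2 a1 - H_form a2 a1 a0
     + (27 * (norm (a3 - a1))\<^sup>2 + 59 * (norm (a3 + a2))\<^sup>2) / 84"
    unfolding H_form_def power2_norm_eq_inner
    by (simp add: inner_simps inner_commute field_simps)
  then show ?thesis by simp
qed

lemma sum_shift_le:
  fixes z :: "nat \<Rightarrow> real"
  assumes "\<And>j. 0 \<le> z j" "i \<le> 3"
  shows "(\<Sum>m<n. z (m + i)) \<le> (\<Sum>j\<le>n + 2. z j)"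
proof -
  have "(\<Sum>m<n. z (m + i)) = sum z ((\<lambda>m. m + i) ` {..<n})"
    by (subst sum.reindex) (auto simp: inj_on_def)
  also have "\<dots> \<le> sum z {..n+2}"
    using assms by (intro sum_mono2) auto
  finally show ?thesis .
qed

text \<open>The sum includes the current term \<open>y n\<close>. As q <= 1/2, half of
  \<open>y n\<close> absorbs it, which doubles both constants and leaves an explicit
  recursion.\<close>

lemma discrete_gronwall:
  fixes y :: "nat \<Rightarrow> real"
  assumes "0 \<le> q" "q \<le> 1/2" "0 \<le> b" "\<And>j. 0 \<le> y j"
    and y: "\<And>n. n \<le> M \<Longrightarrow> y n \<le> b + q * (\<Sum>j\<le>n. y j)"
    and "n \<le> M"
  shows "y n \<le> 2 * b * exp (2 * q * real n)"
proof -
  have 1: "y n \<le> 2 * b + 2 * q * (\<Sum>j<n. y j)" if "n \<le> M" for n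
  proof -
    have "y n \<le> b + q * (\<Sum>j<n. y j) + q * y n"
      using y[OF that] by (simp add: lessThan_Suc_atMost[symmetric] algebra_simps)
    moreover have "q * y n \<le> 1/2 * y n" using assms by (intro mult_right_mono) auto
    ultimately show ?thesis by linarith
  qed
  have 2: "y n \<le> 2 * b * (1 + 2 * q) ^ n" if "n \<le> M" for n
    using that
  proof (induction n rule: less_induct)
    case (less n)
    \<comment> \<open>Geometric sum: the bound \<open>2 * b * (1 + 2 * q) ^ n\<close> reproduces
      itself exactly under the explicit recursion.\<close>
    have g: "2 * q * (\<Sum>j<n. (1 + 2 * q) ^ j) = (1 + 2 * q) ^ n - 1"
      by (induction n) (auto simp: algebra_simps)
    have "(\<Sum>j<n. y j) \<le> (\<Sum>j<n. 2 * b * (1 + 2 * q) ^ j)"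
      using less by (intro sum_mono) auto
    then have "2 * q * (\<Sum>j<n. y j) \<le> 2 * q * (\<Sum>j<n. 2 * b * (1 + 2 * q) ^ j)"
      using assms by (intro mult_left_mono) auto
    also have "\<dots> = 2 * b * (2 * q * (\<Sum>j<n. (1 + 2 * q) ^ j))"
      by (simp add: sum_distrib_left mult_ac)
    also have "\<dots> = 2 * b * (1 + 2 * q) ^ n - 2 * b"
      unfolding g by (simp add: algebra_simps)
    finally show ?case using 1[OF less.prems] by linarith
  qed
  have "(1 + 2 * q) ^ n \<le> exp (2 * q) ^ n"
    using assms by (intro power_mono exp_ge_add_one_self) auto
  also have "\<dots> = exp (2 * q * real n)" by (simp add: exp_of_nat_mult[symmetric] mult_ac)
  finally have "2 * b * (1 + 2 * q) ^ n \<le> 2 * b * exp (2 * q * real n)"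
    using assms by (intro mult_left_mono) auto
  then show ?thesis using 2[OF \<open>n \<le> M\<close>] by linarith
qed

text \<open>On summing over n, each of the four shifted copies of z on the right is at most the full
  sum; as z vanishes at the three starting levels, the left side carries 4 \<theta> times that same
  sum, and the two cancel. What remains fits the implicit Gronwall inequality with q = 4 k C / c,
  and \<open>8 * k * C \<le> c\<close> says that q <= 1/2.\<close>

lemma bdf3_energy_gronwall:
  fixes energy y z :: "nat \<Rightarrow> real"
  assumes pos: "0 < c" "0 \<le> \<theta>" "0 \<le> C" "0 < k" "0 \<le> \<tau>" "0 \<le> T"
    and nonneg: "\<And>n. 0 \<le> y n" "\<And>n. 0 \<le> z n"
    and lower: "\<And>n. c * y n \<le> energy n"
    and init: "energy 2 = 0" "\<And>n. n \<le> 2 \<Longrightarrow> y n = 0" "\<And>n. n \<le> 2 \<Longrightarrow> z n = 0"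
    and step: "\<And>n. n + 3 \<le> M \<Longrightarrow> energy (n+3) - energy (n+2) + k * (4 * \<theta> * z (n+3))
      \<le> k * (\<theta> * (z n + z (n+1) + z (n+2) + z (n+3)) + C * (y n + y (n+1) + y (n+2) + y (n+3)) + C * \<tau>)"
    and T: "real M * k \<le> T" and small: "8 * k * C \<le> c" and "n \<le> M"
  shows "y n \<le> 2 * (C * T * \<tau> / c) * exp (8 * C * T / c)"
proof -
  have sumstep: "energy (n+2) + k * 4 * \<theta> * (\<Sum>m<n. z (m+3)) \<le>
     k * \<theta> * ((\<Sum>m<n. z (m+0)) + (\<Sum>m<n. z (m+1)) + (\<Sum>m<n. z (m+2)) + (\<Sum>m<n. z (m+3)))
     + k * C * ((\<Sum>m<n. y (m+0)) + (\<Sum>m<n. y (m+1)) + (\<Sum>m<n. y (m+2)) + (\<Sum>m<n. y (m+3)))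
     + real n * k * C * \<tau>" if "n + 2 \<le> M" for n
    using that
  proof (induction n)
    case 0
    then show ?case using init(1) by (simp add: numeral_2_eq_2)
  next
    case (Suc n)
    then have "n + 3 \<le> M" "n + 2 \<le> M" by auto
    from step[OF this(1)] Suc.IH[OF this(2)] show ?case
      by (simp add: algebra_simps eval_nat_numeral)
  qed
  have bound: "y n \<le> C * T * \<tau> / c + (4 * k * C / c) * (\<Sum>j\<le>n. y j)" if n: "n \<le> M" for n
  proof (cases "n \<le> 2")
    case True
    then show ?thesis using init pos nonneg
      by (auto intro!: add_nonneg_nonneg mult_nonneg_nonneg divide_nonneg_nonneg sum_nonneg)
  next
    case False
    then obtain m where m: "n = m + 2" using le_Suc_ex[of 2 n] by (auto simp: add.commute)
    have zs: "(\<Sum>i<m. z (i + 3)) = (\<Sum>j\<le>m + 2. z j)"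
    proof -
      have "(\<Sum>j\<le>m + 2. z j) = (\<Sum>j<m + 3. z j)"
        by (rule sum.cong) auto
      also have "\<dots> = (\<Sum>i<3. z i) + (\<Sum>i<m. z (i + 3))"
        using sum.nat_group[of z] by (induction m) (auto simp: eval_nat_numeral)
      also have "(\<Sum>i<3. z i) = 0" using init by simp
      finally show ?thesis by simp
    qed
    let ?Z = "\<Sum>j\<le>m + 2. z j" and ?Y = "\<Sum>j\<le>m + 2. y j"
    have "k * \<theta> * ((\<Sum>i<m. z (i+0)) + (\<Sum>i<m. z (i+1)) + (\<Sum>i<m. z (i+2)) + (\<Sum>i<m. z (i+3)))
      \<le> k * \<theta> * (?Z + ?Z + ?Z + ?Z)"
      using pos nonneg by (intro mult_left_mono add_mono sum_shift_le) auto
    moreover have "k * C * ((\<Sum>i<m. y (i+0)) + (\<Sum>i<m. y (i+1)) + (\<Sum>i<m. y (i+2)) + (\<Sum>i<m. y (i+3)))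
      \<le> k * C * (?Y + ?Y + ?Y + ?Y)"
      using pos nonneg by (intro mult_left_mono add_mono sum_shift_le) auto
    moreover have "real m * k * C * \<tau> \<le> T * C * \<tau>"
    proof -
      have "real m * k \<le> real M * k" using n m pos by (intro mult_right_mono) auto
      then have "real m * k \<le> T" using T by linarith
      then show ?thesis using pos by (intro mult_right_mono) auto
    qed
    ultimately have "energy (m + 2) \<le> 4 * k * C * ?Y + T * C * \<tau>"
      using sumstep[of m] n m unfolding zs by (simp add: algebra_simps)
    then have "c * y n \<le> 4 * k * C * ?Y + T * C * \<tau>" using lower[of n] m by simp
    then show ?thesis using pos m by (simp add: field_simps)
  qed
  have "y n \<le> 2 * (C * T * \<tau> / c) * exp (2 * (4 * k * C / c) * real n)"
    using pos small nonneg bound \<open>n \<le> M\<close>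
    by (intro discrete_gronwall[where M = M]) (auto simp: field_simps)
  also have "\<dots> \<le> 2 * (C * T * \<tau> / c) * exp (8 * C * T / c)"
  proof -
    have "real n * k \<le> real M * k" using \<open>n \<le> M\<close> pos by (intro mult_right_mono) auto
    then have "real n * k \<le> T" using T by simp
    then have "C * (real n * k) \<le> C * T" using pos by (intro mult_left_mono) auto
    then have "2 * (4 * k * C / c) * real n \<le> 8 * C * T / c" using pos by (simp add: field_simps)
    then show ?thesis using pos by (intro mult_left_mono) auto
  qed
  finally show ?thesis .
qed

section \<open>Even periodic grid functions\<close>

text \<open>A fundamental domain for the period 2N. It starts at 0 so as to contain, for N >= 1, the
  grid and also the faces, whose index in the normal direction runs from 0 to N. Up to reflection
  every cell occurs in it 2^d times.\<close>

definition torus :: "nat \<Rightarrow> (int^'d) set" where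
  "torus N = {I. \<forall>i. 0 \<le> I $ i \<and> I $ i < 2 * int N}"

definition periodic :: "nat \<Rightarrow> (int^'d \<Rightarrow> 'b) \<Rightarrow> bool" where
  "periodic N F \<longleftrightarrow> (\<forall>i I. F (I + axis i (2 * int N)) = F I)"

definition tsum :: "nat \<Rightarrow> (int^'d \<Rightarrow> real) \<Rightarrow> real" where
  "tsum N F = mesh N ^ CARD('d) * (\<Sum>I\<in>torus N. F I)"

definition fwd :: "nat \<Rightarrow> 'd \<Rightarrow> (int^'d \<Rightarrow> real^3) \<Rightarrow> int^'d \<Rightarrow> real^3" where
  "fwd N i F I = (1 / mesh N) *\<^sub>R (F (I + axis i 1) - F I)"

definition dd2 :: "nat \<Rightarrow> 'd \<Rightarrow> (int^'d \<Rightarrow> real^3) \<Rightarrow> int^'d \<Rightarrow> real^3" where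
  "dd2 N i F I = (1 / (mesh N)\<^sup>2) *\<^sub>R (F (I + axis i 1) - 2 *\<^sub>R F I + F (I + axis i (- 1)))"

text \<open>Unlike in \<open>Lap_4\<close> no extension is built in, and all shifts are additions,
  so that they compose by \<open>add_axis_axis\<close>.\<close>

definition tlap :: "nat \<Rightarrow> (int^'d \<Rightarrow> real^3) \<Rightarrow> int^'d \<Rightarrow> real^3" where
  "tlap N F I = (\<Sum>i\<in>UNIV. (1 / (12 * (mesh N)\<^sup>2)) *\<^sub>R
     (- F (I + axis i (- 2)) + 16 *\<^sub>R F (I + axis i (- 1)) - 30 *\<^sub>R F I
      + 16 *\<^sub>R F (I + axis i 1) - F (I + axis i 2)))"

definition td1 :: "nat \<Rightarrow> 'd \<Rightarrow> (int^'d \<Rightarrow> real^3) \<Rightarrow> int^'d \<Rightarrow> real^3" where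
  "td1 N i F I = (1 / (12 * mesh N)) *\<^sub>R
     (F (I + axis i (- 2)) - 8 *\<^sub>R F (I + axis i (- 1)) + 8 *\<^sub>R F (I + axis i 1) - F (I + axis i 2))"

lemma diff_axis: "(I :: int^'d) - axis i a = I + axis i (- a)"
  by (simp add: vec_eq_iff axis_def)

lemma add_axis_axis: "(I :: int^'d) + axis i a + axis i b = I + axis i (a + b)"
  by (simp add: vec_eq_iff axis_def)

lemma axis_zero_int: "axis i (0::int) = 0"
  by (simp add: vec_eq_iff axis_def)

lemma finite_int_box: "finite {I :: int^'d. \<forall>i. a \<le> I $ i \<and> I $ i \<le> b}"
proof (rule finite_subset)
  show "{I :: int^'d. \<forall>i. a \<le> I $ i \<and> I $ i \<le> b} \<subseteq> (\<lambda>f. \<chi> i. f i) ` (PiE UNIV (\<lambda>_. {a..b}))"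
  proof
    fix I :: "int^'d" assume "I \<in> {I. \<forall>i. a \<le> I $ i \<and> I $ i \<le> b}"
    then show "I \<in> (\<lambda>f. \<chi> i. f i) ` (PiE UNIV (\<lambda>_. {a..b}))"
      by (intro image_eqI[where x = "\<lambda>i. I $ i"]) auto
  qed
  show "finite ((\<lambda>f. \<chi> i. f i) ` (PiE (UNIV :: 'd set) (\<lambda>_. {a..b})))"
    by (intro finite_imageI finite_PiE) auto
qed

lemma finite_torus: "finite (torus N :: (int^'d) set)"
  by (rule finite_subset[OF _ finite_int_box[of 0 "2 * int N"]]) (auto simp: torus_def less_imp_le)

text \<open>The shift permutes the residues modulo 2N in the i-th coordinate; the one index that
  leaves the box is brought back by a full period, which does not change \<Phi>.\<close>

lemma sum_torus_shift1:
  fixes \<Phi> :: "int^'d \<Rightarrow> real"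
  assumes "N \<ge> 1" "periodic N \<Phi>"
  shows "(\<Sum>I\<in>torus N. \<Phi> (I + axis (i :: 'd) 1)) = (\<Sum>I\<in>torus N. \<Phi> I)"
proof (rule sum.reindex_bij_witness[
    where i = "\<lambda>I. if I $ i = 0 then I + axis i (2 * int N - 1) else I + axis i (- 1)"
      and j = "\<lambda>I. if I $ i = 2 * int N - 1 then I + axis i (1 - 2 * int N) else I + axis i 1"])
  fix I :: "int^'d" assume I: "I \<in> torus N"
  show "\<Phi> (if I $ i = 2 * int N - 1 then I + axis i (1 - 2 * int N) else I + axis i 1) = \<Phi> (I + axis i 1)"
  proof (cases "I $ i = 2 * int N - 1")
    case True
    have "\<Phi> (I + axis i (1 - 2 * int N) + axis i (2 * int N)) = \<Phi> (I + axis i (1 - 2 * int N))"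
      using assms(2) by (simp add: periodic_def)
    then show ?thesis using True by (simp add: add_axis_axis)
  qed simp
next
  fix I :: "int^'d" assume "I \<in> torus N"
  then show "(if I $ i = 2 * int N - 1 then I + axis i (1 - 2 * int N) else I + axis i 1) \<in> torus N"
    using assms(1) unfolding torus_def by (auto simp: axis_def) (smt (verit))+
next
  fix I :: "int^'d" assume "I \<in> torus N"
  then show "(if I $ i = 0 then I + axis i (2 * int N - 1) else I + axis i (- 1)) \<in> torus N"
    using assms(1) unfolding torus_def by (auto simp: axis_def) (smt (verit))+
next
  fix I :: "int^'d" assume "I \<in> torus N"
  then have "0 \<le> I $ i" "I $ i < 2 * int N" by (auto simp: torus_def)
  then show "(if (if I $ i = 2 * int N - 1 then I + axis i (1 - 2 * int N) else I + axis i 1) $ i = 0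
      then (if I $ i = 2 * int N - 1 then I + axis i (1 - 2 * int N) else I + axis i 1) + axis i (2 * int N - 1)
      else (if I $ i = 2 * int N - 1 then I + axis i (1 - 2 * int N) else I + axis i 1) + axis i (- 1)) = I"
    by (auto simp: vec_eq_iff axis_def)
next
  fix I :: "int^'d" assume "I \<in> torus N"
  then have "0 \<le> I $ i" "I $ i < 2 * int N" by (auto simp: torus_def)
  then show "(if (if I $ i = 0 then I + axis i (2 * int N - 1) else I + axis i (- 1)) $ i = 2 * int N - 1
      then (if I $ i = 0 then I + axis i (2 * int N - 1) else I + axis i (- 1)) + axis i (1 - 2 * int N)
      else (if I $ i = 0 then I + axis i (2 * int N - 1) else I + axis i (- 1)) + axis i 1) = I"
    by (auto simp: vec_eq_iff axis_def)
qed

lemma periodic_shift: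
  assumes "periodic N F" shows "periodic N (\<lambda>I. F (I + J))"
proof -
  have "F (I + axis i (2 * int N) + J) = F (I + J)" for i I
  proof -
    have "I + axis i (2 * int N) + J = (I + J) + axis i (2 * int N)" by (simp add: ac_simps)
    then show ?thesis using assms by (simp only: periodic_def)
  qed
  then show ?thesis by (simp add: periodic_def)
qed

lemma sum_torus_shift:
  fixes \<Phi> :: "int^'d \<Rightarrow> real"
  assumes "N \<ge> 1" "periodic N \<Phi>"
  shows "(\<Sum>I\<in>torus N. \<Phi> (I + axis (i :: 'd) a)) = (\<Sum>I\<in>torus N. \<Phi> I)"
proof (induction a rule: int_induct[where k = 0])
  case base
  show ?case by (simp add: axis_zero_int)
next
  case (step1 a)
  have "(\<Sum>I\<in>torus N. \<Phi> (I + axis i 1 + axis i a)) = (\<Sum>I\<in>torus N. \<Phi> (I + axis i a))"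
    by (rule sum_torus_shift1[OF assms(1) periodic_shift[OF assms(2)]])
  moreover have "I + axis i 1 + axis i a = I + axis i (a + 1)" for I :: "int^'d"
    by (simp only: add_axis_axis add.commute[of 1 a])
  ultimately show ?case using step1 by simp
next
  case (step2 a)
  have "(\<Sum>I\<in>torus N. \<Phi> (I + axis i 1 + axis i (a - 1))) = (\<Sum>I\<in>torus N. \<Phi> (I + axis i (a - 1)))"
    by (rule sum_torus_shift1[OF assms(1) periodic_shift[OF assms(2)]])
  then show ?case using step2 by (simp add: add_axis_axis)
qed

lemma tsum_shift:
  assumes "N \<ge> 1" "periodic N \<Phi>"
  shows "tsum N (\<lambda>I. \<Phi> (I + axis i a)) = tsum N \<Phi>"
  unfolding tsum_def sum_torus_shift[OF assms] ..

lemma tsum_add: "tsum N (\<lambda>I. F I + G I) = tsum N F + tsum N G"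
  by (simp add: tsum_def sum.distrib distrib_left)

lemma tsum_diff: "tsum N (\<lambda>I. F I - G I) = tsum N F - tsum N G"
  by (simp add: tsum_def sum_subtractf right_diff_distrib)

lemma tsum_cmult: "tsum N (\<lambda>I. c * F I) = c * tsum N F"
  by (simp add: tsum_def sum_distrib_left[symmetric])

lemma tsum_sum: "tsum N (\<lambda>I. \<Sum>i\<in>A. F i I) = (\<Sum>i\<in>A. tsum N (F i))"
  by (simp add: tsum_def sum.swap[of _ A] sum_distrib_left)

lemma mesh_nonneg [simp]: "0 \<le> mesh N"
  by (simp add: mesh_def)

lemma mesh_pos: "N \<ge> 1 \<Longrightarrow> 0 < mesh N"
  by (simp add: mesh_def)

lemma tsum_mono: "(\<And>I. F I \<le> G I) \<Longrightarrow> tsum N F \<le> tsum N G"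
  unfolding tsum_def by (intro mult_left_mono sum_mono) auto

lemma tsum_nonneg: "(\<And>I. 0 \<le> F I) \<Longrightarrow> 0 \<le> tsum N F"
  unfolding tsum_def by (intro mult_nonneg_nonneg sum_nonneg) auto

lemma tsum_minus: "tsum N (\<lambda>I. - F I) = - tsum N F"
  by (simp add: tsum_def sum_negf)

text \<open>A correlation depends only on the difference of the two shifts. This reduces every
  bilinear difference expression to the numbers \<open>s i m\<close> of the next proof.\<close>

lemma tsum_corr:
  assumes N: "N \<ge> 1" and F: "periodic N F" and G: "periodic N G"
  shows "tsum N (\<lambda>I. F (I + axis i a) \<bullet> G (I + axis i b)) = tsum N (\<lambda>I. F I \<bullet> G (I + axis i (b - a)))"
proof -
  have "periodic N (\<lambda>I. F I \<bullet> G (I + axis i (b - a)))"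
    using F periodic_shift[OF G] by (simp add: periodic_def)
  from tsum_shift[OF N this, of i a] show ?thesis by (simp add: add_axis_axis)
qed

text \<open>In each direction the fourth-order stencil equals D - (h^2/12) D^2 with D the
  three-point difference \<open>dd2\<close>, and -D is the forward difference followed by its
  adjoint. The proof compares the coefficients of the correlations \<open>s i m\<close>. Both forms
  on the right are nonnegative for F = G, so both can enter the energy.\<close>

lemma summation_by_parts:
  fixes F G :: "int^'d \<Rightarrow> real^3"
  assumes N: "N \<ge> 1" and F: "periodic N F" and G: "periodic N G"
  shows "tsum N (\<lambda>I. tlap N F I \<bullet> G I) =
    - (\<Sum>i\<in>UNIV. tsum N (\<lambda>I. fwd N i F I \<bullet> fwd N i G I)
        + (mesh N)\<^sup>2 / 12 * tsum N (\<lambda>I. dd2 N i F I \<bullet> dd2 N i G I))"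
proof -
  let ?h = "mesh N"
  have h: "?h > 0" using N by (rule mesh_pos)
  define s where "s i m = tsum N (\<lambda>I. F I \<bullet> G (I + axis i m))" for i m
  have c: "tsum N (\<lambda>I. F (I + axis i a) \<bullet> G (I + axis i b)) = s i (b - a)"
    "tsum N (\<lambda>I. F (I + axis i a) \<bullet> G I) = s i (- a)"
    "tsum N (\<lambda>I. F I \<bullet> G (I + axis i b)) = s i b"
    "tsum N (\<lambda>I. F I \<bullet> G I) = s i 0" for i a b
    using tsum_corr[OF N F G, of i a b] tsum_corr[OF N F G, of i a 0]
    by (auto simp: s_def axis_zero_int)
  have p1: "fwd N i F I \<bullet> fwd N i G I = (1 / ?h\<^sup>2) * (F (I + axis i 1) \<bullet> G (I + axis i 1)
      - F (I + axis i 1) \<bullet> G I - F I \<bullet> G (I + axis i 1) + F I \<bullet> G I)" for i I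
    by (simp add: fwd_def inner_diff_left inner_diff_right power2_eq_square diff_divide_distrib add_divide_distrib)
  have 1: "tsum N (\<lambda>I. fwd N i F I \<bullet> fwd N i G I) = (1 / ?h\<^sup>2) * (2 * s i 0 - s i 1 - s i (- 1))" for i
    unfolding p1 tsum_cmult tsum_add tsum_diff c(1-3) c(4)[of i] by simp
  have p2: "dd2 N i F I \<bullet> dd2 N i G I = (1 / ?h^4) *
     (F (I + axis i 1) \<bullet> G (I + axis i 1) - 2 * (F (I + axis i 1) \<bullet> G I)
      + F (I + axis i 1) \<bullet> G (I + axis i (- 1)) - 2 * (F I \<bullet> G (I + axis i 1)) + 4 * (F I \<bullet> G I)
      - 2 * (F I \<bullet> G (I + axis i (- 1))) + F (I + axis i (- 1)) \<bullet> G (I + axis i 1)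
      - 2 * (F (I + axis i (- 1)) \<bullet> G I) + F (I + axis i (- 1)) \<bullet> G (I + axis i (- 1)))" for i I
  proof -
    have "(c *\<^sub>R (p - 2 *\<^sub>R q + r)) \<bullet> (c *\<^sub>R (p' - 2 *\<^sub>R q' + r')) = c * c *
      (p \<bullet> p' - 2 * (p \<bullet> q') + p \<bullet> r' - 2 * (q \<bullet> p') + 4 * (q \<bullet> q') - 2 * (q \<bullet> r')
       + r \<bullet> p' - 2 * (r \<bullet> q') + r \<bullet> r')" for c and p q r p' q' r' :: "real^3"
      by (simp add: inner_diff_left inner_diff_right inner_add_left inner_add_right algebra_simps)
    moreover have "1 / ?h\<^sup>2 * (1 / ?h\<^sup>2) = 1 / ?h^4" by (simp add: power2_eq_square eval_nat_numeral)
    ultimately show ?thesis unfolding dd2_def by metis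
  qed
  have 2: "tsum N (\<lambda>I. dd2 N i F I \<bullet> dd2 N i G I) = (1 / ?h^4) *
      (6 * s i 0 - 4 * s i 1 - 4 * s i (- 1) + s i 2 + s i (- 2))" for i
    unfolding p2 tsum_cmult tsum_add tsum_diff c(1-3) c(4)[of i] by simp
  have 3: "tsum N (\<lambda>I. tlap N F I \<bullet> G I) = (\<Sum>i\<in>UNIV. (1 / (12 * ?h\<^sup>2)) *
      (- s i 2 + 16 * s i 1 - 30 * s i 0 + 16 * s i (- 1) - s i (- 2)))"
    unfolding tlap_def inner_sum_left tsum_sum inner_scaleR_left inner_diff_left inner_add_left
      inner_minus_left tsum_cmult tsum_diff tsum_add tsum_minus c(1-3)
    by (simp add: s_def axis_zero_int)
  show ?thesis unfolding 1 2 3 sum_negf[symmetric]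
    using h by (intro sum.cong refl) (simp add: field_simps eval_nat_numeral)
qed

text \<open>Telescoping with weights (-1, 7, 7, -1)/12: the wide difference is a combination of
  nearest-neighbour ones, and so is controlled by \<open>h1\<close>.\<close>

lemma td1_fwd:
  "td1 N i F I = (1/12) *\<^sub>R (- fwd N i F (I + axis i 1) + 7 *\<^sub>R fwd N i F I
     + 7 *\<^sub>R fwd N i F (I + axis i (- 1)) - fwd N i F (I + axis i (- 2)))"
proof -
  have "I + axis i 1 + axis i 1 = I + axis i 2" "I + axis i (- 1) + axis i 1 = I"
    "I + axis i (- 2) + axis i 1 = I + axis i (- 1)"
    by (simp_all add: vec_eq_iff axis_def)
  note e = this
  have "c *\<^sub>R (p - 8 *\<^sub>R q + 8 *\<^sub>R r - s) = - (c *\<^sub>R (s - r)) + 7 *\<^sub>R (c *\<^sub>R (r - u))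
     + 7 *\<^sub>R (c *\<^sub>R (u - q)) - c *\<^sub>R (q - p)" for c and p q r s u :: "real^3"
    unfolding vec_eq_iff vector_add_component vector_minus_component vector_scaleR_component
      vector_uminus_component real_scaleR_def by (simp add: right_diff_distrib distrib_left)
  note * = this
  have h: "1 / (12 * mesh N) = 1 / 12 * (1 / mesh N)"
    by (rule sym, rule times_divide_times_eq[of 1 12 1, unfolded mult_1])
  show ?thesis unfolding td1_def fwd_def e h scaleR_scaleR[symmetric]
    by (rule arg_cong[OF *])
qed

section \<open>Behaviour of the stencils under the ghost-point reflection\<close>

lemma Lap_4_tlap: "Lap_4 N f = tlap N (ext N f)"
  by (simp add: fun_eq_iff Lap_4_def tlap_def D2_4_def diff_axis)

lemma D1_4_td1: "D1_4 N i f = td1 N i (ext N f)"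
  by (simp add: fun_eq_iff D1_4_def td1_def diff_axis)

lemma reflect_period: "reflect N (j + 2 * int N) = reflect N j"
proof -
  have "(j + 2 * int N - 1) mod (2 * int N) = (j - 1) mod (2 * int N)"
    using mod_add_self2[of "j - 1" "2 * int N"] by (simp add: algebra_simps)
  then show ?thesis by (simp only: reflect_def)
qed

text \<open>\<open>reflect\<close> is piecewise affine with slope 1 or -1. The residue r tells
  whether the copy of {1..N} that contains j is traversed forwards (r < N) or backwards, and a step
  a from the representative corresponds to a step a or -a from j.\<close>

lemma reflect_cases:
  assumes "N \<ge> 1"
  shows "(\<forall>a. reflect N (reflect N j + a) = reflect N (j + a)) \<or>
         (\<forall>a. reflect N (reflect N j + a) = reflect N (j - a))"
proof -
  define r where "r = (j - 1) mod (2 * int N)"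
  define q where "q = (j - 1) div (2 * int N)"
  have j: "j = 1 + r + q * (2 * int N)" unfolding r_def q_def by (simp add: mult.commute)
  have per: "reflect N (b + c * (2 * int N)) = reflect N b" for b c
  proof -
    have "(b + c * (2 * int N) - 1) mod (2 * int N) = (b - 1) mod (2 * int N)"
      using mod_mult_self1[of "b - 1" c "2 * int N"] by (simp add: algebra_simps)
    then show ?thesis by (simp only: reflect_def)
  qed
  show ?thesis
  proof (cases "r < int N")
    case True
    then have R: "reflect N j = r + 1" by (simp add: reflect_def r_def)
    have "reflect N (reflect N j + a) = reflect N (j + a)" for a
      unfolding R using per[of "r + 1 + a" q] by (simp add: j algebra_simps)
    then show ?thesis by blast
  next
    case False
    then have R: "reflect N j = 2 * int N - r" by (simp add: reflect_def r_def)
    have "reflect N (reflect N j + a) = reflect N (j - a)" for a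
    proof -
      have "reflect N (2 * int N - r + a) = reflect N (a - r)"
        using per[of "a - r" 1] by (simp add: algebra_simps)
      also have "\<dots> = reflect N (1 - (a - r))" using reflect_left[OF assms] by simp
      also have "\<dots> = reflect N (j - a)"
        using per[of "1 + r - a" q] by (simp add: j algebra_simps)
      finally show ?thesis unfolding R .
    qed
    then show ?thesis by blast
  qed
qed

lemma ext_periodic: "periodic N (ext N f)"
proof -
  have "ext N f (I + axis i (2 * int N)) = ext N f I" for i I
    unfolding ext_def by (rule arg_cong[of _ _ f]) (simp add: vec_eq_iff axis_def reflect_period)
  then show ?thesis by (simp add: periodic_def)
qed

definition refl_idx :: "nat \<Rightarrow> int^'d \<Rightarrow> int^'d" where
  "refl_idx N I = (\<chi> i. reflect N (I $ i))"

lemma refl_idx_grid: "N \<ge> 1 \<Longrightarrow> refl_idx N I \<in> grid N"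
  using reflect_range by (auto simp: refl_idx_def grid_def)

lemma ext_refl_idx: "ext N f I = f (refl_idx N I)"
  by (simp add: ext_def refl_idx_def)

lemma refl_idx_id: "I \<in> grid N \<Longrightarrow> refl_idx N I = I"
  by (auto simp: refl_idx_def grid_def vec_eq_iff reflect_interior)

lemma ext_grid: "I \<in> grid N \<Longrightarrow> ext N f I = f I"
  by (simp add: ext_refl_idx refl_idx_id)

lemma ext_axis_cases:
  assumes "N \<ge> 1"
  shows "(\<forall>a. ext N f (refl_idx N I + axis i a) = ext N f (I + axis i a)) \<or>
         (\<forall>a. ext N f (refl_idx N I + axis i a) = ext N f (I + axis i (- a)))"
proof -
  have rr: "reflect N (reflect N j) = reflect N j" for j
    using reflect_range[OF assms] reflect_interior by blast
  have e: "(\<chi> j. reflect N ((refl_idx N I + axis i a) $ j)) = (\<chi> j. reflect N ((I + axis i b) $ j))"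
    if "reflect N (reflect N (I $ i) + a) = reflect N (I $ i + b)" for a b
    using that by (auto simp: vec_eq_iff refl_idx_def axis_def rr)
  from reflect_cases[OF assms, of "I $ i"] show ?thesis
  proof
    assume "\<forall>a. reflect N (reflect N (I $ i) + a) = reflect N (I $ i + a)"
    then show ?thesis unfolding ext_def by (intro disjI1 allI arg_cong[of _ _ f] e) blast
  next
    assume "\<forall>a. reflect N (reflect N (I $ i) + a) = reflect N (I $ i - a)"
    then have "\<forall>a. reflect N (reflect N (I $ i) + a) = reflect N (I $ i + (- a))" by simp
    then show ?thesis unfolding ext_def by (intro disjI2 allI arg_cong[of _ _ f] e) blast
  qed
qed

text \<open>The stencil is symmetric, so both alternatives of \<open>ext_axis_cases\<close> leave it
  unchanged. Applied to an extension it gives again an even periodic function, which is why the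
  scheme, posed on the grid, holds at all indices.\<close>

lemma tlap_refl:
  assumes "N \<ge> 1"
  shows "tlap N (ext N f) (refl_idx N I) = tlap N (ext N f) I"
proof -
  have 0: "ext N f (refl_idx N I) = ext N f I"
    by (simp add: ext_refl_idx refl_idx_id refl_idx_grid[OF assms])
  show ?thesis unfolding tlap_def
  proof (rule sum.cong[OF refl], goal_cases)
    case (1 i)
    from ext_axis_cases[OF assms, of f I i] show ?case
    proof
      assume a: "\<forall>a. ext N f (refl_idx N I + axis i a) = ext N f (I + axis i a)"
      show ?thesis unfolding 0 a[rule_format] ..
    next
      assume a: "\<forall>a. ext N f (refl_idx N I + axis i a) = ext N f (I + axis i (- a))"
      show ?thesis unfolding 0 a[rule_format] by (simp add: algebra_simps)
    qed
  qed
qed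

text \<open>The stencil is antisymmetric, so on a backward copy the sign flips. Only the square, as
  it occurs in \<open>tgrad_sq\<close>, is even again.\<close>

lemma td1_refl:
  assumes "N \<ge> 1"
  shows "td1 N i (ext N f) (refl_idx N I) = td1 N i (ext N f) I \<or>
         td1 N i (ext N f) (refl_idx N I) = - td1 N i (ext N f) I"
  using ext_axis_cases[OF assms, of f I i]
proof
  assume a: "\<forall>a. ext N f (refl_idx N I + axis i a) = ext N f (I + axis i a)"
  show ?thesis unfolding td1_def a[rule_format] by simp
next
  assume a: "\<forall>a. ext N f (refl_idx N I + axis i a) = ext N f (I + axis i (- a))"
  show ?thesis unfolding td1_def a[rule_format]
    by (intro disjI2) (simp add: vec_eq_iff field_simps)
qed

definition tgrad_sq :: "nat \<Rightarrow> (int^'d \<Rightarrow> real^3) \<Rightarrow> int^'d \<Rightarrow> real" where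
  "tgrad_sq N F I = (\<Sum>i\<in>UNIV. (norm (td1 N i F I))\<^sup>2)"

lemma norm_sq_vec3: "(norm (v :: real^'n))\<^sup>2 = (\<Sum>l\<in>UNIV. (v $ l)\<^sup>2)"
  by (simp add: norm_vec_def L2_set_def sum_nonneg)

lemma grad_sq_4_tgrad: "grad_sq_4 N f = tgrad_sq N (ext N f)"
  unfolding fun_eq_iff grad_sq_4_def tgrad_sq_def norm_sq_vec3 D1_4_td1
  by (intro allI sum.swap)

lemma tgrad_sq_refl:
  assumes "N \<ge> 1"
  shows "tgrad_sq N (ext N f) (refl_idx N I) = tgrad_sq N (ext N f) I"
  unfolding tgrad_sq_def
proof (rule sum.cong[OF refl], goal_cases)
  case (1 i)
  show ?case using td1_refl[OF assms, of i f I] by auto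
qed

lemma grid_norm_le:
  fixes f :: "int^'d \<Rightarrow> real^3"
  assumes "N \<ge> 1"
  shows "grid_norm N f \<le> sqrt (tsum N (\<lambda>I. (norm (ext N f I))\<^sup>2))"
proof -
  have "(\<Sum>I\<in>grid N. f I \<bullet> f I) = (\<Sum>I\<in>grid N. (norm (ext N f I))\<^sup>2)"
    by (rule sum.cong) (auto simp: ext_grid power2_norm_eq_inner)
  also have "\<dots> \<le> (\<Sum>I\<in>torus N. (norm (ext N f I))\<^sup>2)"
  proof (intro sum_mono2 finite_torus)
    show "grid N \<subseteq> torus N" using assms by (auto simp: grid_def torus_def) (smt (verit))+
  qed auto
  finally show ?thesis unfolding grid_norm_def grid_inner_def tsum_def
    by (intro real_sqrt_le_mono mult_left_mono) auto
qed

lemma grad_norm_le: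
  fixes f :: "int^'d \<Rightarrow> real^3"
  assumes "N \<ge> 1"
  shows "grad_norm N f \<le> sqrt (\<Sum>i\<in>UNIV. tsum N (\<lambda>I. (norm (fwd N i (ext N f) I))\<^sup>2))"
proof -
  have "(\<Sum>I\<in>faces N i. \<Sum>l\<in>UNIV. (((ext N f (I + axis i 1) $ l) - (ext N f I $ l)) / mesh N)\<^sup>2)
     \<le> (\<Sum>I\<in>torus N. (norm (fwd N i (ext N f) I))\<^sup>2)" for i
  proof -
    have "(\<Sum>I\<in>faces N i. \<Sum>l\<in>UNIV. (((ext N f (I + axis i 1) $ l) - (ext N f I $ l)) / mesh N)\<^sup>2)
      = (\<Sum>I\<in>faces N i. (norm (fwd N i (ext N f) I))\<^sup>2)"
      unfolding norm_sq_vec3 by (simp add: fwd_def)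
    also have "\<dots> \<le> (\<Sum>I\<in>torus N. (norm (fwd N i (ext N f) I))\<^sup>2)"
    proof (intro sum_mono2 finite_torus)
      show "faces N i \<subseteq> torus N" using assms unfolding faces_def torus_def by (smt (verit) Collect_mono of_nat_1 of_nat_mono)
    qed auto
    finally show ?thesis .
  qed
  then show ?thesis unfolding grad_norm_def tsum_def sum_distrib_left[symmetric]
    by (intro real_sqrt_le_mono mult_left_mono sum_mono) auto
qed

section \<open>Extrapolation and projection\<close>

definition extr :: "'a::real_vector \<Rightarrow> 'a \<Rightarrow> 'a \<Rightarrow> 'a" where
  "extr x2 x1 x0 = 3 *\<^sub>R x2 - 3 *\<^sub>R x1 + x0"

lemma extr_diff: "extr x2 x1 x0 - extr y2 y1 y0 = extr (x2 - y2) (x1 - y1) (x0 - y0)"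
  by (simp add: extr_def algebra_simps)

lemma norm_extr_le:
  assumes "norm x2 \<le> B" "norm x1 \<le> B" "norm x0 \<le> B"
  shows "norm (extr x2 x1 x0) \<le> 7 * B"
proof -
  have "norm (extr x2 x1 x0) \<le> norm (3 *\<^sub>R x2) + norm (3 *\<^sub>R x1) + norm x0"
    unfolding extr_def by (meson norm_triangle_ineq norm_triangle_ineq4 order_trans add_right_mono)
  then show ?thesis using assms by simp
qed

text \<open>Cauchy-Schwarz with 9 + 9 + 1 = 19, the defect being written as squares by Lagrange's
  identity.\<close>

lemma norm_extr_sq_le:
  "(norm (extr x2 x1 x0))\<^sup>2 \<le> 19 * ((norm x2)\<^sup>2 + (norm x1)\<^sup>2 + (norm x0)\<^sup>2)"
proof -
  have "norm (extr x2 x1 x0) \<le> norm (3 *\<^sub>R x2) + norm (3 *\<^sub>R x1) + norm x0"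
    unfolding extr_def by (meson norm_triangle_ineq norm_triangle_ineq4 order_trans add_right_mono)
  then have "(norm (extr x2 x1 x0))\<^sup>2 \<le> (3 * norm x2 + 3 * norm x1 + norm x0)\<^sup>2"
    by (intro power_mono) auto
  also have "\<dots> \<le> 19 * ((norm x2)\<^sup>2 + (norm x1)\<^sup>2 + (norm x0)\<^sup>2)"
  proof -
    have "19 * (a\<^sup>2 + b\<^sup>2 + c\<^sup>2) - (3 * a + 3 * b + c)\<^sup>2
      = (3 * a - 3 * b)\<^sup>2 + (a - 3 * c)\<^sup>2 + (b - 3 * c)\<^sup>2" for a b c :: real
      by (simp add: power2_eq_square algebra_simps)
    moreover have "0 \<le> (3 * a - 3 * b)\<^sup>2 + (a - 3 * c)\<^sup>2 + (b - 3 * c)\<^sup>2" for a b c :: real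
      by simp
    ultimately show ?thesis by (metis diff_ge_0_iff_ge)
  qed
  finally show ?thesis .
qed

lemma td1_extr:
  "td1 N i (\<lambda>I. extr (F2 I) (F1 I) (F0 I)) I = extr (td1 N i F2 I) (td1 N i F1 I) (td1 N i F0 I)"
  by (simp add: td1_def extr_def algebra_simps)

lemma td1_diff: "td1 N i (\<lambda>I. F I - G I) I = td1 N i F I - td1 N i G I"
  by (simp add: td1_def algebra_simps)

lemma fwd_extr:
  "fwd N i (\<lambda>I. extr (F2 I) (F1 I) (F0 I)) I = extr (fwd N i F2 I) (fwd N i F1 I) (fwd N i F0 I)"
  by (simp add: fwd_def extr_def algebra_simps)

lemma fwd_diff: "fwd N i (\<lambda>I. F I - G I) I = fwd N i F I - fwd N i G I"
  by (simp add: fwd_def algebra_simps)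

lemma tlap_extr:
  "tlap N (\<lambda>I. extr (F2 I) (F1 I) (F0 I)) I = extr (tlap N F2 I) (tlap N F1 I) (tlap N F0 I)"
  unfolding tlap_def extr_def scaleR_sum_right sum_subtractf[symmetric] sum.distrib[symmetric]
  by (intro sum.cong refl) (simp add: algebra_simps)

lemma tlap_diff: "tlap N (\<lambda>I. F I - G I) I = tlap N F I - tlap N G I"
  unfolding tlap_def sum_subtractf[symmetric]
  by (intro sum.cong refl) (simp add: algebra_simps)

lemma tlap_scaleR: "tlap N (\<lambda>I. c *\<^sub>R F I) I = c *\<^sub>R tlap N F I"
  unfolding tlap_def scaleR_sum_right
  by (intro sum.cong refl) (simp add: algebra_simps)

lemma norm_td1_le:
  assumes "\<And>J. norm (fwd N i F J) \<le> B"
  shows "norm (td1 N i F I) \<le> 2 * B"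
proof -
  have "norm (td1 N i F I) \<le> 1/12 * (norm (fwd N i F (I + axis i 1)) + norm (7 *\<^sub>R fwd N i F I)
     + norm (7 *\<^sub>R fwd N i F (I + axis i (- 1))) + norm (fwd N i F (I + axis i (- 2))))"
    unfolding td1_fwd norm_scaleR
    by (intro mult_mono order_trans[OF norm_triangle_ineq4] add_mono order_trans[OF norm_triangle_ineq]
          order_refl) auto
  then show ?thesis
    using assms[of "I + axis i 1"] assms[of I] assms[of "I + axis i (- 1)"] assms[of "I + axis i (- 2)"]
      order_trans[OF norm_ge_zero assms[of I]] by simp
qed

lemma periodic_fwd: "periodic N F \<Longrightarrow> periodic N (fwd N i F)"
  unfolding fwd_def periodic_def by (metis (no_types, lifting) add.commute add.left_commute)

text \<open>Cauchy-Schwarz for the weights of \<open>td1_fwd\<close>, with 1 + 49 + 49 + 1 = 100 <=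
  144. The four shifted sums coincide by periodicity, which gives the factor 4.\<close>

lemma tsum_td1_le:
  assumes N: "N \<ge> 1" and F: "periodic N F"
  shows "tsum N (\<lambda>I. (norm (td1 N i F I))\<^sup>2) \<le> 4 * tsum N (\<lambda>I. (norm (fwd N i F I))\<^sup>2)"
proof -
  let ?f = "\<lambda>a I. (norm (fwd N i F (I + axis i a)))\<^sup>2"
  have pw: "(norm (td1 N i F I))\<^sup>2 \<le> (1 * ?f 1 I + 1 * ?f 0 I) + (1 * ?f (- 1) I + 1 * ?f (- 2) I)" for I
  proof -
    let ?a = "norm (fwd N i F (I + axis i 1))" and ?b = "norm (fwd N i F I)"
      and ?c = "norm (fwd N i F (I + axis i (- 1)))" and ?d = "norm (fwd N i F (I + axis i (- 2)))"
    have "norm (td1 N i F I) \<le> 1/12 * (?a + norm (7 *\<^sub>R fwd N i F I)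
       + norm (7 *\<^sub>R fwd N i F (I + axis i (- 1))) + ?d)"
      unfolding td1_fwd norm_scaleR
      by (intro mult_mono order_trans[OF norm_triangle_ineq4] add_mono order_trans[OF norm_triangle_ineq]
          order_refl) auto
    then have "norm (td1 N i F I) \<le> 1/12 * (?a + 7 * ?b + 7 * ?c + ?d)" by simp
    then have "(norm (td1 N i F I))\<^sup>2 \<le> (1/12 * (?a + 7 * ?b + 7 * ?c + ?d))\<^sup>2"
      by (intro power_mono) auto
    also have "\<dots> \<le> ?a\<^sup>2 + ?b\<^sup>2 + ?c\<^sup>2 + ?d\<^sup>2"
    proof -
      have "100 * (a\<^sup>2 + b\<^sup>2 + c\<^sup>2 + d\<^sup>2) - (a + 7 * b + 7 * c + d)\<^sup>2
        = (7 * a - b)\<^sup>2 + (7 * a - c)\<^sup>2 + (a - d)\<^sup>2 + (7 * b - 7 * c)\<^sup>2 + (b - 7 * d)\<^sup>2 + (c - 7 * d)\<^sup>2"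
        for a b c d :: real by (simp add: power2_eq_square algebra_simps)
      moreover have "0 \<le> (7 * a - b)\<^sup>2 + (7 * a - c)\<^sup>2 + (a - d)\<^sup>2 + (7 * b - 7 * c)\<^sup>2 + (b - 7 * d)\<^sup>2 + (c - 7 * d)\<^sup>2"
        for a b c d :: real by simp
      ultimately have "(a + 7 * b + 7 * c + d)\<^sup>2 \<le> 100 * (a\<^sup>2 + b\<^sup>2 + c\<^sup>2 + d\<^sup>2)" for a b c d :: real
        by (metis diff_ge_0_iff_ge)
      from this[of ?a ?b ?c ?d] have "(?a + 7 * ?b + 7 * ?c + ?d)\<^sup>2 \<le> 144 * (?a\<^sup>2 + ?b\<^sup>2 + ?c\<^sup>2 + ?d\<^sup>2)"
        by (smt (verit) zero_le_power2)
      then show ?thesis by (simp add: power_mult_distrib power_divide)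
    qed
    finally show ?thesis by (simp add: axis_zero_int)
  qed
  have P: "periodic N (\<lambda>I. (norm (fwd N i F I))\<^sup>2)"
    using periodic_fwd[OF F] by (simp add: periodic_def)
  have "tsum N (?f a) = tsum N (\<lambda>I. (norm (fwd N i F I))\<^sup>2)" for a
    by (rule tsum_shift[OF N P])
  then have "tsum N (\<lambda>I. (1 * ?f 1 I + 1 * ?f 0 I) + (1 * ?f (- 1) I + 1 * ?f (- 2) I))
     = 4 * tsum N (\<lambda>I. (norm (fwd N i F I))\<^sup>2)"
    unfolding tsum_add tsum_cmult by (simp del: add_uminus_conv_diff)
  moreover have "tsum N (\<lambda>I. (norm (td1 N i F I))\<^sup>2) \<le>
      tsum N (\<lambda>I. (1 * ?f 1 I + 1 * ?f 0 I) + (1 * ?f (- 1) I + 1 * ?f (- 2) I))"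
    by (rule tsum_mono[OF pw])
  ultimately show ?thesis by linarith
qed

text \<open>The square of a discrete H^1 norm over a full period, left without the root because the
  energy is quadratic.\<close>

definition h1 :: "nat \<Rightarrow> (int^'d \<Rightarrow> real^3) \<Rightarrow> real" where
  "h1 N F = tsum N (\<lambda>I. (norm (F I))\<^sup>2) + (\<Sum>i\<in>UNIV. tsum N (\<lambda>I. (norm (fwd N i F I))\<^sup>2))"

lemma h1_nonneg: "0 \<le> h1 N F"
  unfolding h1_def by (intro add_nonneg_nonneg sum_nonneg tsum_nonneg) auto

lemma tsum_le_h1: "tsum N (\<lambda>I. (norm (F I))\<^sup>2) \<le> h1 N F"
  unfolding h1_def by (simp add: sum_nonneg tsum_nonneg)

lemma tsum_fwd_le_h1: "tsum N (\<lambda>I. (norm (fwd N i F I))\<^sup>2) \<le> h1 N F"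
proof -
  have "tsum N (\<lambda>I. (norm (fwd N i F I))\<^sup>2) \<le> (\<Sum>i\<in>UNIV. tsum N (\<lambda>I. (norm (fwd N i F I))\<^sup>2))"
    by (intro member_le_sum[of i UNIV "\<lambda>i. tsum N (\<lambda>I. (norm (fwd N i F I))\<^sup>2)"]) (auto intro: tsum_nonneg)
  then show ?thesis unfolding h1_def by (simp add: add_increasing tsum_nonneg)
qed

lemma h1_extr_le:
  "h1 N (\<lambda>I. extr (F2 I) (F1 I) (F0 I)) \<le> 19 * (h1 N F2 + h1 N F1 + h1 N F0)"
proof -
  have 1: "tsum N (\<lambda>I. (norm (extr (A2 I) (A1 I) (A0 I)))\<^sup>2) \<le>
    19 * (tsum N (\<lambda>I. (norm (A2 I))\<^sup>2) + tsum N (\<lambda>I. (norm (A1 I))\<^sup>2) + tsum N (\<lambda>I. (norm (A0 I))\<^sup>2))"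
    for A0 A1 A2 :: "int^'a \<Rightarrow> real^3"
    unfolding tsum_add[symmetric] tsum_cmult[symmetric] by (intro tsum_mono norm_extr_sq_le)
  have "h1 N (\<lambda>I. extr (F2 I) (F1 I) (F0 I)) \<le>
    19 * (tsum N (\<lambda>I. (norm (F2 I))\<^sup>2) + tsum N (\<lambda>I. (norm (F1 I))\<^sup>2) + tsum N (\<lambda>I. (norm (F0 I))\<^sup>2)) +
    (\<Sum>i\<in>UNIV. 19 * (tsum N (\<lambda>I. (norm (fwd N i F2 I))\<^sup>2) + tsum N (\<lambda>I. (norm (fwd N i F1 I))\<^sup>2)
       + tsum N (\<lambda>I. (norm (fwd N i F0 I))\<^sup>2)))"
    unfolding h1_def fwd_extr by (intro add_mono sum_mono 1)
  also have "\<dots> = 19 * (h1 N F2 + h1 N F1 + h1 N F0)"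
    unfolding h1_def sum_distrib_left[symmetric] sum.distrib by (simp add: algebra_simps)
  finally show ?thesis .
qed

text \<open>For v = u - e the distance from v to its projection is | |v| - 1 |, hence at most |v -
  u| = |e|; the triangle inequality adds another |e|.\<close>

lemma projection_error:
  fixes u e :: "'a::real_inner"
  assumes "norm u = 1" "norm e \<le> 1/2"
  shows "norm (u - (1 / norm (u - e)) *\<^sub>R (u - e)) \<le> 2 * norm e"
proof -
  let ?v = "u - e"
  have v: "norm ?v \<ge> 1/2" using norm_triangle_ineq2[of u e] assms by simp
  have "norm (?v - (1 / norm ?v) *\<^sub>R ?v) = norm ((1 - 1 / norm ?v) *\<^sub>R ?v)"
    by (simp add: scaleR_diff_left)
  also have "\<dots> = \<bar>1 - 1 / norm ?v\<bar> * \<bar>norm ?v\<bar>" by simp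
  also have "\<dots> = \<bar>(1 - 1 / norm ?v) * norm ?v\<bar>" by (simp only: abs_mult)
  also have "(1 - 1 / norm ?v) * norm ?v = norm ?v - norm u"
    using v assms by (auto simp: field_simps)
  also have "\<bar>norm ?v - norm u\<bar> \<le> norm (?v - u)" by (rule norm_triangle_ineq3)
  finally have "norm (?v - (1 / norm ?v) *\<^sub>R ?v) \<le> norm e" by simp
  moreover have "u - (1 / norm ?v) *\<^sub>R ?v = e + (?v - (1 / norm ?v) *\<^sub>R ?v)" by simp
  ultimately show ?thesis by (smt (verit) norm_triangle_ineq)
qed

text \<open>The two pairs belong to neighbouring cells and the estimate will be divided by the mesh
  size. Hence every term on the right has to carry a difference between the cells; a bound by |e| +
  |e'| would be of no use.\<close>

lemma projection_error_diff:
  fixes u e u' e' :: "'a::real_inner"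
  assumes u: "norm u = 1" "norm u' = 1" and e: "norm e \<le> 1/2" "norm e' \<le> 1/2"
  shows "norm ((u' - (1 / norm (u' - e')) *\<^sub>R (u' - e')) - (u - (1 / norm (u - e)) *\<^sub>R (u - e)))
    \<le> 20 * norm (e' - e) + 14 * (norm (u' - u) * norm e')"
proof -
  define v v' where "v = norm (u - e)" and "v' = norm (u' - e')"
  define s s' where "s = 1 / v" and "s' = 1 / v'"
  have v: "v \<ge> 1/2" "v' \<ge> 1/2" unfolding v_def v'_def
    using norm_triangle_ineq2[of u e] norm_triangle_ineq2[of u' e'] u e by simp_all
  have s: "0 \<le> s" "s \<le> 2" "0 \<le> s'" "s' \<le> 2" using v by (simp_all add: s_def s'_def field_simps)
  \<comment> \<open>Since |u - e|^2 = 1 - 2 u . e + |e|^2 for a unit vector u, the constants cancel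
    and only differences between the two points survive.\<close>
  have sq: "v\<^sup>2 - v'\<^sup>2 = - 2 * (u \<bullet> (e - e') + (u - u') \<bullet> e') + (norm e - norm e') * (norm e + norm e')"
    using u unfolding v_def v'_def
    by (simp add: power2_norm_eq_inner norm_eq_1 inner_diff_left inner_diff_right inner_commute
        algebra_simps flip: power2_eq_square)
  have "\<bar>u \<bullet> (e - e')\<bar> \<le> norm (e' - e)"
    using Cauchy_Schwarz_ineq2[of u "e - e'"] u by (simp add: norm_minus_commute)
  moreover have "\<bar>(u - u') \<bullet> e'\<bar> \<le> norm (u' - u) * norm e'"
    using Cauchy_Schwarz_ineq2[of "u - u'" e'] by (simp add: norm_minus_commute)
  moreover have "\<bar>(norm e - norm e') * (norm e + norm e')\<bar> \<le> norm (e' - e)"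
  proof -
    have "\<bar>(norm e - norm e') * (norm e + norm e')\<bar> \<le> norm (e' - e) * 1"
      unfolding abs_mult using e norm_triangle_ineq3[of e e']
      by (intro mult_mono) (auto simp: norm_minus_commute)
    then show ?thesis by simp
  qed
  ultimately have "\<bar>v\<^sup>2 - v'\<^sup>2\<bar> \<le> 3 * norm (e' - e) + 2 * (norm (u' - u) * norm e')"
  proof -
    have "\<bar>- 2 * (p + q) + w\<bar> \<le> 2 * \<bar>p\<bar> + 2 * \<bar>q\<bar> + \<bar>w\<bar>" for p q w :: real by (smt (verit))
    note this[of "u \<bullet> (e - e')" "(u - u') \<bullet> e'" "(norm e - norm e') * (norm e + norm e')"]
    with \<open>\<bar>u \<bullet> (e - e')\<bar> \<le> _\<close> \<open>\<bar>(u - u') \<bullet> e'\<bar> \<le> _\<close> \<open>\<bar>(norm e - norm e') * (norm e + norm e')\<bar> \<le> _\<close>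
    show ?thesis unfolding sq by (smt (verit))
  qed
  moreover have "\<bar>v - v'\<bar> \<le> \<bar>v\<^sup>2 - v'\<^sup>2\<bar>"
  proof -
    have "\<bar>v\<^sup>2 - v'\<^sup>2\<bar> = \<bar>v - v'\<bar> * (v + v')"
      using v by (simp add: power2_eq_square square_diff_square_factored abs_mult mult.commute)
    moreover have "\<bar>v - v'\<bar> * 1 \<le> \<bar>v - v'\<bar> * (v + v')" using v by (intro mult_left_mono) auto
    ultimately show ?thesis by simp
  qed
  moreover have "\<bar>s' - s\<bar> \<le> 4 * \<bar>v - v'\<bar>"
  proof -
    have "s' - s = s * s' * (v - v')" using v by (simp add: s_def s'_def field_simps)
    then have "\<bar>s' - s\<bar> = s * s' * \<bar>v - v'\<bar>" using s by (simp add: abs_mult)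
    also have "\<dots> \<le> (2 * 2) * \<bar>v - v'\<bar>" using s by (intro mult_right_mono mult_mono) auto
    finally show ?thesis by simp
  qed
  ultimately have ds: "\<bar>s' - s\<bar> \<le> 12 * norm (e' - e) + 8 * (norm (u' - u) * norm e')" by (smt (verit))
  have ds1: "\<bar>1 - s'\<bar> \<le> 2 * norm e'"
  proof -
    have "1 - s' = s' * (v' - norm u')" using v u by (simp add: s'_def field_simps)
    then have "\<bar>1 - s'\<bar> = s' * \<bar>v' - norm u'\<bar>" using s by (simp add: abs_mult)
    also have "\<dots> \<le> 2 * norm e'"
      using s norm_triangle_ineq3[of "u' - e'" u'] unfolding v'_def by (intro mult_mono) auto
    finally show ?thesis .
  qed
  \<comment> \<open>Each summand contains a difference of the data or the factor
    \<open>s' - s\<close>, already bounded by such differences; \<open>1 - s'\<close> is of the size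
    of e'.\<close>
  have "(u' - s' *\<^sub>R (u' - e')) - (u - s *\<^sub>R (u - e)) =
    (1 - s') *\<^sub>R (u' - u) + (s - s') *\<^sub>R u + s' *\<^sub>R (e' - e) + (s' - s) *\<^sub>R e"
    by (simp add: algebra_simps)
  also have "norm \<dots> \<le> norm ((1 - s') *\<^sub>R (u' - u)) + norm ((s - s') *\<^sub>R u)
      + norm (s' *\<^sub>R (e' - e)) + norm ((s' - s) *\<^sub>R e)"
    by (intro order_trans[OF norm_triangle_ineq] add_mono order_refl)
  also have "\<dots> \<le> 2 * norm e' * norm (u' - u) + \<bar>s' - s\<bar> * 1 + 2 * norm (e' - e) + \<bar>s' - s\<bar> * (1/2)"
    unfolding norm_scaleR using ds1 s e u
    by (intro add_mono mult_mono) (auto simp: abs_minus_commute)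
  also have "\<dots> \<le> 20 * norm (e' - e) + 14 * (norm (u' - u) * norm e')"
    using ds by (simp add: mult.commute)
  finally show ?thesis by (simp add: s_def s'_def v_def v'_def)
qed

text \<open>The constants 800 = 2 * 20^2 and 392 = 2 * 14^2 come from squaring the second
  conclusion; its term at the shifted cell has the same sum as the unshifted one by
  periodicity.\<close>

lemma h1_projection_le:
  fixes U e :: "int^'d \<Rightarrow> real^3"
  assumes N: "N \<ge> 1" and per: "periodic N e"
    and U: "\<And>I. norm (U I) = 1" "\<And>i I. norm (fwd N i U I) \<le> K" and K: "0 \<le> K"
    and e: "\<And>I. norm (e I) \<le> 1/2"
    and E: "\<And>I. E I = U I - (1 / norm (U I - e I)) *\<^sub>R (U I - e I)"
  shows "\<And>I. norm (E I) \<le> 2 * norm (e I)"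
    and "\<And>i I. norm (fwd N i E I) \<le> 20 * norm (fwd N i e I) + 14 * K * norm (e (I + axis i 1))"
    and "h1 N E \<le> (800 + 392 * K\<^sup>2 * real CARD('d)) * h1 N e"
proof -
  show 1: "norm (E I) \<le> 2 * norm (e I)" for I
    unfolding E by (rule projection_error[OF U(1) e])
  show 2: "norm (fwd N i E I) \<le> 20 * norm (fwd N i e I) + 14 * K * norm (e (I + axis i 1))" for i I
  proof -
    let ?h = "mesh N"
    have h: "?h > 0" by (rule mesh_pos[OF N])
    have nf: "norm (F (I + axis i 1) - F I) = ?h * norm (fwd N i F I)" for F :: "int^'d \<Rightarrow> real^3"
      using h by (simp add: fwd_def)
    have "norm (E (I + axis i 1) - E I) \<le> 20 * norm (e (I + axis i 1) - e I)
      + 14 * (norm (U (I + axis i 1) - U I) * norm (e (I + axis i 1)))"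
      unfolding E by (rule projection_error_diff[OF U(1) U(1) e e])
    then have "?h * norm (fwd N i E I) \<le> ?h * (20 * norm (fwd N i e I)
      + 14 * norm (fwd N i U I) * norm (e (I + axis i 1)))"
      unfolding nf by (simp add: algebra_simps)
    then have "norm (fwd N i E I) \<le> 20 * norm (fwd N i e I)
      + 14 * norm (fwd N i U I) * norm (e (I + axis i 1))" using h by simp
    also have "\<dots> \<le> 20 * norm (fwd N i e I) + 14 * K * norm (e (I + axis i 1))"
      using U(2)[of i I] by (intro add_mono mult_right_mono) auto
    finally show ?thesis .
  qed
  have t0: "tsum N (\<lambda>I. (norm (E I))\<^sup>2) \<le> 4 * tsum N (\<lambda>I. (norm (e I))\<^sup>2)"
    unfolding tsum_cmult[symmetric]
  proof (rule tsum_mono)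
    fix I show "(norm (E I))\<^sup>2 \<le> 4 * (norm (e I))\<^sup>2"
      using power_mono[OF 1[of I] norm_ge_zero, of 2] by (simp add: power_mult_distrib)
  qed
  have t1: "tsum N (\<lambda>I. (norm (fwd N i E I))\<^sup>2) \<le>
     800 * tsum N (\<lambda>I. (norm (fwd N i e I))\<^sup>2) + 392 * K\<^sup>2 * tsum N (\<lambda>I. (norm (e I))\<^sup>2)" for i
  proof -
    have "periodic N (\<lambda>I. (norm (e I))\<^sup>2)" using per by (simp add: periodic_def)
    from tsum_shift[OF N this, of i 1]
    have sh: "tsum N (\<lambda>I. (norm (e I))\<^sup>2) = tsum N (\<lambda>I. (norm (e (I + axis i 1)))\<^sup>2)" by simp
    show ?thesis unfolding sh tsum_cmult[symmetric] tsum_add[symmetric]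
    proof (rule tsum_mono)
      fix I
      have "(norm (fwd N i E I))\<^sup>2 \<le> (20 * norm (fwd N i e I) + 14 * K * norm (e (I + axis i 1)))\<^sup>2"
        by (intro power_mono 2) auto
      also have "\<dots> \<le> 2 * (20 * norm (fwd N i e I))\<^sup>2 + 2 * (14 * K * norm (e (I + axis i 1)))\<^sup>2"
        using sum_squares_bound[of "20 * norm (fwd N i e I)" "14 * K * norm (e (I + axis i 1))"]
        by (simp add: power2_sum)
      finally show "(norm (fwd N i E I))\<^sup>2 \<le> 800 * (norm (fwd N i e I))\<^sup>2
          + 392 * K\<^sup>2 * (norm (e (I + axis i 1)))\<^sup>2"
        by (simp add: power_mult_distrib)
    qed
  qed
  let ?A = "tsum N (\<lambda>I. (norm (e I))\<^sup>2)" and ?B = "\<Sum>i\<in>UNIV. tsum N (\<lambda>I. (norm (fwd N i e I))\<^sup>2)"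
  have AB: "0 \<le> ?A" "0 \<le> ?B" by (auto intro!: tsum_nonneg sum_nonneg)
  have "h1 N E \<le> 4 * ?A + (\<Sum>i\<in>UNIV. 800 * tsum N (\<lambda>I. (norm (fwd N i e I))\<^sup>2) + 392 * K\<^sup>2 * ?A)"
    unfolding h1_def by (intro add_mono sum_mono t0 t1)
  also have "\<dots> = 4 * ?A + 800 * ?B + 392 * K\<^sup>2 * real CARD('d) * ?A"
    by (simp add: sum.distrib sum_distrib_left)
  also have "\<dots> \<le> (800 + 392 * K\<^sup>2 * real CARD('d)) * (?A + ?B)"
  proof -
    have "0 \<le> 392 * K\<^sup>2 * real CARD('d) * ?B" using AB by simp
    then show ?thesis using AB by (simp add: algebra_simps)
  qed
  finally show "h1 N E \<le> (800 + 392 * K\<^sup>2 * real CARD('d)) * h1 N e" by (simp add: h1_def)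
qed

text \<open>With p and q the two sums of squares, p x - q y = (p - q) x + q (x - y), and p - q is
  factored into differences times sums. The bound 7 is the one for an extrapolation of unit
  vectors.\<close>

lemma gradient_term_diff:
  fixes P Q :: "'d::finite \<Rightarrow> 'a::real_inner" and x y :: "'b::real_normed_vector"
  assumes "\<And>i. norm (P i) \<le> B" "\<And>i. norm (Q i) \<le> B" "norm x \<le> 7" "0 \<le> B"
  shows "norm ((\<Sum>i\<in>UNIV. (norm (P i))\<^sup>2) *\<^sub>R x - (\<Sum>i\<in>UNIV. (norm (Q i))\<^sup>2) *\<^sub>R y)
    \<le> 14 * B * (\<Sum>i\<in>UNIV. norm (P i - Q i)) + real CARD('d) * B\<^sup>2 * norm (x - y)"
proof -
  let ?p = "\<Sum>i\<in>UNIV. (norm (P i))\<^sup>2" and ?q = "\<Sum>i\<in>UNIV. (norm (Q i))\<^sup>2"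
  have pq: "\<bar>?p - ?q\<bar> \<le> 2 * B * (\<Sum>i\<in>UNIV. norm (P i - Q i))"
    unfolding sum_subtractf[symmetric] sum_distrib_left
  proof (intro order_trans[OF sum_abs] sum_mono)
    fix i
    have "\<bar>(norm (P i))\<^sup>2 - (norm (Q i))\<^sup>2\<bar> = \<bar>norm (P i) - norm (Q i)\<bar> * (norm (P i) + norm (Q i))"
      by (simp add: power2_eq_square square_diff_square_factored abs_mult mult.commute)
    also have "\<dots> \<le> norm (P i - Q i) * (B + B)"
      using assms norm_triangle_ineq3[of "P i" "Q i"] by (intro mult_mono add_mono) auto
    finally show "\<bar>(norm (P i))\<^sup>2 - (norm (Q i))\<^sup>2\<bar> \<le> 2 * B * norm (P i - Q i)" by (simp add: mult_ac)
  qed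
  have q: "0 \<le> ?q" "?q \<le> real CARD('d) * B\<^sup>2"
    using assms(2) by (auto intro!: sum_nonneg sum_bounded_above power_mono)
  have "?p *\<^sub>R x - ?q *\<^sub>R y = (?p - ?q) *\<^sub>R x + ?q *\<^sub>R (x - y)" by (simp add: algebra_simps)
  also have "norm \<dots> \<le> \<bar>?p - ?q\<bar> * norm x + ?q * norm (x - y)"
    using norm_triangle_ineq[of "(?p - ?q) *\<^sub>R x" "?q *\<^sub>R (x - y)"] q(1) by simp
  also have "\<dots> \<le> (2 * B * (\<Sum>i\<in>UNIV. norm (P i - Q i))) * 7 + real CARD('d) * B\<^sup>2 * norm (x - y)"
    using pq q assms by (intro add_mono mult_mono) auto
  finally show ?thesis by simp
qed

section \<open>The energy estimate\<close>

text \<open>The \<open>G_form\<close> parts arise from the difference quotient in time, tested with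
  the field and with its Laplacian; the sums over directions are the Dirichlet form of
  \<open>tlap\<close> in \<open>summation_by_parts\<close>. The last part is what telescopes in the
  dissipation and therefore carries the factor k.\<close>

definition energy :: "nat \<Rightarrow> real \<Rightarrow> real \<Rightarrow> real \<Rightarrow> (int^'d \<Rightarrow> real^3) \<Rightarrow> (int^'d \<Rightarrow> real^3) \<Rightarrow> (int^'d \<Rightarrow> real^3) \<Rightarrow> real" where
  "energy N k \<epsilon> \<beta> x y z = tsum N (\<lambda>I. G_form (x I) (y I) (z I))
     + (\<Sum>i\<in>UNIV. tsum N (\<lambda>I. G_form (fwd N i x I) (fwd N i y I) (fwd N i z I))
         + (mesh N)\<^sup>2 / 12 * tsum N (\<lambda>I. G_form (dd2 N i x I) (dd2 N i y I) (dd2 N i z I)))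
     + k * tsum N (\<lambda>I. (1 + \<epsilon>) * H_form (tlap N x I) (tlap N y I) (tlap N z I) + \<beta> / 4 * (norm (tlap N x I))\<^sup>2)"

text \<open>Only the last square in each \<open>G_form\<close> is kept, which gives 1/6; the parts
  with \<open>dd2\<close> and \<open>tlap\<close> are nonnegative and dropped.\<close>

lemma energy_lower:
  assumes "0 \<le> k" "0 \<le> \<epsilon>" "0 \<le> \<beta>"
  shows "1/6 * h1 N x \<le> energy N k \<epsilon> \<beta> x y z"
proof -
  have g: "1/6 * tsum N (\<lambda>I. (norm (a I))\<^sup>2) \<le> tsum N (\<lambda>I. G_form (a I) (b I) (c I))"
    for a b c :: "int^'a \<Rightarrow> real^3"
    unfolding tsum_cmult[symmetric]
    by (intro tsum_mono order_trans[OF _ G_form_lower]) simp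
  have g0: "0 \<le> tsum N (\<lambda>I. G_form (a I) (b I) (c I))"
    for a b c :: "int^'a \<Rightarrow> real^3"
    by (intro tsum_nonneg order_trans[OF _ G_form_lower]) auto
  have "0 \<le> k * tsum N (\<lambda>I. (1 + \<epsilon>) * H_form (tlap N x I) (tlap N y I) (tlap N z I) + \<beta> / 4 * (norm (tlap N x I))\<^sup>2)"
    using assms by (intro mult_nonneg_nonneg tsum_nonneg add_nonneg_nonneg H_form_nonneg) simp_all
  moreover have "(\<Sum>i\<in>UNIV. 1/6 * tsum N (\<lambda>I. (norm (fwd N i x I))\<^sup>2)) \<le>
    (\<Sum>i\<in>UNIV. tsum N (\<lambda>I. G_form (fwd N i x I) (fwd N i y I) (fwd N i z I))
         + (mesh N)\<^sup>2 / 12 * tsum N (\<lambda>I. G_form (dd2 N i x I) (dd2 N i y I) (dd2 N i z I)))"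
    by (intro sum_mono add_increasing2 mult_nonneg_nonneg g g0) simp_all
  ultimately show ?thesis
    using g[of x y z] unfolding energy_def h1_def distrib_left sum_distrib_left by linarith
qed

lemma Young_le:
  fixes x y \<theta> :: real
  assumes "\<theta> > 0" shows "x * y \<le> \<theta> * x\<^sup>2 + y\<^sup>2 / (4 * \<theta>)"
proof -
  have "(2 * \<theta> * x - y)\<^sup>2 = (4 * \<theta>) * (\<theta> * x\<^sup>2 - x * y) + y\<^sup>2"
    by (simp add: power2_eq_square algebra_simps)
  then have "(2 * \<theta> * x - y)\<^sup>2 / (4 * \<theta>) = \<theta> * x\<^sup>2 - x * y + y\<^sup>2 / (4 * \<theta>)"
    using assms by (simp add: add_divide_distrib)
  moreover have "0 \<le> (2 * \<theta> * x - y)\<^sup>2 / (4 * \<theta>)" using assms by simp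
  ultimately show ?thesis by linarith
qed

text \<open>Up to the summand 1 this is 25/(4 \<theta>) times 2 (1 + (2 \<alpha>)^2), the outcome of
  Young's inequality with weight \<theta> in \<open>pointwise_dissipation\<close>.\<close>

definition err_const :: "real \<Rightarrow> real \<Rightarrow> real" where
  "err_const \<alpha> \<theta> = 25 / (2 * \<theta>) * (1 + (2 * \<alpha>)\<^sup>2) + 1"

lemma norm_cross3_le: "norm (cross3 x y) \<le> norm x * norm y"
proof -
  have "(norm (cross3 x y))\<^sup>2 \<le> (norm x * norm y)\<^sup>2"
    using norm_cross_dot[of x y] zero_le_power2[of "x \<bullet> y"] by linarith
  then show ?thesis by (rule power2_le_imp_le) simp
qed

text \<open>W is the plain part of the test function and a3 - 1/2 a2 its Laplacian. Of \<alpha> = 7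
  (1 + \<epsilon>) + \<beta> the first share absorbs the cross product through
  \<open>extrapolation_dissipation\<close>, while \<beta> yields \<beta>/2 |a3|^2 and a telescoping
  part with factor \<beta>/4. Of \<beta>/2 = 8 \<theta> the amount 4 \<theta> is retained; one
  \<theta> per level on the right pays for the products with r and W.\<close>

lemma pointwise_dissipation:
  fixes a0 a1 a2 a3 M r W :: "real^3"
  assumes \<alpha>: "\<alpha> > 7" and M: "norm M \<le> 1 + \<epsilon>" and \<epsilon>: "\<epsilon> = (\<alpha> - 7) / 14"
    and \<beta>: "\<beta> = (\<alpha> - 7) / 2" and \<theta>: "\<theta> = \<beta> / 16"
  shows "(- cross3 M (extr a2 a1 a0) + \<alpha> *\<^sub>R a3 + r) \<bullet> (W - (a3 - (1/2) *\<^sub>R a2))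
    \<le> - ((1 + \<epsilon>) * H_form a3 a2 a1 + \<beta> / 4 * (norm a3)\<^sup>2)
      + ((1 + \<epsilon>) * H_form a2 a1 a0 + \<beta> / 4 * (norm a2)\<^sup>2)
      - 4 * \<theta> * (norm a3)\<^sup>2
      + \<theta> * ((norm a0)\<^sup>2 + (norm a1)\<^sup>2 + (norm a2)\<^sup>2 + (norm a3)\<^sup>2)
      + err_const \<alpha> \<theta> * ((norm r)\<^sup>2 + (norm W)\<^sup>2)"
proof -
  define w x where "w = a3 - (1/2) *\<^sub>R a2" and "x = extr a2 a1 a0"
  define S where "S = (norm a0)\<^sup>2 + (norm a1)\<^sup>2 + (norm a2)\<^sup>2 + (norm a3)\<^sup>2"
  \<comment> \<open>The multiple 5 s is a common crude bound for |x|, |w| and |a3|, so that a single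
    use of Young's inequality, in statement 5, treats all lower-order products.\<close>
  define s where "s = sqrt S"
  have th: "\<theta> > 0" using \<alpha> \<beta> \<theta> by simp
  have S0: "S \<ge> 0" by (simp add: S_def)
  have s: "s \<ge> 0" "s\<^sup>2 = S" using S0 by (auto simp: s_def)
  have cx: "norm (cross3 M x) \<le> (1 + \<epsilon>) * norm x"
    using norm_cross3_le[of M x] M by (meson mult_right_mono norm_ge_zero order_trans)
  have x5: "norm x \<le> 5 * s"
  proof (rule power2_le_imp_le)
    have lin: "p \<le> 25 * (a + b + c + d)" if "p \<le> 19 * (c + b + a)" "0 \<le> a" "0 \<le> b" "0 \<le> c" "0 \<le> d"
      for p a b c d :: real using that by (smt (verit))
    have "(norm x)\<^sup>2 \<le> 25 * S"
      unfolding x_def S_def by (rule lin[OF norm_extr_sq_le]) simp_all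
    then show "(norm x)\<^sup>2 \<le> (5 * s)\<^sup>2" using s by (simp add: power_mult_distrib)
  qed (use s in simp)
  have w2: "(norm w)\<^sup>2 \<le> 2 * ((norm a3)\<^sup>2 + (norm a2)\<^sup>2)"
  proof -
    have "norm w \<le> norm a3 + norm a2 / 2"
      unfolding w_def using norm_triangle_ineq4[of a3 "(1/2) *\<^sub>R a2"] by simp
    then have "(norm w)\<^sup>2 \<le> (norm a3 + norm a2 / 2)\<^sup>2" by (intro power_mono) auto
    also have "\<dots> \<le> 2 * ((norm a3)\<^sup>2 + (norm a2)\<^sup>2)"
    proof -
      have "2 * ((norm a3)\<^sup>2 + (norm a2)\<^sup>2) - (norm a3 + norm a2 / 2)\<^sup>2
        = (norm a3 - norm a2 / 2)\<^sup>2 + 3/2 * (norm a2)\<^sup>2"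
        by (simp add: power2_eq_square algebra_simps)
      moreover have "0 \<le> (norm a3 - norm a2 / 2)\<^sup>2 + 3/2 * (norm a2)\<^sup>2" by simp
      ultimately show ?thesis by linarith
    qed
    finally show ?thesis .
  qed
  have w5: "norm w \<le> 5 * s"
  proof (rule power2_le_imp_le)
    show "(norm w)\<^sup>2 \<le> (5 * s)\<^sup>2"
    proof -
      have lin: "p \<le> 25 * (a + b + c + d)" if "p \<le> 2 * (d + c)" "0 \<le> a" "0 \<le> b" "0 \<le> c" "0 \<le> d"
        for p a b c d :: real using that by (smt (verit))
      have "(norm w)\<^sup>2 \<le> 25 * S" unfolding S_def by (rule lin[OF w2]) simp_all
      then show ?thesis using s by (simp add: power_mult_distrib)
    qed
  qed (use s in simp)
  have a5: "norm a3 \<le> 5 * s"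
  proof (rule power2_le_imp_le)
    show "(norm a3)\<^sup>2 \<le> (5 * s)\<^sup>2"
    proof -
      have "(norm a3)\<^sup>2 \<le> S" unfolding S_def by simp
      then have "(norm a3)\<^sup>2 \<le> 25 * S" using S0 by linarith
      then show ?thesis using s by (simp add: power_mult_distrib)
    qed
  qed (use s in simp)
  have split: "(- cross3 M x + \<alpha> *\<^sub>R a3 + r) \<bullet> (W - w) =
    - \<alpha> * (a3 \<bullet> w) + cross3 M x \<bullet> w - r \<bullet> w + (- cross3 M x + \<alpha> *\<^sub>R a3 + r) \<bullet> W"
    by (simp add: inner_simps algebra_simps)
  have 1: "cross3 M x \<bullet> w \<le> (1 + \<epsilon>) * ((3/28) * (norm x)\<^sup>2 + (7/3) * (norm w)\<^sup>2)"
  proof -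
    have "cross3 M x \<bullet> w \<le> norm (cross3 M x) * norm w" by (rule norm_cauchy_schwarz)
    also have "\<dots> \<le> (1 + \<epsilon>) * norm x * norm w" by (intro mult_right_mono cx) auto
    also have "\<dots> \<le> (1 + \<epsilon>) * ((3/28) * (norm x)\<^sup>2 + (7/3) * (norm w)\<^sup>2)"
      using Young_le[of "3/28" "norm x" "norm w"] \<alpha> \<epsilon> by (simp add: mult.assoc)
    finally show ?thesis .
  qed
  have 2: "a3 \<bullet> w \<ge> 1/2 * (norm a3)\<^sup>2 + 1/4 * ((norm a3)\<^sup>2 - (norm a2)\<^sup>2)"
  proof -
    have "0 \<le> (a3 - a2) \<bullet> (a3 - a2)" by simp
    also have "\<dots> = a3 \<bullet> a3 - 2 * (a3 \<bullet> a2) + a2 \<bullet> a2"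
      by (simp add: inner_diff_left inner_diff_right inner_commute)
    finally have "2 * (a3 \<bullet> a2) \<le> a3 \<bullet> a3 + a2 \<bullet> a2" by linarith
    moreover have "a3 \<bullet> w = a3 \<bullet> a3 - 1/2 * (a3 \<bullet> a2)" by (simp add: w_def inner_diff_right)
    moreover have "1/4 * (a3 \<bullet> a3 - a2 \<bullet> a2) = 1/4 * (a3 \<bullet> a3) - 1/4 * (a2 \<bullet> a2)"
      by (rule right_diff_distrib)
    ultimately show ?thesis unfolding power2_norm_eq_inner by linarith
  qed
  have 3: "- (r \<bullet> w) \<le> norm r * (5 * s)"
  proof -
    have "- (r \<bullet> w) \<le> norm r * norm w"
      using norm_cauchy_schwarz[of "- r" w] by simp
    also have "\<dots> \<le> norm r * (5 * s)" by (intro mult_left_mono w5) auto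
    finally show ?thesis .
  qed
  have 4: "(- cross3 M x + \<alpha> *\<^sub>R a3 + r) \<bullet> W \<le> ((2 * \<alpha>) * (5 * s) + norm r) * norm W"
  proof -
    have "norm (- cross3 M x + \<alpha> *\<^sub>R a3 + r) \<le> norm (cross3 M x) + norm (\<alpha> *\<^sub>R a3) + norm r"
      using norm_triangle_ineq[of "- cross3 M x + \<alpha> *\<^sub>R a3" r]
        norm_triangle_ineq[of "- cross3 M x" "\<alpha> *\<^sub>R a3"] unfolding norm_minus_cancel by linarith
    also have "\<dots> \<le> (1 + \<epsilon>) * (5 * s) + \<alpha> * (5 * s) + norm r"
      using cx x5 a5 \<alpha> \<epsilon> by (intro add_mono order_trans[OF cx] mult_left_mono) auto
    also have "\<dots> \<le> (2 * \<alpha>) * (5 * s) + norm r"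
    proof -
      have "(1 + \<epsilon>) * s \<le> \<alpha> * s" using \<alpha> \<epsilon> s by (intro mult_right_mono) auto
      then show ?thesis by (simp add: algebra_simps)
    qed
    finally have "norm (- cross3 M x + \<alpha> *\<^sub>R a3 + r) \<le> (2 * \<alpha>) * (5 * s) + norm r" .
    then have "norm (- cross3 M x + \<alpha> *\<^sub>R a3 + r) * norm W \<le> ((2 * \<alpha>) * (5 * s) + norm r) * norm W"
      by (intro mult_right_mono) auto
    then show ?thesis using norm_cauchy_schwarz order_trans by blast
  qed
  have 5: "norm r * (5 * s) + ((2 * \<alpha>) * (5 * s) + norm r) * norm W
     \<le> \<theta> * S + err_const \<alpha> \<theta> * ((norm r)\<^sup>2 + (norm W)\<^sup>2)"
  proof -
    let ?y = "norm r + (2 * \<alpha>) * norm W"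
    have "s * (5 * ?y) \<le> \<theta> * S + (5 * ?y)\<^sup>2 / (4 * \<theta>)"
      using Young_le[OF th, of s "5 * ?y"] unfolding s(2) .
    moreover have "?y\<^sup>2 \<le> 2 * (1 + (2 * \<alpha>)\<^sup>2) * ((norm r)\<^sup>2 + (norm W)\<^sup>2)"
    proof -
      have "?y\<^sup>2 \<le> 2 * (norm r)\<^sup>2 + 2 * ((2 * \<alpha>) * norm W)\<^sup>2"
        using sum_squares_bound[of "norm r" "(2 * \<alpha>) * norm W"] by (simp add: power2_sum)
      also have "\<dots> \<le> 2 * (1 + (2 * \<alpha>)\<^sup>2) * ((norm r)\<^sup>2 + (norm W)\<^sup>2)"
        by (simp add: power_mult_distrib algebra_simps)
      finally show ?thesis .
    qed
    then have "25 / (4 * \<theta>) * ?y\<^sup>2 \<le> 25 / (4 * \<theta>) * (2 * (1 + (2 * \<alpha>)\<^sup>2) * ((norm r)\<^sup>2 + (norm W)\<^sup>2))"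
      using th by (intro mult_left_mono) auto
    moreover have "norm r * norm W \<le> (norm r)\<^sup>2 + (norm W)\<^sup>2"
      using Young_le[of 1 "norm r" "norm W"] zero_le_power2[of "norm W"] by linarith
    moreover have "err_const \<alpha> \<theta> * ((norm r)\<^sup>2 + (norm W)\<^sup>2) =
      25 / (4 * \<theta>) * (2 * (1 + (2 * \<alpha>)\<^sup>2) * ((norm r)\<^sup>2 + (norm W)\<^sup>2)) + ((norm r)\<^sup>2 + (norm W)\<^sup>2)"
    proof -
      have "25 / (2 * \<theta>) = 25 / (4 * \<theta>) * 2" by simp
      then show ?thesis unfolding err_const_def by (simp only: distrib_right mult.assoc mult_1)
    qed
    moreover have "(5 * ?y)\<^sup>2 / (4 * \<theta>) = 25 / (4 * \<theta>) * ?y\<^sup>2" by (simp only: power_mult_distrib) simp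
    moreover have "norm r * (5 * s) + ((2 * \<alpha>) * (5 * s) + norm r) * norm W
      = s * (5 * ?y) + norm r * norm W" by (simp add: algebra_simps)
    moreover have "l \<le> t + e" if "a \<le> t + q" "x \<le> y" "R \<le> Z" "e = y + Z" "q = x" "l = a + R"
      for a t q x y R Z e l :: real using that by linarith
    ultimately show ?thesis by blast
  qed
  define P Q H3 H2 where "P = (1 + \<epsilon>) * (7 * (a3 \<bullet> w))"
    and "Q = (1 + \<epsilon>) * ((3/28) * (norm x)\<^sup>2 + (7/3) * (norm w)\<^sup>2)"
    and "H3 = (1 + \<epsilon>) * H_form a3 a2 a1" and "H2 = (1 + \<epsilon>) * H_form a2 a1 a0"
  have 6: "H3 - H2 \<le> P - Q"
  proof -
    have "(1 + \<epsilon>) * (H_form a3 a2 a1 - H_form a2 a1 a0) \<le>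
       (1 + \<epsilon>) * (7 * (a3 \<bullet> w) - (3/28) * (norm x)\<^sup>2 - (7/3) * (norm w)\<^sup>2)"
      unfolding w_def x_def extr_def using \<alpha> \<epsilon>
      by (intro mult_left_mono extrapolation_dissipation) auto
    then show ?thesis unfolding P_def Q_def H3_def H2_def right_diff_distrib distrib_left by linarith
  qed
  have 7: "- \<alpha> * (a3 \<bullet> w) \<le> - P - \<beta> * (1/2 * (norm a3)\<^sup>2) - \<beta> / 4 * (norm a3)\<^sup>2 + \<beta> / 4 * (norm a2)\<^sup>2"
  proof -
    have "\<beta> * (1/2 * (norm a3)\<^sup>2 + 1/4 * ((norm a3)\<^sup>2 - (norm a2)\<^sup>2)) \<le> \<beta> * (a3 \<bullet> w)"
      using 2 \<alpha> \<beta> by (intro mult_left_mono) auto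
    moreover have "\<beta> * (1/2 * (norm a3)\<^sup>2 + 1/4 * ((norm a3)\<^sup>2 - (norm a2)\<^sup>2))
      = \<beta> * (1/2 * (norm a3)\<^sup>2) + \<beta> / 4 * (norm a3)\<^sup>2 - \<beta> / 4 * (norm a2)\<^sup>2"
      by (simp add: right_diff_distrib distrib_left)
    moreover have "\<alpha> = 7 * (1 + \<epsilon>) + \<beta>" using \<epsilon> \<beta> by simp
    then have "\<alpha> * (a3 \<bullet> w) = P + \<beta> * (a3 \<bullet> w)" unfolding P_def by (simp add: algebra_simps)
    ultimately show ?thesis by linarith
  qed
  have 8: "4 * \<theta> * (norm a3)\<^sup>2 \<le> \<beta> * (1/2 * (norm a3)\<^sup>2)"
    unfolding \<theta> using \<alpha> \<beta> by simp
  have "(- cross3 M x + \<alpha> *\<^sub>R a3 + r) \<bullet> (W - w) \<le>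
     - ((1 + \<epsilon>) * H_form a3 a2 a1 + \<beta> / 4 * (norm a3)\<^sup>2)
      + ((1 + \<epsilon>) * H_form a2 a1 a0 + \<beta> / 4 * (norm a2)\<^sup>2)
      - 4 * \<theta> * (norm a3)\<^sup>2 + \<theta> * S + err_const \<alpha> \<theta> * ((norm r)\<^sup>2 + (norm W)\<^sup>2)"
    using split 1[folded Q_def] 3 4 5 6 7 8 unfolding H3_def[symmetric] H2_def[symmetric] by linarith
  then show ?thesis by (simp add: w_def x_def S_def)
qed

lemma fwd_bdf3:
  "fwd N i (\<lambda>I. bdf3 (x3 I) (x2 I) (x1 I) (x0 I)) I
    = bdf3 (fwd N i x3 I) (fwd N i x2 I) (fwd N i x1 I) (fwd N i x0 I)"
  by (simp add: fwd_def bdf3_def algebra_simps)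

lemma dd2_bdf3:
  "dd2 N i (\<lambda>I. bdf3 (x3 I) (x2 I) (x1 I) (x0 I)) I
    = bdf3 (dd2 N i x3 I) (dd2 N i x2 I) (dd2 N i x1 I) (dd2 N i x0 I)"
  by (simp add: dd2_def bdf3_def algebra_simps)

lemma dd2_diff: "dd2 N i (\<lambda>I. F I - G I) I = dd2 N i F I - dd2 N i G I"
  by (simp add: dd2_def algebra_simps)

lemma fwd_scaleR: "fwd N i (\<lambda>I. c *\<^sub>R F I) I = c *\<^sub>R fwd N i F I"
  by (simp add: fwd_def algebra_simps)

lemma dd2_scaleR: "dd2 N i (\<lambda>I. c *\<^sub>R F I) I = c *\<^sub>R dd2 N i F I"
  by (simp add: dd2_def algebra_simps)

lemma tsum_G_step:
  fixes x0 x1 x2 x3 :: "int^'d \<Rightarrow> real^3"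
  shows "tsum N (\<lambda>I. G_form (x3 I) (x2 I) (x1 I)) - tsum N (\<lambda>I. G_form (x2 I) (x1 I) (x0 I))
   \<le> tsum N (\<lambda>I. bdf3 (x3 I) (x2 I) (x1 I) (x0 I) \<bullet> (x3 I - (1/2) *\<^sub>R x2 I))"
  unfolding tsum_diff[symmetric] by (intro tsum_mono bdf3_G_stable)

text \<open>The equation is tested with W - \<open>tlap N W\<close>. Pairing its left side with W
  gives the \<open>G_form\<close> of the errors, pairing it with - \<open>tlap N W\<close> gives,
  after summation by parts, those of their first and second differences. The right side is estimated
  cell by cell in C.\<close>

lemma energy_step:
  fixes e0 e1 e2 e3 M r :: "int^'d \<Rightarrow> real^3"
  assumes N: "N \<ge> 1" and per: "periodic N e0" "periodic N e1" "periodic N e2" "periodic N e3"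
    and k: "k > 0"
    and \<alpha>: "\<alpha> > 7" and M: "\<And>I. norm (M I) \<le> 1 + \<epsilon>" and \<epsilon>: "\<epsilon> = (\<alpha> - 7) / 14"
    and \<beta>: "\<beta> = (\<alpha> - 7) / 2" and \<theta>: "\<theta> = \<beta> / 16"
    and eq: "\<And>I. bdf3 (e3 I) (e2 I) (e1 I) (e0 I) = k *\<^sub>R
      (- cross3 (M I) (extr (tlap N e2 I) (tlap N e1 I) (tlap N e0 I)) + \<alpha> *\<^sub>R tlap N e3 I + r I)"
  shows "energy N k \<epsilon> \<beta> e3 e2 e1 - energy N k \<epsilon> \<beta> e2 e1 e0 + k * (4 * \<theta> * tsum N (\<lambda>I. (norm (tlap N e3 I))\<^sup>2))
    \<le> k * (\<theta> * (tsum N (\<lambda>I. (norm (tlap N e0 I))\<^sup>2) + tsum N (\<lambda>I. (norm (tlap N e1 I))\<^sup>2)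
             + tsum N (\<lambda>I. (norm (tlap N e2 I))\<^sup>2) + tsum N (\<lambda>I. (norm (tlap N e3 I))\<^sup>2))
       + err_const \<alpha> \<theta> * (tsum N (\<lambda>I. (norm (r I))\<^sup>2) + 2 * h1 N e3 + 2 * h1 N e2))"
proof -
  define W where "W = (\<lambda>I. e3 I - (1/2) *\<^sub>R e2 I)"
  define b where "b = (\<lambda>I. bdf3 (e3 I) (e2 I) (e1 I) (e0 I))"
  define a0 a1 a2 a3 where "a0 = tlap N e0" and "a1 = tlap N e1" and "a2 = tlap N e2" and "a3 = tlap N e3"
  have perW: "periodic N W" using per by (simp add: periodic_def W_def)
  have perb: "periodic N b" using per by (simp add: periodic_def b_def)
  have lapW: "tlap N W I = a3 I - (1/2) *\<^sub>R a2 I" for I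
    unfolding W_def tlap_diff tlap_scaleR a3_def a2_def ..
  have th: "\<theta> > 0" using \<alpha> \<beta> \<theta> by simp
  have sbp: "- tsum N (\<lambda>I. b I \<bullet> tlap N W I) =
      (\<Sum>i\<in>UNIV. tsum N (\<lambda>I. fwd N i b I \<bullet> fwd N i W I)
        + (mesh N)\<^sup>2 / 12 * tsum N (\<lambda>I. dd2 N i b I \<bullet> dd2 N i W I))"
    using summation_by_parts[OF N perW perb] by (simp add: inner_commute)
  let ?F = "\<lambda>i x y z. tsum N (\<lambda>I. G_form (fwd N i x I) (fwd N i y I) (fwd N i z I))"
  let ?D = "\<lambda>i x y z. tsum N (\<lambda>I. G_form (dd2 N i x I) (dd2 N i y I) (dd2 N i z I))"
  let ?G = "\<lambda>x y z. tsum N (\<lambda>I. G_form (x I) (y I) (z I))"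
  have "?F i e3 e2 e1 - ?F i e2 e1 e0 \<le> tsum N (\<lambda>I. fwd N i b I \<bullet> fwd N i W I)" for i
    unfolding b_def W_def fwd_bdf3 fwd_diff fwd_scaleR by (rule tsum_G_step)
  moreover have "?D i e3 e2 e1 - ?D i e2 e1 e0 \<le> tsum N (\<lambda>I. dd2 N i b I \<bullet> dd2 N i W I)" for i
    unfolding b_def W_def dd2_bdf3 dd2_diff dd2_scaleR by (rule tsum_G_step)
  ultimately have "(\<Sum>i\<in>UNIV. (?F i e3 e2 e1 - ?F i e2 e1 e0) + (mesh N)\<^sup>2 / 12 * (?D i e3 e2 e1 - ?D i e2 e1 e0))
     \<le> - tsum N (\<lambda>I. b I \<bullet> tlap N W I)"
    unfolding sbp by (intro sum_mono add_mono mult_left_mono) auto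
  then have A: "(\<Sum>i\<in>UNIV. ?F i e3 e2 e1 + (mesh N)\<^sup>2 / 12 * ?D i e3 e2 e1)
     - (\<Sum>i\<in>UNIV. ?F i e2 e1 e0 + (mesh N)\<^sup>2 / 12 * ?D i e2 e1 e0) \<le> - tsum N (\<lambda>I. b I \<bullet> tlap N W I)"
    unfolding sum_subtractf[symmetric] by (simp add: algebra_simps)
  have B: "?G e3 e2 e1 - ?G e2 e1 e0 \<le> tsum N (\<lambda>I. b I \<bullet> W I)"
    unfolding b_def W_def by (rule tsum_G_step)
  let ?H = "\<lambda>x y z I. (1 + \<epsilon>) * H_form (x I) (y I) (z I) + \<beta> / 4 * (norm (x I))\<^sup>2"
  have C: "tsum N (\<lambda>I. b I \<bullet> W I) - tsum N (\<lambda>I. b I \<bullet> tlap N W I) \<le>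
     k * (- tsum N (?H a3 a2 a1) + tsum N (?H a2 a1 a0) - 4 * \<theta> * tsum N (\<lambda>I. (norm (a3 I))\<^sup>2)
      + \<theta> * (tsum N (\<lambda>I. (norm (a0 I))\<^sup>2) + tsum N (\<lambda>I. (norm (a1 I))\<^sup>2)
             + tsum N (\<lambda>I. (norm (a2 I))\<^sup>2) + tsum N (\<lambda>I. (norm (a3 I))\<^sup>2))
      + err_const \<alpha> \<theta> * (tsum N (\<lambda>I. (norm (r I))\<^sup>2) + tsum N (\<lambda>I. (norm (W I))\<^sup>2)))"
    unfolding tsum_add[symmetric] tsum_diff[symmetric] tsum_cmult[symmetric] tsum_minus[symmetric]
  proof (rule tsum_mono)
    fix I
    have "b I \<bullet> W I - b I \<bullet> tlap N W I = k * ((- cross3 (M I) (extr (a2 I) (a1 I) (a0 I)) + \<alpha> *\<^sub>R a3 I + r I)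
       \<bullet> (W I - (a3 I - (1/2) *\<^sub>R a2 I)))"
      unfolding b_def eq lapW a0_def a1_def a2_def a3_def inner_scaleR_left
        inner_diff_right[of _ "W I"] right_diff_distrib ..
    also have "\<dots> \<le> k * (- ?H a3 a2 a1 I + ?H a2 a1 a0 I - 4 * \<theta> * (norm (a3 I))\<^sup>2
      + \<theta> * ((norm (a0 I))\<^sup>2 + (norm (a1 I))\<^sup>2 + (norm (a2 I))\<^sup>2 + (norm (a3 I))\<^sup>2)
      + err_const \<alpha> \<theta> * ((norm (r I))\<^sup>2 + (norm (W I))\<^sup>2))"
      using k by (intro mult_left_mono pointwise_dissipation[OF \<alpha> M \<epsilon> \<beta> \<theta>]) auto
    finally show "b I \<bullet> W I - b I \<bullet> tlap N W I \<le> \<dots>" .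
  qed
  have Wle: "tsum N (\<lambda>I. (norm (W I))\<^sup>2) \<le> 2 * h1 N e3 + 2 * h1 N e2"
  proof -
    have "tsum N (\<lambda>I. (norm (W I))\<^sup>2) \<le> tsum N (\<lambda>I. 2 * (norm (e3 I))\<^sup>2 + 2 * (norm (e2 I))\<^sup>2)"
    proof (rule tsum_mono)
      fix I
      have "norm (W I) \<le> norm (e3 I) + norm (e2 I)"
        unfolding W_def using norm_triangle_ineq4[of "e3 I" "(1/2) *\<^sub>R e2 I"] norm_ge_zero[of "e2 I"]
        unfolding norm_scaleR by linarith
      then have "(norm (W I))\<^sup>2 \<le> (norm (e3 I) + norm (e2 I))\<^sup>2" by (intro power_mono) auto
      also have "\<dots> \<le> 2 * (norm (e3 I))\<^sup>2 + 2 * (norm (e2 I))\<^sup>2"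
        using sum_squares_bound[of "norm (e3 I)" "norm (e2 I)"] by (simp add: power2_sum)
      finally show "(norm (W I))\<^sup>2 \<le> 2 * (norm (e3 I))\<^sup>2 + 2 * (norm (e2 I))\<^sup>2" .
    qed
    also have "\<dots> \<le> 2 * h1 N e3 + 2 * h1 N e2"
      unfolding tsum_add tsum_cmult by (intro add_mono mult_left_mono tsum_le_h1) auto
    finally show ?thesis .
  qed
  have "0 \<le> err_const \<alpha> \<theta>" using th by (simp add: err_const_def)
  then have "k * (err_const \<alpha> \<theta> * (tsum N (\<lambda>I. (norm (r I))\<^sup>2) + tsum N (\<lambda>I. (norm (W I))\<^sup>2)))
    \<le> k * (err_const \<alpha> \<theta> * (tsum N (\<lambda>I. (norm (r I))\<^sup>2) + 2 * h1 N e3 + 2 * h1 N e2))"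
    using Wle k by (intro mult_left_mono) auto
  with A B C show ?thesis unfolding energy_def a0_def a1_def a2_def a3_def
      right_diff_distrib distrib_left mult_minus_right by linarith
qed

section \<open>Inverse inequality and lower-order terms\<close>

lemma periodic_mod:
  fixes F :: "int^'d \<Rightarrow> 'b"
  assumes "periodic N F"
  shows "F (\<chi> i. I $ i mod (2 * int N)) = F I"
proof -
  have p: "F (J + axis i (2 * int N)) = F J" for J i using assms by (simp add: periodic_def)
  have one: "F (J + axis i (2 * int N * c)) = F J" for J i c
  proof (induction c rule: int_induct[where k = 0])
    case base
    show ?case by (simp add: axis_zero_int)
  next
    case (step1 c)
    have "J + axis i (2 * int N * (c + 1)) = J + axis i (2 * int N * c) + axis i (2 * int N)"
      unfolding add_axis_axis by (simp only: distrib_left mult_1_right)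
    then show ?case using step1 p by metis
  next
    case (step2 c)
    have "J + axis i (2 * int N * c) = J + axis i (2 * int N * (c - 1)) + axis i (2 * int N)"
      unfolding add_axis_axis by (simp only: right_diff_distrib mult_1_right diff_add_cancel)
    then show ?case using step2 p by metis
  qed
  \<comment> \<open>Coordinates are reduced one at a time, over a growing finite set S of
    directions; S = \<open>UNIV\<close> is the claim.\<close>
  have "F (\<chi> i. if i \<in> S then I $ i mod (2 * int N) else I $ i) = F I" if "finite S" for S
    using that
  proof induction
    case empty
    then show ?case by simp
  next
    case (insert j S)
    have eq: "(\<chi> i. if i \<in> S then I $ i mod (2 * int N) else I $ i)
      = (\<chi> i. if i \<in> insert j S then I $ i mod (2 * int N) else I $ i)
        + axis j (2 * int N * (I $ j div (2 * int N)))"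
      using insert(2) by (auto simp: vec_eq_iff axis_def)
    have "F (\<chi> i. if i \<in> S then I $ i mod (2 * int N) else I $ i)
      = F (\<chi> i. if i \<in> insert j S then I $ i mod (2 * int N) else I $ i)"
      unfolding eq by (rule one)
    then show ?case using insert(3) by metis
  qed
  from this[of UNIV] show ?thesis by simp
qed

text \<open>The value at one cell is a single term of the sum. The mesh size is at most 1, so its
  d-th power dominates its third power and one exponent serves all dimensions.\<close>

lemma inverse_inequality:
  fixes F :: "int^'d \<Rightarrow> real^3"
  assumes N: "N \<ge> 1" and per: "periodic N F" and d: "CARD('d) \<le> 3"
  shows "mesh N ^ 3 * (norm (F I))\<^sup>2 \<le> tsum N (\<lambda>I. (norm (F I))\<^sup>2)"
proof -
  define J where "J = (\<chi> i. I $ i mod (2 * int N))"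
  have J: "J \<in> torus N" using N by (simp add: J_def torus_def)
  have "(norm (F J))\<^sup>2 \<le> (\<Sum>I\<in>torus N. (norm (F I))\<^sup>2)"
    by (rule member_le_sum[OF J]) (auto simp: finite_torus)
  moreover have "mesh N ^ 3 \<le> mesh N ^ CARD('d)"
    using d N by (intro power_decreasing) (auto simp: mesh_def)
  ultimately have "mesh N ^ 3 * (norm (F J))\<^sup>2 \<le> mesh N ^ CARD('d) * (\<Sum>I\<in>torus N. (norm (F I))\<^sup>2)"
    by (intro mult_mono) auto
  moreover have "F J = F I" unfolding J_def by (rule periodic_mod[OF per])
  ultimately show ?thesis by (simp add: tsum_def)
qed

lemma card_torus: "card (torus N :: (int^'d) set) \<le> (2 * N) ^ CARD('d)"
proof -
  have sub: "torus N \<subseteq> (\<lambda>f. \<chi> i. f i) ` (PiE (UNIV :: 'd set) (\<lambda>_. {0..<2 * int N}))"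
  proof
    fix I :: "int^'d" assume "I \<in> torus N"
    then show "I \<in> (\<lambda>f. \<chi> i. f i) ` (PiE (UNIV :: 'd set) (\<lambda>_. {0..<2 * int N}))"
      by (intro image_eqI[where x = "\<lambda>i. I $ i"]) (auto simp: torus_def)
  qed
  have fin: "finite (PiE (UNIV :: 'd set) (\<lambda>_. {0..<2 * int N}))" by (intro finite_PiE) auto
  have "card (torus N :: (int^'d) set) \<le> card (PiE (UNIV :: 'd set) (\<lambda>_. {0..<2 * int N}))"
    using card_mono[OF finite_imageI[OF fin] sub] card_image_le[OF fin] by (rule order_trans)
  also have "\<dots> = (2 * N) ^ CARD('d)"
    by (subst card_PiE) (auto simp: nat_mult_distrib)
  finally show ?thesis .
qed

lemma tsum_const_le:
  fixes c :: real
  assumes "N \<ge> 1" "0 \<le> c"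
  shows "tsum N (\<lambda>I :: int^'d. c) \<le> 2 ^ CARD('d) * c"
proof -
  have "mesh N ^ CARD('d) * real (card (torus N :: (int^'d) set)) \<le> mesh N ^ CARD('d) * real ((2 * N) ^ CARD('d))"
    using card_torus[where 'd = 'd, of N] by (intro mult_left_mono) (auto simp only: of_nat_le_iff mesh_nonneg zero_le_power)
  also have "\<dots> = (mesh N * (2 * real N)) ^ CARD('d)" by (simp add: power_mult_distrib)
  also have "mesh N * (2 * real N) = 2" using assms by (simp add: mesh_def)
  finally have "mesh N ^ CARD('d) * real (card (torus N :: (int^'d) set)) * c \<le> 2 ^ CARD('d) * c"
    using assms by (intro mult_right_mono) auto
  then show ?thesis by (simp add: tsum_def mult.assoc)
qed

text \<open>57 = 3 * 19: the factor of \<open>sq_sum3_le\<close> times that of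
  \<open>h1_extr_le\<close>. The number 14 (K + 1) = 2 * 7 * (K + 1) bounds the wide differences of
  an extrapolation, and 3 * 2^d comes from the truncation error summed over a full period.\<close>

definition res_const :: "real \<Rightarrow> real \<Rightarrow> nat \<Rightarrow> real" where
  "res_const K \<alpha> d = 57 * ((7 * K + \<alpha> * real d * (14 * (K + 1))\<^sup>2)\<^sup>2 + 4 * real d * (14 * \<alpha> * (14 * (K + 1)))\<^sup>2)
     + 3 * 2 ^ d"

lemma sq_sum3_le: "(a + b + c)\<^sup>2 \<le> 3 * a\<^sup>2 + 3 * b\<^sup>2 + 3 * (c :: real)\<^sup>2"
proof -
  have "3 * a\<^sup>2 + 3 * b\<^sup>2 + 3 * c\<^sup>2 - (a + b + c)\<^sup>2 = (a - b)\<^sup>2 + (a - c)\<^sup>2 + (b - c)\<^sup>2"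
    by (simp add: power2_eq_square algebra_simps)
  moreover have "0 \<le> (a - b)\<^sup>2 + (a - c)\<^sup>2 + (b - c)\<^sup>2" by simp
  ultimately show ?thesis by linarith
qed

text \<open>In r the discrete Laplacian falls only on the exact solution, where K bounds it; errors
  enter through values and first differences, so \<open>h1\<close> suffices. The smallness
  \<open>fE\<close> bounds the differences of the numerical fields by K + 1, as the quadratic
  gradient term requires.\<close>

lemma residual_bound:
  fixes U0 U1 U2 M0 M1 M2 E0 E1 E2 \<tau> r :: "int^'d \<Rightarrow> real^3"
  assumes N: "N \<ge> 1" and K: "0 \<le> K" and \<alpha>: "0 \<le> \<alpha>" and \<tau>0: "0 \<le> \<tau>0"
    and E: "E0 = (\<lambda>I. U0 I - M0 I)" "E1 = (\<lambda>I. U1 I - M1 I)" "E2 = (\<lambda>I. U2 I - M2 I)"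
    and per: "periodic N E0" "periodic N E1" "periodic N E2"
    and U: "\<And>I. norm (U0 I) = 1" "\<And>I. norm (U1 I) = 1" "\<And>I. norm (U2 I) = 1"
    and fU: "\<And>i I. norm (fwd N i U0 I) \<le> K" "\<And>i I. norm (fwd N i U1 I) \<le> K" "\<And>i I. norm (fwd N i U2 I) \<le> K"
    and lU: "\<And>I. norm (tlap N U0 I) \<le> K" "\<And>I. norm (tlap N U1 I) \<le> K" "\<And>I. norm (tlap N U2 I) \<le> K"
    and fE: "\<And>i I. norm (fwd N i E0 I) \<le> 1" "\<And>i I. norm (fwd N i E1 I) \<le> 1" "\<And>i I. norm (fwd N i E2 I) \<le> 1"
    and \<tau>: "\<And>I. norm (\<tau> I) \<le> \<tau>0"
    and Uh: "Uh = (\<lambda>I. extr (U2 I) (U1 I) (U0 I))" and Mh: "Mh = (\<lambda>I. extr (M2 I) (M1 I) (M0 I))"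
    and r: "\<And>I. r I = - cross3 (Uh I - Mh I) (tlap N Uh I)
       + \<alpha> *\<^sub>R (tgrad_sq N Uh I *\<^sub>R Uh I - tgrad_sq N Mh I *\<^sub>R Mh I) + \<tau> I"
  shows "tsum N (\<lambda>I. (norm (r I))\<^sup>2) \<le> res_const K \<alpha> CARD('d) * (h1 N E2 + h1 N E1 + h1 N E0 + \<tau>0\<^sup>2)"
proof -
  let ?d = "real CARD('d)"
  define Eh where "Eh = (\<lambda>I. extr (E2 I) (E1 I) (E0 I))"
  define B where "B = 14 * (K + 1)"
  define c1 c2 where "c1 = 7 * K + \<alpha> * ?d * B\<^sup>2" and "c2 = 14 * \<alpha> * B"
  have B: "0 \<le> B" using K by (simp add: B_def)
  have c: "0 \<le> c1" "0 \<le> c2" using K \<alpha> B by (auto simp: c1_def c2_def)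
  have UM: "Uh I - Mh I = Eh I" for I by (simp add: Uh Mh Eh_def E extr_diff)
  have perEh: "periodic N Eh" using per by (simp add: periodic_def Eh_def)
  have tU: "norm (td1 N i Uh I) \<le> B" for i I
  proof -
    have "norm (fwd N i Uh J) \<le> 7 * K" for J unfolding Uh fwd_extr by (intro norm_extr_le fU)
    from norm_td1_le[OF this, of I] show ?thesis by (simp add: B_def)
  qed
  have fM: "norm (fwd N i (\<lambda>I. U I - E I) I) \<le> K + 1"
    if "\<And>I. norm (fwd N i U I) \<le> K" "\<And>I. norm (fwd N i E I) \<le> 1" for i I and U E :: "int^'d \<Rightarrow> real^3"
    unfolding fwd_diff using norm_triangle_ineq4[of "fwd N i U I" "fwd N i E I"] that[of I] by linarith
  have tM: "norm (td1 N i Mh I) \<le> B" for i I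
  proof -
    have M: "M0 = (\<lambda>I. U0 I - E0 I)" "M1 = (\<lambda>I. U1 I - E1 I)" "M2 = (\<lambda>I. U2 I - E2 I)"
      by (simp_all add: E)
    have "norm (fwd N i Mh J) \<le> 7 * (K + 1)" for J unfolding Mh fwd_extr
      by (intro norm_extr_le; subst M; intro fM fU fE)
    from norm_td1_le[OF this, of I] show ?thesis by (simp add: B_def)
  qed
  have pw: "norm (r I) \<le> c1 * norm (Eh I) + c2 * (\<Sum>i\<in>UNIV. norm (td1 N i Eh I)) + \<tau>0" for I
  proof -
    have "norm (cross3 (Eh I) (tlap N Uh I)) \<le> norm (Eh I) * (7 * K)"
      using norm_cross3_le[of "Eh I" "tlap N Uh I"]
      by (rule order_trans) (auto simp: Uh tlap_extr intro!: mult_left_mono norm_extr_le lU)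
    moreover have "norm (tgrad_sq N Uh I *\<^sub>R Uh I - tgrad_sq N Mh I *\<^sub>R Mh I)
      \<le> 14 * B * (\<Sum>i\<in>UNIV. norm (td1 N i Eh I)) + ?d * B\<^sup>2 * norm (Eh I)"
    proof -
      have "norm (Uh I) \<le> 7"
        using norm_extr_le[of "U2 I" 1 "U1 I" "U0 I"] U by (simp add: Uh)
      from gradient_term_diff[of "\<lambda>i. td1 N i Uh I" B "\<lambda>i. td1 N i Mh I" "Uh I" "Mh I", OF tU tM this B]
      show ?thesis unfolding tgrad_sq_def td1_diff[symmetric] UM .
    qed
    then have "\<alpha> * norm (tgrad_sq N Uh I *\<^sub>R Uh I - tgrad_sq N Mh I *\<^sub>R Mh I)
      \<le> \<alpha> * (14 * B * (\<Sum>i\<in>UNIV. norm (td1 N i Eh I)) + ?d * B\<^sup>2 * norm (Eh I))"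
      using \<alpha> by (rule mult_left_mono)
    moreover have "norm (r I) \<le> norm (cross3 (Eh I) (tlap N Uh I)) +
      \<alpha> * norm (tgrad_sq N Uh I *\<^sub>R Uh I - tgrad_sq N Mh I *\<^sub>R Mh I) + norm (\<tau> I)"
    proof -
      have "norm (a + b + c) \<le> norm a + norm b + norm c" for a b c :: "real^3"
        by (intro order_trans[OF norm_triangle_ineq] add_mono order_trans[OF norm_triangle_ineq] order_refl)
      from this[of "- cross3 (Eh I) (tlap N Uh I)"
          "\<alpha> *\<^sub>R (tgrad_sq N Uh I *\<^sub>R Uh I - tgrad_sq N Mh I *\<^sub>R Mh I)" "\<tau> I"]
      show ?thesis unfolding r UM using \<alpha> by simp
    qed
    ultimately have "norm (r I) \<le> norm (Eh I) * (7 * K)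
      + \<alpha> * (14 * B * (\<Sum>i\<in>UNIV. norm (td1 N i Eh I)) + ?d * B\<^sup>2 * norm (Eh I)) + \<tau>0"
      using \<tau>[of I] by linarith
    also have "\<dots> = c1 * norm (Eh I) + c2 * (\<Sum>i\<in>UNIV. norm (td1 N i Eh I)) + \<tau>0"
      by (simp add: c1_def c2_def algebra_simps)
    finally show ?thesis .
  qed
  have "tsum N (\<lambda>I. (norm (r I))\<^sup>2) \<le>
    tsum N (\<lambda>I. 3 * c1\<^sup>2 * (norm (Eh I))\<^sup>2 + 3 * c2\<^sup>2 * ?d * (\<Sum>i\<in>UNIV. (norm (td1 N i Eh I))\<^sup>2) + 3 * \<tau>0\<^sup>2)"
  proof (rule tsum_mono)
    fix I
    have "(norm (r I))\<^sup>2 \<le> (c1 * norm (Eh I) + c2 * (\<Sum>i\<in>UNIV. norm (td1 N i Eh I)) + \<tau>0)\<^sup>2"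
      by (intro power_mono pw) auto
    also have "\<dots> \<le> 3 * (c1 * norm (Eh I))\<^sup>2 + 3 * (c2 * (\<Sum>i\<in>UNIV. norm (td1 N i Eh I)))\<^sup>2 + 3 * \<tau>0\<^sup>2"
      by (rule sq_sum3_le)
    also have "(c2 * (\<Sum>i\<in>UNIV. norm (td1 N i Eh I)))\<^sup>2 \<le> c2\<^sup>2 * (?d * (\<Sum>i\<in>UNIV. (norm (td1 N i Eh I))\<^sup>2))"
      unfolding power_mult_distrib
      by (intro mult_left_mono order_trans[OF sum_squared_le_sum_of_squares]) (auto simp: mult.commute)
    finally show "(norm (r I))\<^sup>2 \<le> 3 * c1\<^sup>2 * (norm (Eh I))\<^sup>2
       + 3 * c2\<^sup>2 * ?d * (\<Sum>i\<in>UNIV. (norm (td1 N i Eh I))\<^sup>2) + 3 * \<tau>0\<^sup>2"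
      by (simp add: power_mult_distrib mult.assoc)
  qed
  also have "\<dots> = 3 * c1\<^sup>2 * tsum N (\<lambda>I. (norm (Eh I))\<^sup>2)
     + 3 * c2\<^sup>2 * ?d * (\<Sum>i\<in>UNIV. tsum N (\<lambda>I. (norm (td1 N i Eh I))\<^sup>2)) + tsum N (\<lambda>I::int^'d. 3 * \<tau>0\<^sup>2)"
    unfolding tsum_add tsum_cmult tsum_sum ..
  also have "\<dots> \<le> 3 * c1\<^sup>2 * h1 N Eh + 3 * c2\<^sup>2 * ?d * (4 * h1 N Eh) + 2 ^ CARD('d) * (3 * \<tau>0\<^sup>2)"
  proof (intro add_mono mult_left_mono tsum_le_h1 tsum_const_le N)
    have "(\<Sum>i\<in>UNIV. tsum N (\<lambda>I. (norm (td1 N i Eh I))\<^sup>2)) \<le> (\<Sum>i\<in>UNIV. 4 * tsum N (\<lambda>I. (norm (fwd N i Eh I))\<^sup>2))"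
      by (intro sum_mono tsum_td1_le N perEh)
    also have "\<dots> = 4 * (\<Sum>i\<in>UNIV. tsum N (\<lambda>I. (norm (fwd N i Eh I))\<^sup>2))" by (simp add: sum_distrib_left)
    also have "\<dots> \<le> 4 * h1 N Eh" unfolding h1_def by (simp add: tsum_nonneg)
    finally show "(\<Sum>i\<in>UNIV. tsum N (\<lambda>I. (norm (td1 N i Eh I))\<^sup>2)) \<le> 4 * h1 N Eh" .
  qed auto
  also have "\<dots> = 3 * (c1\<^sup>2 + 4 * ?d * c2\<^sup>2) * h1 N Eh + 3 * 2 ^ CARD('d) * \<tau>0\<^sup>2"
    by (simp add: algebra_simps)
  also have "\<dots> \<le> 3 * (c1\<^sup>2 + 4 * ?d * c2\<^sup>2) * (19 * (h1 N E2 + h1 N E1 + h1 N E0)) + 3 * 2 ^ CARD('d) * \<tau>0\<^sup>2"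
    unfolding Eh_def by (intro add_mono mult_left_mono h1_extr_le) auto
  also have "\<dots> \<le> res_const K \<alpha> CARD('d) * (h1 N E2 + h1 N E1 + h1 N E0 + \<tau>0\<^sup>2)"
  proof -
    let ?P = "57 * (c1\<^sup>2 + 4 * ?d * c2\<^sup>2)" and ?Q = "3 * 2 ^ CARD('d) :: real" and ?S = "h1 N E2 + h1 N E1 + h1 N E0"
    have rc: "res_const K \<alpha> CARD('d) = ?P + ?Q"
      by (simp add: res_const_def c1_def c2_def B_def)
    have "0 \<le> ?P * \<tau>0\<^sup>2" "0 \<le> ?Q * ?S" by (auto intro!: mult_nonneg_nonneg add_nonneg_nonneg h1_nonneg)
    moreover have "(?P + ?Q) * (?S + \<tau>0\<^sup>2) = ?P * ?S + ?Q * \<tau>0\<^sup>2 + ?P * \<tau>0\<^sup>2 + ?Q * ?S"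
      by (simp only: distrib_left distrib_right)
    moreover have "3 * p * (19 * q) = 57 * p * q" for p q :: real by simp
    then have "3 * (c1\<^sup>2 + 4 * ?d * c2\<^sup>2) * (19 * ?S) = ?P * ?S" .
    ultimately show ?thesis unfolding rc by linarith
  qed
  finally show ?thesis .
qed

text \<open>The interface between the analysis of the exact solution and the convergence proof. The
  length 1 + K k of the extrapolation is what keeps |M| below 1 + \<epsilon> in
  \<open>pointwise_dissipation\<close>; the last inequality is the truncation error.\<close>

definition consistent :: "nat \<Rightarrow> real \<Rightarrow> real \<Rightarrow> real \<Rightarrow> real \<Rightarrow> (nat \<Rightarrow> int^'d \<Rightarrow> real^3) \<Rightarrow> bool" where
  "consistent N k T \<alpha> K U \<longleftrightarrow> (\<forall>n. periodic N (U n)) \<and>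
    (\<forall>n. real n * k \<le> T \<longrightarrow> (\<forall>I. norm (U n I) = 1 \<and> norm (tlap N (U n) I) \<le> K \<and> (\<forall>i. norm (fwd N i (U n) I) \<le> K))) \<and>
    (\<forall>n. real (n + 3) * k \<le> T \<longrightarrow> (\<forall>I. norm (extr (U (n+2) I) (U (n+1) I) (U n I)) \<le> 1 + K * k \<and>
       norm ((1 / k) *\<^sub>R bdf3 (U (n+3) I) (U (n+2) I) (U (n+1) I) (U n I)
         - (- cross3 (extr (U (n+2) I) (U (n+1) I) (U n I)) (tlap N (\<lambda>I. extr (U (n+2) I) (U (n+1) I) (U n I)) I)
            + \<alpha> *\<^sub>R tlap N (U (n+3)) I
            + \<alpha> *\<^sub>R (tgrad_sq N (\<lambda>I. extr (U (n+2) I) (U (n+1) I) (U n I)) I *\<^sub>R extr (U (n+2) I) (U (n+1) I) (U n I))))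
        \<le> K * (k^3 + mesh N ^ 4)))"

text \<open>The projection relation is imposed at the starting levels too, where unit initial data
  satisfy it.\<close>

definition torus_scheme :: "nat \<Rightarrow> real \<Rightarrow> real \<Rightarrow> (nat \<Rightarrow> int^'d \<Rightarrow> real^3) \<Rightarrow> (nat \<Rightarrow> int^'d \<Rightarrow> real^3) \<Rightarrow> bool" where
  "torus_scheme N k \<alpha> M V \<longleftrightarrow> (\<forall>n. periodic N (V n)) \<and> (\<forall>n I. M n I = (1 / norm (V n I)) *\<^sub>R V n I) \<and>
    (\<forall>n I. (1 / k) *\<^sub>R bdf3 (V (n+3) I) (V (n+2) I) (V (n+1) I) (V n I)
         = - cross3 (extr (M (n+2) I) (M (n+1) I) (M n I)) (tlap N (\<lambda>I. extr (V (n+2) I) (V (n+1) I) (V n I)) I)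
            + \<alpha> *\<^sub>R tlap N (V (n+3)) I
            + \<alpha> *\<^sub>R (tgrad_sq N (\<lambda>I. extr (M (n+2) I) (M (n+1) I) (M n I)) I *\<^sub>R extr (M (n+2) I) (M (n+1) I) (M n I)))"

section \<open>Error recursion and induction in time\<close>

lemma bdf3_diff: "bdf3 x3 x2 x1 x0 - bdf3 y3 y2 y1 y0 = bdf3 (x3 - y3) (x2 - y2) (x1 - y1) (x0 - y0)"
  by (simp add: bdf3_def algebra_simps)

text \<open>Smallness is assumed at the three old levels, since projected fields occur only inside
  extrapolations. The conditions on \<sigma> serve in turn to allow the projection estimates, to
  bound the differences of E by 1, and to give |Mh| <= 1 + \<epsilon>; there 14 = 7 * 2,
  extrapolation times projection.\<close>

lemma error_step:
  fixes U V M e E :: "nat \<Rightarrow> int^'d \<Rightarrow> real^3"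
  assumes N: "N \<ge> 1" and k: "k > 0" and \<alpha>: "\<alpha> > 7" and K: "K \<ge> 0"
    and cons: "consistent N k T \<alpha> K U" and sch: "torus_scheme N k \<alpha> M V"
    and e: "\<And>n. e n = (\<lambda>I. U n I - V n I)" and E: "\<And>n. E n = (\<lambda>I. U n I - M n I)"
    and \<epsilon>: "\<epsilon> = (\<alpha> - 7) / 14" and \<beta>: "\<beta> = (\<alpha> - 7) / 2" and \<theta>: "\<theta> = \<beta> / 16"
    and \<tau>: "\<tau> = k^3 + mesh N ^ 4"
    and n: "real (n + 3) * k \<le> T"
    and \<sigma>: "0 \<le> \<sigma>" "\<sigma> \<le> 1/2" "(20 + 14 * K) * \<sigma> \<le> 1" "14 * \<sigma> + K * k \<le> \<epsilon>"
    and small: "\<And>j I. n \<le> j \<Longrightarrow> j \<le> n + 2 \<Longrightarrow> norm (e j I) \<le> \<sigma>"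
      "\<And>j i I. n \<le> j \<Longrightarrow> j \<le> n + 2 \<Longrightarrow> norm (fwd N i (e j) I) \<le> \<sigma>"
    and C: "C = err_const \<alpha> \<theta> * (res_const K \<alpha> CARD('d) * (800 + 392 * K\<^sup>2 * real CARD('d))
        + res_const K \<alpha> CARD('d) * (1 + K\<^sup>2) + 2)"
  shows "energy N k \<epsilon> \<beta> (e (n+3)) (e (n+2)) (e (n+1)) - energy N k \<epsilon> \<beta> (e (n+2)) (e (n+1)) (e n)
      + k * (4 * \<theta> * tsum N (\<lambda>I. (norm (tlap N (e (n+3)) I))\<^sup>2))
    \<le> k * (\<theta> * (tsum N (\<lambda>I. (norm (tlap N (e n) I))\<^sup>2) + tsum N (\<lambda>I. (norm (tlap N (e (n+1)) I))\<^sup>2)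
             + tsum N (\<lambda>I. (norm (tlap N (e (n+2)) I))\<^sup>2) + tsum N (\<lambda>I. (norm (tlap N (e (n+3)) I))\<^sup>2))
       + C * (h1 N (e n) + h1 N (e (n+1)) + h1 N (e (n+2)) + h1 N (e (n+3))) + C * \<tau>\<^sup>2)"
proof -
  let ?PC = "800 + 392 * K\<^sup>2 * real CARD('d)" and ?RC = "res_const K \<alpha> CARD('d)"
  have perU: "periodic N (U j)" for j using cons by (simp add: consistent_def)
  have perV: "periodic N (V j)" for j using sch by (simp add: torus_scheme_def)
  have pere: "periodic N (e j)" for j using perU[of j] perV[of j] by (simp add: e periodic_def)
  have Mdef: "M j I = (1 / norm (V j I)) *\<^sub>R V j I" for j I using sch by (simp add: torus_scheme_def)
  have perE: "periodic N (E j)" for j using perU[of j] perV[of j] by (simp add: E Mdef periodic_def)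
  have level: "real j * k \<le> T" if "j \<le> n + 3" for j
  proof -
    have "real j * k \<le> real (n + 3) * k" using that k by (intro mult_right_mono) auto
    then show ?thesis using n by simp
  qed
  have U1: "norm (U j I) = 1" "norm (tlap N (U j) I) \<le> K" "norm (fwd N i (U j) I) \<le> K" if "j \<le> n + 3" for j i I
    using cons level[OF that] by (auto simp: consistent_def)
  have Vj: "V j I = U j I - e j I" for j I by (simp add: e)
  have Ej: "E j I = U j I - (1 / norm (U j I - e j I)) *\<^sub>R (U j I - e j I)" for j I
    by (simp add: E Mdef Vj)
  have small2: "norm (e j I) \<le> 1/2" if "n \<le> j" "j \<le> n + 2" for j I
    using small(1)[OF that, of I] \<sigma> by linarith
  have Esm: "norm (E j I) \<le> 2 * \<sigma>" if "n \<le> j" "j \<le> n + 2" for j I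
  proof -
    have "norm (E j I) \<le> 2 * norm (e j I)"
      by (rule h1_projection_le(1)[OF N pere _ _ K small2[OF that] Ej]) (use U1 that in auto)
    then show ?thesis using small(1)[OF that, of I] by linarith
  qed
  have Ef: "norm (fwd N i (E j) I) \<le> 1" if "n \<le> j" "j \<le> n + 2" for j i I
  proof -
    have "norm (fwd N i (E j) I) \<le> 20 * norm (fwd N i (e j) I) + 14 * K * norm (e j (I + axis i 1))"
      by (rule h1_projection_le(2)[OF N pere _ _ K small2[OF that] Ej]) (use U1 that in auto)
    also have "\<dots> \<le> 20 * \<sigma> + 14 * K * \<sigma>"
      using small(1)[OF that] small(2)[OF that] K by (intro add_mono mult_left_mono) auto
    also have "\<dots> \<le> 1" using \<sigma>(3) by (simp add: distrib_right)
    finally show ?thesis .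
  qed
  have Eh1: "h1 N (E j) \<le> ?PC * h1 N (e j)" if "n \<le> j" "j \<le> n + 2" for j
    by (rule h1_projection_le(3)[OF N pere _ _ K small2[OF that] Ej]) (use U1 that in auto)
  define Uh Mh where "Uh = (\<lambda>I. extr (U (n+2) I) (U (n+1) I) (U n I))"
    and "Mh = (\<lambda>I. extr (M (n+2) I) (M (n+1) I) (M n I))"
  define \<tau>f where "\<tau>f I = (1 / k) *\<^sub>R bdf3 (U (n+3) I) (U (n+2) I) (U (n+1) I) (U n I)
         - (- cross3 (Uh I) (tlap N Uh I) + \<alpha> *\<^sub>R tlap N (U (n+3)) I + \<alpha> *\<^sub>R (tgrad_sq N Uh I *\<^sub>R Uh I))" for I
  have \<tau>f: "norm (\<tau>f I) \<le> K * \<tau>" "norm (Uh I) \<le> 1 + K * k" for I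
    using cons n unfolding consistent_def \<tau>f_def Uh_def \<tau> by blast+
  define r where "r I = - cross3 (Uh I - Mh I) (tlap N Uh I)
       + \<alpha> *\<^sub>R (tgrad_sq N Uh I *\<^sub>R Uh I - tgrad_sq N Mh I *\<^sub>R Mh I) + \<tau>f I" for I
  have \<tau>0: "0 \<le> \<tau>" using k by (simp add: \<tau>)
  have rb: "tsum N (\<lambda>I. (norm (r I))\<^sup>2) \<le> ?RC * (h1 N (E (n+2)) + h1 N (E (n+1)) + h1 N (E n) + (K * \<tau>)\<^sup>2)"
    by (rule residual_bound[OF N K _ _ E E E perE perE perE _ _ _ _ _ _ _ _ _ _ _ _ \<tau>f(1) Uh_def Mh_def r_def])
      (use \<alpha> K \<tau>0 U1 Ef in auto)
  have Mb: "norm (Mh I) \<le> 1 + \<epsilon>" for I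
  proof -
    have "Mh I = Uh I - extr (E (n+2) I) (E (n+1) I) (E n I)"
      by (simp add: Mh_def Uh_def E extr_def algebra_simps)
    moreover have "norm (extr (E (n+2) I) (E (n+1) I) (E n I)) \<le> 7 * (2 * \<sigma>)"
      by (intro norm_extr_le Esm) auto
    ultimately show ?thesis
      using norm_triangle_ineq4[of "Uh I" "extr (E (n+2) I) (E (n+1) I) (E n I)"] \<tau>f(2)[of I] \<sigma>(4) by simp
  qed
  \<comment> \<open>The cross products are split so that the Laplacian of the error meets the
    numerical \<open>Mh\<close>, and the error of the field meets the Laplacian of the exact
    solution. The other splitting would leave the uncontrolled Laplacian of the numerical field in
    the residual.\<close>
  have eq: "bdf3 (e (n+3) I) (e (n+2) I) (e (n+1) I) (e n I) = k *\<^sub>R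
      (- cross3 (Mh I) (extr (tlap N (e (n+2)) I) (tlap N (e (n+1)) I) (tlap N (e n) I)) + \<alpha> *\<^sub>R tlap N (e (n+3)) I + r I)" for I
  proof -
    define Vh where "Vh = (\<lambda>I. extr (V (n+2) I) (V (n+1) I) (V n I))"
    have s: "(1 / k) *\<^sub>R bdf3 (V (n+3) I) (V (n+2) I) (V (n+1) I) (V n I) =
       - cross3 (Mh I) (tlap N Vh I) + \<alpha> *\<^sub>R tlap N (V (n+3)) I + \<alpha> *\<^sub>R (tgrad_sq N Mh I *\<^sub>R Mh I)"
      using sch unfolding torus_scheme_def Mh_def Vh_def by blast
    have l: "extr (tlap N (e (n+2)) I) (tlap N (e (n+1)) I) (tlap N (e n) I) = tlap N Uh I - tlap N Vh I"
      unfolding e tlap_diff Uh_def Vh_def tlap_extr extr_diff ..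
    have "(1 / k) *\<^sub>R bdf3 (e (n+3) I) (e (n+2) I) (e (n+1) I) (e n I) =
      (1 / k) *\<^sub>R bdf3 (U (n+3) I) (U (n+2) I) (U (n+1) I) (U n I) - (1 / k) *\<^sub>R bdf3 (V (n+3) I) (V (n+2) I) (V (n+1) I) (V n I)"
      unfolding e bdf3_diff[symmetric] scaleR_diff_right ..
    also have "\<dots> = \<tau>f I + (- cross3 (Uh I) (tlap N Uh I) + \<alpha> *\<^sub>R tlap N (U (n+3)) I + \<alpha> *\<^sub>R (tgrad_sq N Uh I *\<^sub>R Uh I))
        - (- cross3 (Mh I) (tlap N Vh I) + \<alpha> *\<^sub>R tlap N (V (n+3)) I + \<alpha> *\<^sub>R (tgrad_sq N Mh I *\<^sub>R Mh I))"
      unfolding s \<tau>f_def by simp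
    also have "\<dots> = - cross3 (Mh I) (tlap N Uh I - tlap N Vh I) + \<alpha> *\<^sub>R tlap N (e (n+3)) I + r I"
      unfolding r_def e tlap_diff
      by (simp add: cross3_simps Cross3.left_diff_distrib Cross3.right_diff_distrib scaleR_diff_right)
    finally have "k *\<^sub>R ((1 / k) *\<^sub>R bdf3 (e (n+3) I) (e (n+2) I) (e (n+1) I) (e n I)) =
        k *\<^sub>R (- cross3 (Mh I) (tlap N Uh I - tlap N Vh I) + \<alpha> *\<^sub>R tlap N (e (n+3)) I + r I)" by simp
    then show ?thesis unfolding l using k by simp
  qed
  have th: "\<theta> > 0" using \<alpha> by (simp add: \<theta> \<beta>)
  have ec: "0 \<le> err_const \<alpha> \<theta>" using th by (simp add: err_const_def)
  have rc: "0 \<le> ?RC" by (simp add: res_const_def)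
  let ?y = "\<lambda>j. h1 N (e j)"
  have y0: "0 \<le> ?y j" for j by (rule h1_nonneg)
  have "tsum N (\<lambda>I. (norm (r I))\<^sup>2) \<le> ?RC * (?PC * ?y (n+2) + ?PC * ?y (n+1) + ?PC * ?y n + (K * \<tau>)\<^sup>2)"
    by (rule order_trans[OF rb]) (intro mult_left_mono add_mono Eh1 rc; simp)
  then have "err_const \<alpha> \<theta> * (tsum N (\<lambda>I. (norm (r I))\<^sup>2) + 2 * ?y (n+3) + 2 * ?y (n+2)) \<le>
     err_const \<alpha> \<theta> * (?RC * (?PC * ?y (n+2) + ?PC * ?y (n+1) + ?PC * ?y n + (K * \<tau>)\<^sup>2) + 2 * ?y (n+3) + 2 * ?y (n+2))"
    by (intro mult_left_mono ec) auto
  also have "\<dots> \<le> err_const \<alpha> \<theta> * ((?RC * ?PC + ?RC * (1 + K\<^sup>2) + 2) * (?y n + ?y (n+1) + ?y (n+2) + ?y (n+3))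
      + (?RC * ?PC + ?RC * (1 + K\<^sup>2) + 2) * \<tau>\<^sup>2)"
  proof (intro mult_left_mono ec)
    let ?R1 = "?RC * ?PC" and ?R2 = "?RC * (1 + K\<^sup>2)"
    have R: "0 \<le> ?R1" "0 \<le> ?R2" "?RC * K\<^sup>2 \<le> ?R2" using rc by (auto intro!: mult_nonneg_nonneg simp: distrib_left)
    have "R * (P * a2 + P * a1 + P * a0 + (K * \<tau>)\<^sup>2) + 2 * a3 + 2 * a2
       = R * P * (a2 + a1 + a0) + R * K\<^sup>2 * \<tau>\<^sup>2 + 2 * (a3 + a2)" for a0 a1 a2 a3 R P :: real
      by (simp add: power_mult_distrib distrib_left mult.assoc)
    note this[of ?RC ?PC]
    moreover have "?R1 * (a2 + a1 + a0) + ?RC * K\<^sup>2 * \<tau>\<^sup>2 + 2 * (a3 + a2)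
      \<le> (?R1 + ?R2 + 2) * (a0 + a1 + a2 + a3) + (?R1 + ?R2 + 2) * \<tau>\<^sup>2"
      if "0 \<le> a0" "0 \<le> a1" "0 \<le> a2" "0 \<le> a3" for a0 a1 a2 a3 :: real
    proof -
      have "?R1 * (a2 + a1 + a0) \<le> ?R1 * (a0 + a1 + a2 + a3)" using R that by (intro mult_left_mono) auto
      moreover have "2 * (a3 + a2) \<le> 2 * (a0 + a1 + a2 + a3)" using that by simp
      moreover have "0 \<le> ?R2 * (a0 + a1 + a2 + a3)" using R that by simp
      moreover have "?RC * K\<^sup>2 * \<tau>\<^sup>2 \<le> ?R2 * \<tau>\<^sup>2" using R by (intro mult_right_mono) auto
      moreover have "0 \<le> ?R1 * \<tau>\<^sup>2" "0 \<le> 2 * \<tau>\<^sup>2" using R by auto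
      ultimately show ?thesis unfolding distrib_right[of _ _ "a0 + a1 + a2 + a3"] distrib_right[of _ _ "\<tau>\<^sup>2"]
        by linarith
    qed
    ultimately show "?RC * (?PC * ?y (n+2) + ?PC * ?y (n+1) + ?PC * ?y n + (K * \<tau>)\<^sup>2) + 2 * ?y (n+3) + 2 * ?y (n+2)
      \<le> (?R1 + ?R2 + 2) * (?y n + ?y (n+1) + ?y (n+2) + ?y (n+3)) + (?R1 + ?R2 + 2) * \<tau>\<^sup>2"
      using y0 by metis
  qed
  also have "\<dots> = C * (?y n + ?y (n+1) + ?y (n+2) + ?y (n+3)) + C * \<tau>\<^sup>2"
    unfolding C by (simp only: distrib_left[of "err_const \<alpha> \<theta>" "_ * _" "_ * _"] mult.assoc)
  finally have rr: "err_const \<alpha> \<theta> * (tsum N (\<lambda>I. (norm (r I))\<^sup>2) + 2 * ?y (n+3) + 2 * ?y (n+2)) \<le>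
     C * (?y n + ?y (n+1) + ?y (n+2) + ?y (n+3)) + C * \<tau>\<^sup>2" .
  let ?Z = "\<theta> * (tsum N (\<lambda>I. (norm (tlap N (e n) I))\<^sup>2) + tsum N (\<lambda>I. (norm (tlap N (e (n+1)) I))\<^sup>2)
             + tsum N (\<lambda>I. (norm (tlap N (e (n+2)) I))\<^sup>2) + tsum N (\<lambda>I. (norm (tlap N (e (n+3)) I))\<^sup>2))"
  have "k * (?Z + err_const \<alpha> \<theta> * (tsum N (\<lambda>I. (norm (r I))\<^sup>2) + 2 * ?y (n+3) + 2 * ?y (n+2)))
    \<le> k * (?Z + C * (?y n + ?y (n+1) + ?y (n+2) + ?y (n+3)) + C * \<tau>\<^sup>2)"
    using rr k by (intro mult_left_mono) auto
  then show ?thesis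
    using energy_step[OF N pere pere pere pere k \<alpha> Mb \<epsilon> \<beta> \<theta> eq] by (rule order_trans[rotated])
qed

lemma energy_zero: "energy N k \<epsilon> \<beta> (\<lambda>I. 0) (\<lambda>I. 0) (\<lambda>I. 0) = 0"
  by (simp add: energy_def G_form_def H_form_def fwd_def dd2_def tlap_def tsum_def)

lemma torus_convergence:
  fixes K \<alpha> C0 T :: real
  assumes d: "CARD('d) \<le> 3" and \<alpha>: "\<alpha> > 7" and K: "K \<ge> 0" and C0: "C0 > 0" and T: "T > 0"
  shows "\<exists>C>0. \<exists>h0>0. \<exists>k0>0. \<forall>N\<ge>1. \<forall>k>0. \<forall>(U :: nat \<Rightarrow> int^'d \<Rightarrow> real^3) M V.
    mesh N < h0 \<longrightarrow> k < k0 \<longrightarrow> k \<le> C0 * mesh N \<longrightarrow> consistent N k T \<alpha> K U \<longrightarrow> torus_scheme N k \<alpha> M V \<longrightarrow>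
    (\<forall>n\<le>2. V n = U n) \<longrightarrow>
    (\<forall>n. real n * k \<le> T \<longrightarrow> h1 N (\<lambda>I. U n I - M n I) \<le> C * (k^3 + mesh N ^ 4)\<^sup>2)"
proof -
  define \<epsilon> \<beta> \<theta> where "\<epsilon> = (\<alpha> - 7) / 14" and "\<beta> = (\<alpha> - 7) / 2" and "\<theta> = \<beta> / 16"
  define PC where "PC = 800 + 392 * K\<^sup>2 * real CARD('d)"
  define C where "C = err_const \<alpha> \<theta> * (res_const K \<alpha> CARD('d) * PC + res_const K \<alpha> CARD('d) * (1 + K\<^sup>2) + 2)"
  define A where "A = 2 * (C * T / (1/6)) * exp (8 * C * T / (1/6))"
  \<comment> \<open>The first entry gives \<sigma> <= 1/2 and (20 + 14 K) \<sigma> <= 1, the second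
    14 \<sigma> <= \<epsilon>/2. The other half of \<epsilon> is reserved for K k and enters
    \<open>k0\<close>, together with 8 k C <= 1/6. \<open>h0\<close> is chosen so that L h <=
    \<sigma>^2 for h < \<open>h0\<close>.\<close>
  define \<sigma> where "\<sigma> = min (1 / (28 + 14 * K)) (\<epsilon> / 28)"
  define L where "L = A * (C0^3 + 1)\<^sup>2"
  define h0 where "h0 = min 1 (\<sigma>\<^sup>2 / (L + 1))"
  define k0 where "k0 = min (1 / (48 * C + 1)) (\<epsilon> / (2 * K + 1))"
  have eps: "\<epsilon> > 0" "\<beta> > 0" "\<theta> > 0" using \<alpha> by (simp_all add: \<epsilon>_def \<beta>_def \<theta>_def)
  have PC: "PC > 0" using K by (simp add: PC_def add_pos_nonneg)
  have rc: "0 \<le> res_const K \<alpha> CARD('d)" by (simp add: res_const_def)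
  have C: "C \<ge> 0" using eps PC rc unfolding C_def
    by (intro mult_nonneg_nonneg add_nonneg_nonneg) (auto simp: err_const_def)
  have A: "A \<ge> 0" using C T by (simp add: A_def)
  have \<sigma>: "\<sigma> > 0" "\<sigma> \<le> 1/2" "(20 + 14 * K) * \<sigma> \<le> 1" "14 * \<sigma> \<le> \<epsilon> / 2"
  proof -
    show "\<sigma> > 0" using eps K by (simp add: \<sigma>_def)
    have s: "\<sigma> \<le> 1 / (28 + 14 * K)" by (simp add: \<sigma>_def)
    have "1 / (28 + 14 * K) \<le> 1 / 2" using K by (intro divide_left_mono) auto
    with s show "\<sigma> \<le> 1/2" by linarith
    have "(20 + 14 * K) * \<sigma> \<le> (28 + 14 * K) * \<sigma>" using K \<open>\<sigma> > 0\<close> by (intro mult_right_mono) auto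
    also have "\<dots> \<le> (28 + 14 * K) * (1 / (28 + 14 * K))" using s K by (intro mult_left_mono) auto
    also have "\<dots> = 1" using K by simp
    finally show "(20 + 14 * K) * \<sigma> \<le> 1" .
    have "\<sigma> \<le> \<epsilon> / 28" by (simp add: \<sigma>_def)
    then show "14 * \<sigma> \<le> \<epsilon> / 2" by linarith
  qed
  have L: "L \<ge> 0" using A by (simp add: L_def)
  have h0: "h0 > 0" using \<sigma> L by (simp add: h0_def)
  have k0: "k0 > 0" using C eps K by (simp add: k0_def)
  have main: "h1 N (\<lambda>I. U n I - M n I) \<le> (PC * A + 1) * (k^3 + mesh N ^ 4)\<^sup>2"
    if N: "N \<ge> 1" and k: "k > 0" "k < k0" "k \<le> C0 * mesh N" and h: "mesh N < h0"
      and cons: "consistent N k T \<alpha> K U" and sch: "torus_scheme N k \<alpha> M V"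
      and init: "\<forall>n\<le>2. V n = U n" and n: "real n * k \<le> T"
    for N k n and U M V :: "nat \<Rightarrow> int^'d \<Rightarrow> real^3"
  proof -
    let ?h = "mesh N"
    define \<tau> where "\<tau> = k^3 + ?h ^ 4"
    define e E where "e = (\<lambda>n I. U n I - V n I)" and "E = (\<lambda>n I. U n I - M n I)"
    have hp: "?h > 0" by (rule mesh_pos[OF N])
    have h1: "?h \<le> 1" "?h \<le> \<sigma>\<^sup>2 / (L + 1)" using h by (simp_all add: h0_def)
    have \<tau>0: "0 \<le> \<tau>" using k by (simp add: \<tau>_def)
    have \<tau>h: "\<tau> \<le> (C0^3 + 1) * ?h^3"
    proof -
      have "k^3 \<le> (C0 * ?h)^3" using k by (intro power_mono) auto
      moreover have "?h^4 \<le> ?h^3" using h1 by (intro power_decreasing) auto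
      ultimately show ?thesis by (simp add: \<tau>_def power_mult_distrib distrib_right)
    qed
    have Kk: "K * k \<le> \<epsilon> / 2"
    proof -
      have "k \<le> \<epsilon> / (2 * K + 1)" using k by (simp add: k0_def)
      then have "K * k \<le> K * (\<epsilon> / (2 * K + 1))" using K by (intro mult_left_mono)
      also have "\<dots> = (K / (2 * K + 1)) * \<epsilon>" by simp
      also have "\<dots> \<le> (1/2) * \<epsilon>" using K eps by (intro mult_right_mono) (auto simp: divide_le_eq)
      finally show ?thesis by simp
    qed
    have kC: "8 * k * C \<le> 1/6"
    proof -
      have "k \<le> 1 / (48 * C + 1)" using k by (simp add: k0_def)
      then have "k * (48 * C + 1) \<le> 1" using C by (simp add: pos_le_divide_eq)
      then have "k * (48 * C) + k \<le> 1" by (simp add: distrib_left)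
      then have "k * (48 * C) \<le> 1" using k by linarith
      then show ?thesis by (simp add: mult_ac)
    qed
    have perU: "periodic N (U j)" for j using cons by (simp add: consistent_def)
    have perV: "periodic N (V j)" for j using sch by (simp add: torus_scheme_def)
    have pere: "periodic N (e j)" for j using perU[of j] perV[of j] by (simp add: e_def periodic_def)
    \<comment> \<open>By k <= C0 h the squared norm is O(h^6), and the inverse inequality divides by
      h^3; the remaining O(h^3) is below \<sigma>^2 for small h. This is applied to the errors and
      to their forward differences.\<close>
    have sup: "norm (F I) \<le> \<sigma>" if F: "periodic N F" "tsum N (\<lambda>I. (norm (F I))\<^sup>2) \<le> A * \<tau>\<^sup>2" for F :: "int^'d \<Rightarrow> real^3" and I
    proof -
      have "?h^3 * (norm (F I))\<^sup>2 \<le> A * \<tau>\<^sup>2"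
        using inverse_inequality[OF N F(1) d] F(2) by (rule order_trans)
      also have "\<dots> \<le> A * ((C0^3 + 1) * ?h^3)\<^sup>2"
        using A \<tau>h \<tau>0 by (intro mult_left_mono power_mono) auto
      also have "\<dots> = ?h^3 * (L * ?h^3)"
        by (simp add: L_def power_mult_distrib power2_eq_square mult_ac)
      finally have "(norm (F I))\<^sup>2 \<le> L * ?h^3" using hp by simp
      also have "\<dots> \<le> L * ?h"
        using L hp h1 power_decreasing[of 1 3 ?h] by (intro mult_left_mono) auto
      also have "\<dots> \<le> (L + 1) * (\<sigma>\<^sup>2 / (L + 1))" using L h1 hp by (intro mult_mono) auto
      also have "\<dots> = \<sigma>\<^sup>2" using L by simp
      finally show ?thesis by (rule power2_le_imp_le) (use \<sigma>(1) in simp)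
    qed
    \<comment> \<open>The bound at earlier levels supplies only the pointwise smallness. The
      Gronwall argument is rerun from level 2 for each n, so its constant A depends on T but not on
      n.\<close>
    have claim: "real n * k \<le> T \<longrightarrow> h1 N (e n) \<le> A * \<tau>\<^sup>2" for n
    proof (induction n rule: less_induct)
      case (less n)
      show ?case
      proof
        assume nT: "real n * k \<le> T"
        have le: "real j * k \<le> T" if "j \<le> n" for j
        proof -
          have "real j * k \<le> real n * k" using that k by (intro mult_right_mono) auto
          then show ?thesis using nT by simp
        qed
        have IH: "h1 N (e j) \<le> A * \<tau>\<^sup>2" if "j < n" for j
          using less[OF that] le[of j] that by auto
        have e0: "e j = (\<lambda>I. 0)" if "j \<le> 2" for j using init that by (simp add: e_def)
        have h10: "h1 N (e j) = 0" if "j \<le> 2" for j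
          by (simp add: e0[OF that] h1_def fwd_def tsum_def)
        have z0: "tsum N (\<lambda>I. (norm (tlap N (e j) I))\<^sup>2) = 0" if "j \<le> 2" for j
          by (simp add: e0[OF that] tlap_def tsum_def)
        \<comment> \<open>For j < 2 the subtractions are truncated; there only the lower bound is
          used, which holds for any triple.\<close>
        define En where "En j = energy N k \<epsilon> \<beta> (e j) (e (j - 1)) (e (j - 2))" for j
        have "h1 N (e n) \<le> 2 * (C * T * \<tau>\<^sup>2 / (1/6)) * exp (8 * C * T / (1/6))"
        proof (rule bdf3_energy_gronwall[where energy = En and z = "\<lambda>j. tsum N (\<lambda>I. (norm (tlap N (e j) I))\<^sup>2)"
              and y = "\<lambda>j. h1 N (e j)" and \<theta> = \<theta> and k = k and M = n])
          show "1/6 * h1 N (e j) \<le> En j" for j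
            unfolding En_def using k eps by (intro energy_lower) auto
          show "En 2 = 0" unfolding En_def by (simp add: e0 energy_zero)
          show "En (j + 3) - En (j + 2) + k * (4 * \<theta> * tsum N (\<lambda>I. (norm (tlap N (e (j + 3)) I))\<^sup>2))
            \<le> k * (\<theta> * (tsum N (\<lambda>I. (norm (tlap N (e j) I))\<^sup>2) + tsum N (\<lambda>I. (norm (tlap N (e (j + 1)) I))\<^sup>2)
             + tsum N (\<lambda>I. (norm (tlap N (e (j + 2)) I))\<^sup>2) + tsum N (\<lambda>I. (norm (tlap N (e (j + 3)) I))\<^sup>2))
             + C * (h1 N (e j) + h1 N (e (j + 1)) + h1 N (e (j + 2)) + h1 N (e (j + 3))) + C * \<tau>\<^sup>2)"
            if j: "j + 3 \<le> n" for j
          proof -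
            have E: "En (j + 3) = energy N k \<epsilon> \<beta> (e (j+3)) (e (j+2)) (e (j+1))"
              "En (j + 2) = energy N k \<epsilon> \<beta> (e (j+2)) (e (j+1)) (e j)" by (simp_all add: En_def)
            show ?thesis unfolding E
            proof (rule error_step[OF N k(1) \<alpha> K cons sch e_def[THEN fun_cong] E_def[THEN fun_cong] \<epsilon>_def \<beta>_def \<theta>_def \<tau>_def le[OF j]
                    less_imp_le[OF \<sigma>(1)] \<sigma>(2,3) _ _ _ C_def[unfolded PC_def]])
              show "14 * \<sigma> + K * k \<le> \<epsilon>" using \<sigma>(4) Kk by linarith
              show "norm (e i I) \<le> \<sigma>" if "j \<le> i" "i \<le> j + 2" for i I
                using IH[of i] that j order_trans[OF tsum_le_h1] by (intro sup pere) auto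
              show "norm (fwd N l (e i) I) \<le> \<sigma>" if "j \<le> i" "i \<le> j + 2" for i l I
                using IH[of i] that j order_trans[OF tsum_fwd_le_h1] by (intro sup periodic_fwd pere) auto
            qed
          qed
        qed (use k eps C T \<tau>0 nT kC h10 z0 in \<open>auto intro: h1_nonneg tsum_nonneg\<close>)
        then show "h1 N (e n) \<le> A * \<tau>\<^sup>2" by (simp add: A_def mult_ac)
      qed
    qed
    have en: "norm (e n I) \<le> 1/2" for I
    proof -
      have "tsum N (\<lambda>I. (norm (e n I))\<^sup>2) \<le> A * \<tau>\<^sup>2"
        using claim[of n] n tsum_le_h1[of N "e n"] by auto
      from sup[OF pere this, of I] show ?thesis using \<sigma>(2) by linarith
    qed
    have En: "E n I = U n I - (1 / norm (U n I - e n I)) *\<^sub>R (U n I - e n I)" for I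
      using sch by (simp add: torus_scheme_def E_def e_def)
    have U: "norm (U n I) = 1" "norm (fwd N i (U n) I) \<le> K" for i I
      using cons n by (auto simp: consistent_def)
    have "h1 N (E n) \<le> PC * h1 N (e n)"
      unfolding PC_def by (rule h1_projection_le(3)[OF N pere U K en En])
    also have "\<dots> \<le> PC * (A * \<tau>\<^sup>2)" using claim[of n] n PC by (intro mult_left_mono) auto
    also have "\<dots> \<le> (PC * A + 1) * \<tau>\<^sup>2" by (simp add: distrib_right)
    finally show ?thesis by (simp add: E_def \<tau>_def)
  qed
  have "PC * A + 1 > 0" using PC A by (simp add: add_nonneg_pos)
  with h0 k0 main show ?thesis by blast
qed

section \<open>Calculus on the closed cube\<close>

lemma unit_cube_cbox: "unit_cube = cbox (\<chi> i. 0) (\<chi> i. (1 :: real))"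
  by (auto simp: unit_cube_def mem_box_cart)

lemma compact_unit_cube: "compact (unit_cube :: (real^'d) set)"
  unfolding unit_cube_cbox by (rule compact_cbox)

lemma line_dom_eq:
  assumes "x \<in> unit_cube"
  shows "line_dom i x = {- (x $ i) .. 1 - x $ i}"
  using assms by (auto simp: line_dom_def unit_cube_def axis_def)

lemma line_dom_nontrivial:
  assumes "x \<in> unit_cube"
  shows "at 0 within line_dom i x \<noteq> bot"
proof -
  have "0 \<le> x $ i" "x $ i \<le> 1" using assms by (auto simp: unit_cube_def)
  then show ?thesis unfolding line_dom_eq[OF assms] trivial_limit_within
    by (simp add: islimpt_Icc)
qed

lemma zero_line_dom: "x \<in> unit_cube \<Longrightarrow> 0 \<in> line_dom i x"
  by (simp add: line_dom_def)

text \<open>Lines are parametrised by the i-th coordinate itself instead of an increment, so that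
  the parameter interval is {0..1} for every x, while \<open>line_dom\<close> moves with the
  point.\<close>

definition upd :: "real^'d \<Rightarrow> 'd \<Rightarrow> real \<Rightarrow> real^'d" where
  "upd x i s = (\<chi> j. if j = i then s else x $ j)"

lemma upd_cube: "x \<in> unit_cube \<Longrightarrow> s \<in> {0..1} \<Longrightarrow> upd x i s \<in> unit_cube"
  by (auto simp: upd_def unit_cube_def)

lemma upd_nth [simp]: "upd x i s $ i = s" "j \<noteq> i \<Longrightarrow> upd x i s $ j = x $ j"
  by (simp_all add: upd_def)

lemma upd_self [simp]: "upd x i (x $ i) = x"
  by (simp add: upd_def vec_eq_iff)

lemma upd_commute: "i \<noteq> j \<Longrightarrow> upd (upd x i s) j r = upd (upd x j r) i s"
  by (auto simp: upd_def vec_eq_iff)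

lemma upd_axis: "upd x i s + r *\<^sub>R axis i 1 = upd x i (s + r)"
  by (auto simp: upd_def vec_eq_iff axis_def)

text \<open>\<open>partial\<close> differentiates within the cube and sees nothing outside it. The
  witnesses of regularity in time agree with the solution on the cube only; this lemma carries
  derivatives from one to the other.\<close>

lemma partial_cong:
  assumes fg: "\<And>y. y \<in> unit_cube \<Longrightarrow> f y = g y" and x: "x \<in> unit_cube"
  shows "partial i f x = partial i g x"
proof -
  have "((\<lambda>s. f (x + s *\<^sub>R axis i 1)) has_vector_derivative D) (at 0 within line_dom i x) \<longleftrightarrow>
        ((\<lambda>s. g (x + s *\<^sub>R axis i 1)) has_vector_derivative D) (at 0 within line_dom i x)" for D
    using fg zero_line_dom[OF x, of i]
    by (auto simp: line_dom_def intro: has_vector_derivative_transform[rotated 2])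
  then show ?thesis by (simp add: partial_def vector_derivative_def)
qed

lemma partials_cong:
  assumes fg: "\<And>y. y \<in> unit_cube \<Longrightarrow> f y = g y" and x: "x \<in> unit_cube"
  shows "partials is f x = partials is g x"
  using x
proof (induction "is" arbitrary: x)
  case (Cons i "is")
  then show ?case using partial_cong[of "partials is f" "partials is g" x i] by simp
qed (use fg in simp)

lemma C_space_partial_line:
  assumes "C_space j f" "length is < j" "x \<in> unit_cube"
  shows "((\<lambda>s. partials is f (x + s *\<^sub>R axis i 1)) has_vector_derivative partials (i # is) f x)
    (at 0 within line_dom i x)"
  using assms unfolding C_space_def by (simp add: partial_def vector_derivative_works)

lemma C_space_line:
  assumes f: "C_space j f" "length is < j" and x: "x \<in> unit_cube" and s: "s \<in> {0..1}"
  shows "((\<lambda>s. partials is f (upd x i s)) has_vector_derivative partials (i # is) f (upd x i s))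
    (at s within {0..1})"
proof -
  let ?g = "\<lambda>r. partials is f (upd x i s + r *\<^sub>R axis i 1)"
  have c: "upd x i s \<in> unit_cube" using x s by (rule upd_cube)
  have img: "(\<lambda>u. u - s) ` {0..1} = line_dom i (upd x i s)"
    unfolding line_dom_eq[OF c] by (auto simp: image_iff intro!: bexI[of _ "_ + s"])
  have "(?g \<circ> (\<lambda>u. u - s) has_vector_derivative 1 *\<^sub>R partials (i # is) f (upd x i s)) (at s within {0..1})"
  proof (rule vector_diff_chain_within)
    show "((\<lambda>u. u - s) has_vector_derivative 1) (at s within {0..1})"
      by (auto intro!: derivative_eq_intros)
    show "(?g has_vector_derivative partials (i # is) f (upd x i s)) (at (s - s) within (\<lambda>u. u - s) ` {0..1})"
      unfolding img using C_space_partial_line[OF f c] by simp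
  qed
  moreover have "?g \<circ> (\<lambda>u. u - s) = (\<lambda>s. partials is f (upd x i s))"
    by (simp add: fun_eq_iff upd_axis)
  ultimately show ?thesis by simp
qed

lemma C_space_continuous: "C_space j f \<Longrightarrow> length is \<le> j \<Longrightarrow> continuous_on unit_cube (partials is f)"
  by (simp add: C_space_def)

lemma C_space_partials:
  assumes "C_space (length is + m) f"
  shows "C_space m (partials is f)"
proof -
  have e: "partials js (partials is f) = partials (js @ is) f" for js by simp
  show ?thesis
    unfolding C_space_def e
    by (intro conjI allI impI ballI assms[unfolded C_space_def, THEN conjunct1, rule_format]
        assms[unfolded C_space_def, THEN conjunct2, rule_format]) auto
qed

lemma C_space_mono: "C_space j f \<Longrightarrow> m \<le> j \<Longrightarrow> C_space m f"
  by (auto simp: C_space_def)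

lemma finite_words: "finite {is :: 'd::finite list. length is \<le> j}"
  using finite_lists_length_le[of "UNIV :: 'd set" j] by simp

lemma C_norm_bound:
  fixes f :: "real^'d \<Rightarrow> real^3"
  assumes f: "C_space j f" and l: "length is \<le> j" and x: "x \<in> unit_cube"
  shows "norm (partials is f x) \<le> C_norm j f"
proof -
  have "compact ((\<lambda>x. norm (partials is f x)) ` unit_cube)"
    by (intro compact_continuous_image continuous_on_norm C_space_continuous[OF f l] compact_unit_cube)
  then have "bdd_above ((\<lambda>x. norm (partials is f x)) ` unit_cube)"
    by (intro bounded_imp_bdd_above compact_imp_bounded)
  then have "norm (partials is f x) \<le> (SUP x\<in>unit_cube. norm (partials is f x))"
    using x by (intro cSUP_upper)
  also have "\<dots> \<le> C_norm j f"
    unfolding C_norm_def using l by (intro Max_ge finite_imageI finite_words) auto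
  finally show ?thesis .
qed

lemma C_space_linear_aux:
  fixes f g :: "real^'d \<Rightarrow> real^3"
  assumes f: "C_space j f" and g: "C_space j g" and l: "length is \<le> j" and x: "x \<in> unit_cube"
  shows "partials is (\<lambda>x. a *\<^sub>R f x + b *\<^sub>R g x) x = a *\<^sub>R partials is f x + b *\<^sub>R partials is g x"
  using l x
proof (induction "is" arbitrary: x)
  case (Cons i "is")
  have l: "length is < j" using Cons.prems by simp
  have "partials (i # is) (\<lambda>x. a *\<^sub>R f x + b *\<^sub>R g x) x
     = partial i (\<lambda>x. a *\<^sub>R partials is f x + b *\<^sub>R partials is g x) x"
    unfolding foldr.simps o_apply using Cons by (intro partial_cong) auto
  also have "\<dots> = a *\<^sub>R partials (i # is) f x + b *\<^sub>R partials (i # is) g x"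
    unfolding partial_def[of i "\<lambda>x. a *\<^sub>R partials is f x + b *\<^sub>R partials is g x"]
    using C_space_partial_line[OF f l Cons.prems(2), of i] C_space_partial_line[OF g l Cons.prems(2), of i]
      line_dom_nontrivial[OF Cons.prems(2)]
    by (intro vector_derivative_within)
      (auto intro!: has_vector_derivative_add bounded_linear.has_vector_derivative[OF bounded_linear_scaleR_right])
  finally show ?case .
qed simp

lemma C_space_linear:
  fixes f g :: "real^'d \<Rightarrow> real^3"
  assumes f: "C_space j f" and g: "C_space j g"
  shows "C_space j (\<lambda>x. a *\<^sub>R f x + b *\<^sub>R g x)"
  unfolding C_space_def
proof (intro conjI allI impI ballI)
  fix "is" :: "'d list" and i x
  assume l: "length is < j" and x: "x \<in> (unit_cube :: (real^'d) set)"
  have "((\<lambda>s. a *\<^sub>R partials is f (x + s *\<^sub>R axis i 1) + b *\<^sub>R partials is g (x + s *\<^sub>R axis i 1))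
      has_vector_derivative a *\<^sub>R partials (i # is) f x + b *\<^sub>R partials (i # is) g x) (at 0 within line_dom i x)"
    by (intro has_vector_derivative_add bounded_linear.has_vector_derivative[OF bounded_linear_scaleR_right]
        C_space_partial_line[OF f l x] C_space_partial_line[OF g l x])
  then have "((\<lambda>s. partials is (\<lambda>x. a *\<^sub>R f x + b *\<^sub>R g x) (x + s *\<^sub>R axis i 1))
      has_vector_derivative a *\<^sub>R partials (i # is) f x + b *\<^sub>R partials (i # is) g x) (at 0 within line_dom i x)"
    using l zero_line_dom[OF x, of i]
    by (elim has_vector_derivative_transform[rotated 2]) (auto simp: line_dom_def C_space_linear_aux[OF f g])
  then show "(\<lambda>s. partials is (\<lambda>x. a *\<^sub>R f x + b *\<^sub>R g x) (x + s *\<^sub>R axis i 1)) differentiable at 0 within line_dom i x"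
    by (rule differentiableI_vector)
next
  fix "is" :: "'d list" assume l: "length is \<le> j"
  have "continuous_on unit_cube (\<lambda>x. a *\<^sub>R partials is f x + b *\<^sub>R partials is g x)"
    using C_space_continuous[OF f l] C_space_continuous[OF g l] by (intro continuous_intros)
  then show "continuous_on unit_cube (partials is (\<lambda>x. a *\<^sub>R f x + b *\<^sub>R g x))"
    using C_space_linear_aux[OF f g l] by (simp cong: continuous_on_cong)
qed

text \<open>The mean value theorem, first in direction i for the difference in direction j, then in
  direction j for the derivative. It is a scalar theorem, hence the component l.\<close>

lemma mixed_difference:
  fixes g :: "real^'d \<Rightarrow> real^3"
  assumes g: "C_space 2 g" and x: "x \<in> unit_cube" and ij: "i \<noteq> j" and r: "r > 0"
    and a: "0 \<le> a" "a + r \<le> 1" and b: "0 \<le> b" "b + r \<le> 1"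
  shows "\<exists>\<xi>\<in>{a..a+r}. \<exists>\<eta>\<in>{b..b+r}.
    (g (upd (upd x i (a + r)) j (b + r)) $ l - g (upd (upd x i (a + r)) j b) $ l)
     - (g (upd (upd x i a) j (b + r)) $ l - g (upd (upd x i a) j b) $ l)
    = r * r * partials [j, i] g (upd (upd x i \<xi>) j \<eta>) $ l"
proof -
  define w where "w s = g (upd (upd x i s) j (b + r)) $ l - g (upd (upd x i s) j b) $ l" for s
  define w' where "w' s = partial i g (upd (upd x i s) j (b + r)) $ l - partial i g (upd (upd x i s) j b) $ l" for s
  have comp: "((\<lambda>s. F s $ l) has_derivative (\<lambda>u. u * (D $ l))) (at s within S)"
    if "(F has_vector_derivative D) (at s within S)" for F :: "real \<Rightarrow> real^3" and D s S
    using bounded_linear.has_vector_derivative[OF bounded_linear_vec_nth that]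
    by (simp add: has_vector_derivative_def)
  have di: "((\<lambda>s. g (upd (upd x i s) j c) $ l) has_derivative (\<lambda>u. u * (partial i g (upd (upd x i s) j c) $ l)))
      (at s within {a..a+r})" if "s \<in> {a..a+r}" "c \<in> {0..1}" for s c
  proof -
    have "((\<lambda>s. partials [] g (upd (upd x j c) i s)) has_vector_derivative partials [i] g (upd (upd x j c) i s))
      (at s within {0..1})"
      using that a by (intro C_space_line[OF g] upd_cube x) auto
    then have "((\<lambda>s. g (upd (upd x i s) j c)) has_vector_derivative partial i g (upd (upd x i s) j c))
      (at s within {0..1})" using ij by (simp add: upd_commute)
    then have "((\<lambda>s. g (upd (upd x i s) j c)) has_vector_derivative partial i g (upd (upd x i s) j c))
      (at s within {a..a+r})" using a by (elim has_vector_derivative_within_subset) auto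
    then show ?thesis by (rule comp)
  qed
  have "(w has_derivative (\<lambda>u. u * w' s)) (at s within {a..a+r})" if "s \<in> {a..a+r}" for s
  proof -
    have "(w has_derivative (\<lambda>u. u * (partial i g (upd (upd x i s) j (b + r)) $ l)
         - u * (partial i g (upd (upd x i s) j b) $ l))) (at s within {a..a+r})"
      unfolding w_def[abs_def] using that b r by (intro has_derivative_diff di) auto
    then show ?thesis by (simp add: w'_def right_diff_distrib)
  qed
  then have "\<exists>\<xi>\<in>{a<..<a+r}. w (a + r) - w a = (a + r - a) * w' \<xi>"
    using r by (intro mvt_simple) auto
  then obtain \<xi> where xi: "\<xi> \<in> {a<..<a+r}" "w (a + r) - w a = r * w' \<xi>" by auto
  have "((\<lambda>t. partial i g (upd (upd x i \<xi>) j t) $ l) has_derivative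
      (\<lambda>u. u * (partials [j, i] g (upd (upd x i \<xi>) j t) $ l))) (at t within {b..b+r})" if "t \<in> {b..b+r}" for t
  proof -
    have "((\<lambda>t. partials [i] g (upd (upd x i \<xi>) j t)) has_vector_derivative partials (j # [i]) g (upd (upd x i \<xi>) j t))
      (at t within {0..1})"
      using that a b xi by (intro C_space_line[OF g] upd_cube x) auto
    then have "((\<lambda>t. partials [i] g (upd (upd x i \<xi>) j t)) has_vector_derivative partials (j # [i]) g (upd (upd x i \<xi>) j t))
      (at t within {b..b+r})" using b by (elim has_vector_derivative_within_subset) auto
    from comp[OF this] show ?thesis by simp
  qed
  then have "\<exists>\<eta>\<in>{b<..<b+r}. partial i g (upd (upd x i \<xi>) j (b + r)) $ l - partial i g (upd (upd x i \<xi>) j b) $ l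
     = (b + r - b) * (partials [j, i] g (upd (upd x i \<xi>) j \<eta>) $ l)"
    using r by (intro mvt_simple) auto
  then obtain \<eta> where eta: "\<eta> \<in> {b<..<b+r}" "w' \<xi> = r * (partials [j, i] g (upd (upd x i \<xi>) j \<eta>) $ l)"
    by (auto simp: w'_def)
  have "w (a + r) - w a = r * r * partials [j, i] g (upd (upd x i \<xi>) j \<eta>) $ l"
    using xi eta by (simp add: mult.assoc)
  moreover have "\<xi> \<in> {a..a+r}" "\<eta> \<in> {b..b+r}" using xi eta by auto
  ultimately show ?thesis unfolding w_def by blast
qed

text \<open>Schwarz's theorem up to the boundary: the same second difference is expanded in both
  orders, divided by the area of its square, and the square shrinks to x.\<close>

lemma partial_commute:
  fixes g :: "real^'d \<Rightarrow> real^3"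
  assumes g: "C_space 2 g" and x: "x \<in> unit_cube"
  shows "partial i (partial j g) x = partial j (partial i g) x"
proof (cases "i = j")
  case False
  define r where "r n = 1 / real (Suc (Suc n))" for n
  \<comment> \<open>The corner of a square of side r that contains the two coordinates of x and
    stays inside the cube even if x lies on a face.\<close>
  define a b where "a n = min (x $ i) (1 - r n)" and "b n = min (x $ j) (1 - r n)" for n
  have r: "0 < r n" "r n \<le> 1" for n by (auto simp: r_def)
  have xc: "0 \<le> x $ i" "x $ i \<le> 1" "0 \<le> x $ j" "x $ j \<le> 1" using x by (auto simp: unit_cube_def)
  have ab: "0 \<le> a n" "a n + r n \<le> 1" "0 \<le> b n" "b n + r n \<le> 1"
    "x $ i \<in> {a n .. a n + r n}" "x $ j \<in> {b n .. b n + r n}" for n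
    using xc r[of n] by (auto simp: a_def b_def min_def)
  have rl: "r \<longlonglongrightarrow> 0" unfolding r_def using LIMSEQ_ignore_initial_segment[OF LIMSEQ_inverse_real_of_nat, of 1]
    by (simp add: inverse_eq_divide)
  have "partials [j, i] g x $ l = partials [i, j] g x $ l" for l
  proof -
    have "\<forall>n. \<exists>\<xi>\<in>{a n..a n + r n}. \<exists>\<eta>\<in>{b n..b n + r n}. \<exists>\<xi>'\<in>{a n..a n + r n}. \<exists>\<eta>'\<in>{b n..b n + r n}.
       partials [j, i] g (upd (upd x i \<xi>) j \<eta>) $ l = partials [i, j] g (upd (upd x i \<xi>') j \<eta>') $ l"
    proof
      fix n
      obtain \<xi> \<eta> where 1: "\<xi> \<in> {a n..a n + r n}" "\<eta> \<in> {b n..b n + r n}"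
        "(g (upd (upd x i (a n + r n)) j (b n + r n)) $ l - g (upd (upd x i (a n + r n)) j (b n)) $ l)
         - (g (upd (upd x i (a n)) j (b n + r n)) $ l - g (upd (upd x i (a n)) j (b n)) $ l)
         = r n * r n * partials [j, i] g (upd (upd x i \<xi>) j \<eta>) $ l"
        using mixed_difference[OF g x False r(1) ab(1-4)] by blast
      obtain \<eta>' \<xi>' where 2: "\<eta>' \<in> {b n..b n + r n}" "\<xi>' \<in> {a n..a n + r n}"
        "(g (upd (upd x j (b n + r n)) i (a n + r n)) $ l - g (upd (upd x j (b n + r n)) i (a n)) $ l)
         - (g (upd (upd x j (b n)) i (a n + r n)) $ l - g (upd (upd x j (b n)) i (a n)) $ l)
         = r n * r n * partials [i, j] g (upd (upd x j \<eta>') i \<xi>') $ l"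
        using mixed_difference[OF g x False[symmetric] r(1) ab(3,4,1,2)] by blast
      have "r n * r n * partials [j, i] g (upd (upd x i \<xi>) j \<eta>) $ l
         = r n * r n * partials [i, j] g (upd (upd x i \<xi>') j \<eta>') $ l"
        using 1(3) 2(3) unfolding upd_commute[OF False[symmetric]] by linarith
      then have "partials [j, i] g (upd (upd x i \<xi>) j \<eta>) $ l = partials [i, j] g (upd (upd x i \<xi>') j \<eta>') $ l"
        using r(1)[of n] by simp
      then show "\<exists>\<xi>\<in>{a n..a n + r n}. \<exists>\<eta>\<in>{b n..b n + r n}. \<exists>\<xi>'\<in>{a n..a n + r n}. \<exists>\<eta>'\<in>{b n..b n + r n}.
       partials [j, i] g (upd (upd x i \<xi>) j \<eta>) $ l = partials [i, j] g (upd (upd x i \<xi>') j \<eta>') $ l"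
        using 1 2 by blast
    qed
    then obtain \<xi> \<eta> \<xi>' \<eta>' where pt: "\<And>n. \<xi> n \<in> {a n..a n + r n}" "\<And>n. \<eta> n \<in> {b n..b n + r n}"
      "\<And>n. \<xi>' n \<in> {a n..a n + r n}" "\<And>n. \<eta>' n \<in> {b n..b n + r n}"
      "\<And>n. partials [j, i] g (upd (upd x i (\<xi> n)) j (\<eta> n)) $ l = partials [i, j] g (upd (upd x i (\<xi>' n)) j (\<eta>' n)) $ l"
      by metis
    have conv: "(\<lambda>n. upd (upd x i (p n)) j (q n)) \<longlonglongrightarrow> x"
      if "\<And>n. p n \<in> {a n..a n + r n}" "\<And>n. q n \<in> {b n..b n + r n}" for p q
    proof (rule vec_tendstoI)
      fix k
      have lim: "f \<longlonglongrightarrow> c" if "\<And>n. f n \<in> {d n..d n + r n}" "\<And>n. c \<in> {d n..d n + r n}" for f d c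
      proof -
        have "(\<lambda>n. f n - c) \<longlonglongrightarrow> 0"
        proof (rule Lim_null_comparison[OF _ rl], rule always_eventually, rule allI)
          fix n show "norm (f n - c) \<le> r n" using that[of n] by (auto simp: abs_le_iff)
        qed
        then show ?thesis by (simp add: LIM_zero_iff)
      qed
      have "p \<longlonglongrightarrow> x $ i" "q \<longlonglongrightarrow> x $ j" by (rule lim[OF that(1) ab(5)], rule lim[OF that(2) ab(6)])
      then show "(\<lambda>n. upd (upd x i (p n)) j (q n) $ k) \<longlonglongrightarrow> x $ k"
        using False by (cases "k = j"; cases "k = i") auto
    qed
    have cube: "upd (upd x i p) j q \<in> unit_cube"
      if "p \<in> {a n..a n + r n}" "q \<in> {b n..b n + r n}" for p q n
      using that ab(1-4)[of n] by (intro upd_cube x) auto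
    have lim: "(\<lambda>n. partials is g (upd (upd x i (p n)) j (q n)) $ l) \<longlonglongrightarrow> partials is g x $ l"
      if "\<And>n. p n \<in> {a n..a n + r n}" "\<And>n. q n \<in> {b n..b n + r n}" "length is \<le> 2" for p q "is"
    proof (rule tendsto_vec_nth, rule continuous_on_tendsto_compose[OF C_space_continuous[OF g that(3)]])
      show "(\<lambda>n. upd (upd x i (p n)) j (q n)) \<longlonglongrightarrow> x" by (rule conv[OF that(1,2)])
      show "\<forall>\<^sub>F n in sequentially. upd (upd x i (p n)) j (q n) \<in> unit_cube"
        by (rule always_eventually, rule allI, rule cube[OF that(1,2)])
    qed (rule x)
    have "(\<lambda>n. partials [j, i] g (upd (upd x i (\<xi> n)) j (\<eta> n)) $ l) \<longlonglongrightarrow> partials [j, i] g x $ l"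
      by (rule lim[OF pt(1,2)]) simp
    moreover have "(\<lambda>n. partials [i, j] g (upd (upd x i (\<xi>' n)) j (\<eta>' n)) $ l) \<longlonglongrightarrow> partials [i, j] g x $ l"
      by (rule lim[OF pt(3,4)]) simp
    ultimately show ?thesis unfolding pt(5) by (rule LIMSEQ_unique)
  qed
  then show ?thesis by (simp add: vec_eq_iff)
qed simp

section \<open>Time derivatives of fields with values in spaces of differentiable functions\<close>

lemma partials_diff_quotient:
  fixes f g w :: "real^'d \<Rightarrow> real^3"
  assumes f: "C_space j f" and g: "C_space j g" and w: "C_space j w" and l: "length is \<le> j" and x: "x \<in> unit_cube"
  shows "norm (c *\<^sub>R (partials is f x - partials is g x) - partials is w x)
    \<le> C_norm j (\<lambda>x. c *\<^sub>R (f x - g x) - w x)"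
proof -
  have e: "(\<lambda>x. c *\<^sub>R (f x - g x) - w x) = (\<lambda>x. 1 *\<^sub>R (c *\<^sub>R f x + (- c) *\<^sub>R g x) + (- 1) *\<^sub>R w x)"
    by (simp add: fun_eq_iff scaleR_diff_right)
  have fg: "C_space j (\<lambda>x. c *\<^sub>R f x + (- c) *\<^sub>R g x)" by (rule C_space_linear[OF f g])
  have "C_space j (\<lambda>x. c *\<^sub>R (f x - g x) - w x)" unfolding e by (rule C_space_linear[OF fg w])
  from C_norm_bound[OF this l x]
  have "norm (partials is (\<lambda>x. c *\<^sub>R (f x - g x) - w x) x) \<le> C_norm j (\<lambda>x. c *\<^sub>R (f x - g x) - w x)" .
  moreover have "partials is (\<lambda>x. c *\<^sub>R (f x - g x) - w x) x = c *\<^sub>R (partials is f x - partials is g x) - partials is w x"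
    unfolding e C_space_linear_aux[OF fg w l x] C_space_linear_aux[OF f g l x]
    by (simp add: scaleR_diff_right)
  ultimately show ?thesis by simp
qed

lemma has_vector_derivative_quotient:
  fixes f :: "real \<Rightarrow> 'a::real_normed_vector"
  assumes "((\<lambda>s. (1 / (s - t)) *\<^sub>R (f s - f t) - D) \<longlongrightarrow> 0) (at t within S)"
  shows "(f has_vector_derivative D) (at t within S)"
  unfolding has_vector_derivative_def has_derivative_within
proof (intro conjI bounded_linear_scaleR_left)
  show "((\<lambda>y. (1 / norm (y - t)) *\<^sub>R (f y - (f t + (y - t) *\<^sub>R D))) \<longlongrightarrow> 0) (at t within S)"
  proof (rule Lim_null_comparison)
    show "((\<lambda>s. norm ((1 / (s - t)) *\<^sub>R (f s - f t) - D)) \<longlongrightarrow> 0) (at t within S)"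
      using assms by (rule tendsto_norm_zero)
    show "\<forall>\<^sub>F y in at t within S. norm ((1 / norm (y - t)) *\<^sub>R (f y - (f t + (y - t) *\<^sub>R D)))
        \<le> norm ((1 / (y - t)) *\<^sub>R (f y - f t) - D)"
      unfolding eventually_at_filter
    proof (intro always_eventually allI impI)
      fix y assume y: "y \<noteq> t"
      have "(1 / (y - t)) *\<^sub>R (f y - f t) - D = (1 / (y - t)) *\<^sub>R (f y - (f t + (y - t) *\<^sub>R D))"
        using y by (simp add: scaleR_diff_right scaleR_add_right)
      then show "norm ((1 / norm (y - t)) *\<^sub>R (f y - (f t + (y - t) *\<^sub>R D)))
        \<le> norm ((1 / (y - t)) *\<^sub>R (f y - f t) - D)" by simp
    qed
  qed
qed

lemma vector_mvt_bound:
  fixes f :: "real \<Rightarrow> 'a::real_normed_vector"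
  assumes "\<And>s. s \<in> S \<Longrightarrow> (f has_vector_derivative f' s) (at s within S)" "convex S"
    and "\<And>s. s \<in> S \<Longrightarrow> norm (f' s) \<le> B" "x \<in> S" "y \<in> S"
  shows "norm (f y - f x) \<le> B * \<bar>y - x\<bar>"
proof -
  have "norm (f y - f x) \<le> B * norm (y - x)"
  proof (rule differentiable_bound[where S = S and f' = "\<lambda>s u. u *\<^sub>R f' s"])
    fix s assume s: "s \<in> S"
    then show "(f has_derivative (\<lambda>u. u *\<^sub>R f' s)) (at s within S)"
      using assms(1) by (simp add: has_vector_derivative_def)
    show "onorm (\<lambda>u. u *\<^sub>R f' s) \<le> B"
    proof (rule onorm_le)
      fix u :: real
      have "\<bar>u\<bar> * norm (f' s) \<le> \<bar>u\<bar> * B" using assms(3)[OF s] by (rule mult_left_mono) simp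
      then show "norm (u *\<^sub>R f' s) \<le> B * norm u" by (simp add: mult.commute)
    qed
  qed (use assms in auto)
  then show ?thesis by simp
qed

text \<open>Compactness of the interval, by Bolzano's bisection. The values at t itself are a
  separate hypothesis because the filter at t excludes the point.\<close>

lemma locally_bounded_interval:
  fixes g :: "real \<Rightarrow> 'i \<Rightarrow> real"
  assumes loc: "\<And>t. t \<in> {0..T} \<Longrightarrow> \<exists>K. \<forall>\<^sub>F s in at t within {0..T}. \<forall>x\<in>X. g s x \<le> K"
    and pt: "\<And>t. t \<in> {0..T} \<Longrightarrow> \<exists>K. \<forall>x\<in>X. g t x \<le> K" and T: "0 \<le> T"
  shows "\<exists>K. \<forall>t\<in>{0..T}. \<forall>x\<in>X. g t x \<le> K"
proof -
  define P where "P a b = (\<exists>K. \<forall>t. t \<in> {0..T} \<longrightarrow> a \<le> t \<longrightarrow> t \<le> b \<longrightarrow> (\<forall>x\<in>X. g t x \<le> K))" for a b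
  have "P 0 T" using T
  proof (induction rule: Bolzano)
    case (trans a b c)
    then obtain K K' where "\<forall>t. t \<in> {0..T} \<longrightarrow> a \<le> t \<longrightarrow> t \<le> b \<longrightarrow> (\<forall>x\<in>X. g t x \<le> K)"
      "\<forall>t. t \<in> {0..T} \<longrightarrow> b \<le> t \<longrightarrow> t \<le> c \<longrightarrow> (\<forall>x\<in>X. g t x \<le> K')" unfolding P_def by blast
    then show ?case unfolding P_def by (intro exI[of _ "max K K'"]) (metis linear max.coboundedI1 max.coboundedI2)
  next
    case (local t)
    then have t: "t \<in> {0..T}" by simp
    from loc[OF t] obtain K d where d: "d > 0"
      "\<And>s. s \<in> {0..T} \<Longrightarrow> s \<noteq> t \<Longrightarrow> dist s t < d \<Longrightarrow> \<forall>x\<in>X. g s x \<le> K"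
      unfolding eventually_at by blast
    from pt[OF t] obtain K' where K': "\<forall>x\<in>X. g t x \<le> K'" by blast
    show ?case
    proof (intro exI[of _ d] conjI allI impI d(1))
      fix a b assume ab: "a \<le> t \<and> t \<le> b \<and> b - a < d"
      show "P a b" unfolding P_def
      proof (intro exI[of _ "max K K'"] allI impI ballI)
        fix s x assume s: "s \<in> {0..T}" "a \<le> s" "s \<le> b" and x: "x \<in> X"
        show "g s x \<le> max K K'"
        proof (cases "s = t")
          case True
          then show ?thesis using K' x by auto
        next
          case False
          have "dist s t < d" using s ab by (auto simp: dist_real_def)
          then show ?thesis using d(2)[OF s(1) False] x by auto
        qed
      qed
    qed
  qed
  then show ?thesis unfolding P_def by (metis atLeastAtMost_iff)
qed

text \<open>Convergence in the norm of C^j dominates convergence of each spatial partial, so time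
  derivatives pass through \<open>partials\<close>. As for the bound K, the top derivative is
  continuous in the C^j norm, hence locally bounded; each lower one is bounded by its value at time
  0 plus T times the bound of the next.\<close>

lemma C_time_chain:
  fixes u :: "real \<Rightarrow> real^'d \<Rightarrow> real^3"
  assumes u: "C_time T p j u" and T: "T > 0"
  shows "\<exists>v K. (\<forall>t\<in>{0..T}. \<forall>x\<in>unit_cube. v 0 t x = u t x) \<and> (\<forall>q\<le>p. \<forall>t\<in>{0..T}. C_space j (v q t)) \<and>
    (\<forall>q<p. \<forall>is t. length is \<le> j \<longrightarrow> t \<in> {0..T} \<longrightarrow> (\<forall>x\<in>unit_cube.
       ((\<lambda>s. partials is (v q s) x) has_vector_derivative partials is (v (Suc q) t) x) (at t within {0..T}))) \<and>
    (\<forall>q\<le>p. \<forall>is t. length is \<le> j \<longrightarrow> t \<in> {0..T} \<longrightarrow> (\<forall>x\<in>unit_cube. norm (partials is (v q t) x) \<le> K))"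
proof -
  obtain v :: "nat \<Rightarrow> real \<Rightarrow> real^'d \<Rightarrow> real^3" where v':
    "\<forall>t\<in>{0..T}. \<forall>x\<in>unit_cube. v 0 t x = u t x"
    "\<forall>q\<le>p. \<forall>t\<in>{0..T}. C_space j (v q t)"
    "\<forall>q<p. \<forall>t\<in>{0..T}.
        ((\<lambda>s. C_norm j (\<lambda>x. (1 / (s - t)) *\<^sub>R (v q s x - v q t x) - v (Suc q) t x)) \<longlongrightarrow> 0)
          (at t within {0..T})"
    "\<forall>t\<in>{0..T}. ((\<lambda>s. C_norm j (\<lambda>x. v p s x - v p t x)) \<longlongrightarrow> 0) (at t within {0..T})"
    using u[unfolded C_time_def] by (elim exE conjE) (rule that)
  note v = v'(1) v'(2)[rule_format] v'(3)[rule_format] v'(4)[rule_format]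
  have inT: "\<forall>\<^sub>F s in at t within {0..T}. s \<in> {0..T}" for t
    by (simp add: eventually_at_filter)
  have der: "((\<lambda>s. partials is (v q s) x) has_vector_derivative partials is (v (Suc q) t) x) (at t within {0..T})"
    if q: "q < p" and l: "length is \<le> j" and t: "t \<in> {0..T}" and x: "x \<in> unit_cube" for q "is" t x
  proof (rule has_vector_derivative_quotient, rule Lim_null_comparison[OF _ v(3)[OF q t]])
    show "\<forall>\<^sub>F s in at t within {0..T}.
       norm ((1 / (s - t)) *\<^sub>R (partials is (v q s) x - partials is (v q t) x) - partials is (v (Suc q) t) x)
       \<le> C_norm j (\<lambda>x. (1 / (s - t)) *\<^sub>R (v q s x - v q t x) - v (Suc q) t x)"
      using inT
    proof (rule eventually_mono)
      fix s assume "s \<in> {0..T}"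
      then show "norm ((1 / (s - t)) *\<^sub>R (partials is (v q s) x - partials is (v q t) x) - partials is (v (Suc q) t) x)
       \<le> C_norm j (\<lambda>x. (1 / (s - t)) *\<^sub>R (v q s x - v q t x) - v (Suc q) t x)"
        using q t by (intro partials_diff_quotient[OF _ _ _ l x] v(2)) auto
    qed
  qed
  let ?X = "{is :: 'd list. length is \<le> j} \<times> (unit_cube :: (real^'d) set)"
  have top: "\<exists>K. \<forall>t\<in>{0..T}. \<forall>y\<in>?X. norm (partials (fst y) (v p t) (snd y)) \<le> K"
  proof (rule locally_bounded_interval)
    fix t assume t: "t \<in> {0..T}"
    have zero: "C_space j (\<lambda>x::real^'d. 0 :: real^3)"
      using C_space_linear[OF v(2)[OF order_refl t] v(2)[OF order_refl t], of 0 0] by simp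
    have zp: "partials is (\<lambda>x::real^'d. 0 :: real^3) x = 0" if "length is \<le> j" "x \<in> unit_cube" for "is" x
      using C_space_linear_aux[OF zero zero that, of 0 0] by simp
    have "\<forall>\<^sub>F s in at t within {0..T}. C_norm j (\<lambda>x. v p s x - v p t x) < 1"
      using order_tendstoD(2)[OF v(4)[OF t], of 1] by simp
    with inT have "\<forall>\<^sub>F s in at t within {0..T}. \<forall>y\<in>?X. norm (partials (fst y) (v p s) (snd y)) \<le> 1 + C_norm j (v p t)"
    proof eventually_elim
      case (elim s)
      show ?case
      proof
        fix y assume "y \<in> ?X"
        then have y: "length (fst y) \<le> j" "snd y \<in> unit_cube" by auto
        have "norm (1 *\<^sub>R (partials (fst y) (v p s) (snd y) - partials (fst y) (v p t) (snd y)) - partials (fst y) (\<lambda>x. 0) (snd y))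
          \<le> C_norm j (\<lambda>x. 1 *\<^sub>R (v p s x - v p t x) - 0)"
          by (rule partials_diff_quotient[OF v(2)[OF order_refl elim(1)] v(2)[OF order_refl t] zero y])
        then have "norm (partials (fst y) (v p s) (snd y) - partials (fst y) (v p t) (snd y)) < 1"
          using elim(2) zp[OF y] by simp
        moreover have "norm (partials (fst y) (v p t) (snd y)) \<le> C_norm j (v p t)"
          by (rule C_norm_bound[OF v(2)[OF order_refl t] y])
        ultimately show "norm (partials (fst y) (v p s) (snd y)) \<le> 1 + C_norm j (v p t)"
          using norm_triangle_ineq2[of "partials (fst y) (v p s) (snd y)" "partials (fst y) (v p t) (snd y)"] by linarith
      qed
    qed
    then show "\<exists>K. \<forall>\<^sub>F s in at t within {0..T}. \<forall>y\<in>?X. norm (partials (fst y) (v p s) (snd y)) \<le> K" by blast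
    show "\<exists>K. \<forall>y\<in>?X. norm (partials (fst y) (v p t) (snd y)) \<le> K"
      using C_norm_bound[OF v(2)[OF order_refl t]] by (intro exI[of _ "C_norm j (v p t)"]) auto
  qed (use T in simp)
  have "\<exists>K. \<forall>t\<in>{0..T}. \<forall>y\<in>?X. norm (partials (fst y) (v (p - m) t) (snd y)) \<le> K" if "m \<le> p" for m
    using that
  proof (induction m)
    case 0
    then show ?case using top by simp
  next
    case (Suc m)
    then obtain K where K: "\<forall>t\<in>{0..T}. \<forall>y\<in>?X. norm (partials (fst y) (v (p - m) t) (snd y)) \<le> K" by auto
    define q where "q = p - Suc m"
    have q: "Suc q = p - m" "q < p" using Suc.prems by (auto simp: q_def)
    have "norm (partials (fst y) (v q t) (snd y)) \<le> C_norm j (v q 0) + K * T" if t: "t \<in> {0..T}" and y: "y \<in> ?X" for t y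
    proof -
      have y': "length (fst y) \<le> j" "snd y \<in> unit_cube" using y by auto
      have T0: "0 \<in> {0..T}" using T by simp
      have "norm (partials (fst y) (v q t) (snd y) - partials (fst y) (v q 0) (snd y)) \<le> K * \<bar>t - 0\<bar>"
      proof (rule vector_mvt_bound[where S = "{0..T}"])
        fix s assume s: "s \<in> {0..T}"
        show "((\<lambda>s. partials (fst y) (v q s) (snd y)) has_vector_derivative partials (fst y) (v (Suc q) s) (snd y)) (at s within {0..T})"
          by (rule der[OF q(2) y'(1) s y'(2)])
        show "norm (partials (fst y) (v (Suc q) s) (snd y)) \<le> K" unfolding q(1) using K s y by blast
      qed (use t T in auto)
      also have "\<dots> \<le> K * T"
      proof -
        have "0 \<le> K" using K T0 y norm_ge_zero order_trans by blast
        then show ?thesis using t by (intro mult_left_mono) auto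
      qed
      finally have "norm (partials (fst y) (v q t) (snd y) - partials (fst y) (v q 0) (snd y)) \<le> K * T" .
      moreover have "norm (partials (fst y) (v q 0) (snd y)) \<le> C_norm j (v q 0)"
        using q by (intro C_norm_bound v(2) T0 y') auto
      ultimately show ?thesis
        using norm_triangle_ineq2[of "partials (fst y) (v q t) (snd y)" "partials (fst y) (v q 0) (snd y)"] by linarith
    qed
    then show ?case unfolding q_def by blast
  qed
  then have "\<forall>q\<le>p. \<exists>K. \<forall>t\<in>{0..T}. \<forall>y\<in>?X. norm (partials (fst y) (v q t) (snd y)) \<le> K"
    by (metis diff_diff_cancel diff_le_self)
  then obtain Kq where Kq: "\<And>q t y. q \<le> p \<Longrightarrow> t \<in> {0..T} \<Longrightarrow> y \<in> ?X \<Longrightarrow> norm (partials (fst y) (v q t) (snd y)) \<le> Kq q"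
    by metis
  have bd: "norm (partials is (v q t) x) \<le> Max (Kq ` {..p})"
    if "q \<le> p" "length is \<le> j" "t \<in> {0..T}" "x \<in> unit_cube" for q "is" t x
  proof -
    have "norm (partials is (v q t) x) \<le> Kq q" using Kq[OF that(1,3), of "(is, x)"] that by simp
    also have "\<dots> \<le> Max (Kq ` {..p})" using that by (intro Max_ge) auto
    finally show ?thesis .
  qed
  show ?thesis
    by (intro exI[of _ v] exI[of _ "Max (Kq ` {..p})"] conjI allI impI ballI)
      (use v(1,2) der bd in auto)
qed

section \<open>Stencils on even extensions\<close>

text \<open>The derivative of the remainder is the remainder of the derivative, of one order less,
  and the mean value inequality on the segment from x to y integrates its bound. The factor 1/p! is
  given up.\<close>

lemma taylor_remainder:
  fixes f :: "nat \<Rightarrow> real \<Rightarrow> 'a::real_normed_vector"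
  assumes "\<And>q s. q < p \<Longrightarrow> s \<in> S \<Longrightarrow> (f q has_vector_derivative f (Suc q) s) (at s within S)"
    and S: "convex S" "x \<in> S" and y: "y \<in> S" and B: "\<And>s. s \<in> S \<Longrightarrow> norm (f p s) \<le> B"
  shows "norm (f 0 y - (\<Sum>q<p. ((y - x) ^ q / fact q) *\<^sub>R f q x)) \<le> B * \<bar>y - x\<bar> ^ p"
  using assms(1) B y
proof (induction p arbitrary: f y)
  case 0
  then show ?case by simp
next
  case (Suc p)
  define g where "g z = f 0 z - (f 0 x + (\<Sum>q<p. ((z - x) ^ Suc q / fact (Suc q)) *\<^sub>R f (Suc q) x))" for z
  define g' where "g' z = f (Suc 0) z - (\<Sum>q<p. ((z - x) ^ q / fact q) *\<^sub>R f (Suc q) x)" for z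
  have seg: "closed_segment x y \<subseteq> S" using S Suc.prems(3) by (simp add: closed_segment_subset)
  have "norm (g y - g x) \<le> (B * \<bar>y - x\<bar> ^ p) * \<bar>y - x\<bar>"
  proof (rule vector_mvt_bound[where S = "closed_segment x y" and f' = g'])
    fix z assume z: "z \<in> closed_segment x y"
    have zS: "z \<in> S" using z seg by blast
    have pw: "((\<lambda>z. (z - x) ^ Suc q / fact (Suc q)) has_vector_derivative (z - x) ^ q / fact q) (at z within closed_segment x y)" for q
    proof -
      have "((\<lambda>z. (z - x) ^ Suc q) has_real_derivative real (Suc q) * (1 * (z - x) ^ (Suc q - Suc 0))) (at z within closed_segment x y)"
        by (rule DERIV_power) (auto intro!: derivative_eq_intros)
      then have "((\<lambda>z. (z - x) ^ Suc q / fact (Suc q)) has_real_derivative (real (Suc q) * (z - x) ^ q) / fact (Suc q)) (at z within closed_segment x y)"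
        by (intro DERIV_cdivide) simp
      moreover have "(real (Suc q) * (z - x) ^ q) / fact (Suc q) = (z - x) ^ q / fact q"
        by (simp add: fact_Suc del: of_nat_Suc)
      ultimately show ?thesis by (simp add: has_real_derivative_iff_has_vector_derivative)
    qed
    have "(f 0 has_vector_derivative f (Suc 0) z) (at z within closed_segment x y)"
      using Suc.prems(1)[of 0 z] zS seg by (auto intro: has_vector_derivative_within_subset)
    then have "(g has_vector_derivative f (Suc 0) z - (0 + (\<Sum>q<p. ((z - x) ^ q / fact q) *\<^sub>R f (Suc q) x))) (at z within closed_segment x y)"
      unfolding g_def[abs_def]
      by (intro has_vector_derivative_diff has_vector_derivative_add has_vector_derivative_sum has_vector_derivative_const
          bounded_linear.has_vector_derivative[OF bounded_linear_scaleR_left] pw)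
    then show "(g has_vector_derivative g' z) (at z within closed_segment x y)" by (simp add: g'_def)
    have "norm (g' z) \<le> B * \<bar>z - x\<bar> ^ p"
      unfolding g'_def using Suc.IH[of "\<lambda>q. f (Suc q)" z] Suc.prems zS by auto
    also have "\<dots> \<le> B * \<bar>y - x\<bar> ^ p"
    proof (intro mult_left_mono power_mono)
      show "\<bar>z - x\<bar> \<le> \<bar>y - x\<bar>" using z by (auto simp: closed_segment_eq_real_ivl split: if_splits)
      show "0 \<le> B" using Suc.prems(2)[OF Suc.prems(3)] norm_ge_zero order_trans by blast
    qed auto
    finally show "norm (g' z) \<le> B * \<bar>y - x\<bar> ^ p" .
  qed auto
  moreover have "g x = 0" by (simp add: g_def)
  moreover have "g y = f 0 y - (\<Sum>q<Suc p. ((y - x) ^ q / fact q) *\<^sub>R f q x)"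
    unfolding g_def by (subst sum.lessThan_Suc_shift) simp
  ultimately show ?case by (simp add: mult_ac)
qed

text \<open>Reflection multiplies the q-th derivative by (-1)^q. At 0 the one-sided derivatives
  agree: at odd orders both vanish, at even orders the sign is 1.\<close>

lemma even_extension:
  fixes f :: "nat \<Rightarrow> real \<Rightarrow> 'a::real_normed_vector"
  assumes d: "\<And>q s. q < p \<Longrightarrow> s \<in> {0..1} \<Longrightarrow> (f q has_vector_derivative f (Suc q) s) (at s within {0..1})"
    and odd0: "\<And>q. odd q \<Longrightarrow> q \<le> p \<Longrightarrow> f q 0 = 0"
    and F: "\<And>q s. F q s = (if 0 \<le> s then f q s else (-1) ^ q *\<^sub>R f q (- s))"
    and q: "q < p" and s: "s \<in> {-1..1}"
  shows "(F q has_vector_derivative F (Suc q) s) (at s within {-1..1})"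
proof -
  have Un: "{-1..1::real} = {-1..0} \<union> {0..1}" by auto
  have R: "(F q has_vector_derivative F (Suc q) s) (at s within {0..1})" if "s \<in> {0..1}" for s
  proof -
    have "(f q has_vector_derivative F (Suc q) s) (at s within {0..1})"
      using d[OF q that] that by (simp add: F)
    then show ?thesis
      by (rule has_vector_derivative_transform[OF that, rotated]) (simp add: F)
  qed
  have L: "(F q has_vector_derivative F (Suc q) s) (at s within {-1..0})" if "s \<in> {-1..0}" for s
  proof -
    have i: "uminus ` {-1..0} = {0..1::real}" by (auto simp: image_iff intro: bexI[of _ "- _"])
    have "(f q \<circ> uminus has_vector_derivative (-1) *\<^sub>R f (Suc q) (- s)) (at s within {-1..0})"
    proof (rule vector_diff_chain_within)
      show "(uminus has_vector_derivative -1) (at s within {-1..0})"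
        by (auto intro!: derivative_eq_intros)
      show "(f q has_vector_derivative f (Suc q) (- s)) (at (- s) within uminus ` {-1..0})"
        unfolding i using that by (intro d q) auto
    qed
    then have "((\<lambda>s. (-1) ^ q *\<^sub>R (f q \<circ> uminus) s) has_vector_derivative (-1) ^ q *\<^sub>R ((-1) *\<^sub>R f (Suc q) (- s))) (at s within {-1..0})"
      by (rule bounded_linear.has_vector_derivative[OF bounded_linear_scaleR_right])
    moreover have "(-1) ^ q *\<^sub>R ((-1) *\<^sub>R f (Suc q) (- s)) = F (Suc q) s"
    proof (cases "s = 0")
      case True
      show ?thesis
      proof (cases "odd (Suc q)")
        case True
        then have "f (Suc q) 0 = 0" using odd0 q by simp
        then show ?thesis using \<open>s = 0\<close> by (simp add: F)
      next
        case False
        then show ?thesis using \<open>s = 0\<close> by (simp add: F)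
      qed
    next
      case False
      then show ?thesis using that by (simp add: F)
    qed
    ultimately have "((\<lambda>s. (-1) ^ q *\<^sub>R (f q \<circ> uminus) s) has_vector_derivative F (Suc q) s) (at s within {-1..0})"
      by simp
    then show ?thesis
    proof (rule has_vector_derivative_transform[OF that, rotated])
      fix y :: real assume "y \<in> {-1..0}"
      show "F q y = (-1) ^ q *\<^sub>R (f q \<circ> uminus) y"
      proof (cases "y = 0")
        case True
        then show ?thesis using odd0[of q] q by (cases "odd q") (auto simp: F)
      next
        case False
        then show ?thesis using \<open>y \<in> {-1..0}\<close> by (simp add: F)
      qed
    qed
  qed
  \<comment> \<open>At a point outside one of the two halves the filter of that half is trivial, so
    the limits along the halves combine at every s.\<close>
  have triv: "at s within S = bot" if "closed S" "s \<notin> S" for S :: "real set" and s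
    using that closed_limpt trivial_limit_within by metis
  have D: "(F q has_derivative (\<lambda>u. u *\<^sub>R F (Suc q) s)) (at s within {-1..0} \<union> {0..1})"
  proof -
    have 1: "((\<lambda>y. (1 / norm (y - s)) *\<^sub>R (F q y - (F q s + (y - s) *\<^sub>R F (Suc q) s))) \<longlongrightarrow> 0) (at s within {-1..0})"
    proof (cases "s \<in> {-1..0}")
      case True
      from L[OF True] show ?thesis unfolding has_vector_derivative_def has_derivative_within by blast
    next
      case False
      then show ?thesis using triv[of "{-1..0}" s] by simp
    qed
    have 2: "((\<lambda>y. (1 / norm (y - s)) *\<^sub>R (F q y - (F q s + (y - s) *\<^sub>R F (Suc q) s))) \<longlongrightarrow> 0) (at s within {0..1})"
    proof (cases "s \<in> {0..1}")
      case True
      from R[OF True] show ?thesis unfolding has_vector_derivative_def has_derivative_within by blast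
    next
      case False
      then show ?thesis using triv[of "{0..1}" s] by simp
    qed
    have "((\<lambda>y. (1 / norm (y - s)) *\<^sub>R (F q y - (F q s + (y - s) *\<^sub>R F (Suc q) s))) \<longlongrightarrow> 0) (at s within {-1..0} \<union> {0..1})"
      unfolding at_within_union by (rule filterlim_sup[OF 1 2])
    then show ?thesis unfolding has_derivative_within by (simp only: bounded_linear_scaleR_left simp_thms)
  qed
  then show ?thesis unfolding has_vector_derivative_def Un .
qed

text \<open>The continuous counterpart of \<open>reflect\<close>, for arguments between -1 and 2,
  where one reflection at 0 or at 1 suffices.\<close>

definition fold01 :: "real \<Rightarrow> real" where
  "fold01 y = (if y < 0 then - y else if y > 1 then 2 - y else y)"

text \<open>The segment from x to y crosses at most one end, so one even extension at a time is
  enough. The substitution of 1 - s for s carries the right end to the left one, with the sign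
  (-1)^q on derivatives.\<close>

lemma even_taylor:
  fixes f :: "nat \<Rightarrow> real \<Rightarrow> 'a::real_normed_vector"
  assumes d: "\<And>q s. q < 6 \<Longrightarrow> s \<in> {0..1} \<Longrightarrow> (f q has_vector_derivative f (Suc q) s) (at s within {0..1})"
    and odd0: "\<And>q. odd q \<Longrightarrow> q \<le> 6 \<Longrightarrow> f q 0 = 0" and odd1: "\<And>q. odd q \<Longrightarrow> q \<le> 6 \<Longrightarrow> f q 1 = 0"
    and B: "\<And>s. s \<in> {0..1} \<Longrightarrow> norm (f 6 s) \<le> B" and x: "x \<in> {0..1}" and y: "y \<in> {-1..2}"
  shows "norm (f 0 (fold01 y) - (\<Sum>q<6. ((y - x) ^ q / fact q) *\<^sub>R f q x)) \<le> B * \<bar>y - x\<bar> ^ 6"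
proof -
  have left: "norm (g 0 (fold01 y) - (\<Sum>q<6. ((y - x) ^ q / fact q) *\<^sub>R g q x)) \<le> B * \<bar>y - x\<bar> ^ 6"
    if g: "\<And>q s. q < 6 \<Longrightarrow> s \<in> {0..1} \<Longrightarrow> (g q has_vector_derivative g (Suc q) s) (at s within {0..1})"
      and g0: "\<And>q. odd q \<Longrightarrow> q \<le> 6 \<Longrightarrow> g q 0 = 0" and gB: "\<And>s. s \<in> {0..1} \<Longrightarrow> norm (g 6 s) \<le> B"
      and x: "x \<in> {0..1}" and y: "y \<in> {-1..1}" for g :: "nat \<Rightarrow> real \<Rightarrow> 'a" and x y
  proof -
    define F where "F q s = (if 0 \<le> s then g q s else (-1) ^ q *\<^sub>R g q (- s))" for q s
    have "norm (F 0 y - (\<Sum>q<6. ((y - x) ^ q / fact q) *\<^sub>R F q x)) \<le> B * \<bar>y - x\<bar> ^ 6"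
    proof (rule taylor_remainder[where S = "{-1..1}"])
      show "(F q has_vector_derivative F (Suc q) s) (at s within {-1..1})" if "q < 6" "s \<in> {-1..1}" for q s
        by (rule even_extension[OF g g0 F_def that]) auto
      show "norm (F 6 s) \<le> B" if "s \<in> {-1..1}" for s using that gB by (auto simp: F_def)
    qed (use x y in auto)
    moreover have "F q x = g q x" for q using x by (simp add: F_def)
    moreover have "F 0 y = g 0 (fold01 y)" using y by (auto simp: F_def fold01_def)
    ultimately show ?thesis by simp
  qed
  show ?thesis
  proof (cases "y \<le> 1")
    case True
    then show ?thesis using y by (intro left d odd0 B x) auto
  next
    case False
    define g where "g q s = (-1) ^ q *\<^sub>R f q (1 - s)" for q s
    have "norm (g 0 (fold01 (1 - y)) - (\<Sum>q<6. (((1 - y) - (1 - x)) ^ q / fact q) *\<^sub>R g q (1 - x))) \<le> B * \<bar>(1 - y) - (1 - x)\<bar> ^ 6"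
    proof (rule left)
      fix q :: nat and s :: real assume q: "q < 6" and s: "s \<in> {0..1}"
      have i: "(\<lambda>s. 1 - s) ` {0..1} = {0..1::real}" by (auto simp: image_iff intro: bexI[of _ "1 - _"])
      have "(f q \<circ> (\<lambda>s. 1 - s) has_vector_derivative (-1) *\<^sub>R f (Suc q) (1 - s)) (at s within {0..1})"
      proof (rule vector_diff_chain_within)
        show "((\<lambda>s. 1 - s) has_vector_derivative -1) (at s within {0..1})"
          by (auto intro!: derivative_eq_intros)
        show "(f q has_vector_derivative f (Suc q) (1 - s)) (at (1 - s) within (\<lambda>s. 1 - s) ` {0..1})"
          unfolding i using s by (intro d q) auto
      qed
      then have "((\<lambda>s. (-1) ^ q *\<^sub>R (f q \<circ> (\<lambda>s. 1 - s)) s) has_vector_derivative (-1) ^ q *\<^sub>R ((-1) *\<^sub>R f (Suc q) (1 - s))) (at s within {0..1})"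
        by (rule bounded_linear.has_vector_derivative[OF bounded_linear_scaleR_right])
      then show "(g q has_vector_derivative g (Suc q) s) (at s within {0..1})"
        by (simp add: g_def[abs_def] o_def)
    next
      fix q :: nat assume "odd q" "q \<le> 6"
      then show "g q 0 = 0" using odd1 by (simp add: g_def)
    next
      fix s :: real assume "s \<in> {0..1}"
      then show "norm (g 6 s) \<le> B" using B by (simp add: g_def)
    qed (use x y False in auto)
    moreover have "g 0 (fold01 (1 - y)) = f 0 (fold01 y)" using False y by (auto simp: g_def fold01_def)
    moreover have "(((1 - y) - (1 - x)) ^ q / fact q) *\<^sub>R g q (1 - x) = ((y - x) ^ q / fact q) *\<^sub>R f q x" for q
    proof -
      have "(x - y) ^ q * (-1) ^ q = (y - x) ^ q" by (simp add: power_mult_distrib[symmetric])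
      then show ?thesis by (simp add: g_def)
    qed
    moreover have "\<bar>(1 - y) - (1 - x)\<bar> = \<bar>y - x\<bar>" by simp
    ultimately show ?thesis by (simp only:)
  qed
qed

text \<open>The stencil is exact for polynomials of degree at most 5. The remainders at distance h
  and 2 h contribute (2 * 64 + 2 * 16) / 12 = 40/3 <= 14.\<close>

lemma stencil_d2:
  fixes c :: "nat \<Rightarrow> 'a::real_normed_vector" and g :: "real \<Rightarrow> 'a"
  assumes h: "h > 0" and g: "\<And>z. \<bar>z\<bar> \<le> 2 * h \<Longrightarrow> norm (g z - (\<Sum>q<6. (z ^ q / fact q) *\<^sub>R c q)) \<le> B * \<bar>z\<bar> ^ 6"
  shows "norm ((1 / (12 * h\<^sup>2)) *\<^sub>R (- g (- 2 * h) + 16 *\<^sub>R g (- h) - 30 *\<^sub>R g 0 + 16 *\<^sub>R g h - g (2 * h)) - c 2)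
    \<le> 14 * B * h ^ 4"
proof -
  define P where "P z = (\<Sum>q<6. (z ^ q / fact q) *\<^sub>R c q)" for z
  define E where "E z = g z - P z" for z
  have B0: "0 \<le> B"
  proof -
    have "0 \<le> B * \<bar>h\<bar> ^ 6" using g[of h] h by (auto intro: order_trans[OF norm_ge_zero])
    then show ?thesis using h by (simp add: zero_le_mult_iff)
  qed
  have "- P (- 2 * h) + 16 *\<^sub>R P (- h) - 30 *\<^sub>R P 0 + 16 *\<^sub>R P h - P (2 * h)
     = (\<Sum>q<6. ((- ((- 2 * h) ^ q) + 16 * (- h) ^ q - 30 * 0 ^ q + 16 * h ^ q - (2 * h) ^ q) / fact q) *\<^sub>R c q)"
    unfolding P_def scaleR_sum_right sum_negf[symmetric] sum.distrib[symmetric] sum_subtractf[symmetric]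
    by (intro sum.cong refl) (simp add: algebra_simps diff_divide_distrib add_divide_distrib)
  also have "\<dots> = (\<Sum>q<6. (if q = 2 then 12 * h\<^sup>2 else 0) *\<^sub>R c q)"
  proof (intro sum.cong refl)
    fix q :: nat assume "q \<in> {..<6}"
    then have "q \<in> {0,1,2,3,4,5}" by auto
    then show "((- ((- 2 * h) ^ q) + 16 * (- h) ^ q - 30 * 0 ^ q + 16 * h ^ q - (2 * h) ^ q) / fact q) *\<^sub>R c q
       = (if q = 2 then 12 * h\<^sup>2 else 0) *\<^sub>R c q"
      by (auto simp: power_mult_distrib fact_numeral)
  qed
  also have "\<dots> = (12 * h\<^sup>2) *\<^sub>R c 2" by (simp add: if_distrib[of "\<lambda>r. r *\<^sub>R _"] cong: if_cong)
  finally have P: "- P (- 2 * h) + 16 *\<^sub>R P (- h) - 30 *\<^sub>R P 0 + 16 *\<^sub>R P h - P (2 * h) = (12 * h\<^sup>2) *\<^sub>R c 2" .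
  have g': "g z = E z + P z" for z by (simp add: E_def)
  have "(1 / (12 * h\<^sup>2)) *\<^sub>R (- g (- 2 * h) + 16 *\<^sub>R g (- h) - 30 *\<^sub>R g 0 + 16 *\<^sub>R g h - g (2 * h)) - c 2
    = (1 / (12 * h\<^sup>2)) *\<^sub>R ((- E (- 2 * h) + 16 *\<^sub>R E (- h) - 30 *\<^sub>R E 0 + 16 *\<^sub>R E h - E (2 * h))
       + (- P (- 2 * h) + 16 *\<^sub>R P (- h) - 30 *\<^sub>R P 0 + 16 *\<^sub>R P h - P (2 * h))) - c 2"
    unfolding g' by (simp add: algebra_simps)
  also have "\<dots> = (1 / (12 * h\<^sup>2)) *\<^sub>R (- E (- 2 * h) + 16 *\<^sub>R E (- h) - 30 *\<^sub>R E 0 + 16 *\<^sub>R E h - E (2 * h))"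
    unfolding P using h by (simp add: scaleR_add_right)
  also have "norm \<dots> \<le> (1 / (12 * h\<^sup>2)) * (norm (E (- 2 * h)) + 16 * norm (E (- h)) + 30 * norm (E 0) + 16 * norm (E h) + norm (E (2 * h)))"
  proof -
    have "norm (- a + b - c + d - e) \<le> norm a + norm b + norm c + norm d + norm e" for a b c d e :: 'a
      by (intro order_trans[OF norm_triangle_ineq4] add_mono order_trans[OF norm_triangle_ineq] order_refl) simp
    from this[of "E (- 2 * h)" "16 *\<^sub>R E (- h)" "30 *\<^sub>R E 0" "16 *\<^sub>R E h" "E (2 * h)"] show ?thesis
      unfolding norm_scaleR by (intro mult_mono) auto
  qed
  also have "\<dots> \<le> (1 / (12 * h\<^sup>2)) * (B * (2 * h) ^ 6 + 16 * (B * h ^ 6) + 30 * 0 + 16 * (B * h ^ 6) + B * (2 * h) ^ 6)"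
  proof (intro mult_left_mono add_mono)
    show "norm (E (- 2 * h)) \<le> B * (2 * h) ^ 6" "norm (E (- h)) \<le> B * h ^ 6" "norm (E 0) \<le> 0" "norm (E h) \<le> B * h ^ 6"
      "norm (E (2 * h)) \<le> B * (2 * h) ^ 6"
      using g[of "- 2 * h"] g[of "- h"] g[of 0] g[of h] g[of "2 * h"] h by (auto simp: E_def P_def abs_mult)
  qed auto
  also have "\<dots> = 40 / 3 * B * h ^ 4" using h by (simp add: field_simps eval_nat_numeral)
  also have "\<dots> \<le> 14 * B * h ^ 4" using B0 h by (intro mult_right_mono) auto
  finally show ?thesis .
qed

text \<open>Exact up to degree 4 only: degree 5 leaves - h^4/30 times \<open>c 5\<close>, hence the
  bound on it. The remainders give (2 * 64 + 2 * 8) / 12 = 12 times h^5, and h <= 1 lowers the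
  power.\<close>

lemma stencil_d1:
  fixes c :: "nat \<Rightarrow> 'a::real_normed_vector" and g :: "real \<Rightarrow> 'a"
  assumes h: "h > 0" "h \<le> 1" and g: "\<And>z. \<bar>z\<bar> \<le> 2 * h \<Longrightarrow> norm (g z - (\<Sum>q<6. (z ^ q / fact q) *\<^sub>R c q)) \<le> B * \<bar>z\<bar> ^ 6"
    and c5: "norm (c 5) \<le> B"
  shows "norm ((1 / (12 * h)) *\<^sub>R (g (- 2 * h) - 8 *\<^sub>R g (- h) + 8 *\<^sub>R g h - g (2 * h)) - c 1) \<le> 14 * B * h ^ 4"
proof -
  define P where "P z = (\<Sum>q<6. (z ^ q / fact q) *\<^sub>R c q)" for z
  define E where "E z = g z - P z" for z
  have B0: "0 \<le> B" using c5 norm_ge_zero order_trans by blast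
  have "P (- 2 * h) - 8 *\<^sub>R P (- h) + 8 *\<^sub>R P h - P (2 * h)
     = (\<Sum>q<6. (((- 2 * h) ^ q - 8 * (- h) ^ q + 8 * h ^ q - (2 * h) ^ q) / fact q) *\<^sub>R c q)"
    unfolding P_def scaleR_sum_right sum.distrib[symmetric] sum_subtractf[symmetric]
    by (intro sum.cong refl) (simp add: algebra_simps diff_divide_distrib add_divide_distrib)
  also have "\<dots> = (\<Sum>q<6. ((if q = 1 then 12 * h else 0) + (if q = 5 then - (2 / 5 * h ^ 5) else 0)) *\<^sub>R c q)"
  proof (intro sum.cong refl)
    fix q :: nat assume "q \<in> {..<6}"
    then have "q \<in> {0,1,2,3,4,5}" by auto
    then show "(((- 2 * h) ^ q - 8 * (- h) ^ q + 8 * h ^ q - (2 * h) ^ q) / fact q) *\<^sub>R c q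
       = ((if q = 1 then 12 * h else 0) + (if q = 5 then - (2 / 5 * h ^ 5) else 0)) *\<^sub>R c q"
      by (auto simp: power_mult_distrib fact_numeral)
  qed
  also have "\<dots> = (12 * h) *\<^sub>R c 1 - (2 / 5 * h ^ 5) *\<^sub>R c 5"
    by (simp add: scaleR_add_left sum.distrib if_distrib[of "\<lambda>r. r *\<^sub>R _"] cong: if_cong)
  finally have P: "P (- 2 * h) - 8 *\<^sub>R P (- h) + 8 *\<^sub>R P h - P (2 * h) = (12 * h) *\<^sub>R c 1 - (2 / 5 * h ^ 5) *\<^sub>R c 5" .
  have g': "g z = E z + P z" for z by (simp add: E_def)
  have "(1 / (12 * h)) *\<^sub>R (g (- 2 * h) - 8 *\<^sub>R g (- h) + 8 *\<^sub>R g h - g (2 * h)) - c 1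
    = (1 / (12 * h)) *\<^sub>R ((E (- 2 * h) - 8 *\<^sub>R E (- h) + 8 *\<^sub>R E h - E (2 * h))
       + (P (- 2 * h) - 8 *\<^sub>R P (- h) + 8 *\<^sub>R P h - P (2 * h))) - c 1"
    unfolding g' by (simp add: algebra_simps)
  also have "\<dots> = (1 / (12 * h)) *\<^sub>R (E (- 2 * h) - 8 *\<^sub>R E (- h) + 8 *\<^sub>R E h - E (2 * h) - (2 / 5 * h ^ 5) *\<^sub>R c 5)"
    unfolding P using h by (simp add: scaleR_add_right scaleR_diff_right)
  also have "norm \<dots> \<le> (1 / (12 * h)) * (norm (E (- 2 * h)) + 8 * norm (E (- h)) + 8 * norm (E h) + norm (E (2 * h)) + 2 / 5 * h ^ 5 * norm (c 5))"
  proof -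
    have "norm (a - b + c - d - e) \<le> norm a + norm b + norm c + norm d + norm e" for a b c d e :: 'a
      by (intro order_trans[OF norm_triangle_ineq4] add_mono order_trans[OF norm_triangle_ineq] order_refl)
    from this[of "E (- 2 * h)" "8 *\<^sub>R E (- h)" "8 *\<^sub>R E h" "E (2 * h)" "(2 / 5 * h ^ 5) *\<^sub>R c 5"] show ?thesis
      unfolding norm_scaleR using h by (intro mult_mono) auto
  qed
  also have "\<dots> \<le> (1 / (12 * h)) * (B * (2 * h) ^ 6 + 8 * (B * h ^ 6) + 8 * (B * h ^ 6) + B * (2 * h) ^ 6 + 2 / 5 * h ^ 5 * B)"
  proof (intro mult_left_mono add_mono c5)
    show "norm (E (- 2 * h)) \<le> B * (2 * h) ^ 6" "norm (E (- h)) \<le> B * h ^ 6" "norm (E h) \<le> B * h ^ 6"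
      "norm (E (2 * h)) \<le> B * (2 * h) ^ 6"
      using g[of "- 2 * h"] g[of "- h"] g[of h] g[of "2 * h"] h by (auto simp: E_def P_def abs_mult)
  qed (use h in auto)
  also have "\<dots> = 12 * B * h ^ 5 + 1 / 30 * B * h ^ 4" using h by (simp add: field_simps eval_nat_numeral)
  also have "\<dots> \<le> 12 * B * h ^ 4 + 1 / 30 * B * h ^ 4"
    using B0 h by (intro add_mono mult_left_mono power_decreasing order_refl) auto
  also have "\<dots> = (12 + 1/30) * (B * h ^ 4)" by simp
  also have "\<dots> \<le> 14 * (B * h ^ 4)" using B0 h by (intro mult_right_mono) auto
  finally show ?thesis by simp
qed

section \<open>Jets at the boundary\<close>

text \<open>A Taylor polynomial of degree 3 at the face s = 0, the coefficients including the factor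
  1/q!. Four terms are what C^6 leaves after the two derivatives of the Laplacian. One K controls
  remainder and coefficients, so that it can be tracked through products.\<close>

definition jet :: "real \<Rightarrow> (nat \<Rightarrow> 'a::real_normed_vector) \<Rightarrow> (real \<Rightarrow> 'a) \<Rightarrow> bool" where
  "jet K c f \<longleftrightarrow> 0 \<le> K \<and> (\<forall>s\<in>{0..1}. norm (f s - (\<Sum>q<4. s ^ q *\<^sub>R c q)) \<le> K * s ^ 4) \<and> (\<forall>q<4. norm (c q) \<le> K)"

text \<open>Z lists vanishing coefficients: {1} and {1,3} express evenness to the available order,
  {0} and {0,2} oddness.\<close>

definition jets :: "real \<Rightarrow> nat set \<Rightarrow> (real \<Rightarrow> 'a::real_normed_vector) \<Rightarrow> bool" where
  "jets K Z f \<longleftrightarrow> (\<exists>c. jet K c f \<and> (\<forall>q\<in>Z. c q = 0))"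

lemma jet_add:
  assumes "jet K c f" "jet L d g"
  shows "jet (K + L) (\<lambda>q. c q + d q) (\<lambda>s. f s + g s)"
  unfolding jet_def
proof (intro conjI ballI allI impI)
  fix s :: real assume s: "s \<in> {0..1}"
  have "f s + g s - (\<Sum>q<4. s ^ q *\<^sub>R (c q + d q)) = (f s - (\<Sum>q<4. s ^ q *\<^sub>R c q)) + (g s - (\<Sum>q<4. s ^ q *\<^sub>R d q))"
    by (simp add: scaleR_add_right sum.distrib)
  also have "norm \<dots> \<le> K * s ^ 4 + L * s ^ 4"
    using assms s unfolding jet_def by (intro order_trans[OF norm_triangle_ineq] add_mono) auto
  finally show "norm (f s + g s - (\<Sum>q<4. s ^ q *\<^sub>R (c q + d q))) \<le> (K + L) * s ^ 4" by (simp add: distrib_right)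
next
  fix q :: nat assume "q < 4"
  then show "norm (c q + d q) \<le> K + L"
    using assms unfolding jet_def by (intro order_trans[OF norm_triangle_ineq] add_mono) auto
qed (use assms in \<open>auto simp: jet_def\<close>)

lemma jet_scale:
  assumes "jet K c f"
  shows "jet (\<bar>a\<bar> * K) (\<lambda>q. a *\<^sub>R c q) (\<lambda>s. a *\<^sub>R f s)"
  unfolding jet_def
proof (intro conjI ballI allI impI)
  fix s :: real assume s: "s \<in> {0..1}"
  have "a *\<^sub>R f s - (\<Sum>q<4. s ^ q *\<^sub>R a *\<^sub>R c q) = a *\<^sub>R (f s - (\<Sum>q<4. s ^ q *\<^sub>R c q))"
    by (simp add: scaleR_diff_right scaleR_sum_right mult.commute)
  also have "norm \<dots> = \<bar>a\<bar> * norm (f s - (\<Sum>q<4. s ^ q *\<^sub>R c q))" by simp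
  also have "\<dots> \<le> \<bar>a\<bar> * (K * s ^ 4)"
    using assms s unfolding jet_def by (intro mult_left_mono) auto
  finally show "norm (a *\<^sub>R f s - (\<Sum>q<4. s ^ q *\<^sub>R a *\<^sub>R c q)) \<le> \<bar>a\<bar> * K * s ^ 4" by simp
next
  fix q :: nat assume "q < 4"
  then show "norm (a *\<^sub>R c q) \<le> \<bar>a\<bar> * K"
    using assms unfolding jet_def by (auto intro: mult_left_mono)
qed (use assms in \<open>auto simp: jet_def\<close>)

lemma lessThan_4: "{..<4::nat} = {0,1,2,3}" by auto

text \<open>Cauchy product of the polynomials. The two remainders contribute 5 + 4, and the six
  products of total degree at least 4, collected in R, contribute 6; the total 15 is rounded to
  16.\<close>

lemma jet_mult:
  fixes b :: "'a::real_normed_vector \<Rightarrow> 'b::real_normed_vector \<Rightarrow> 'c::real_normed_vector"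
  assumes b: "bounded_bilinear b" and nb: "\<And>x y. norm (b x y) \<le> norm x * norm y"
    and f: "jet K c f" and g: "jet L d g"
  shows "jet (16 * K * L) (\<lambda>n. \<Sum>p\<le>n. b (c p) (d (n - p))) (\<lambda>s. b (f s) (g s))"
proof -
  interpret b: bounded_bilinear b by (rule b)
  have K: "0 \<le> K" and L: "0 \<le> L" using f g by (auto simp: jet_def)
  have c: "norm (c q) \<le> K" "norm (d q) \<le> L" if "q < 4" for q using f g that by (auto simp: jet_def)
  have cd: "norm (b (c p) (d q)) \<le> K * L" if "p < 4" "q < 4" for p q
    using c[OF that(1)] c[OF that(2)] K by (intro order_trans[OF nb] mult_mono) auto
  have "norm (b (f s) (g s) - (\<Sum>n<4. s ^ n *\<^sub>R (\<Sum>p\<le>n. b (c p) (d (n - p))))) \<le> 16 * K * L * s ^ 4"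
    if s: "s \<in> {0..1}" for s
  proof -
    let ?P = "\<Sum>q<4. s ^ q *\<^sub>R c q" and ?Q = "\<Sum>q<4. s ^ q *\<^sub>R d q"
    have sp: "0 \<le> s ^ q" "s ^ q \<le> 1" for q using s by (auto intro: power_le_one)
    have Pn: "norm ?P \<le> 4 * K"
    proof -
      have "norm ?P \<le> (\<Sum>q<4::nat. K)"
      proof (rule sum_norm_le)
        fix q :: nat assume "q \<in> {..<4}"
        then show "norm (s ^ q *\<^sub>R c q) \<le> K"
          using c(1)[of q] sp[of q] mult_mono[of "s ^ q" 1 "norm (c q)" K] by simp
      qed
      then show ?thesis by simp
    qed
    have Qn: "norm ?Q \<le> 4 * L"
    proof -
      have "norm ?Q \<le> (\<Sum>q<4::nat. L)"
      proof (rule sum_norm_le)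
        fix q :: nat assume "q \<in> {..<4}"
        then show "norm (s ^ q *\<^sub>R d q) \<le> L"
          using c(2)[of q] sp[of q] mult_mono[of "s ^ q" 1 "norm (d q)" L] by simp
      qed
      then show ?thesis by simp
    qed
    have fP: "norm (f s - ?P) \<le> K * s ^ 4" and gQ: "norm (g s - ?Q) \<le> L * s ^ 4"
      using f g s by (auto simp: jet_def)
    have gn: "norm (g s) \<le> 5 * L"
    proof -
      have "L * s ^ 4 \<le> L" using sp[of 4] L by (simp add: mult_left_le)
      moreover have "norm (g s) \<le> norm (g s - ?Q) + norm ?Q" using norm_triangle_ineq[of "g s - ?Q" ?Q] by simp
      ultimately show ?thesis using gQ Qn by linarith
    qed
    define R where "R = b (c 1) (d 3) + b (c 2) (d 2) + b (c 3) (d 1) + s *\<^sub>R (b (c 2) (d 3) + b (c 3) (d 2))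
       + (s * s) *\<^sub>R b (c 3) (d 3)"
    have PQ: "b ?P ?Q = (\<Sum>n<4. s ^ n *\<^sub>R (\<Sum>p\<le>n. b (c p) (d (n - p)))) + s ^ 4 *\<^sub>R R"
      unfolding lessThan_4 R_def
      by (simp add: b.add_left b.add_right b.scaleR_left b.scaleR_right eval_nat_numeral atMost_Suc algebra_simps)
    have Rn: "norm R \<le> 6 * (K * L)"
    proof -
      have "norm (s *\<^sub>R (b (c 2) (d 3) + b (c 3) (d 2))) \<le> 1 * (K * L + K * L)"
        unfolding norm_scaleR using s cd by (intro mult_mono order_trans[OF norm_triangle_ineq] add_mono) auto
      moreover have "norm ((s * s) *\<^sub>R b (c 3) (d 3)) \<le> 1 * (K * L)"
        unfolding norm_scaleR using s cd by (intro mult_mono) (auto simp: mult_le_one)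
      moreover have "norm (b (c 1) (d 3)) \<le> K * L" "norm (b (c 2) (d 2)) \<le> K * L" "norm (b (c 3) (d 1)) \<le> K * L"
        by (auto intro: cd)
      moreover have "norm (a1 + a2 + a3 + a4 + a5) \<le> norm a1 + norm a2 + norm a3 + norm a4 + norm a5" for a1 a2 a3 a4 a5 :: 'c
        by (intro order_trans[OF norm_triangle_ineq] add_mono order_refl)
      ultimately show ?thesis unfolding R_def by (smt (verit))
    qed
    have "b (f s) (g s) - (\<Sum>n<4. s ^ n *\<^sub>R (\<Sum>p\<le>n. b (c p) (d (n - p))))
       = b (f s - ?P) (g s) + b ?P (g s - ?Q) + s ^ 4 *\<^sub>R R"
      using PQ by (simp add: b.diff_left b.diff_right)
    also have "norm \<dots> \<le> norm (b (f s - ?P) (g s)) + norm (b ?P (g s - ?Q)) + norm (s ^ 4 *\<^sub>R R)"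
      by (intro order_trans[OF norm_triangle_ineq] add_mono order_refl)
    also have "\<dots> \<le> (K * s ^ 4) * (5 * L) + (4 * K) * (L * s ^ 4) + s ^ 4 * (6 * (K * L))"
    proof (intro add_mono)
      show "norm (b (f s - ?P) (g s)) \<le> (K * s ^ 4) * (5 * L)"
        using fP gn K sp by (intro order_trans[OF nb] mult_mono) auto
      show "norm (b ?P (g s - ?Q)) \<le> (4 * K) * (L * s ^ 4)"
        using Pn gQ K L sp by (intro order_trans[OF nb] mult_mono) auto
      show "norm (s ^ 4 *\<^sub>R R) \<le> s ^ 4 * (6 * (K * L))"
        using Rn sp[of 4] by (auto intro: mult_left_mono)
    qed
    also have "\<dots> = 15 * (K * L * s ^ 4)" by simp
    also have "\<dots> \<le> 16 * (K * L * s ^ 4)" using K L sp by (intro mult_right_mono) auto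
    finally show ?thesis by simp
  qed
  moreover have "norm (\<Sum>p\<le>n. b (c p) (d (n - p))) \<le> 16 * K * L" if "n < 4" for n
  proof -
    have "norm (\<Sum>p\<le>n. b (c p) (d (n - p))) \<le> (\<Sum>p\<le>n. K * L)"
      using that by (intro sum_norm_le cd) auto
    also have "\<dots> = real (Suc n) * (K * L)" by simp
    also have "\<dots> \<le> 16 * (K * L)" using that K L by (intro mult_right_mono) auto
    finally show ?thesis by simp
  qed
  ultimately show ?thesis using K L by (auto simp: jet_def)
qed

lemma jets_add: "jets K Z f \<Longrightarrow> jets L Z g \<Longrightarrow> jets (K + L) Z (\<lambda>s. f s + g s)"
  unfolding jets_def using jet_add by fastforce

lemma jets_scale: "jets K Z f \<Longrightarrow> jets (\<bar>a\<bar> * K) Z (\<lambda>s. a *\<^sub>R f s)"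
  unfolding jets_def using jet_scale by fastforce

lemma jets_minus: "jets K Z f \<Longrightarrow> jets K Z (\<lambda>s. - f s)"
  using jets_scale[of K Z f "-1"] by simp

lemma jets_mult:
  assumes b: "bounded_bilinear b" "\<And>x y. norm (b x y) \<le> norm x * norm y"
    and Z: "Z = {} \<or> Z = {1} \<or> Z = {1,3}" and f: "jets K Z f" and g: "jets L Z g"
  shows "jets (16 * K * L) Z (\<lambda>s. b (f s) (g s))"
proof -
  interpret b: bounded_bilinear b by (rule b)
  from f g obtain c d where c: "jet K c f" "\<forall>q\<in>Z. c q = 0" and d: "jet L d g" "\<forall>q\<in>Z. d q = 0"
    by (auto simp: jets_def)
  show ?thesis unfolding jets_def
    by (intro exI[of _ "\<lambda>n. \<Sum>p\<le>n. b (c p) (d (n - p))"] conjI jet_mult[OF b c(1) d(1)])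
      (use Z c(2) d(2) in \<open>auto simp: eval_nat_numeral atMost_Suc b.zero_left b.zero_right\<close>)
qed

text \<open>Odd times odd is even. This is used for the square of the normal derivative, the one odd
  factor in the equation.\<close>

lemma jets_mult_odd:
  assumes b: "bounded_bilinear b" "\<And>x y. norm (b x y) \<le> norm x * norm y"
    and Z: "(Z = {0} \<and> Z' = {1}) \<or> (Z = {0,2} \<and> Z' = {1,3})" and f: "jets K Z f" and g: "jets L Z g"
  shows "jets (16 * K * L) Z' (\<lambda>s. b (f s) (g s))"
proof -
  interpret b: bounded_bilinear b by (rule b)
  from f g obtain c d where c: "jet K c f" "\<forall>q\<in>Z. c q = 0" and d: "jet L d g" "\<forall>q\<in>Z. d q = 0"
    by (auto simp: jets_def)
  show ?thesis unfolding jets_def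
    by (intro exI[of _ "\<lambda>n. \<Sum>p\<le>n. b (c p) (d (n - p))"] conjI jet_mult[OF b c(1) d(1)])
      (use Z c(2) d(2) in \<open>auto simp: eval_nat_numeral atMost_Suc b.zero_left b.zero_right\<close>)
qed

lemma jets_sum:
  assumes "finite A" "\<And>j. j \<in> A \<Longrightarrow> jets K Z (f j)" "0 \<le> K"
  shows "jets (real (card A) * K) Z (\<lambda>s. \<Sum>j\<in>A. f j s)"
  using assms
proof (induction A)
  case empty
  have "jets 0 Z (\<lambda>s. 0 :: 'b)" unfolding jets_def by (intro exI[of _ "\<lambda>_. 0"]) (simp add: jet_def)
  then show ?case by simp
next
  case (insert j A)
  then have "jets (K + real (card A) * K) Z (\<lambda>s. f j s + (\<Sum>j\<in>A. f j s))" by (intro jets_add) auto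
  then show ?case using insert by (simp add: distrib_right)
qed

text \<open>Letting s tend to 0 kills \<open>d 0\<close>; dividing by s then lowers n by
  one.\<close>

lemma small_polynomial_zero:
  fixes d :: "nat \<Rightarrow> 'a::real_normed_vector"
  assumes "\<And>s. s \<in> {0<..1} \<Longrightarrow> norm (\<Sum>q<n. s ^ q *\<^sub>R d q) \<le> K * s ^ n" and "q < n"
  shows "d q = 0"
  using assms
proof (induction n arbitrary: d q)
  case 0
  then show ?case by simp
next
  case (Suc n)
  have split: "(\<Sum>q<Suc n. s ^ q *\<^sub>R d q) = d 0 + s *\<^sub>R (\<Sum>q<n. s ^ q *\<^sub>R d (Suc q))" for s
    by (subst sum.lessThan_Suc_shift) (simp add: scaleR_sum_right)
  define C where "C = \<bar>K\<bar> + (\<Sum>q<n. norm (d (Suc q)))"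
  have "norm (d 0) \<le> C * s" if s: "s \<in> {0<..1}" for s
  proof -
    have pl: "s ^ m \<le> 1" for m using s by (intro power_le_one) auto
    have "d 0 = (\<Sum>q<Suc n. s ^ q *\<^sub>R d q) - s *\<^sub>R (\<Sum>q<n. s ^ q *\<^sub>R d (Suc q))" unfolding split by simp
    then have "norm (d 0) \<le> norm (\<Sum>q<Suc n. s ^ q *\<^sub>R d q) + norm (s *\<^sub>R (\<Sum>q<n. s ^ q *\<^sub>R d (Suc q)))"
      by (metis norm_triangle_ineq4)
    also have "\<dots> \<le> K * s ^ Suc n + s * (\<Sum>q<n. norm (d (Suc q)))"
    proof (rule add_mono)
      show "norm (\<Sum>q<Suc n. s ^ q *\<^sub>R d q) \<le> K * s ^ Suc n" by (rule Suc.prems(1)[OF s])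
      have "norm (\<Sum>q<n. s ^ q *\<^sub>R d (Suc q)) \<le> (\<Sum>q<n. norm (d (Suc q)))"
        using s pl by (intro sum_norm_le) (auto simp: mult_left_le_one_le)
      then show "norm (s *\<^sub>R (\<Sum>q<n. s ^ q *\<^sub>R d (Suc q))) \<le> s * (\<Sum>q<n. norm (d (Suc q)))"
        using s by (auto intro: mult_left_mono)
    qed
    also have "K * s ^ Suc n \<le> \<bar>K\<bar> * s"
    proof -
      have "K * s ^ Suc n \<le> \<bar>K\<bar> * (s * s ^ n)" using s by (intro mult_mono) auto
      also have "\<dots> \<le> \<bar>K\<bar> * (s * 1)" using s pl by (intro mult_left_mono) auto
      finally show ?thesis by simp
    qed
    finally show ?thesis by (simp add: C_def distrib_right distrib_left mult.commute)
  qed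
  then have C: "\<And>s. s \<in> {0<..1} \<Longrightarrow> norm (d 0) \<le> C * s" .
  have "norm (d 0) \<le> 0"
  proof (rule field_le_epsilon)
    fix e :: real assume e: "0 < e"
    have C0: "0 \<le> C" by (simp add: C_def sum_nonneg)
    have "norm (d 0) \<le> C * min 1 (e / (C + 1))" using e C0 by (intro C) auto
    also have "\<dots> \<le> C * (e / (C + 1))" using C0 by (intro mult_left_mono) auto
    also have "\<dots> = (C / (C + 1)) * e" by simp
    also have "\<dots> \<le> 1 * e" using C0 e by (intro mult_right_mono) auto
    finally show "norm (d 0) \<le> 0 + e" by simp
  qed
  then have d0: "d 0 = 0" by simp
  have IH: "d (Suc q) = 0" if "q < n" for q
  proof (rule Suc.IH[of "\<lambda>q. d (Suc q)", OF _ that])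
    fix s :: real assume s: "s \<in> {0<..1}"
    have "s * norm (\<Sum>q<n. s ^ q *\<^sub>R d (Suc q)) \<le> s * (K * s ^ n)"
      using Suc.prems(1)[OF s] s unfolding split d0 by (simp add: mult_ac)
    then show "norm (\<Sum>q<n. s ^ q *\<^sub>R d (Suc q)) \<le> K * s ^ n" using s by simp
  qed
  show ?case using d0 IH Suc.prems(2) by (cases q) auto
qed

lemma jet_unique:
  assumes "jet K c f" "jet L d f" "q < 4"
  shows "c q = d q"
proof -
  have "c q - d q = 0"
  proof (rule small_polynomial_zero[where K = "K + L" and n = 4])
    fix s :: real assume s: "s \<in> {0<..1}"
    have "(\<Sum>q<4. s ^ q *\<^sub>R (c q - d q)) = (f s - (\<Sum>q<4. s ^ q *\<^sub>R d q)) - (f s - (\<Sum>q<4. s ^ q *\<^sub>R c q))"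
      by (simp add: scaleR_diff_right sum_subtractf)
    also have "norm \<dots> \<le> L * s ^ 4 + K * s ^ 4"
      using assms s unfolding jet_def by (intro order_trans[OF norm_triangle_ineq4 add_mono]) auto
    finally show "norm (\<Sum>q<4. s ^ q *\<^sub>R (c q - d q)) \<le> (K + L) * s ^ 4" by (simp add: distrib_right)
  qed fact
  then show ?thesis by simp
qed

lemma jets_vanish: "jets K Z f \<Longrightarrow> jet L d f \<Longrightarrow> q \<in> Z \<Longrightarrow> q < 4 \<Longrightarrow> d q = 0"
  unfolding jets_def using jet_unique by metis

lemma jet_derivative:
  assumes f: "jet K c f" and D: "(f has_vector_derivative D) (at 0 within {0..1})"
  shows "c 1 = D"
proof -
  have f0: "f 0 = c 0"
  proof -
    have "\<forall>s\<in>{0..1}. norm (f s - (\<Sum>q<4. s ^ q *\<^sub>R c q)) \<le> K * s ^ 4" using f by (simp add: jet_def)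
    from bspec[OF this, of 0] have "norm (f 0 - (\<Sum>q<4. 0 ^ q *\<^sub>R c q)) \<le> 0" by simp
    moreover have "(\<Sum>q<4. 0 ^ q *\<^sub>R c q) = c 0" by (simp add: lessThan_4)
    ultimately show ?thesis by simp
  qed
  have "(f has_vector_derivative c 1) (at 0 within {0..1})"
  proof (rule has_vector_derivative_quotient, rule Lim_null_comparison)
    define C where "C = norm (c 2) + norm (c 3) + K"
    show "((\<lambda>s. C * s) \<longlongrightarrow> 0) (at 0 within {0..1::real})" by (auto intro!: tendsto_eq_intros)
    show "\<forall>\<^sub>F s in at 0 within {0..1}. norm ((1 / (s - 0)) *\<^sub>R (f s - f 0) - c 1) \<le> C * s"
      unfolding eventually_at_filter
    proof (intro always_eventually allI impI)
      fix s :: real assume "s \<noteq> 0" "s \<in> {0..1}"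
      then have s: "0 < s" "s \<le> 1" by auto
      define r where "r = f s - (\<Sum>q<4. s ^ q *\<^sub>R c q)"
      have r: "norm r \<le> K * s ^ 4" using f s by (auto simp: r_def jet_def)
      have K: "0 \<le> K" using f by (simp add: jet_def)
      have "f s = c 0 + s *\<^sub>R c 1 + s ^ 2 *\<^sub>R c 2 + s ^ 3 *\<^sub>R c 3 + r" by (simp add: r_def lessThan_4)
      then have "(1 / (s - 0)) *\<^sub>R (f s - f 0) - c 1 = s *\<^sub>R c 2 + (s * s) *\<^sub>R c 3 + (1 / s) *\<^sub>R r"
        using s by (simp add: f0 scaleR_add_right eval_nat_numeral)
      also have "norm \<dots> \<le> norm (s *\<^sub>R c 2) + norm ((s * s) *\<^sub>R c 3) + norm ((1 / s) *\<^sub>R r)"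
        by (intro order_trans[OF norm_triangle_ineq] add_mono order_refl)
      also have "\<dots> \<le> s * norm (c 2) + s * norm (c 3) + s * K"
      proof (intro add_mono)
        show "norm ((s * s) *\<^sub>R c 3) \<le> s * norm (c 3)"
        proof -
          have "s * (s * norm (c 3)) \<le> s * (1 * norm (c 3))" using s by (intro mult_left_mono mult_right_mono) auto
          then show ?thesis using s by (simp add: mult.assoc)
        qed
        have "norm ((1 / s) *\<^sub>R r) \<le> (1 / s) * (K * s ^ 4)" using r s by (auto intro: divide_right_mono)
        also have "\<dots> = s * (K * s ^ 2)" using s by (simp add: eval_nat_numeral)
        also have "\<dots> \<le> s * K" using s K by (intro mult_left_mono) (auto simp: mult_left_le power_le_one)
        finally show "norm ((1 / s) *\<^sub>R r) \<le> s * K" .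
      qed (use s in auto)
      finally show "norm ((1 / (s - 0)) *\<^sub>R (f s - f 0) - c 1) \<le> C * s" by (simp add: C_def algebra_simps)
    qed
  qed
  moreover have "at (0::real) within {0..1} \<noteq> bot" by (simp add: trivial_limit_within islimpt_Icc)
  ultimately show ?thesis using D by (metis vector_derivative_within)
qed

text \<open>The difference \<open>f(2s) - 4 f(s) + 3 f(0)\<close> annihilates the terms of order 0 and 2.\<close>

definition third_diff :: "real \<Rightarrow> (real \<Rightarrow> 'a::real_vector) \<Rightarrow> 'a" where
  "third_diff s f = f (2 * s) - 4 *\<^sub>R f s + 3 *\<^sub>R f 0"

text \<open>Order 3 is multiplied by 2^3 - 4 = 4, and the remainders contribute 16 + 4 = 20. Order 1
  is not annihilated by \<open>third_diff\<close>, hence the condition on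
  \<open>c 1\<close>.\<close>

lemma third_diff_jet:
  assumes f: "jet K c f" and c1: "c 1 = 0" and s: "0 < s" "s \<le> 1/2"
  shows "norm (third_diff s f - (4 * s ^ 3) *\<^sub>R c 3) \<le> 20 * K * s ^ 4"
proof -
  define r where "r z = f z - (\<Sum>q<4. z ^ q *\<^sub>R c q)" for z
  have r: "norm (r z) \<le> K * z ^ 4" if "z \<in> {0..1}" for z using f that by (simp add: r_def jet_def)
  have fz: "f z = c 0 + z ^ 2 *\<^sub>R c 2 + z ^ 3 *\<^sub>R c 3 + r z" for z using c1 by (simp add: r_def lessThan_4)
  have r0: "r 0 = 0" using r[of 0] by simp
  have "third_diff s f - (4 * s ^ 3) *\<^sub>R c 3 = r (2 * s) - 4 *\<^sub>R r s"
  proof -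
    have e: "4 *\<^sub>R x = x + 3 *\<^sub>R x" for x :: 'a using scaleR_add_left[of 1 3 x] by simp
    show ?thesis
      unfolding third_diff_def fz r0 by (simp add: power_mult_distrib e[of "c 0"] algebra_simps flip: scaleR_add_left)
  qed
  also have "norm \<dots> \<le> norm (r (2 * s)) + norm (4 *\<^sub>R r s)" by (rule norm_triangle_ineq4)
  also have "\<dots> \<le> K * (2 * s) ^ 4 + 4 * (K * s ^ 4)"
    using r[of "2 * s"] r[of s] s by (intro add_mono) auto
  also have "\<dots> = 20 * K * s ^ 4" by (simp add: power_mult_distrib)
  finally show ?thesis .
qed

text \<open>As s tends to 0, \<psi> s tends to 0 and its time derivative \<phi> s converges, both
  uniformly in t, so the limit of \<phi> s is the derivative of 0. Quantitatively: over a time step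
  \<eta> the increment of \<psi> s' is close to \<eta> times \<phi> s t, and it is at most 2 K
  s'.\<close>

lemma small_primitive_small_derivative:
  fixes \<psi> \<phi> :: "real \<Rightarrow> real \<Rightarrow> 'a::real_normed_vector"
  assumes T: "T > 0" and K: "K \<ge> 0" and der: "\<And>s t. s \<in> {0<..r} \<Longrightarrow> t \<in> {0..T} \<Longrightarrow> (\<psi> s has_vector_derivative \<phi> s t) (at t within {0..T})"
    and cont: "\<And>s. s \<in> {0<..r} \<Longrightarrow> continuous_on {0..T} (\<phi> s)"
    and small: "\<And>s t. s \<in> {0<..r} \<Longrightarrow> t \<in> {0..T} \<Longrightarrow> norm (\<psi> s t) \<le> K * s"
    and cauchy: "\<And>s s' t. s \<in> {0<..r} \<Longrightarrow> s' \<in> {0<..r} \<Longrightarrow> t \<in> {0..T} \<Longrightarrow> norm (\<phi> s t - \<phi> s' t) \<le> K * (s + s')"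
    and s: "s \<in> {0<..r}" and t: "t \<in> {0..T}"
  shows "norm (\<phi> s t) \<le> K * s"
proof (rule field_le_epsilon)
  fix e :: real assume e: "e > 0"
  from cont[OF s] t e obtain \<delta> where \<delta>: "\<delta> > 0" "\<And>\<tau>. \<tau> \<in> {0..T} \<Longrightarrow> dist \<tau> t < \<delta> \<Longrightarrow> dist (\<phi> s \<tau>) (\<phi> s t) < e / 2"
    unfolding continuous_on_iff by (meson half_gt_zero)
  define \<eta> where "\<eta> = min (\<delta> / 2) (T / 2)"
  have \<eta>: "\<eta> > 0" "\<eta> < \<delta>" "\<eta> \<le> T / 2" using \<delta> T by (auto simp: \<eta>_def)
  \<comment> \<open>The step goes to the side that stays in [0,T], which \<eta> <= T/2 makes
    possible.\<close>
  define t1 where "t1 = (if t \<le> T / 2 then t + \<eta> else t - \<eta>)"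
  have t1: "t1 \<in> {0..T}" "\<bar>t1 - t\<bar> = \<eta>" using t \<eta> by (auto simp: t1_def)
  \<comment> \<open>Chosen so that (2 K + K \<eta>) s' <= e \<eta>/2; the other half of e is spent
    on the oscillation of \<phi> s near t.\<close>
  define s' where "s' = min s (e * \<eta> / (2 * (2 * K + K * \<eta> + 1)))"
  have den: "2 * K + K * \<eta> + 1 > 0" using K \<eta> by (simp add: add_nonneg_pos)
  have s': "s' \<in> {0<..r}" using s e \<eta> den by (auto simp: s'_def)
  define D where "D \<tau> = \<psi> s' \<tau> - \<tau> *\<^sub>R \<phi> s t" for \<tau>
  have seg: "closed_segment t t1 \<subseteq> {0..T}" using t t1 by (intro closed_segment_subset) auto
  have "norm (D t1 - D t) \<le> (K * (s + s') + e / 2) * \<bar>t1 - t\<bar>"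
  proof (rule vector_mvt_bound[where S = "closed_segment t t1" and f' = "\<lambda>\<tau>. \<phi> s' \<tau> - 1 *\<^sub>R \<phi> s t"])
    fix \<tau> assume \<tau>: "\<tau> \<in> closed_segment t t1"
    have \<tau>T: "\<tau> \<in> {0..T}" using \<tau> seg by blast
    show "(D has_vector_derivative \<phi> s' \<tau> - 1 *\<^sub>R \<phi> s t) (at \<tau> within closed_segment t t1)"
      unfolding D_def[abs_def]
      by (intro has_vector_derivative_diff has_vector_derivative_within_subset[OF der[OF s' \<tau>T] seg]
          bounded_linear.has_vector_derivative[OF bounded_linear_scaleR_left] has_vector_derivative_id)
    have "dist \<tau> t < \<delta>" using \<tau> t1(2) \<eta> by (auto simp: dist_real_def closed_segment_eq_real_ivl split: if_splits)
    then have "norm (\<phi> s \<tau> - \<phi> s t) < e / 2" using \<delta>(2)[OF \<tau>T] by (simp add: dist_norm)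
    moreover have "norm (\<phi> s' \<tau> - \<phi> s \<tau>) \<le> K * (s' + s)" by (rule cauchy[OF s' s \<tau>T])
    ultimately show "norm (\<phi> s' \<tau> - 1 *\<^sub>R \<phi> s t) \<le> K * (s + s') + e / 2"
      using norm_triangle_ineq[of "\<phi> s' \<tau> - \<phi> s \<tau>" "\<phi> s \<tau> - \<phi> s t"] by (simp add: add.commute)
  qed auto
  then have 1: "norm (D t1 - D t) \<le> (K * (s + s') + e / 2) * \<eta>" using t1 by simp
  have "(t1 - t) *\<^sub>R \<phi> s t = (\<psi> s' t1 - \<psi> s' t) - (D t1 - D t)" by (simp add: D_def scaleR_diff_left)
  then have "norm ((t1 - t) *\<^sub>R \<phi> s t) \<le> norm (\<psi> s' t1) + norm (\<psi> s' t) + norm (D t1 - D t)"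
    by (metis norm_triangle_ineq4 order_trans add_right_mono)
  then have "\<eta> * norm (\<phi> s t) \<le> K * s' + K * s' + (K * (s + s') + e / 2) * \<eta>"
    using small[OF s' t1(1)] small[OF s' t] 1 t1(2) by simp
  also have "\<dots> = (K * s + e / 2) * \<eta> + (2 * K + K * \<eta>) * s'" by (simp add: algebra_simps)
  also have "(2 * K + K * \<eta>) * s' \<le> (2 * K + K * \<eta> + 1) * (e * \<eta> / (2 * (2 * K + K * \<eta> + 1)))"
    using K \<eta> s' by (intro mult_mono) (auto simp: s'_def)
  also have "\<dots> = e / 2 * \<eta>" using den by (simp add: field_simps)
  finally have "\<eta> * norm (\<phi> s t) \<le> \<eta> * (K * s + e)" by (simp add: algebra_simps)
  then show "norm (\<phi> s t) \<le> K * s + e" using \<eta> by simp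
qed

section \<open>Normal and tangential derivatives on a face\<close>

lemma partials_move:
  assumes "C_space (length is + 1) f" "x \<in> unit_cube"
  shows "partials (i # is) f x = partials (is @ [i]) f x"
  using assms
proof (induction "is" arbitrary: x)
  case (Cons k "is")
  have "C_space 2 (partials is f)" using C_space_partials[of "is" 2 f] Cons.prems(1) by simp
  then have "partials (i # k # is) f x = partials (k # i # is) f x"
    using partial_commute[of "partials is f" x i k] Cons.prems(2) by simp
  also have "\<dots> = partial k (partials (i # is) f) x" by simp
  also have "\<dots> = partial k (partials (is @ [i]) f) x"
    using Cons.prems(2) C_space_mono[OF Cons.prems(1), of "length is + 1"]
    by (intro partial_cong Cons.IH) auto
  finally show ?case by simp
qed simp

lemma partials_replicate_move:
  assumes "C_space (length is + q) f" "x \<in> unit_cube"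
  shows "partials (replicate q i @ is) f x = partials (is @ replicate q i) f x"
  using assms
proof (induction q arbitrary: x)
  case (Suc q)
  have "partials (replicate (Suc q) i @ is) f x = partial i (partials (replicate q i @ is) f) x" by simp
  also have "\<dots> = partial i (partials (is @ replicate q i) f) x"
    using Suc.prems(2) C_space_mono[OF Suc.prems(1), of "length is + q"]
    by (intro partial_cong Suc.IH) auto
  also have "\<dots> = partials (i # (is @ replicate q i)) f x" by simp
  also have "\<dots> = partials ((is @ replicate q i) @ [i]) f x"
    using Suc.prems by (intro partials_move) auto
  finally show ?case by (simp add: replicate_append_same)
qed simp

lemma partial_face_zero:
  assumes g: "\<And>y. y \<in> unit_cube \<Longrightarrow> y $ i = e \<Longrightarrow> g y = 0" and x: "x \<in> unit_cube" "x $ i = e" and ij: "j \<noteq> i"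
  shows "partial j g x = 0"
proof -
  have "((\<lambda>s. g (x + s *\<^sub>R axis j 1)) has_vector_derivative 0) (at 0 within line_dom j x)"
  proof (rule has_vector_derivative_transform[OF zero_line_dom[OF x(1)]])
    show "((\<lambda>s. 0) has_vector_derivative 0) (at 0 within line_dom j x)" by (rule has_vector_derivative_const)
    fix s assume "s \<in> line_dom j x"
    then show "g (x + s *\<^sub>R axis j 1) = 0" using x ij by (intro g) (auto simp: line_dom_def axis_def)
  qed
  then show ?thesis unfolding partial_def
    by (intro vector_derivative_within line_dom_nontrivial x)
qed

lemma partials_face_zero:
  assumes g: "\<And>y. y \<in> unit_cube \<Longrightarrow> y $ i = e \<Longrightarrow> g y = 0" and x: "x \<in> unit_cube" "x $ i = e" and "i \<notin> set is"
  shows "partials is g x = 0"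
  using x assms(4)
proof (induction "is" arbitrary: x)
  case (Cons j "is")
  have "partial j (partials is g) x = 0"
    using Cons by (intro partial_face_zero[of i e]) auto
  then show ?case by simp
qed (use g in simp)

text \<open>The normal through a point of the face \<open>x $ i = e\<close>, oriented into the cube.\<close>

definition inward :: "'d \<Rightarrow> real \<Rightarrow> real^'d \<Rightarrow> real \<Rightarrow> real^'d" where
  "inward i e x s = upd x i (e + (1 - 2 * e) * s)"

lemma inward_arg: "e \<in> {0, 1} \<Longrightarrow> s \<in> {0..1} \<Longrightarrow> e + (1 - 2 * e) * s \<in> {0..1::real}"
  by auto

lemma inward_cube: "e \<in> {0, 1} \<Longrightarrow> x \<in> unit_cube \<Longrightarrow> s \<in> {0..1} \<Longrightarrow> inward i e x s \<in> unit_cube"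
  unfolding inward_def by (intro upd_cube inward_arg)

lemma inward_0: "x $ i = e \<Longrightarrow> inward i e x 0 = x"
  using upd_self[of x i] by (auto simp: inward_def simp del: upd_self)

lemma inward_derivative:
  assumes f: "C_space j f" "length is < j" and x: "x \<in> unit_cube" and e: "e \<in> {0, 1}" and s: "s \<in> {0..1}"
  shows "((\<lambda>s. partials is f (inward i e x s)) has_vector_derivative (1 - 2 * e) *\<^sub>R partials (i # is) f (inward i e x s))
    (at s within {0..1})"
proof -
  let ?a = "\<lambda>s. e + (1 - 2 * e) * s"
  have img: "?a ` {0..1} \<subseteq> {0..1}" using e by auto
  have "((\<lambda>s. partials is f (upd x i s)) \<circ> ?a has_vector_derivative (1 - 2 * e) *\<^sub>R partials (i # is) f (upd x i (?a s))) (at s within {0..1})"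
  proof (rule vector_diff_chain_within)
    show "(?a has_vector_derivative (1 - 2 * e)) (at s within {0..1})"
      by (auto intro!: derivative_eq_intros)
    show "((\<lambda>s. partials is f (upd x i s)) has_vector_derivative partials (i # is) f (upd x i (?a s))) (at (?a s) within ?a ` {0..1})"
      using C_space_line[OF f x, of "?a s" i] img inward_arg[OF e s] by (auto intro: has_vector_derivative_within_subset)
  qed
  then show ?thesis by (simp add: o_def inward_def)
qed

text \<open>A word of length at most 2 leaves four further normal derivatives within order 6. The
  factor (1 - 2 e)^q is the sign that comes from orienting the normal inwards.\<close>

lemma inward_jet:
  fixes f :: "real^'d \<Rightarrow> real^3"
  assumes f: "C_space 6 f" "C_norm 6 f \<le> B" and l: "length is \<le> 2" and x: "x \<in> unit_cube" "x $ i = e" and e: "e \<in> {0, 1}"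
  shows "jet B (\<lambda>q. ((1 - 2 * e) ^ q / fact q) *\<^sub>R partials (replicate q i @ is) f x) (\<lambda>s. partials is f (inward i e x s))"
proof -
  define F where "F q s = (1 - 2 * e) ^ q *\<^sub>R partials (replicate q i @ is) f (inward i e x s)" for q s
  have sg: "\<bar>(1 - 2 * e) ^ q\<bar> = 1" for q using e by (auto simp: power_abs)
  have bd: "norm (partials js f y) \<le> B" if "length js \<le> 6" "y \<in> unit_cube" for js y
    using C_norm_bound[OF f(1) that] f(2) by linarith
  have "norm (F 0 s - (\<Sum>q<4. ((s - 0) ^ q / fact q) *\<^sub>R F q 0)) \<le> B * \<bar>s - 0\<bar> ^ 4" if s: "s \<in> {0..1}" for s
  proof (rule taylor_remainder[where S = "{0..1}"])
    fix q :: nat and s :: real assume q: "q < 4" and s: "s \<in> {0..1}"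
    have "((\<lambda>s. (1 - 2 * e) ^ q *\<^sub>R partials (replicate q i @ is) f (inward i e x s)) has_vector_derivative
       (1 - 2 * e) ^ q *\<^sub>R ((1 - 2 * e) *\<^sub>R partials (i # (replicate q i @ is)) f (inward i e x s))) (at s within {0..1})"
      using q l by (intro bounded_linear.has_vector_derivative[OF bounded_linear_scaleR_right] inward_derivative[OF f(1) _ x(1) e s]) auto
    then show "(F q has_vector_derivative F (Suc q) s) (at s within {0..1})"
      unfolding F_def[abs_def] by (simp add: mult.commute)
  next
    fix s :: real assume s: "s \<in> {0..1}"
    show "norm (F 4 s) \<le> B" unfolding F_def norm_scaleR sg
      using l inward_cube[OF e x(1) s] by (simp add: bd del: foldr_append)
  qed (use s in auto)
  moreover have "((s - 0) ^ q / fact q) *\<^sub>R F q 0 = s ^ q *\<^sub>R (((1 - 2 * e) ^ q / fact q) *\<^sub>R partials (replicate q i @ is) f x)" for q s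
    by (simp add: F_def inward_0[of x i e, OF x(2)])
  moreover have "F 0 s = partials is f (inward i e x s)" for s by (simp add: F_def)
  moreover have "norm (((1 - 2 * e) ^ q / fact q) *\<^sub>R partials (replicate q i @ is) f x) \<le> B" if "q < 4" for q
  proof -
    have "norm (((1 - 2 * e) ^ q / fact q) *\<^sub>R partials (replicate q i @ is) f x)
      = (1 / fact q) * norm (partials (replicate q i @ is) f x)"
      by (simp add: sg del: foldr_append)
    also have "\<dots> \<le> 1 * B"
      using that l by (intro mult_mono bd x) (auto simp: fact_ge_1 divide_le_eq)
    finally show ?thesis by simp
  qed
  moreover have "0 \<le> B" using order_trans[OF norm_ge_zero bd[of "[]" x]] x by simp
  ultimately show ?thesis unfolding jet_def by (intro conjI ballI allI impI) (simp_all only: abs_of_nonneg diff_zero atLeastAtMost_iff)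
qed

section \<open>Unit vector fields and the equation solved for the Laplacian\<close>

lemma inner_const_derivative:
  fixes f g :: "real \<Rightarrow> 'a::real_inner"
  assumes f: "(f has_vector_derivative f') (at s within {0..1})" and g: "(g has_vector_derivative g') (at s within {0..1})"
    and F: "((\<lambda>r. F r) has_vector_derivative F') (at s within {0..1})" and s: "s \<in> {0..1}"
    and eq: "\<And>r. r \<in> {0..1} \<Longrightarrow> f r \<bullet> g r = F r"
  shows "f s \<bullet> g' + f' \<bullet> g s = F'"
proof -
  have "((\<lambda>r. f r \<bullet> g r) has_vector_derivative f s \<bullet> g' + f' \<bullet> g s) (at s within {0..1})"
    by (rule bounded_bilinear.has_vector_derivative[OF bounded_bilinear_inner f g])
  then have "(F has_vector_derivative f s \<bullet> g' + f' \<bullet> g s) (at s within {0..1})"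
    by (rule has_vector_derivative_transform[OF s, rotated]) (simp add: eq)
  moreover have "at s within {0..1} \<noteq> bot" using s by (simp add: trivial_limit_within islimpt_Icc)
  ultimately show ?thesis using F by (metis vector_derivative_within)
qed

lemma unit_field_derivatives:
  fixes f :: "real^'d \<Rightarrow> real^3"
  assumes f: "C_space 2 f" and unit: "\<And>y. y \<in> unit_cube \<Longrightarrow> norm (f y) = 1" and x: "x \<in> unit_cube"
  shows "f x \<bullet> partial i f x = 0" and "f x \<bullet> partial i (partial i f) x = - (norm (partial i f x))\<^sup>2"
proof -
  have d1: "((\<lambda>s. f (upd y i s)) has_vector_derivative partial i f (upd y i s)) (at s within {0..1})"
    if "y \<in> unit_cube" "s \<in> {0..1}" for y s
    using C_space_line[OF f, of "[]" y s i] that by simp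
  have d2: "((\<lambda>s. partial i f (upd y i s)) has_vector_derivative partial i (partial i f) (upd y i s)) (at s within {0..1})"
    if "y \<in> unit_cube" "s \<in> {0..1}" for y s
    using C_space_line[OF f, of "[i]" y s i] that by simp
  have xi: "x $ i \<in> {0..1}" using x by (auto simp: unit_cube_def)
  have orth: "f y \<bullet> partial i f y = 0" if y: "y \<in> unit_cube" for y
  proof -
    have yi: "y $ i \<in> {0..1}" using y by (auto simp: unit_cube_def)
    have "f (upd y i (y $ i)) \<bullet> partial i f (upd y i (y $ i)) + partial i f (upd y i (y $ i)) \<bullet> f (upd y i (y $ i)) = 0"
    proof (rule inner_const_derivative[OF d1[OF y yi] d1[OF y yi] _ yi])
      show "((\<lambda>r. 1::real) has_vector_derivative 0) (at (y $ i) within {0..1})" by (rule has_vector_derivative_const)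
      fix r :: real assume "r \<in> {0..1}"
      then show "f (upd y i r) \<bullet> f (upd y i r) = 1" using unit[OF upd_cube[OF y, of r i]] by (simp add: norm_eq_1)
    qed
    then show ?thesis by (simp add: inner_commute)
  qed
  show "f x \<bullet> partial i f x = 0" by (rule orth[OF x])
  have "f (upd x i (x $ i)) \<bullet> partial i (partial i f) (upd x i (x $ i)) + partial i f (upd x i (x $ i)) \<bullet> partial i f (upd x i (x $ i)) = 0"
  proof (rule inner_const_derivative[OF d1[OF x xi] d2[OF x xi] _ xi])
    show "((\<lambda>r. 0::real) has_vector_derivative 0) (at (x $ i) within {0..1})" by (rule has_vector_derivative_const)
    fix r :: real assume "r \<in> {0..1}"
    then show "f (upd x i r) \<bullet> partial i f (upd x i r) = 0" by (intro orth upd_cube x)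
  qed
  then show "f x \<bullet> partial i (partial i f) x = - (norm (partial i f x))\<^sup>2" by (simp add: power2_norm_eq_inner)
qed

definition grad_sq :: "(real^'d \<Rightarrow> real^3) \<Rightarrow> real^'d \<Rightarrow> real" where
  "grad_sq f x = (\<Sum>j\<in>UNIV. (norm (partial j f x))\<^sup>2)"

text \<open>For L the Laplacian, m x (m x L) = (m . L) m - L, and differentiating |m|^2 = 1 twice
  gives m . L = - |grad m|^2. The right side is the form of the equation that the scheme
  discretises.\<close>

lemma unit_field_laplacian:
  fixes f :: "real^'d \<Rightarrow> real^3"
  assumes f: "C_space 2 f" and unit: "\<And>y. y \<in> unit_cube \<Longrightarrow> norm (f y) = 1" and x: "x \<in> unit_cube"
  shows "- cross3 (f x) (laplacian f x) - \<alpha> *\<^sub>R cross3 (f x) (cross3 (f x) (laplacian f x))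
    = - cross3 (f x) (laplacian f x) + \<alpha> *\<^sub>R (laplacian f x + grad_sq f x *\<^sub>R f x)"
proof -
  have "f x \<bullet> laplacian f x = - grad_sq f x"
    unfolding laplacian_def grad_sq_def inner_sum_right sum_negf[symmetric]
    by (intro sum.cong refl unit_field_derivatives[OF f unit x])
  moreover have "f x \<bullet> f x = 1" using unit[OF x] by (simp add: norm_eq_1)
  ultimately show ?thesis unfolding Lagrange by (simp add: scaleR_add_right scaleR_diff_right)
qed

text \<open>The inverse of the map \<open>w \<mapsto> \<alpha> w - m \<times> w\<close> for a unit vector \<open>m\<close>.\<close>

definition solve_lin :: "real \<Rightarrow> real^3 \<Rightarrow> real^3 \<Rightarrow> real^3" where
  "solve_lin \<alpha> m r = (1 / (1 + \<alpha>\<^sup>2)) *\<^sub>R (\<alpha> *\<^sub>R r + cross3 m r + (1 / \<alpha>) *\<^sub>R ((m \<bullet> r) *\<^sub>R m))"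

lemma solve_lin_inverse:
  assumes m: "norm m = 1" and \<alpha>: "\<alpha> > 0"
  shows "solve_lin \<alpha> m (\<alpha> *\<^sub>R w - cross3 m w) = w"
proof -
  have mm: "m \<bullet> m = 1" using m by (simp add: norm_eq_1)
  \<comment> \<open>Adding \<alpha> r and m x r for r = \<alpha> w - m x w gives (1 + \<alpha>^2) w
    - (m . w) m; the third term of \<open>solve_lin\<close> restores the multiple of m.\<close>
  have "cross3 m (\<alpha> *\<^sub>R w - cross3 m w) = \<alpha> *\<^sub>R cross3 m w - ((m \<bullet> w) *\<^sub>R m - w)"
    by (simp add: Cross3.right_diff_distrib Lagrange mm cross_mult_right)
  moreover have "m \<bullet> (\<alpha> *\<^sub>R w - cross3 m w) = \<alpha> * (m \<bullet> w)"
    by (simp add: inner_diff_right dot_cross_self)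
  ultimately have "solve_lin \<alpha> m (\<alpha> *\<^sub>R w - cross3 m w) = (1 / (1 + \<alpha>\<^sup>2)) *\<^sub>R ((1 + \<alpha>\<^sup>2) *\<^sub>R w)"
    unfolding solve_lin_def using \<alpha> by (simp add: algebra_simps power2_eq_square)
  also have "\<dots> = w"
  proof -
    have "1 + \<alpha>\<^sup>2 \<noteq> 0" by (smt (verit) zero_le_power2)
    then show ?thesis by simp
  qed
  finally show ?thesis .
qed

lemma bounded_bilinear_cross3: "bounded_bilinear cross3"
  using bilinear_cross bilinear_conv_bounded_bilinear by blast

lemmas jets_cross = jets_mult[OF bounded_bilinear_cross3 norm_cross3_le]
lemmas jets_inner = jets_mult[where b = "(\<bullet>)", OF bounded_bilinear_inner]
lemmas jets_scaleR = jets_mult[where b = "(*\<^sub>R)", OF bounded_bilinear_scaleR]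

lemma norm_inner_le: "norm (x \<bullet> y) \<le> norm x * norm y"
  using Cauchy_Schwarz_ineq2[of x y] by simp

lemma jets_solve_lin:
  assumes Z: "Z = {} \<or> Z = {1} \<or> Z = {1,3}" and f: "jets K Z f" and g: "jets L Z g"
  shows "\<exists>K'. jets K' Z (\<lambda>s. solve_lin \<alpha> (f s) (g s))"
proof -
  have 1: "jets (\<bar>\<alpha>\<bar> * L) Z (\<lambda>s. \<alpha> *\<^sub>R g s)" by (rule jets_scale[OF g])
  have 2: "jets (16 * K * L) Z (\<lambda>s. cross3 (f s) (g s))" by (rule jets_cross[OF Z f g])
  have 3: "jets (16 * K * L) Z (\<lambda>s. f s \<bullet> g s)" by (rule jets_inner[OF norm_inner_le Z f g])
  have 4: "jets (16 * (16 * K * L) * K) Z (\<lambda>s. (f s \<bullet> g s) *\<^sub>R f s)"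
    by (rule jets_scaleR[OF _ Z 3 f]) simp
  show ?thesis unfolding solve_lin_def
    by (rule exI, rule jets_scale, rule jets_add, rule jets_add[OF 1 2], rule jets_scale[OF 4])
qed

lemma jets_cong:
  assumes f: "jets K Z f" and fg: "\<And>s. s \<in> {0..1} \<Longrightarrow> g s = f s"
  shows "jets K Z g"
proof -
  obtain c where c: "jet K c f" "\<forall>q\<in>Z. c q = 0" using f by (auto simp: jets_def)
  have "jet K c g" unfolding jet_def
  proof (intro conjI ballI)
    fix s :: real assume s: "s \<in> {0..1}"
    show "norm (g s - (\<Sum>q<4. s ^ q *\<^sub>R c q)) \<le> K * s ^ 4"
      unfolding fg[OF s] using c(1) s by (simp add: jet_def)
  qed (use c(1) in \<open>simp_all add: jet_def\<close>)
  with c(2) show ?thesis by (auto simp: jets_def)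
qed

text \<open>A nonempty open interval has positive measure, so what holds almost everywhere holds
  somewhere close to every time.\<close>

lemma AE_dense:
  fixes T t \<delta> :: real
  assumes ae: "AE t in lebesgue. t \<in> {0..T} \<longrightarrow> P t" and T: "T > 0" and t: "t \<in> {0..T}" and \<delta>: "\<delta> > 0"
  shows "\<exists>t'\<in>{0..T}. \<bar>t' - t\<bar> < \<delta> \<and> P t'"
proof (rule ccontr)
  assume no: "\<not> ?thesis"
  define a b where "a = max 0 (t - \<delta>)" and "b = min T (t + \<delta>)"
  have ab: "a < b"
  proof -
    have "0 \<le> t" "t \<le> T" using t by auto
    then have "0 < t + \<delta>" "t - \<delta> < T" "t - \<delta> < t + \<delta>" using \<delta> by linarith+
    then show ?thesis using T by (simp add: a_def b_def)
  qed
  have "AE s in lebesgue. s \<notin> {a<..<b}"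
    using ae
  proof (rule eventually_mono)
    fix s assume s: "s \<in> {0..T} \<longrightarrow> P s"
    show "s \<notin> {a<..<b}"
    proof
      assume "s \<in> {a<..<b}"
      then have "s \<in> {0..T}" "\<bar>s - t\<bar> < \<delta>" by (auto simp: a_def b_def)
      then show False using no s by blast
    qed
  qed
  moreover have "{a<..<b} \<in> sets lebesgue" by simp
  ultimately have "{a<..<b} \<in> null_sets lebesgue" by (simp add: AE_iff_null_sets)
  then have "emeasure lebesgue {a<..<b} = 0" by (simp add: null_sets_def)
  then show False using ab by simp
qed

section \<open>Boundary behaviour of the exact solution\<close>

text \<open>The chain w comes from C^3([0,T];C^1): \<open>w 1\<close> is the time derivative of m,
  and first space derivatives may be differentiated in time as well. Six space derivatives, with one
  bound B, are available at almost every time.\<close>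

locale exact_solution =
  fixes m :: "real \<Rightarrow> real^'d \<Rightarrow> real^3" and m0 :: "real^'d \<Rightarrow> real^3" and T \<alpha> B :: real
    and w :: "nat \<Rightarrow> real \<Rightarrow> real^'d \<Rightarrow> real^3"
  assumes T: "T > 0" and \<alpha>: "\<alpha> > 0"
    and unit: "\<And>t x. t \<in> {0..T} \<Longrightarrow> x \<in> unit_cube \<Longrightarrow> norm (m t x) = 1"
    and sol: "LLG_solution T \<alpha> m0 m"
    and w0: "\<And>t x. t \<in> {0..T} \<Longrightarrow> x \<in> unit_cube \<Longrightarrow> w 0 t x = m t x"
    and wC: "\<And>q t. q \<le> 3 \<Longrightarrow> t \<in> {0..T} \<Longrightarrow> C_space 1 (w q t)"
    and wd: "\<And>q is t x. q < 3 \<Longrightarrow> length is \<le> 1 \<Longrightarrow> t \<in> {0..T} \<Longrightarrow> x \<in> unit_cube \<Longrightarrow>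
       ((\<lambda>s. partials is (w q s) x) has_vector_derivative partials is (w (Suc q) t) x) (at t within {0..T})"
    and good: "AE t in lebesgue. t \<in> {0..T} \<longrightarrow> C_space 6 (m t) \<and> C_norm 6 (m t) \<le> B"
begin

definition good_time :: "real \<Rightarrow> bool" where
  "good_time t \<longleftrightarrow> t \<in> {0..T} \<and> C_space 6 (m t) \<and> C_norm 6 (m t) \<le> B"

lemma good_dense: "t \<in> {0..T} \<Longrightarrow> \<delta> > 0 \<Longrightarrow> \<exists>t'. good_time t' \<and> \<bar>t' - t\<bar> < \<delta>"
  using AE_dense[OF good T, of t \<delta>] by (auto simp: good_time_def)

text \<open>Every estimate that rests on six space derivatives reaches the remaining times through
  this lemma, so the quantity estimated has to be continuous in time.\<close>

lemma all_times:
  fixes g :: "real \<Rightarrow> real"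
  assumes cont: "continuous_on {0..T} g" and le: "\<And>t. good_time t \<Longrightarrow> g t \<le> c" and t: "t \<in> {0..T}"
  shows "g t \<le> c"
proof (rule field_le_epsilon)
  fix e :: real assume "e > 0"
  with cont t obtain \<delta> where \<delta>: "\<delta> > 0" "\<And>s. s \<in> {0..T} \<Longrightarrow> dist s t < \<delta> \<Longrightarrow> dist (g s) (g t) < e"
    unfolding continuous_on_iff by meson
  obtain s where s: "good_time s" "\<bar>s - t\<bar> < \<delta>" using good_dense[OF t \<delta>(1)] by blast
  have "dist (g s) (g t) < e" using s by (intro \<delta>(2)) (auto simp: good_time_def dist_real_def)
  then show "g t \<le> c + e" using le[OF s(1)] by (simp add: dist_real_def)
qed

lemma C2: "t \<in> {0..T} \<Longrightarrow> C_space 2 (m t)"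
  using sol by (simp add: LLG_solution_def)

lemma at_within_T: "t \<in> {0..T} \<Longrightarrow> at t within {0..T} \<noteq> bot"
  using T by (simp add: trivial_limit_within islimpt_Icc)

lemma m_derivative:
  assumes "t \<in> {0..T}" "x \<in> unit_cube"
  shows "((\<lambda>s. m s x) has_vector_derivative w 1 t x) (at t within {0..T})"
proof -
  have "((\<lambda>s. w 0 s x) has_vector_derivative w 1 t x) (at t within {0..T})"
    using wd[of 0 "[]" t x] assms by simp
  then show ?thesis
    by (rule has_vector_derivative_transform[OF assms(1), rotated]) (simp add: w0 assms)
qed

lemma equation:
  assumes t: "t \<in> {0..T}" and x: "x \<in> unit_cube"
  shows "w 1 t x = - cross3 (m t x) (laplacian (m t) x) + \<alpha> *\<^sub>R (laplacian (m t) x + grad_sq (m t) x *\<^sub>R m t x)"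
proof -
  have "((\<lambda>s. m s x) has_vector_derivative
           (- cross3 (m t x) (laplacian (m t) x)
            - \<alpha> *\<^sub>R cross3 (m t x) (cross3 (m t x) (laplacian (m t) x)))) (at t within {0..T})"
    using sol t x by (simp add: LLG_solution_def)
  with m_derivative[OF t x] at_within_T[OF t]
  have "w 1 t x = - cross3 (m t x) (laplacian (m t) x)
            - \<alpha> *\<^sub>R cross3 (m t x) (cross3 (m t x) (laplacian (m t) x))"
    by (metis vector_derivative_within)
  also have "\<dots> = - cross3 (m t x) (laplacian (m t) x) + \<alpha> *\<^sub>R (laplacian (m t) x + grad_sq (m t) x *\<^sub>R m t x)"
    by (rule unit_field_laplacian[OF C2[OF t] unit[OF t] x])
  finally show ?thesis .
qed

lemma laplacian_eq:
  assumes t: "t \<in> {0..T}" and x: "x \<in> unit_cube"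
  shows "laplacian (m t) x = solve_lin \<alpha> (m t x) (w 1 t x - \<alpha> *\<^sub>R (grad_sq (m t) x *\<^sub>R m t x))"
proof -
  have "w 1 t x - \<alpha> *\<^sub>R (grad_sq (m t) x *\<^sub>R m t x) = \<alpha> *\<^sub>R laplacian (m t) x - cross3 (m t x) (laplacian (m t) x)"
    unfolding equation[OF t x] by (simp add: scaleR_add_right)
  then show ?thesis using solve_lin_inverse[OF unit[OF t x] \<alpha>] by simp
qed

lemma neumann:
  assumes t: "t \<in> {0..T}" and x: "x \<in> unit_cube" "x $ i = e" and e: "e \<in> {0, 1}"
  shows "partial i (m t) x = 0"
proof -
  have nd: "normal_derivative (axis i a) f x = a *\<^sub>R partial i f x" for a f
  proof -
    have "normal_derivative (axis i a) f x = (\<Sum>j\<in>UNIV. if j = i then a *\<^sub>R partial j f x else 0)"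
      unfolding normal_derivative_def by (intro sum.cong refl) (auto simp: axis_def)
    then show ?thesis by simp
  qed
  have z: "normal_derivative \<nu> (m t) x = 0" if "\<nu> \<in> outward_normals x" for \<nu>
    using sol t x that by (simp add: LLG_solution_def)
  show ?thesis
  proof (cases "e = 1")
    case True
    then have "axis i 1 \<in> outward_normals x" using x by (auto simp: outward_normals_def)
    from z[OF this] show ?thesis by (simp add: nd)
  next
    case False
    then have "- axis i 1 \<in> outward_normals x" using x e by (auto simp: outward_normals_def)
    moreover have "- axis i (1::real) = axis i (- 1)" by (simp add: vec_eq_iff axis_def)
    ultimately have "normal_derivative (axis i (- 1)) (m t) x = 0" using z by metis
    then show ?thesis by (simp add: nd)
  qed
qed

text \<open>The Neumann condition holds at all times and may be differentiated in time, because time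
  derivatives commute with first space derivatives along the chain w.\<close>

lemma neumann_time:
  assumes t: "t \<in> {0..T}" and x: "x \<in> unit_cube" "x $ i = e" and e: "e \<in> {0, 1}"
  shows "partial i (w 1 t) x = 0"
proof -
  have "((\<lambda>s. partials [i] (w 0 s) x) has_vector_derivative partials [i] (w 1 t) x) (at t within {0..T})"
    using wd[of 0 "[i]" t x] t x by simp
  moreover have "((\<lambda>s. partials [i] (w 0 s) x) has_vector_derivative 0) (at t within {0..T})"
  proof (rule has_vector_derivative_transform[OF t _ has_vector_derivative_const[of 0]])
    fix s assume s: "s \<in> {0..T}"
    have "partial i (w 0 s) x = partial i (m s) x" using s by (intro partial_cong x w0)
    then show "partials [i] (w 0 s) x = 0" using neumann[OF s x e] by simp
  qed
  ultimately have "partials [i] (w 1 t) x = 0"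
    using at_within_T[OF t] by (metis vector_derivative_within)
  then show ?thesis by simp
qed

lemma good_word_jets:
  assumes t: "good_time t" and x: "x \<in> unit_cube" "x $ i = e" and e: "e \<in> {0, 1}" and l: "length is \<le> 2"
    and z: "\<And>q. q \<in> Z \<Longrightarrow> partials (replicate q i @ is) (m t) x = 0"
  shows "jets B Z (\<lambda>s. partials is (m t) (inward i e x s))"
proof -
  have J: "jet B (\<lambda>q. ((1 - 2 * e) ^ q / fact q) *\<^sub>R partials (replicate q i @ is) (m t) x) (\<lambda>s. partials is (m t) (inward i e x s))"
    using t by (intro inward_jet[OF _ _ l x e]) (auto simp: good_time_def)
  show ?thesis unfolding jets_def
    by (rule exI, rule conjI[OF J], rule ballI) (simp only: z scaleR_zero_right)
qed

text \<open>The normal derivative vanishes on the whole face, so its tangential derivatives vanish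
  there; commuting partials brings the normal ones to the inside.\<close>

lemma tangential_zero:
  assumes t: "good_time t" and z: "\<And>y. y \<in> unit_cube \<Longrightarrow> y $ i = e \<Longrightarrow> partials (replicate q i) (m t) y = 0"
    and q: "q \<le> 4" and x: "x \<in> unit_cube" "x $ i = e" and "is": "i \<notin> set is" "length is \<le> 2"
  shows "partials (replicate q i @ is) (m t) x = 0"
proof -
  have "partials (replicate q i @ is) (m t) x = partials (is @ replicate q i) (m t) x"
  proof (rule partials_replicate_move[OF _ x(1)])
    have "C_space 6 (m t)" using t by (simp add: good_time_def)
    then show "C_space (length is + q) (m t)" using q "is" by (elim C_space_mono) simp
  qed
  also have "\<dots> = partials is (partials (replicate q i) (m t)) x" by simp
  also have "\<dots> = 0" by (rule partials_face_zero[OF z x "is"(1)])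
  finally show ?thesis .
qed

text \<open>Tangential derivatives of an even function are even, its normal derivative is odd, and
  all squares are even. \<open>?Zo\<close> is Z shifted down by one, because one normal derivative
  has already been taken.\<close>

lemma gradient_jets:
  assumes t: "good_time t" and x: "x \<in> unit_cube" "x $ i = e" and e: "e \<in> {0, 1}"
    and Z: "Z = {1} \<or> Z = {1,3}"
    and z: "\<And>q y. q \<in> Z \<Longrightarrow> y \<in> unit_cube \<Longrightarrow> y $ i = e \<Longrightarrow> partials (replicate q i) (m t) y = 0"
  shows "\<exists>K. jets K Z (\<lambda>s. grad_sq (m t) (inward i e x s))"
proof -
  have B0: "0 \<le> B"
    using good_word_jets[OF t x e, of "[]" "{}"] by (auto simp: jets_def jet_def)
  have Z4: "q \<le> 4" if "q \<in> Z" for q using Z that by auto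
  have "jets (16 * B * B) Z (\<lambda>s. partials [j] (m t) (inward i e x s) \<bullet> partials [j] (m t) (inward i e x s))" for j
  proof (cases "j = i")
    case True
    let ?Zo = "if Z = {1} then {0} else {0, 2 :: nat}"
    have "jets B ?Zo (\<lambda>s. partials [i] (m t) (inward i e x s))"
    proof (rule good_word_jets[OF t x e])
      fix q assume "q \<in> ?Zo"
      then have "Suc q \<in> Z" using Z by (auto split: if_splits)
      from z[OF this x] show "partials (replicate q i @ [i]) (m t) x = 0"
        by (simp only: replicate_append_same replicate_Suc)
    qed simp
    then show ?thesis unfolding True using Z
      by (intro jets_mult_odd[where Z = ?Zo] bounded_bilinear_inner norm_inner_le) auto
  next
    case False
    have "jets B Z (\<lambda>s. partials [j] (m t) (inward i e x s))"
      using False by (intro good_word_jets[OF t x e] tangential_zero[where e = e, OF t z] Z4 x) auto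
    then show ?thesis using Z by (intro jets_inner[OF norm_inner_le]) auto
  qed
  then have "jets (real (card (UNIV :: 'd set)) * (16 * B * B)) Z (\<lambda>s. \<Sum>j\<in>UNIV. partials [j] (m t) (inward i e x s) \<bullet> partials [j] (m t) (inward i e x s))"
    using B0 by (intro jets_sum) auto
  then show ?thesis unfolding grad_sq_def power2_norm_eq_inner by auto
qed

text \<open>The second normal derivative is the Laplacian minus the tangential second derivatives,
  and \<open>laplacian_eq\<close> expresses the Laplacian by m, its time derivative and its
  gradient, all even to the order in Z. So its coefficient of order q vanishes, and this is the
  normal derivative of m of order q + 2.\<close>

lemma parity_step:
  assumes t: "good_time t" and x: "x \<in> unit_cube" "x $ i = e" and e: "e \<in> {0, 1}"
    and Z: "Z = {1} \<or> Z = {1,3}"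
    and z: "\<And>q y. q \<in> Z \<Longrightarrow> y \<in> unit_cube \<Longrightarrow> y $ i = e \<Longrightarrow> partials (replicate q i) (m t) y = 0"
    and mt: "jets K Z (\<lambda>s. w 1 t (inward i e x s))" and q: "q \<in> Z"
  shows "partials (replicate (q + 2) i) (m t) x = 0"
proof -
  have tT: "t \<in> {0..T}" using t by (simp add: good_time_def)
  have B0: "0 \<le> B"
    using good_word_jets[OF t x e, of "[]" "{}"] by (auto simp: jets_def jet_def)
  have Z4: "q \<le> 4" if "q \<in> Z" for q using Z that by auto
  have Z': "Z = {} \<or> Z = {1} \<or> Z = {1,3}" using Z by blast
  have m: "jets B Z (\<lambda>s. m t (inward i e x s))"
    using good_word_jets[OF t x e, of "[]" Z] z[OF _ x] by simp
  obtain Kg where g: "jets Kg Z (\<lambda>s. grad_sq (m t) (inward i e x s))"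
    using gradient_jets[OF t x e Z z] by blast
  have gm: "jets (16 * Kg * B) Z (\<lambda>s. grad_sq (m t) (inward i e x s) *\<^sub>R m t (inward i e x s))"
    by (rule jets_scaleR[OF _ Z' g m]) simp
  have "jets (K + \<bar>- \<alpha>\<bar> * (16 * Kg * B)) Z (\<lambda>s. w 1 t (inward i e x s) + (- \<alpha>) *\<^sub>R (grad_sq (m t) (inward i e x s) *\<^sub>R m t (inward i e x s)))"
    by (rule jets_add[OF mt jets_scale[OF gm]])
  from jets_solve_lin[OF Z' m this, of \<alpha>] obtain Kl where
    l: "jets Kl Z (\<lambda>s. solve_lin \<alpha> (m t (inward i e x s)) (w 1 t (inward i e x s) + (- \<alpha>) *\<^sub>R (grad_sq (m t) (inward i e x s) *\<^sub>R m t (inward i e x s))))"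
    by blast
  have s: "jets (real (card (UNIV - {i})) * B) Z (\<lambda>s. \<Sum>j\<in>UNIV - {i}. partials [j, j] (m t) (inward i e x s))"
  proof (rule jets_sum)
    fix j assume j: "j \<in> UNIV - {i}"
    show "jets B Z (\<lambda>s. partials [j, j] (m t) (inward i e x s))"
      using j by (intro good_word_jets[OF t x e] tangential_zero[where e = e, OF t z] Z4 x) auto
  qed (use B0 in auto)
  have both: "jets (Kl + real (card (UNIV - {i})) * B) Z (\<lambda>s. solve_lin \<alpha> (m t (inward i e x s)) (w 1 t (inward i e x s)
      + (- \<alpha>) *\<^sub>R (grad_sq (m t) (inward i e x s) *\<^sub>R m t (inward i e x s)))
      + - (\<Sum>j\<in>UNIV - {i}. partials [j, j] (m t) (inward i e x s)))"
    by (rule jets_add[OF l jets_minus[OF s]])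
  have eq: "partials [i, i] (m t) (inward i e x s) = solve_lin \<alpha> (m t (inward i e x s)) (w 1 t (inward i e x s)
      + (- \<alpha>) *\<^sub>R (grad_sq (m t) (inward i e x s) *\<^sub>R m t (inward i e x s)))
      + - (\<Sum>j\<in>UNIV - {i}. partials [j, j] (m t) (inward i e x s))" if "s \<in> {0..1}" for s
  proof -
    have c: "inward i e x s \<in> unit_cube" by (rule inward_cube[OF e x(1) that])
    have "laplacian (m t) (inward i e x s) = partials [i, i] (m t) (inward i e x s)
      + (\<Sum>j\<in>UNIV - {i}. partials [j, j] (m t) (inward i e x s))"
      unfolding laplacian_def by (subst sum.remove[of UNIV i]) auto
    then show ?thesis using laplacian_eq[OF tT c] by simp
  qed
  have "jets (Kl + real (card (UNIV - {i})) * B) Z (\<lambda>s. partials [i, i] (m t) (inward i e x s))"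
    by (rule jets_cong[OF both eq])
  moreover have "jet B (\<lambda>q. ((1 - 2 * e) ^ q / fact q) *\<^sub>R partials (replicate q i @ [i, i]) (m t) x) (\<lambda>s. partials [i, i] (m t) (inward i e x s))"
    using t by (intro inward_jet[OF _ _ _ x e]) (auto simp: good_time_def)
  ultimately have "((1 - 2 * e) ^ q / fact q) *\<^sub>R partials (replicate q i @ [i, i]) (m t) x = 0"
    by (rule jets_vanish[OF _ _ q]) (use Z q in auto)
  moreover have "(1 - 2 * e) ^ q / fact q \<noteq> 0" using e by auto
  ultimately have "partials (replicate q i @ [i, i]) (m t) x = 0" using scaleR_eq_0_iff by blast
  moreover have "replicate q i @ [i, i] = replicate (q + 2) i"
    by (simp add: replicate_append_same replicate_app_Cons_same)
  ultimately show ?thesis by simp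
qed

text \<open>Kept explicit, in the shape in which the jet lemmas return it, because the estimates in
  \<open>third_diff_small\<close> have to be uniform in time.\<close>

definition K_jet :: real where
  "K_jet = 16 * B * (real CARD('d) * B) + \<bar>\<alpha>\<bar> * (real CARD('d) * B + 16 * (real CARD('d) * (16 * B * B)) * B)"

text \<open>At a good time the right side of the equation contains derivatives of m of order at most
  2, each with a four-term expansion. The time derivative inherits it, beyond the single space
  derivative given by the chain w.\<close>

lemma time_derivative_jets:
  assumes t: "good_time t" and x: "x \<in> unit_cube" "x $ i = e" and e: "e \<in> {0, 1}"
  shows "jets K_jet {} (\<lambda>s. w 1 t (inward i e x s))"
proof -
  have tT: "t \<in> {0..T}" using t by (simp add: good_time_def)
  have word: "jets B {} (\<lambda>s. partials is (m t) (inward i e x s))" if "length is \<le> 2" for "is"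
    by (rule good_word_jets[OF t x e that]) auto
  have B0: "0 \<le> B" using word[of "[]"] by (auto simp: jets_def jet_def)
  have m: "jets B {} (\<lambda>s. m t (inward i e x s))" using word[of "[]"] by simp
  have "jets (real CARD('d) * B) {} (\<lambda>s. \<Sum>j\<in>UNIV. partials [j, j] (m t) (inward i e x s))"
    by (rule jets_sum, simp, rule word) (use B0 in auto)
  then have l: "jets (real CARD('d) * B) {} (\<lambda>s. laplacian (m t) (inward i e x s))"
    unfolding laplacian_def by simp
  have "jets (16 * B * B) {} (\<lambda>s. partials [j] (m t) (inward i e x s) \<bullet> partials [j] (m t) (inward i e x s))" for j
    by (rule jets_inner[OF norm_inner_le _ word word]) auto
  then have "jets (real CARD('d) * (16 * B * B)) {} (\<lambda>s. \<Sum>j\<in>UNIV. partials [j] (m t) (inward i e x s) \<bullet> partials [j] (m t) (inward i e x s))"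
    by (rule jets_sum[rotated 1]) (use B0 in auto)
  then have g: "jets (real CARD('d) * (16 * B * B)) {} (\<lambda>s. grad_sq (m t) (inward i e x s))"
    unfolding grad_sq_def power2_norm_eq_inner by simp
  have gm: "jets (16 * (real CARD('d) * (16 * B * B)) * B) {} (\<lambda>s. grad_sq (m t) (inward i e x s) *\<^sub>R m t (inward i e x s))"
    by (rule jets_scaleR[OF _ _ g m]) auto
  have "jets K_jet {} (\<lambda>s. - cross3 (m t (inward i e x s)) (laplacian (m t) (inward i e x s))
     + \<alpha> *\<^sub>R (laplacian (m t) (inward i e x s) + grad_sq (m t) (inward i e x s) *\<^sub>R m t (inward i e x s)))"
    unfolding K_jet_def by (intro jets_add jets_minus jets_cross jets_scale m l gm) auto
  then show ?thesis
  proof (rule jets_cong)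
    fix s :: real assume "s \<in> {0..1}"
    then show "w 1 t (inward i e x s) = - cross3 (m t (inward i e x s)) (laplacian (m t) (inward i e x s))
     + \<alpha> *\<^sub>R (laplacian (m t) (inward i e x s) + grad_sq (m t) (inward i e x s) *\<^sub>R m t (inward i e x s))"
      by (intro equation[OF tT] inward_cube[OF e x(1)])
  qed
qed

lemma time_derivative_jet1:
  assumes t: "good_time t" and x: "x \<in> unit_cube" "x $ i = e" and e: "e \<in> {0, 1}"
  shows "\<exists>c. jet K_jet c (\<lambda>s. w 1 t (inward i e x s)) \<and> c 1 = 0"
proof -
  have tT: "t \<in> {0..T}" using t by (simp add: good_time_def)
  obtain c where c: "jet K_jet c (\<lambda>s. w 1 t (inward i e x s))"
    using time_derivative_jets[OF assms] by (auto simp: jets_def)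
  have "((\<lambda>s. partials [] (w 1 t) (inward i e x s)) has_vector_derivative (1 - 2 * e) *\<^sub>R partials [i] (w 1 t) (inward i e x 0)) (at 0 within {0..1})"
    by (rule inward_derivative[OF wC[of 1 t] _ x(1) e]) (use tT in auto)
  moreover have "partials [i] (w 1 t) (inward i e x 0) = 0"
    using neumann_time[OF tT x e] by (simp add: inward_0[of x i e, OF x(2)])
  ultimately have "((\<lambda>s. w 1 t (inward i e x s)) has_vector_derivative 0) (at 0 within {0..1})" by simp
  from jet_derivative[OF c this] c show ?thesis by blast
qed

lemma third_normal_derivative:
  assumes t: "good_time t" and x: "x \<in> unit_cube" "x $ i = e" and e: "e \<in> {0, 1}"
  shows "partials [i, i, i] (m t) x = 0"
proof -
  have tT: "t \<in> {0..T}" using t by (simp add: good_time_def)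
  have "jets K_jet {1} (\<lambda>s. w 1 t (inward i e x s))"
    using time_derivative_jet1[OF assms] by (auto simp: jets_def)
  moreover have "partials (replicate q i) (m t) y = 0" if "q \<in> {1}" "y \<in> unit_cube" "y $ i = e" for q y
    using neumann[OF tT that(2,3) e] that(1) by simp
  ultimately have "partials (replicate (1 + 2) i) (m t) x = 0"
    by (intro parity_step[OF t x e, where Z = "{1}"]) auto
  then show ?thesis by (simp add: numeral_3_eq_3)
qed

text \<open>\<psi> and \<phi> are third-order quotients along the normal of m and of its time
  derivative. \<psi> s is O(s) because orders 1 and 3 of m vanish at good times, and by continuity
  at all times; since \<phi> s is its time derivative at every time,
  \<open>small_primitive_small_derivative\<close> applies.\<close>

lemma third_diff_small:
  assumes x: "x \<in> unit_cube" "x $ i = e" and e: "e \<in> {0, 1}" and t: "t \<in> {0..T}" and s: "s \<in> {0<..1/2}"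
  shows "norm ((1 / s ^ 3) *\<^sub>R third_diff s (\<lambda>s. w 1 t (inward i e x s))) \<le> 20 * max K_jet B * s"
proof -
  define K where "K = 20 * max K_jet B"
  define \<psi> \<phi> where "\<psi> s t = (1 / s ^ 3) *\<^sub>R third_diff s (\<lambda>s. m t (inward i e x s))"
    and "\<phi> s t = (1 / s ^ 3) *\<^sub>R third_diff s (\<lambda>s. w 1 t (inward i e x s))" for s t
  have c: "inward i e x r \<in> unit_cube" if "r \<in> {0..1}" for r by (rule inward_cube[OF e x(1) that])
  have der: "(\<psi> s has_vector_derivative \<phi> s t) (at t within {0..T})" if "s \<in> {0<..1/2}" "t \<in> {0..T}" for s t
    unfolding \<psi>_def[abs_def] \<phi>_def third_diff_def using that
    by (intro bounded_linear.has_vector_derivative[OF bounded_linear_scaleR_right] has_vector_derivative_add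
        has_vector_derivative_diff m_derivative c) auto
  have cont: "continuous_on {0..T} (\<phi> s)" if "s \<in> {0<..1/2}" for s
  proof -
    have w: "continuous_on {0..T} (\<lambda>t. w 1 t (inward i e x r))" if "r \<in> {0..1}" for r
    proof (rule continuous_on_vector_derivative)
      fix t assume "t \<in> {0..T}"
      then show "((\<lambda>t. w 1 t (inward i e x r)) has_vector_derivative w 2 t (inward i e x r)) (at t within {0..T})"
        using wd[of 1 "[]" t "inward i e x r"] c[OF that] by (simp add: numeral_2_eq_2)
    qed
    show ?thesis unfolding \<phi>_def third_diff_def using that by (intro continuous_intros w) auto
  qed
  have cont\<psi>: "continuous_on {0..T} (\<psi> s)" if "s \<in> {0<..1/2}" for s
    using der[OF that] by (rule continuous_on_vector_derivative)
  obtain t' where t': "good_time t'" using good_dense[OF t, of 1] by auto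
  have K0: "0 \<le> K" "0 \<le> K_jet" "0 \<le> B"
  proof -
    show "0 \<le> K_jet" using time_derivative_jet1[OF t' x e] by (auto simp: jet_def)
    show "0 \<le> B" using good_word_jets[OF t' x e, of "[]" "{}"] by (auto simp: jets_def jet_def)
    then show "0 \<le> K" by (simp add: K_def)
  qed
  have scale: "norm ((1 / s ^ 3) *\<^sub>R (v :: real^3)) \<le> K * s" if "norm v \<le> 20 * L * s ^ 4" "L \<le> max K_jet B" "s \<in> {0<..1/2}" for v L s
  proof -
    have "norm ((1 / s ^ 3) *\<^sub>R v) = (1 / s ^ 3) * norm v" using that(3) by simp
    also have "\<dots> \<le> (1 / s ^ 3) * (20 * L * s ^ 4)" using that by (intro mult_left_mono) auto
    also have "\<dots> = 20 * L * s" using that(3) by (simp add: eval_nat_numeral)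
    also have "\<dots> \<le> K * s" using that unfolding K_def by (intro mult_right_mono) auto
    finally show ?thesis .
  qed
  have small: "norm (\<psi> s t) \<le> K * s" if s: "s \<in> {0<..1/2}" and t: "t \<in> {0..T}" for s t
  proof (rule all_times[OF _ _ t])
    show "continuous_on {0..T} (\<lambda>t. norm (\<psi> s t))" by (intro continuous_intros cont\<psi> s)
    fix t assume t: "good_time t"
    have tT: "t \<in> {0..T}" using t by (simp add: good_time_def)
    have j: "jet B (\<lambda>q. ((1 - 2 * e) ^ q / fact q) *\<^sub>R partials (replicate q i @ []) (m t) x) (\<lambda>s. partials [] (m t) (inward i e x s))"
      using t by (intro inward_jet[OF _ _ _ x e]) (auto simp: good_time_def)
    have 1: "partials (replicate 1 i @ []) (m t) x = 0" using neumann[OF tT x e] by simp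
    have 3: "partials (replicate 3 i @ []) (m t) x = 0"
      using third_normal_derivative[OF t x e] by (simp add: numeral_3_eq_3)
    have "norm (third_diff s (\<lambda>s. partials [] (m t) (inward i e x s)) - (4 * s ^ 3) *\<^sub>R (((1 - 2 * e) ^ 3 / fact 3) *\<^sub>R partials (replicate 3 i @ []) (m t) x)) \<le> 20 * B * s ^ 4"
      using s by (intro third_diff_jet[OF j]) (auto simp only: 1 scaleR_zero_right greaterThanAtMost_iff)
    then have "norm (third_diff s (\<lambda>s. m t (inward i e x s))) \<le> 20 * B * s ^ 4"
      unfolding 3 by simp
    then show "norm (\<psi> s t) \<le> K * s" unfolding \<psi>_def by (rule scale[OF _ _ s]) simp
  qed
  \<comment> \<open>The coefficient \<open>c 3\<close> depends on t and is not yet known to vanish,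
    but it cancels in the difference of two step sizes.\<close>
  have cauchy: "norm (\<phi> s t - \<phi> s' t) \<le> K * (s + s')" if s: "s \<in> {0<..1/2}" "s' \<in> {0<..1/2}" and t: "t \<in> {0..T}" for s s' t
  proof (rule all_times[OF _ _ t])
    show "continuous_on {0..T} (\<lambda>t. norm (\<phi> s t - \<phi> s' t))" by (intro continuous_intros cont s)
    fix t assume t: "good_time t"
    obtain c where c: "jet K_jet c (\<lambda>s. w 1 t (inward i e x s))" "c 1 = 0"
      using time_derivative_jet1[OF t x e] by blast
    have "norm (\<phi> s t - 4 *\<^sub>R c 3) \<le> K * s" if "s \<in> {0<..1/2}" for s
    proof -
      have "\<phi> s t - 4 *\<^sub>R c 3 = (1 / s ^ 3) *\<^sub>R (third_diff s (\<lambda>s. w 1 t (inward i e x s)) - (4 * s ^ 3) *\<^sub>R c 3)"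
        using that by (simp add: \<phi>_def scaleR_diff_right)
      also have "norm \<dots> \<le> K * s"
        using that by (intro scale[of _ K_jet] third_diff_jet[OF c]) auto
      finally show ?thesis .
    qed
    from this[OF s(1)] this[OF s(2)] show "norm (\<phi> s t - \<phi> s' t) \<le> K * (s + s')"
      using norm_triangle_ineq4[of "\<phi> s t - 4 *\<^sub>R c 3" "\<phi> s' t - 4 *\<^sub>R c 3"] by (simp add: distrib_left)
  qed
  have "norm (\<phi> s t) \<le> K * s"
    by (rule small_primitive_small_derivative[OF T K0(1) der cont small cauchy s t])
  then show ?thesis by (simp add: \<phi>_def K_def)
qed

text \<open>The third-order quotient of the time derivative tends to \<open>4 *\<^sub>R c 3\<close>
  and also to 0, hence \<open>c 3 = 0\<close>. Now the time derivative is even to order 3, and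
  \<open>parity_step\<close> with q = 3 gives order 5.\<close>

lemma fifth_normal_derivative:
  assumes t: "good_time t" and x: "x \<in> unit_cube" "x $ i = e" and e: "e \<in> {0, 1}"
  shows "partials [i, i, i, i, i] (m t) x = 0"
proof -
  have tT: "t \<in> {0..T}" using t by (simp add: good_time_def)
  obtain c where c: "jet K_jet c (\<lambda>s. w 1 t (inward i e x s))" "c 1 = 0"
    using time_derivative_jet1[OF t x e] by blast
  define K where "K = 20 * max K_jet B"
  have "norm (4 *\<^sub>R c 3) \<le> 2 * K * s" if s: "s \<in> {0<..1/2}" for s
  proof -
    let ?D = "third_diff s (\<lambda>s. w 1 t (inward i e x s))"
    have 1: "norm ((1 / s ^ 3) *\<^sub>R ?D) \<le> K * s" unfolding K_def by (rule third_diff_small[OF x e tT s])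
    have "norm (?D - (4 * s ^ 3) *\<^sub>R c 3) \<le> 20 * K_jet * s ^ 4" using s by (intro third_diff_jet[OF c]) auto
    then have "(1 / s ^ 3) * norm (?D - (4 * s ^ 3) *\<^sub>R c 3) \<le> (1 / s ^ 3) * (20 * K_jet * s ^ 4)"
      using s by (intro mult_left_mono) auto
    also have "\<dots> = 20 * K_jet * s" using s by (simp add: eval_nat_numeral)
    also have "\<dots> \<le> K * s" using s unfolding K_def by (intro mult_right_mono) auto
    finally have "norm ((1 / s ^ 3) *\<^sub>R (?D - (4 * s ^ 3) *\<^sub>R c 3)) \<le> K * s" using s by simp
    moreover have e: "4 *\<^sub>R c 3 = (1 / s ^ 3) *\<^sub>R ?D - (1 / s ^ 3) *\<^sub>R (?D - (4 * s ^ 3) *\<^sub>R c 3)"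
      using s by (simp add: scaleR_diff_right)
    have "norm (4 *\<^sub>R c 3) \<le> norm ((1 / s ^ 3) *\<^sub>R ?D) + norm ((1 / s ^ 3) *\<^sub>R (?D - (4 * s ^ 3) *\<^sub>R c 3))"
      unfolding e by (rule norm_triangle_ineq4)
    ultimately have "norm (4 *\<^sub>R c 3) \<le> K * s + K * s" using 1 by linarith
    then show ?thesis by simp
  qed
  then have b: "\<And>s. s \<in> {0<..1/2} \<Longrightarrow> norm (4 *\<^sub>R c 3) \<le> 2 * K * s" .
  have "norm (\<Sum>q<1. s ^ q *\<^sub>R c 3) \<le> K * s ^ 1" if s: "s \<in> {0<..1}" for s
  proof -
    have "norm (4 *\<^sub>R c 3) \<le> 2 * K * (s / 2)" using s by (intro b) auto
    then have "4 * norm (c 3) \<le> K * s" by simp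
    moreover have "norm (c 3) \<le> 4 * norm (c 3)" by simp
    ultimately have "norm (c 3) \<le> K * s" by (rule order_trans[rotated])
    then show ?thesis by simp
  qed
  from small_polynomial_zero[where n = 1 and d = "\<lambda>_. c 3" and K = K and q = 0, OF this] have "c 3 = 0" by simp
  then have j: "jets K_jet {1,3} (\<lambda>s. w 1 t (inward i e x s))" using c by (auto simp: jets_def)
  have z: "partials (replicate q i) (m t) y = 0" if "q \<in> {1, 3}" "y \<in> unit_cube" "y $ i = e" for q y
    using neumann[OF tT that(2,3) e] third_normal_derivative[OF t that(2,3) e] that(1)
    by (auto simp: numeral_3_eq_3)
  have "partials (replicate (3 + 2) i) (m t) x = 0"
    by (rule parity_step[OF t x e _ z j]) auto
  then show ?thesis by (simp add: eval_nat_numeral)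
qed

end

section \<open>Cell centres and folded lines\<close>

lemma cell_center_cube:
  assumes "I \<in> grid N"
  shows "cell_center N I \<in> unit_cube"
proof -
  have "0 \<le> (real_of_int (I $ i) - 1/2) * mesh N \<and> (real_of_int (I $ i) - 1/2) * mesh N \<le> 1" for i
  proof -
    have I: "1 \<le> I $ i" "I $ i \<le> int N" using assms by (auto simp: grid_def)
    then have N: "real N > 0" by linarith
    have a: "1 \<le> real_of_int (I $ i)" "real_of_int (I $ i) \<le> real N" using I by linarith+
    have "(real_of_int (I $ i) - 1/2) / real N \<le> 1" using a N by (simp add: pos_divide_le_eq)
    moreover have "0 \<le> (real_of_int (I $ i) - 1/2) / real N" using a N by (intro divide_nonneg_pos) auto
    ultimately show ?thesis by (simp add: mesh_def)
  qed
  then show ?thesis by (simp add: cell_center_def unit_cube_def)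
qed

text \<open>For N >= 2 a stencil of half-width 2 leaves {1..N} by at most two indices, and one
  reflection brings it back. That reflection of indices is the reflection of cell centres at 0 or at
  1.\<close>

lemma reflect_fold01:
  assumes N: "N \<ge> 2" and j: "1 \<le> j" "j \<le> int N" and a: "\<bar>a\<bar> \<le> 2"
  shows "(real_of_int (reflect N (j + a)) - 1/2) * mesh N = fold01 ((real_of_int j - 1/2) * mesh N + real_of_int a * mesh N)"
proof -
  have N1: "N \<ge> 1" using N by simp
  have h: "mesh N > 0" "real N * mesh N = 1" using N by (auto simp: mesh_def)
  have y: "(real_of_int j - 1/2) * mesh N + real_of_int a * mesh N = (real_of_int (j + a) - 1/2) * mesh N"
    by (simp add: algebra_simps)
  consider "j + a \<le> 0" | "j + a > int N" | "1 \<le> j + a" "j + a \<le> int N" by linarith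
  then show ?thesis
  proof cases
    case 1
    have "reflect N (1 - (1 - (j + a))) = reflect N (1 - (j + a))" by (rule reflect_left[OF N1])
    also have "\<dots> = 1 - (j + a)" using 1 j a N by (intro reflect_interior) auto
    finally have r: "reflect N (j + a) = 1 - (j + a)" by simp
    have "real_of_int (j + a) - 1/2 < 0" using 1 by linarith
    then have "(real_of_int (j + a) - 1/2) * mesh N < 0" using h by (simp add: mult_neg_pos)
    then show ?thesis unfolding y r fold01_def by (simp add: algebra_simps)
  next
    case 2
    have "reflect N (int N + (j + a - int N)) = reflect N (int N + 1 - (j + a - int N))" by (rule reflect_right[OF N1])
    also have "\<dots> = int N + 1 - (j + a - int N)" using 2 j a N by (intro reflect_interior) auto
    finally have r: "reflect N (j + a) = 2 * int N + 1 - (j + a)" by simp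
    have "real N < real_of_int (j + a) - 1/2" using 2 by linarith
    then have "real N * mesh N < (real_of_int (j + a) - 1/2) * mesh N" using h by (intro mult_strict_right_mono)
    then have g: "1 < (real_of_int (j + a) - 1/2) * mesh N" using h by simp
    have "(real_of_int (2 * int N + 1 - (j + a)) - 1/2) * mesh N = 2 * (real N * mesh N) - (real_of_int (j + a) - 1/2) * mesh N"
      by (simp add: algebra_simps)
    then show ?thesis unfolding y r fold01_def using g h by simp
  next
    case 3
    then have r: "reflect N (j + a) = j + a" by (rule reflect_interior)
    have p: "0 \<le> real_of_int (j + a) - 1/2" "real_of_int (j + a) - 1/2 \<le> real N" using 3 by linarith+
    have "0 \<le> (real_of_int (j + a) - 1/2) * mesh N" using p(1) h by (intro mult_nonneg_nonneg) auto
    moreover have "(real_of_int (j + a) - 1/2) * mesh N \<le> real N * mesh N" using p(2) h by (intro mult_right_mono) auto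
    ultimately show ?thesis unfolding y r fold01_def h(2) by simp
  qed
qed

lemma ext_line:
  fixes f :: "real^'d \<Rightarrow> real^3"
  assumes N: "N \<ge> 2" and I: "I \<in> grid N" and a: "\<bar>a\<bar> \<le> 2"
  shows "ext N (restrict_grid N f) (I + axis i a)
    = f (upd (cell_center N I) i (fold01 (cell_center N I $ i + real_of_int a * mesh N)))"
proof -
  have "cell_center N (\<chi> j. reflect N ((I + axis i a) $ j))
     = upd (cell_center N I) i (fold01 (cell_center N I $ i + real_of_int a * mesh N))"
  proof -
    have Ij: "1 \<le> I $ j" "I $ j \<le> int N" for j using I by (auto simp: grid_def)
    have "cell_center N (\<chi> j. reflect N ((I + axis i a) $ j)) $ j
      = upd (cell_center N I) i (fold01 (cell_center N I $ i + real_of_int a * mesh N)) $ j" for j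
      using reflect_fold01[OF N Ij a, of i] reflect_interior[OF Ij, of j]
      by (cases "j = i") (auto simp: cell_center_def axis_def)
    then show ?thesis by (simp add: vec_eq_iff)
  qed
  then show ?thesis by (simp add: ext_def restrict_grid_def)
qed

lemma fold01_range: "y \<in> {-1..2} \<Longrightarrow> fold01 y \<in> {0..1}"
  by (auto simp: fold01_def)

lemma fold01_dist: "x \<in> {0..1} \<Longrightarrow> \<bar>fold01 y - x\<bar> \<le> \<bar>y - x\<bar>"
  by (auto simp: fold01_def)

text \<open>\<open>fold01\<close> does not increase the distance to a point of [0,1], so the mean
  value inequality along the line also covers neighbours across the boundary.\<close>

lemma ext_neighbour_diff:
  fixes f :: "real^'d \<Rightarrow> real^3"
  assumes N: "N \<ge> 2" and I: "I \<in> grid N" and a: "\<bar>a\<bar> \<le> 1" and f: "C_space 1 f"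
    and K: "\<And>x. x \<in> unit_cube \<Longrightarrow> norm (partial i f x) \<le> K"
  shows "norm (ext N (restrict_grid N f) (I + axis i a) - f (cell_center N I)) \<le> K * mesh N"
proof -
  let ?x = "cell_center N I"
  have x: "?x \<in> unit_cube" by (rule cell_center_cube[OF I])
  have h: "mesh N > 0" "mesh N \<le> 1/2" using N by (auto simp: mesh_def field_simps)
  have xi: "?x $ i \<in> {0..1}" using x by (auto simp: unit_cube_def)
  define y where "y = ?x $ i + real_of_int a * mesh N"
  have ah: "\<bar>real_of_int a * mesh N\<bar> \<le> mesh N"
  proof -
    have "\<bar>real_of_int a\<bar> \<le> 1" using a by linarith
    then have "\<bar>real_of_int a\<bar> * mesh N \<le> 1 * mesh N" using h by (intro mult_right_mono) auto
    then show ?thesis using h by (simp add: abs_mult)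
  qed
  have y: "y \<in> {-1..2}"
  proof -
    have "real_of_int a * mesh N \<le> mesh N" "- mesh N \<le> real_of_int a * mesh N"
      using abs_le_D1[OF ah] abs_le_D2[OF ah] by linarith+
    moreover have "0 \<le> ?x $ i" "?x $ i \<le> 1" using xi by auto
    ultimately have "-1 \<le> y" "y \<le> 2" using h unfolding y_def by linarith+
    then show ?thesis by simp
  qed
  have d1: "((\<lambda>s. f (upd ?x i s)) has_vector_derivative partial i f (upd ?x i s)) (at s within {0..1})" if "s \<in> {0..1}" for s
    using C_space_line[OF f, of "[]" ?x s i] that x by simp
  have "norm (f (upd ?x i (fold01 y)) - f (upd ?x i (?x $ i))) \<le> K * \<bar>fold01 y - ?x $ i\<bar>"
    by (rule vector_mvt_bound[where S = "{0..1}", OF d1 _ _ xi fold01_range[OF y]]) (auto intro!: K upd_cube x)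
  also have "\<dots> \<le> K * mesh N"
  proof (rule mult_left_mono)
    show "\<bar>fold01 y - ?x $ i\<bar> \<le> mesh N" using fold01_dist[OF xi, of y] ah by (simp add: y_def)
    show "0 \<le> K" using K[OF x] norm_ge_zero order_trans by blast
  qed
  finally show ?thesis using ext_line[OF N I, of a f i] a by (simp add: y_def)
qed

context exact_solution
begin

lemma good_even_taylor:
  assumes t: "good_time t" and x: "x \<in> unit_cube" and y: "y \<in> {-1..2}"
  shows "norm (m t (upd x i (fold01 y)) - (\<Sum>q<6. ((y - x $ i) ^ q / fact q) *\<^sub>R partials (replicate q i) (m t) x))
    \<le> B * \<bar>y - x $ i\<bar> ^ 6"
proof -
  define f where "f q s = partials (replicate q i) (m t) (upd x i s)" for q s
  have C: "C_space 6 (m t)" "C_norm 6 (m t) \<le> B" "t \<in> {0..T}" using t by (auto simp: good_time_def)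
  have xi: "x $ i \<in> {0..1}" using x by (auto simp: unit_cube_def)
  have odd: "f q e = 0" if "odd q" "q \<le> 6" "e \<in> {0, 1}" for q e
  proof -
    have c: "upd x i e \<in> unit_cube" using that(3) by (intro upd_cube x) auto
    have "q \<in> {1, 3, 5}" using that(1,2) by (auto elim!: oddE)
    then show ?thesis
      using neumann[OF C(3) c _ that(3), of i] third_normal_derivative[OF t c _ that(3), of i]
        fifth_normal_derivative[OF t c _ that(3), of i]
      by (auto simp: f_def eval_nat_numeral)
  qed
  have "norm (f 0 (fold01 y) - (\<Sum>q<6. ((y - x $ i) ^ q / fact q) *\<^sub>R f q (x $ i))) \<le> B * \<bar>y - x $ i\<bar> ^ 6"
  proof (rule even_taylor[OF _ _ _ _ xi y])
    show "(f q has_vector_derivative f (Suc q) s) (at s within {0..1})" if "q < 6" "s \<in> {0..1}" for q s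
      unfolding f_def[abs_def] using C_space_line[OF C(1) _ x that(2), of "replicate q i" i] that(1) by simp
    show "norm (f 6 s) \<le> B" if "s \<in> {0..1}" for s
      using C_norm_bound[OF C(1), of "replicate 6 i" "upd x i s"] upd_cube[OF x that] C(2) unfolding f_def by simp
  qed (use odd in auto)
  then show ?thesis by (simp add: f_def)
qed

lemma good_stencils:
  assumes t: "good_time t" and N: "N \<ge> 2" and I: "I \<in> grid N"
  shows "norm (D2_4 N i (restrict_grid N (m t)) I - partial i (partial i (m t)) (cell_center N I)) \<le> 14 * B * mesh N ^ 4"
    and "norm (D1_4 N i (restrict_grid N (m t)) I - partial i (m t) (cell_center N I)) \<le> 14 * B * mesh N ^ 4"
proof -
  let ?x = "cell_center N I" and ?h = "mesh N"
  have x: "?x \<in> unit_cube" by (rule cell_center_cube[OF I])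
  have h: "?h > 0" "?h \<le> 1/2" using N by (auto simp: mesh_def field_simps)
  have xi: "?x $ i \<in> {0..1}" using x by (auto simp: unit_cube_def)
  define g where "g z = m t (upd ?x i (fold01 (?x $ i + z)))" for z
  define c where "c q = partials (replicate q i) (m t) ?x" for q
  have gt: "norm (g z - (\<Sum>q<6. (z ^ q / fact q) *\<^sub>R c q)) \<le> B * \<bar>z\<bar> ^ 6" if "\<bar>z\<bar> \<le> 2 * ?h" for z
  proof -
    have "?x $ i + z \<in> {-1..2}" using that xi h by (auto simp: abs_le_iff)
    from good_even_taylor[OF t x this, of i] show ?thesis by (simp add: g_def c_def)
  qed
  have e: "ext N (restrict_grid N (m t)) (I + axis i a) = g (real_of_int a * ?h)" if "\<bar>a\<bar> \<le> 2" for a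
    unfolding g_def by (rule ext_line[OF N I that])
  have e0: "ext N (restrict_grid N (m t)) I = g 0"
    using e[of 0] by (simp add: axis_eq_0_iff[THEN iffD2])
  have da: "(I :: int^'d) - axis i a = I + axis i (- a)" for a by (simp add: vec_eq_iff axis_def)
  have D2: "D2_4 N i (restrict_grid N (m t)) I = (1 / (12 * ?h\<^sup>2)) *\<^sub>R (- g (- 2 * ?h) + 16 *\<^sub>R g (- ?h) - 30 *\<^sub>R g 0 + 16 *\<^sub>R g ?h - g (2 * ?h))"
    unfolding D2_4_def da e0 using e[of "-2"] e[of "-1"] e[of 1] e[of 2] by simp
  have D1: "D1_4 N i (restrict_grid N (m t)) I = (1 / (12 * ?h)) *\<^sub>R (g (- 2 * ?h) - 8 *\<^sub>R g (- ?h) + 8 *\<^sub>R g ?h - g (2 * ?h))"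
    unfolding D1_4_def da using e[of "-2"] e[of "-1"] e[of 1] e[of 2] by simp
  have "norm ((1 / (12 * ?h\<^sup>2)) *\<^sub>R (- g (- 2 * ?h) + 16 *\<^sub>R g (- ?h) - 30 *\<^sub>R g 0 + 16 *\<^sub>R g ?h - g (2 * ?h)) - c 2) \<le> 14 * B * ?h ^ 4"
    by (rule stencil_d2[OF h(1) gt])
  then show "norm (D2_4 N i (restrict_grid N (m t)) I - partial i (partial i (m t)) ?x) \<le> 14 * B * ?h ^ 4"
    unfolding D2 by (simp add: c_def numeral_2_eq_2)
  have "norm (c 5) \<le> B"
    unfolding c_def using C_norm_bound[of 6 "m t" "replicate 5 i" ?x] x t by (simp add: good_time_def)
  then have "norm ((1 / (12 * ?h)) *\<^sub>R (g (- 2 * ?h) - 8 *\<^sub>R g (- ?h) + 8 *\<^sub>R g ?h - g (2 * ?h)) - c 1) \<le> 14 * B * ?h ^ 4"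
    using h by (intro stencil_d1[OF h(1) _ gt]) auto
  then show "norm (D1_4 N i (restrict_grid N (m t)) I - partial i (m t) ?x) \<le> 14 * B * ?h ^ 4"
    unfolding D1 by (simp add: c_def)
qed

lemma continuous_m: "x \<in> unit_cube \<Longrightarrow> continuous_on {0..T} (\<lambda>t. m t x)"
  using m_derivative by (intro continuous_on_vector_derivative)

lemma continuous_w1: "x \<in> unit_cube \<Longrightarrow> continuous_on {0..T} (\<lambda>t. w 1 t x)"
proof (rule continuous_on_vector_derivative)
  fix t assume "x \<in> unit_cube" "t \<in> {0..T}"
  then show "((\<lambda>t. w 1 t x) has_vector_derivative w 2 t x) (at t within {0..T})"
    using wd[of 1 "[]" t x] by (simp add: numeral_2_eq_2)
qed

lemma continuous_partial: 
  assumes x: "x \<in> unit_cube"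
  shows "continuous_on {0..T} (\<lambda>t. partial i (m t) x)"
proof -
  have "continuous_on {0..T} (\<lambda>t. partials [i] (w 0 t) x)"
    using wd[of 0 "[i]" _ x] x by (intro continuous_on_vector_derivative) auto
  moreover have "partials [i] (w 0 t) x = partial i (m t) x" if "t \<in> {0..T}" for t
    using that by (simp add: partial_cong[of "w 0 t" "m t"] x w0)
  ultimately show ?thesis by (rule continuous_on_eq)
qed

text \<open>Continuity in time of second space derivatives is obtained from the solved equation,
  thus for the Laplacian as a whole. This is why \<open>Lap_4_consistent\<close> passes to all times
  for the sum over directions and not for each \<open>D2_4\<close>.\<close>

lemma continuous_laplacian:
  assumes x: "x \<in> unit_cube"
  shows "continuous_on {0..T} (\<lambda>t. laplacian (m t) x)"
proof -
  have "continuous_on {0..T} (\<lambda>t. grad_sq (m t) x)"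
    unfolding grad_sq_def by (intro continuous_intros continuous_partial x)
  then have "continuous_on {0..T} (\<lambda>t. solve_lin \<alpha> (m t x) (w 1 t x - \<alpha> *\<^sub>R (grad_sq (m t) x *\<^sub>R m t x)))"
    unfolding solve_lin_def
    by (intro continuous_intros continuous_on_cross continuous_m continuous_w1 x)
  then show ?thesis by (rule continuous_on_eq) (simp only: laplacian_eq[OF _ x])
qed

lemma continuous_ext:
  assumes N: "N \<ge> 1"
  shows "continuous_on {0..T} (\<lambda>t. ext N (restrict_grid N (m t)) I)"
proof -
  have "(\<chi> i. reflect N (I $ i)) \<in> grid N" using reflect_range[OF N] by (auto simp: grid_def)
  then show ?thesis unfolding ext_def restrict_grid_def by (intro continuous_m cell_center_cube)
qed

lemma D1_4_consistent:
  assumes t: "t \<in> {0..T}" and N: "N \<ge> 2" and I: "I \<in> grid N"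
  shows "norm (D1_4 N i (restrict_grid N (m t)) I - partial i (m t) (cell_center N I)) \<le> 14 * B * mesh N ^ 4"
proof (rule all_times[OF _ _ t])
  show "continuous_on {0..T} (\<lambda>t. norm (D1_4 N i (restrict_grid N (m t)) I - partial i (m t) (cell_center N I)))"
    unfolding D1_4_def using N by (intro continuous_intros continuous_ext continuous_partial cell_center_cube I) auto
qed (rule good_stencils(2)[OF _ N I])

lemma Lap_4_consistent:
  assumes t: "t \<in> {0..T}" and N: "N \<ge> 2" and I: "I \<in> grid N"
  shows "norm (Lap_4 N (restrict_grid N (m t)) I - laplacian (m t) (cell_center N I)) \<le> real CARD('d) * (14 * B * mesh N ^ 4)"
proof (rule all_times[OF _ _ t])
  show "continuous_on {0..T} (\<lambda>t. norm (Lap_4 N (restrict_grid N (m t)) I - laplacian (m t) (cell_center N I)))"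
    unfolding Lap_4_def D2_4_def
    using N by (intro continuous_intros continuous_ext continuous_laplacian cell_center_cube I) auto
  fix t assume g: "good_time t"
  have "norm (Lap_4 N (restrict_grid N (m t)) I - laplacian (m t) (cell_center N I))
    = norm (\<Sum>i\<in>UNIV. D2_4 N i (restrict_grid N (m t)) I - partial i (partial i (m t)) (cell_center N I))"
    by (simp add: Lap_4_def laplacian_def sum_subtractf)
  also have "\<dots> \<le> (\<Sum>i\<in>(UNIV :: 'd set). 14 * B * mesh N ^ 4)"
    by (intro sum_norm_le good_stencils(1)[OF g N I])
  finally show "norm (Lap_4 N (restrict_grid N (m t)) I - laplacian (m t) (cell_center N I)) \<le> real CARD('d) * (14 * B * mesh N ^ 4)"
    by simp
qed

lemma laplacian_bound:
  assumes t: "t \<in> {0..T}" and x: "x \<in> unit_cube"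
  shows "norm (laplacian (m t) x) \<le> real CARD('d) * B"
proof (rule all_times[OF _ _ t])
  show "continuous_on {0..T} (\<lambda>t. norm (laplacian (m t) x))" by (intro continuous_intros continuous_laplacian x)
  fix t assume g: "good_time t"
  have "norm (partials [i, i] (m t) x) \<le> B" for i
    using C_norm_bound[of 6 "m t" "[i, i]" x] g x by (simp add: good_time_def)
  then have "norm (laplacian (m t) x) \<le> (\<Sum>i\<in>(UNIV :: 'd set). B)"
    unfolding laplacian_def by (intro sum_norm_le) auto
  then show "norm (laplacian (m t) x) \<le> real CARD('d) * B" by simp
qed

lemma B_nonneg: "0 \<le> B"
proof -
  obtain t where t: "good_time t" using good_dense[of 0 1] T by auto
  have c: "(0 :: real^'d) \<in> unit_cube" by (simp add: unit_cube_def)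
  have "norm (partials [] (m t) 0) \<le> C_norm 6 (m t)" using t c by (intro C_norm_bound) (auto simp: good_time_def)
  then show ?thesis using t unfolding good_time_def by (meson norm_ge_zero order_trans)
qed

end

section \<open>Consistency and convergence\<close>

text \<open>
  Sequences whose first, second and third differences have the sizes they have for samples, with
  step \<open>k\<close>, of a function of class \<open>C\<^sup>3\<close>.
\<close>

definition regular :: "real \<Rightarrow> real \<Rightarrow> (nat \<Rightarrow> 'a::real_normed_vector) \<Rightarrow> bool" where
  "regular K k g \<longleftrightarrow> 0 \<le> K \<and> (\<forall>j\<le>3. norm (g j) \<le> K) \<and> (\<forall>j\<le>2. norm (g (Suc j) - g j) \<le> K * k) \<and>
     (\<forall>j\<le>1. norm (g (Suc (Suc j)) - 2 *\<^sub>R g (Suc j) + g j) \<le> K * k\<^sup>2) \<and>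
     norm (g 3 - 3 *\<^sub>R g 2 + 3 *\<^sub>R g 1 - g 0) \<le> K * k ^ 3"

lemma regular_add:
  assumes f: "regular K k f" and g: "regular L k g"
  shows "regular (K + L) k (\<lambda>j. f j + g j)"
proof -
  have tri: "norm (x + y) \<le> (K + L) * c" if "norm x \<le> K * c" "norm y \<le> L * c" for x y :: 'a and c
    using norm_triangle_ineq[of x y] that by (simp add: distrib_right)
  have "norm (f j + g j) \<le> K + L" if "j \<le> 3" for j
    using tri[of "f j" 1 "g j"] f g that by (simp add: regular_def)
  moreover have "norm ((f (Suc j) + g (Suc j)) - (f j + g j)) \<le> (K + L) * k" if "j \<le> 2" for j
    using tri[of "f (Suc j) - f j" k "g (Suc j) - g j"] f g that by (simp add: regular_def algebra_simps)
  moreover have "norm ((f (Suc (Suc j)) + g (Suc (Suc j))) - 2 *\<^sub>R (f (Suc j) + g (Suc j)) + (f j + g j)) \<le> (K + L) * k\<^sup>2" if "j \<le> 1" for j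
  proof -
    have "(f (Suc (Suc j)) + g (Suc (Suc j))) - 2 *\<^sub>R (f (Suc j) + g (Suc j)) + (f j + g j)
      = (f (Suc (Suc j)) - 2 *\<^sub>R f (Suc j) + f j) + (g (Suc (Suc j)) - 2 *\<^sub>R g (Suc j) + g j)" by (simp add: algebra_simps)
    moreover have "norm (f (Suc (Suc j)) - 2 *\<^sub>R f (Suc j) + f j) \<le> K * k\<^sup>2"
      "norm (g (Suc (Suc j)) - 2 *\<^sub>R g (Suc j) + g j) \<le> L * k\<^sup>2" using f g that by (auto simp: regular_def)
    ultimately show ?thesis using tri by metis
  qed
  moreover have "norm ((f 3 + g 3) - 3 *\<^sub>R (f 2 + g 2) + 3 *\<^sub>R (f 1 + g 1) - (f 0 + g 0)) \<le> (K + L) * k ^ 3"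
  proof -
    have "(f 3 + g 3) - 3 *\<^sub>R (f 2 + g 2) + 3 *\<^sub>R (f 1 + g 1) - (f 0 + g 0)
      = (f 3 - 3 *\<^sub>R f 2 + 3 *\<^sub>R f 1 - f 0) + (g 3 - 3 *\<^sub>R g 2 + 3 *\<^sub>R g 1 - g 0)" by (simp add: algebra_simps)
    moreover have "norm (f 3 - 3 *\<^sub>R f 2 + 3 *\<^sub>R f 1 - f 0) \<le> K * k ^ 3"
      "norm (g 3 - 3 *\<^sub>R g 2 + 3 *\<^sub>R g 1 - g 0) \<le> L * k ^ 3" using f g unfolding regular_def by blast+
    ultimately show ?thesis using tri by metis
  qed
  ultimately show ?thesis using f g by (simp add: regular_def)
qed

lemma regular_scale:
  assumes f: "regular K k f"
  shows "regular (\<bar>a\<bar> * K) k (\<lambda>j. a *\<^sub>R f j)"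
proof -
  have sc: "norm (a *\<^sub>R x) \<le> \<bar>a\<bar> * K * c" if "norm x \<le> K * c" for x :: 'a and c
    using mult_left_mono[OF that, of "\<bar>a\<bar>"] by (simp add: mult.assoc)
  have "norm (a *\<^sub>R f j) \<le> \<bar>a\<bar> * K" if "j \<le> 3" for j
    using sc[of "f j" 1] f that by (simp add: regular_def)
  moreover have "norm (a *\<^sub>R f (Suc j) - a *\<^sub>R f j) \<le> \<bar>a\<bar> * K * k" if "j \<le> 2" for j
    using sc[of "f (Suc j) - f j" k] f that by (simp add: regular_def scaleR_diff_right)
  moreover have "norm (a *\<^sub>R f (Suc (Suc j)) - 2 *\<^sub>R (a *\<^sub>R f (Suc j)) + a *\<^sub>R f j) \<le> \<bar>a\<bar> * K * k\<^sup>2" if "j \<le> 1" for j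
  proof -
    have "a *\<^sub>R f (Suc (Suc j)) - 2 *\<^sub>R (a *\<^sub>R f (Suc j)) + a *\<^sub>R f j = a *\<^sub>R (f (Suc (Suc j)) - 2 *\<^sub>R f (Suc j) + f j)"
      by (simp add: scaleR_diff_right scaleR_add_right mult.commute)
    then show ?thesis using sc f that unfolding regular_def by metis
  qed
  moreover have "norm (a *\<^sub>R f 3 - 3 *\<^sub>R (a *\<^sub>R f 2) + 3 *\<^sub>R (a *\<^sub>R f 1) - a *\<^sub>R f 0) \<le> \<bar>a\<bar> * K * k ^ 3"
  proof -
    have "a *\<^sub>R f 3 - 3 *\<^sub>R (a *\<^sub>R f 2) + 3 *\<^sub>R (a *\<^sub>R f 1) - a *\<^sub>R f 0 = a *\<^sub>R (f 3 - 3 *\<^sub>R f 2 + 3 *\<^sub>R f 1 - f 0)"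
      by (simp add: scaleR_diff_right scaleR_add_right mult.commute)
    then show ?thesis using sc f unfolding regular_def by metis
  qed
  ultimately show ?thesis using f by (simp add: regular_def)
qed

text \<open>Leibniz rules for differences; the one of third order has total weight 1 + 3 + 3 + 1 =
  8, which covers the others.\<close>

lemma regular_mult:
  fixes b :: "'a::real_normed_vector \<Rightarrow> 'b::real_normed_vector \<Rightarrow> 'c::real_normed_vector"
  assumes b: "bounded_bilinear b" and nb: "\<And>x y. norm (b x y) \<le> norm x * norm y"
    and f: "regular K k f" and g: "regular L k g" and k: "0 \<le> k"
  shows "regular (8 * K * L) k (\<lambda>j. b (f j) (g j))"
proof -
  interpret b: bounded_bilinear b by (rule b)
  have K: "0 \<le> K" "0 \<le> L" using f g by (auto simp: regular_def)
  have n: "norm (b x y) \<le> K * L * (c * d)" if "norm x \<le> K * c" "norm y \<le> L * d" "0 \<le> c" for x y c d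
  proof -
    have "norm x * norm y \<le> (K * c) * (L * d)" using that K by (intro mult_mono) auto
    then show ?thesis using nb[of x y] by (simp add: mult_ac)
  qed
  have f0: "norm (f j) \<le> K * 1" and g0: "norm (g j) \<le> L * 1" if "j \<le> 3" for j using f g that by (auto simp: regular_def)
  have f1: "norm (f (Suc j) - f j) \<le> K * k" and g1: "norm (g (Suc j) - g j) \<le> L * k" if "j \<le> 2" for j
    using f g that by (auto simp: regular_def)
  have f2: "norm (f (Suc (Suc j)) - 2 *\<^sub>R f (Suc j) + f j) \<le> K * k\<^sup>2"
    and g2: "norm (g (Suc (Suc j)) - 2 *\<^sub>R g (Suc j) + g j) \<le> L * k\<^sup>2" if "j \<le> 1" for j
    using f g that by (auto simp: regular_def)
  have f3: "norm (f 3 - 3 *\<^sub>R f 2 + 3 *\<^sub>R f 1 - f 0) \<le> K * k ^ 3"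
    and g3: "norm (g 3 - 3 *\<^sub>R g 2 + 3 *\<^sub>R g 1 - g 0) \<le> L * k ^ 3" using f g by (auto simp: regular_def)
  have KL: "0 \<le> K * L" using K by simp
  have "norm (b (f j) (g j)) \<le> 8 * K * L" if "j \<le> 3" for j
  proof -
    have "norm (b (f j) (g j)) \<le> K * L * (1 * 1)" using that by (intro n f0 g0) auto
    then show ?thesis using KL by simp
  qed
  moreover have "norm (b (f (Suc j)) (g (Suc j)) - b (f j) (g j)) \<le> 8 * K * L * k" if j: "j \<le> 2" for j
  proof -
    have "b (f (Suc j)) (g (Suc j)) - b (f j) (g j) = b (f (Suc j) - f j) (g (Suc j)) + b (f j) (g (Suc j) - g j)"
      by (simp add: b.diff_left b.diff_right)
    also have "norm \<dots> \<le> K * L * (k * 1) + K * L * (1 * k)"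
      using j k by (intro order_trans[OF norm_triangle_ineq add_mono] n f0 g0 f1 g1) auto
    also have "\<dots> = 2 * (K * L * k)" by simp
    also have "\<dots> \<le> 8 * (K * L * k)" using KL k by (intro mult_right_mono) auto
    finally show ?thesis by simp
  qed
  moreover have "norm (b (f (Suc (Suc j))) (g (Suc (Suc j))) - 2 *\<^sub>R b (f (Suc j)) (g (Suc j)) + b (f j) (g j)) \<le> 8 * K * L * k\<^sup>2" if j: "j \<le> 1" for j
  proof -
    have two: "2 *\<^sub>R z = z + z" for z :: 'c by (rule scaleR_2)
    have two': "2 *\<^sub>R z = z + z" for z :: 'a by (rule scaleR_2)
    have two'': "2 *\<^sub>R z = z + z" for z :: 'b by (rule scaleR_2)
    have "b (f (Suc (Suc j))) (g (Suc (Suc j))) - 2 *\<^sub>R b (f (Suc j)) (g (Suc j)) + b (f j) (g j)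
      = b (f (Suc (Suc j)) - 2 *\<^sub>R f (Suc j) + f j) (g (Suc (Suc j)))
        + (b (f (Suc j) - f j) (g (Suc (Suc j)) - g (Suc j)) + b (f (Suc j) - f j) (g (Suc (Suc j)) - g (Suc j)))
        + b (f j) (g (Suc (Suc j)) - 2 *\<^sub>R g (Suc j) + g j)"
      unfolding two two' two'' by (simp add: b.diff_left b.diff_right b.add_left b.add_right algebra_simps)
    also have "norm \<dots> \<le> K * L * (k\<^sup>2 * 1) + (K * L * (k * k) + K * L * (k * k)) + K * L * (1 * k\<^sup>2)"
      using j k by (intro order_trans[OF norm_triangle_ineq add_mono] n f0 g0 f1 g1 f2 g2) auto
    also have "\<dots> = 4 * (K * L * k\<^sup>2)" by (simp add: power2_eq_square)
    also have "\<dots> \<le> 8 * (K * L * k\<^sup>2)" using KL k by (intro mult_right_mono) auto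
    finally show ?thesis by simp
  qed
  moreover have "norm (b (f 3) (g 3) - 3 *\<^sub>R b (f 2) (g 2) + 3 *\<^sub>R b (f 1) (g 1) - b (f 0) (g 0)) \<le> 8 * K * L * k ^ 3"
  proof -
    have e: "b (f 3) (g 3) - 3 *\<^sub>R b (f 2) (g 2) + 3 *\<^sub>R b (f 1) (g 1) - b (f 0) (g 0)
      = b (f 3 - 3 *\<^sub>R f 2 + 3 *\<^sub>R f 1 - f 0) (g 3)
        + 3 *\<^sub>R b (f 2 - 2 *\<^sub>R f 1 + f 0) (g 3 - g 2)
        + 3 *\<^sub>R b (f 1 - f 0) (g 3 - 2 *\<^sub>R g 2 + g 1)
        + b (f 0) (g 3 - 3 *\<^sub>R g 2 + 3 *\<^sub>R g 1 - g 0)"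
    proof -
      have 3: "3 *\<^sub>R z = z + z + z" for z :: "'z::real_vector"
        using scaleR_add_left[of 1 2 z] by (simp add: scaleR_2)
      show ?thesis unfolding 3 scaleR_2
        by (simp add: b.diff_left b.diff_right b.add_left b.add_right algebra_simps)
    qed
    have "norm (3 *\<^sub>R b (f 2 - 2 *\<^sub>R f 1 + f 0) (g 3 - g 2)) \<le> 3 * (K * L * (k\<^sup>2 * k))"
      using n[OF f2[of 0] g1[of 2]] k by (simp add: numeral_2_eq_2 numeral_3_eq_3)
    moreover have "norm (3 *\<^sub>R b (f 1 - f 0) (g 3 - 2 *\<^sub>R g 2 + g 1)) \<le> 3 * (K * L * (k * k\<^sup>2))"
      using n[OF f1[of 0] g2[of 1]] k by (simp add: numeral_2_eq_2 numeral_3_eq_3)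
    moreover have "norm (b (f 3 - 3 *\<^sub>R f 2 + 3 *\<^sub>R f 1 - f 0) (g 3)) \<le> K * L * (k ^ 3 * 1)"
      using k by (intro n f3 g0) auto
    moreover have "norm (b (f 0) (g 3 - 3 *\<^sub>R g 2 + 3 *\<^sub>R g 1 - g 0)) \<le> K * L * (1 * k ^ 3)"
      using k by (intro n g3 f0) auto
    ultimately have "norm (b (f 3) (g 3) - 3 *\<^sub>R b (f 2) (g 2) + 3 *\<^sub>R b (f 1) (g 1) - b (f 0) (g 0))
      \<le> K * L * (k ^ 3 * 1) + 3 * (K * L * (k\<^sup>2 * k)) + 3 * (K * L * (k * k\<^sup>2)) + K * L * (1 * k ^ 3)"
      unfolding e by (intro order_trans[OF norm_triangle_ineq] add_mono)
    also have "\<dots> = 8 * K * L * k ^ 3" by (simp add: eval_nat_numeral)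
    finally show ?thesis .
  qed
  ultimately show ?thesis using KL by (simp add: regular_def)
qed

lemma regular_sum:
  assumes "finite A" "\<And>i. i \<in> A \<Longrightarrow> regular K k (f i)" "0 \<le> K" "0 \<le> k"
  shows "regular (real (card A) * K) k (\<lambda>j. \<Sum>i\<in>A. f i j)"
  using assms
proof (induction A)
  case empty
  then show ?case by (simp add: regular_def)
next
  case (insert a A)
  then have "regular (K + real (card A) * K) k (\<lambda>j. f a j + (\<Sum>i\<in>A. f i j))" by (intro regular_add) auto
  then show ?case using insert by (simp add: distrib_right)
qed

text \<open>Taylor expansion at one of the samples. The third difference is the worst, with 27 + 3 *
  8 + 3 = 54.\<close>

lemma regular_samples:
  fixes f :: "nat \<Rightarrow> real \<Rightarrow> 'a::real_normed_vector"
  assumes d: "\<And>q t. q < 3 \<Longrightarrow> t \<in> {0..T} \<Longrightarrow> (f q has_vector_derivative f (Suc q) t) (at t within {0..T})"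
    and K: "\<And>q t. q \<le> 3 \<Longrightarrow> t \<in> {0..T} \<Longrightarrow> norm (f q t) \<le> K"
    and k: "k > 0" and t: "0 \<le> t" "t + 3 * k \<le> T"
  shows "regular (54 * K) k (\<lambda>j. f 0 (t + real j * k))"
proof -
  have T: "t + real j * k \<in> {0..T}" if "j \<le> 3" for j
  proof -
    have "real j * k \<le> 3 * k" using that k by (intro mult_right_mono) auto
    moreover have "0 \<le> real j * k" using k by simp
    ultimately have "0 \<le> t + real j * k" "t + real j * k \<le> T" using t by linarith+
    then show ?thesis by simp
  qed
  have K0: "0 \<le> K" using K[of 0 "t + real 0 * k"] T[of 0] norm_ge_zero order_trans by blast
  define r where "r p j i = f 0 (t + real i * k) - (\<Sum>q<p. ((real i * k - real j * k) ^ q / fact q) *\<^sub>R f q (t + real j * k))" for p j i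
  have r: "norm (r p j i) \<le> K * \<bar>real i * k - real j * k\<bar> ^ p" if "p \<le> 3" "i \<le> 3" "j \<le> 3" for p i j
  proof -
    have "norm (f 0 (t + real i * k) - (\<Sum>q<p. (((t + real i * k) - (t + real j * k)) ^ q / fact q) *\<^sub>R f q (t + real j * k)))
      \<le> K * \<bar>(t + real i * k) - (t + real j * k)\<bar> ^ p"
      using that by (intro taylor_remainder[where S = "{0..T}"] d K T) auto
    then show ?thesis by (simp add: r_def)
  qed
  have b: "K * x \<le> 54 * K * x" if "0 \<le> x" for x
  proof -
    have "1 * (K * x) \<le> 54 * (K * x)" using K0 that by (intro mult_right_mono) auto
    then show ?thesis by simp
  qed
  have "norm (f 0 (t + real j * k)) \<le> 54 * K" if "j \<le> 3" for j
    using K[of 0, OF _ T[OF that]] b[of 1] by simp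
  moreover have "norm (f 0 (t + real (Suc j) * k) - f 0 (t + real j * k)) \<le> 54 * K * k" if "j \<le> 2" for j
  proof -
    have "f 0 (t + real (Suc j) * k) - f 0 (t + real j * k) = r 1 j (Suc j)" by (simp add: r_def)
    then show ?thesis using r[of 1 "Suc j" j] b[of k] that k by (simp add: algebra_simps)
  qed
  moreover have "norm (f 0 (t + real (Suc (Suc j)) * k) - 2 *\<^sub>R f 0 (t + real (Suc j) * k) + f 0 (t + real j * k)) \<le> 54 * K * k\<^sup>2" if "j \<le> 1" for j
  proof -
    have "f 0 (t + real (Suc (Suc j)) * k) - 2 *\<^sub>R f 0 (t + real (Suc j) * k) + f 0 (t + real j * k)
       = r 2 j (Suc (Suc j)) - 2 *\<^sub>R r 2 j (Suc j)"
    proof -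
      have "{..<2::nat} = {0, 1}" by auto
      moreover have "(real (Suc (Suc j)) * k - real j * k) = 2 * k" "(real (Suc j) * k - real j * k) = k" by (simp_all add: algebra_simps)
      ultimately show ?thesis unfolding r_def by (simp add: scaleR_add_right scaleR_diff_right scaleR_2)
    qed
    also have "norm \<dots> \<le> K * (2 * k)\<^sup>2 + 2 * (K * k\<^sup>2)"
      using r[of 2 "Suc (Suc j)" j] r[of 2 "Suc j" j] that k
      by (intro order_trans[OF norm_triangle_ineq4 add_mono]) (auto simp: algebra_simps)
    also have "\<dots> = 6 * (K * k\<^sup>2)" by (simp add: power_mult_distrib)
    also have "\<dots> \<le> 54 * (K * k\<^sup>2)" using K0 by (intro mult_right_mono) auto
    finally show ?thesis by simp
  qed
  moreover have "norm (f 0 (t + real 3 * k) - 3 *\<^sub>R f 0 (t + real 2 * k) + 3 *\<^sub>R f 0 (t + real 1 * k) - f 0 (t + real 0 * k)) \<le> 54 * K * k ^ 3"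
  proof -
    have l3: "{..<3::nat} = {0, 1, 2}" by auto
    have "f 0 (t + real 3 * k) - 3 *\<^sub>R f 0 (t + real 2 * k) + 3 *\<^sub>R f 0 (t + real 1 * k) - f 0 (t + real 0 * k)
       = r 3 0 3 - 3 *\<^sub>R r 3 0 2 + 3 *\<^sub>R r 3 0 1 - r 3 0 0"
      unfolding r_def l3 by (simp add: scaleR_add_right scaleR_diff_right power_mult_distrib) (simp add: algebra_simps flip: scaleR_add_left)
    also have "norm \<dots> \<le> K * (3 * k) ^ 3 + 3 * (K * (2 * k) ^ 3) + 3 * (K * k ^ 3) + 0"
      using r[of 3 3 0] r[of 3 2 0] r[of 3 1 0] r[of 3 0 0] k
      by (intro order_trans[OF norm_triangle_ineq4 add_mono] order_trans[OF norm_triangle_ineq add_mono]) auto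
    also have "\<dots> = 54 * K * k ^ 3" by (simp add: power_mult_distrib)
    finally show ?thesis .
  qed
  ultimately show ?thesis using K0 by (simp add: regular_def)
qed

text \<open>BDF3 differentiates cubic polynomials exactly. The remainders of order 4 contribute 3 +
  3/2 * 16 + 1/3 * 81 = 54.\<close>

lemma bdf3_samples:
  fixes f :: "nat \<Rightarrow> real \<Rightarrow> 'a::real_normed_vector"
  assumes d: "\<And>q t. q < 4 \<Longrightarrow> t \<in> {0..T} \<Longrightarrow> (f q has_vector_derivative f (Suc q) t) (at t within {0..T})"
    and K: "\<And>t. t \<in> {0..T} \<Longrightarrow> norm (f 4 t) \<le> K"
    and k: "k > 0" and t: "0 \<le> t - 3 * k" "t \<le> T"
  shows "norm ((1 / k) *\<^sub>R ((11/6) *\<^sub>R f 0 t - 3 *\<^sub>R f 0 (t - k) + (3/2) *\<^sub>R f 0 (t - 2 * k) - (1/3) *\<^sub>R f 0 (t - 3 * k)) - f 1 t)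
    \<le> 54 * K * k ^ 3"
proof -
  have l4: "{..<4::nat} = {0, 1, 2, 3}" by auto
  define r where "r z = f 0 (t - z) - (f 0 t - z *\<^sub>R f 1 t + (z\<^sup>2 / 2) *\<^sub>R f 2 t - (z ^ 3 / 6) *\<^sub>R f 3 t)" for z
  have r: "norm (r z) \<le> K * z ^ 4" if "0 \<le> z" "z \<le> 3 * k" for z
  proof -
    have tT: "t \<in> {0..T}" "t - z \<in> {0..T}" using t that k by auto
    have "norm (f 0 (t - z) - (\<Sum>q<4. (((t - z) - t) ^ q / fact q) *\<^sub>R f q t)) \<le> K * \<bar>(t - z) - t\<bar> ^ 4"
      using tT by (intro taylor_remainder[where S = "{0..T}"] d K) auto
    moreover have "(\<Sum>q<4. (((t - z) - t) ^ q / fact q) *\<^sub>R f q t) = f 0 t - z *\<^sub>R f 1 t + (z\<^sup>2 / 2) *\<^sub>R f 2 t - (z ^ 3 / 6) *\<^sub>R f 3 t"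
      unfolding l4 by (simp add: fact_numeral)
    ultimately show ?thesis using that by (simp add: r_def)
  qed
  have f: "f 0 (t - z) = r z + (f 0 t - z *\<^sub>R f 1 t + (z\<^sup>2 / 2) *\<^sub>R f 2 t - (z ^ 3 / 6) *\<^sub>R f 3 t)" for z by (simp add: r_def)
  have e: "(11/6) *\<^sub>R f 0 t - 3 *\<^sub>R f 0 (t - k) + (3/2) *\<^sub>R f 0 (t - 2 * k) - (1/3) *\<^sub>R f 0 (t - 3 * k)
    = k *\<^sub>R f 1 t + (- 3 *\<^sub>R r k + (3/2) *\<^sub>R r (2 * k) - (1/3) *\<^sub>R r (3 * k))"
  proof -
    have "(11/6) *\<^sub>R a - 3 *\<^sub>R (r1 + (a - k *\<^sub>R b + (k\<^sup>2 / 2) *\<^sub>R c - (k ^ 3 / 6) *\<^sub>R d))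
      + (3/2) *\<^sub>R (r2 + (a - (2 * k) *\<^sub>R b + ((2 * k)\<^sup>2 / 2) *\<^sub>R c - ((2 * k) ^ 3 / 6) *\<^sub>R d))
      - (1/3) *\<^sub>R (r3 + (a - (3 * k) *\<^sub>R b + ((3 * k)\<^sup>2 / 2) *\<^sub>R c - ((3 * k) ^ 3 / 6) *\<^sub>R d))
      = (11/6 - 3 + 3/2 - 1/3) *\<^sub>R a + (3 * k - 3 * k + k) *\<^sub>R b + (- 3 / 2 * k\<^sup>2 + 3 * k\<^sup>2 - 3 / 2 * k\<^sup>2) *\<^sub>R c
        + (1 / 2 * k ^ 3 - 2 * k ^ 3 + 3 / 2 * k ^ 3) *\<^sub>R d
        + (- 3 *\<^sub>R r1 + (3/2) *\<^sub>R r2 - (1/3) *\<^sub>R r3)" for a b c d r1 r2 r3 :: 'a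
      by (simp only: scaleR_add_right scaleR_diff_right scaleR_scaleR scaleR_add_left scaleR_diff_left power_mult_distrib) simp
    from this[of "f 0 t" "r k" "f 1 t" "f 2 t" "f 3 t" "r (2 * k)" "r (3 * k)"] show ?thesis
      unfolding f by simp
  qed
  have "(1 / k) *\<^sub>R ((11/6) *\<^sub>R f 0 t - 3 *\<^sub>R f 0 (t - k) + (3/2) *\<^sub>R f 0 (t - 2 * k) - (1/3) *\<^sub>R f 0 (t - 3 * k)) - f 1 t
    = (1 / k) *\<^sub>R (- 3 *\<^sub>R r k + (3/2) *\<^sub>R r (2 * k) - (1/3) *\<^sub>R r (3 * k))"
    unfolding e using k by (simp add: scaleR_add_right)
  also have "norm \<dots> = (1 / k) * norm (- 3 *\<^sub>R r k + (3/2) *\<^sub>R r (2 * k) - (1/3) *\<^sub>R r (3 * k))" using k by simp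
  also have "\<dots> \<le> (1 / k) * (3 * (K * k ^ 4) + 3/2 * (K * (2 * k) ^ 4) + 1/3 * (K * (3 * k) ^ 4))"
    using r[of k] r[of "2 * k"] r[of "3 * k"] k
    by (intro mult_left_mono order_trans[OF norm_triangle_ineq4 add_mono] order_trans[OF norm_triangle_ineq add_mono]) auto
  also have "\<dots> = 54 * K * k ^ 3" using k by (simp add: power_mult_distrib field_simps eval_nat_numeral)
  finally show ?thesis .
qed

text \<open>For exact samples the extrapolation error is minus their third difference; perturbations
  of the samples are amplified by at most 3 + 3 + 1 = 7.\<close>

lemma extr_consistent:
  assumes "regular K k g" and "\<And>j. j \<le> 2 \<Longrightarrow> norm (u j - g j) \<le> c"
  shows "norm (extr (u 2) (u 1) (u 0) - g 3) \<le> K * k ^ 3 + 7 * c"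
proof -
  have a: "norm (extr (u 2) (u 1) (u 0) - extr (g 2) (g 1) (g 0)) \<le> 7 * c"
    unfolding extr_diff by (intro norm_extr_le assms(2)) auto
  have b: "norm (extr (g 2) (g 1) (g 0) - g 3) \<le> K * k ^ 3"
  proof -
    have "extr (g 2) (g 1) (g 0) - g 3 = - (g 3 - 3 *\<^sub>R g 2 + 3 *\<^sub>R g 1 - g 0)" by (simp add: extr_def)
    then show ?thesis using assms(1) unfolding regular_def by (metis norm_minus_cancel)
  qed
  have "norm (extr (u 2) (u 1) (u 0) - g 3) \<le> norm (extr (u 2) (u 1) (u 0) - extr (g 2) (g 1) (g 0)) + norm (extr (g 2) (g 1) (g 0) - g 3)"
    by (rule order_trans[OF _ norm_triangle_ineq]) simp
  then show ?thesis using a b by linarith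
qed

lemma ext_extr:
  "ext N (\<lambda>I. extr (f2 I) (f1 I) (f0 I)) = (\<lambda>I. extr (ext N f2 I) (ext N f1 I) (ext N f0 I))"
  by (simp add: ext_def fun_eq_iff)

text \<open>A second chain v, from C^4([0,T];C^0), supplies the fourth time derivative for the BDF3
  truncation error; w supplies space derivatives.\<close>

locale regular_solution = exact_solution m m0 T \<alpha> B w
  for m :: "real \<Rightarrow> real^'d \<Rightarrow> real^3" and m0 T \<alpha> B w +
  fixes v :: "nat \<Rightarrow> real \<Rightarrow> real^'d \<Rightarrow> real^3" and K :: real
  assumes v0: "\<And>t x. t \<in> {0..T} \<Longrightarrow> x \<in> unit_cube \<Longrightarrow> v 0 t x = m t x"
    and vd: "\<And>q t x. q < 4 \<Longrightarrow> t \<in> {0..T} \<Longrightarrow> x \<in> unit_cube \<Longrightarrow>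
       ((\<lambda>s. v q s x) has_vector_derivative v (Suc q) t x) (at t within {0..T})"
    and vK: "\<And>q t x. q \<le> 4 \<Longrightarrow> t \<in> {0..T} \<Longrightarrow> x \<in> unit_cube \<Longrightarrow> norm (v q t x) \<le> K"
    and wK: "\<And>q is t x. q \<le> 3 \<Longrightarrow> length is \<le> 1 \<Longrightarrow> t \<in> {0..T} \<Longrightarrow> x \<in> unit_cube \<Longrightarrow> norm (partials is (w q t) x) \<le> K"
begin

lemma K_nonneg: "0 \<le> K"
proof -
  have "(0 :: real^'d) \<in> unit_cube" by (simp add: unit_cube_def)
  then have "norm (v 0 0 0) \<le> K" using T by (intro vK) auto
  then show ?thesis using norm_ge_zero order_trans by blast
qed

lemma v1: "t \<in> {0..T} \<Longrightarrow> x \<in> unit_cube \<Longrightarrow> v 1 t x = w 1 t x"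
proof -
  assume t: "t \<in> {0..T}" and x: "x \<in> unit_cube"
  have "((\<lambda>s. v 0 s x) has_vector_derivative v 1 t x) (at t within {0..T})" using vd[of 0 t x] t x by simp
  then have "((\<lambda>s. m s x) has_vector_derivative v 1 t x) (at t within {0..T})"
    by (rule has_vector_derivative_transform[OF t, rotated]) (simp add: v0 x)
  then show ?thesis using m_derivative[OF t x] at_within_T[OF t] by (metis vector_derivative_within)
qed

lemma partial_bound: "t \<in> {0..T} \<Longrightarrow> x \<in> unit_cube \<Longrightarrow> norm (partial i (m t) x) \<le> K"
  using wK[of 0 "[i]" t x] partial_cong[of "w 0 t" "m t" x i] by (simp add: w0)

definition K_grad :: real where "K_grad = real CARD('d) * (8 * (54 * K) * (54 * K))"

text \<open>The constant that \<open>regular_scale\<close>, \<open>regular_add\<close> and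
  \<open>regular_mult\<close> return for the formula of \<open>solve_lin\<close>.\<close>

definition K_lap :: real where
  "K_lap = \<bar>1 / (1 + \<alpha>\<^sup>2)\<bar> * (\<bar>\<alpha>\<bar> * (54 * K + \<bar>- \<alpha>\<bar> * (8 * K_grad * (54 * K)))
     + 8 * (54 * K) * (54 * K + \<bar>- \<alpha>\<bar> * (8 * K_grad * (54 * K)))
     + \<bar>1 / \<alpha>\<bar> * (8 * (8 * (54 * K) * (54 * K + \<bar>- \<alpha>\<bar> * (8 * K_grad * (54 * K)))) * (54 * K)))"

context
  fixes x :: "real^'d" and k t :: real
  assumes x: "x \<in> unit_cube" and k: "k > 0" and t: "0 \<le> t" "t + 3 * k \<le> T"
begin

lemma sample_time: "j \<le> 3 \<Longrightarrow> t + real j * k \<in> {0..T}"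
proof -
  assume "j \<le> 3"
  then have "real j * k \<le> 3 * k" "0 \<le> real j * k" using k by (auto intro: mult_right_mono)
  then have "0 \<le> t + real j * k" "t + real j * k \<le> T" using t by linarith+
  then show ?thesis by simp
qed

lemma regular_cong:
  assumes "regular L k f" "\<And>j. j \<le> 3 \<Longrightarrow> g j = f j"
  shows "regular L k g"
proof -
  have "g (Suc j) = f (Suc j)" "g j = f j" if "j \<le> 2" for j using assms(2) that by auto
  moreover have "g (Suc (Suc j)) = f (Suc (Suc j))" if "j \<le> 1" for j using assms(2) that by auto
  moreover have "g 3 = f 3" "g 2 = f 2" "g 1 = f 1" "g 0 = f 0" using assms(2) by auto
  ultimately show ?thesis using assms unfolding regular_def by (auto; metis le_SucI numeral_2_eq_2)
qed

lemma regular_m: "regular (54 * K) k (\<lambda>j. m (t + real j * k) x)"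
proof (rule regular_cong)
  show "regular (54 * K) k (\<lambda>j. w 0 (t + real j * k) x)"
    by (rule regular_samples[where T = T, OF _ _ k t]) (use wd[of _ "[]"] wK[of _ "[]"] x in auto)
  show "m (t + real j * k) x = w 0 (t + real j * k) x" if "j \<le> 3" for j
    using w0[OF sample_time[OF that] x] by simp
qed

lemma regular_partial: "regular (54 * K) k (\<lambda>j. partial i (m (t + real j * k)) x)"
proof (rule regular_cong)
  show "regular (54 * K) k (\<lambda>j. partials [i] (w 0 (t + real j * k)) x)"
    by (rule regular_samples[where T = T and f = "\<lambda>q s. partials [i] (w q s) x", OF _ _ k t])
      (use wd[of _ "[i]"] wK[of _ "[i]"] x in auto)
  show "partial i (m (t + real j * k)) x = partials [i] (w 0 (t + real j * k)) x" if "j \<le> 3" for j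
    using partial_cong[of "w 0 (t + real j * k)" "m (t + real j * k)" x i] w0[OF sample_time[OF that]] x by simp
qed

text \<open>The time derivative of m needs three further time derivatives. They come from v; the
  chain w would give two.\<close>

lemma regular_w1: "regular (54 * K) k (\<lambda>j. w 1 (t + real j * k) x)"
proof (rule regular_cong)
  show "regular (54 * K) k (\<lambda>j. v (Suc 0) (t + real j * k) x)"
    by (rule regular_samples[where T = T and f = "\<lambda>q s. v (Suc q) s x", OF _ _ k t])
      (use vd vK x in auto)
  show "w 1 (t + real j * k) x = v (Suc 0) (t + real j * k) x" if "j \<le> 3" for j
    using v1[OF sample_time[OF that] x] by simp
qed

lemma regular_grad_sq: "regular K_grad k (\<lambda>j. grad_sq (m (t + real j * k)) x)"
proof -
  have "regular (8 * (54 * K) * (54 * K)) k (\<lambda>j. partial i (m (t + real j * k)) x \<bullet> partial i (m (t + real j * k)) x)" for i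
    using k by (intro regular_mult[OF bounded_bilinear_inner norm_inner_le] regular_partial) auto
  then have "regular (real (card (UNIV :: 'd set)) * (8 * (54 * K) * (54 * K))) k
      (\<lambda>j. \<Sum>i\<in>UNIV. partial i (m (t + real j * k)) x \<bullet> partial i (m (t + real j * k)) x)"
    using k K_nonneg by (intro regular_sum) auto
  then show ?thesis unfolding grad_sq_def power2_norm_eq_inner K_grad_def .
qed

text \<open>\<open>solve_lin\<close> is composed of linear and bilinear operations on
  \<open>regular\<close> sequences. The resulting O(k^3) for third differences makes the explicit
  extrapolation of the Laplacian third-order accurate.\<close>

lemma regular_laplacian: "regular K_lap k (\<lambda>j. laplacian (m (t + real j * k)) x)"
proof (rule regular_cong)
  let ?r = "\<lambda>j. w 1 (t + real j * k) x + (- \<alpha>) *\<^sub>R (grad_sq (m (t + real j * k)) x *\<^sub>R m (t + real j * k) x)"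
  let ?Kr = "54 * K + \<bar>- \<alpha>\<bar> * (8 * K_grad * (54 * K))"
  have k0: "0 \<le> k" using k by simp
  have "regular (8 * K_grad * (54 * K)) k (\<lambda>j. grad_sq (m (t + real j * k)) x *\<^sub>R m (t + real j * k) x)"
    by (rule regular_mult[OF bounded_bilinear_scaleR _ regular_grad_sq regular_m k0]) simp
  then have r: "regular ?Kr k ?r" by (intro regular_add regular_w1 regular_scale)
  have "regular (8 * (54 * K) * ?Kr) k (\<lambda>j. m (t + real j * k) x \<bullet> ?r j)"
    by (rule regular_mult[OF bounded_bilinear_inner norm_inner_le regular_m r k0])
  then have 1: "regular (8 * (8 * (54 * K) * ?Kr) * (54 * K)) k (\<lambda>j. (m (t + real j * k) x \<bullet> ?r j) *\<^sub>R m (t + real j * k) x)"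
    by (rule regular_mult[OF bounded_bilinear_scaleR _ _ regular_m k0, rotated]) simp
  have 2: "regular (8 * (54 * K) * ?Kr) k (\<lambda>j. cross3 (m (t + real j * k) x) (?r j))"
    by (rule regular_mult[OF bounded_bilinear_cross3 norm_cross3_le regular_m r k0])
  show "regular K_lap k (\<lambda>j. solve_lin \<alpha> (m (t + real j * k) x) (?r j))"
    unfolding solve_lin_def K_lap_def by (intro regular_scale regular_add r 1 2)
  show "laplacian (m (t + real j * k)) x = solve_lin \<alpha> (m (t + real j * k) x) (?r j)" if "j \<le> 3" for j
    using laplacian_eq[OF sample_time[OF that] x] by simp
qed

lemma bdf3_consistent:
  "norm ((1 / k) *\<^sub>R bdf3 (m (t + 3 * k) x) (m (t + 2 * k) x) (m (t + k) x) (m t x) - w 1 (t + 3 * k) x) \<le> 54 * K * k ^ 3"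
proof -
  have T3: "t + 3 * k \<in> {0..T}" "t + 2 * k \<in> {0..T}" "t + k \<in> {0..T}" "t \<in> {0..T}" using t k by auto
  have "norm ((1 / k) *\<^sub>R ((11/6) *\<^sub>R v 0 (t + 3 * k) x - 3 *\<^sub>R v 0 (t + 3 * k - k) x + (3/2) *\<^sub>R v 0 (t + 3 * k - 2 * k) x
      - (1/3) *\<^sub>R v 0 (t + 3 * k - 3 * k) x) - v 1 (t + 3 * k) x) \<le> 54 * K * k ^ 3"
    by (rule bdf3_samples[where f = "\<lambda>q s. v q s x" and T = T, OF _ _ k]) (use vd vK x t k in auto)
  moreover have "t + 3 * k - k = t + 2 * k" "t + 3 * k - 2 * k = t + k" "t + 3 * k - 3 * k = t" by simp_all
  ultimately show ?thesis using v0[OF T3(1) x] v0[OF T3(2) x] v0[OF T3(3) x] v0[OF T3(4) x] v1[OF T3(1) x]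
    by (simp only: bdf3_def)
qed

end

definition exact_torus :: "nat \<Rightarrow> real \<Rightarrow> nat \<Rightarrow> int^'d \<Rightarrow> real^3" where
  "exact_torus N k n = ext N (restrict_grid N (m (real n * k)))"

definition K_cons :: real where
  "K_cons = 54 * K + (54 * K * (7 * (real CARD('d) * B + real CARD('d) * (14 * B))) + (K_lap + 7 * (real CARD('d) * (14 * B))))
     + \<alpha> * (real CARD('d) * (14 * B))
     + \<alpha> * (14 * (7 * (K + 14 * B)) * (real CARD('d) * (54 * K + 7 * (14 * B))) + real CARD('d) * (7 * (K + 14 * B))\<^sup>2 * (54 * K))"

text \<open>The equation at the new time \<open>t + 3 * k\<close> is subtracted. This leaves the
  differences in the time derivative, the cross product, the implicit Laplacian and the gradient
  term; \<open>extr_consistent\<close> compares the extrapolated quantities in the second and the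
  fourth with their exact values at the new time.\<close>

lemma residual_grid:
  assumes N: "N \<ge> 2" and k: "k > 0" and n: "real (n + 3) * k \<le> T" and I: "I \<in> grid N"
    and Uh: "Uh = (\<lambda>I. extr (exact_torus N k (n+2) I) (exact_torus N k (n+1) I) (exact_torus N k n I))"
  shows "norm (Uh I) \<le> 1 + 54 * K * k ^ 3"
    and "norm ((1 / k) *\<^sub>R bdf3 (exact_torus N k (n+3) I) (exact_torus N k (n+2) I) (exact_torus N k (n+1) I) (exact_torus N k n I)
         - (- cross3 (Uh I) (tlap N Uh I) + \<alpha> *\<^sub>R tlap N (exact_torus N k (n+3)) I + \<alpha> *\<^sub>R (tgrad_sq N Uh I *\<^sub>R Uh I)))
        \<le> K_cons * (k^3 + mesh N ^ 4)"
proof -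
  let ?U = "exact_torus N k" and ?d = "real CARD('d)" and ?h = "mesh N"
  define t x where "t = real n * k" and "x = cell_center N I"
  define M G L where "M j = m (t + real j * k) x" and "G i j = partial i (m (t + real j * k)) x"
    and "L j = laplacian (m (t + real j * k)) x" for i j
  have x: "x \<in> unit_cube" unfolding x_def by (rule cell_center_cube[OF I])
  have t: "0 \<le> t" "t + 3 * k \<le> T" using k n by (auto simp: t_def algebra_simps)
  have tj: "real (n + j) * k = t + real j * k" "(real n + real j) * k = t + real j * k" for j
    by (simp_all add: t_def algebra_simps)
  have st: "t + real j * k \<in> {0..T}" if "j \<le> 3" for j by (rule sample_time[OF x k t that])
  have h: "0 < ?h" "?h \<le> 1" using N by (auto simp: mesh_def)
  have h4: "0 \<le> ?h ^ 4" "?h ^ 4 \<le> 1" using h by (auto intro: power_le_one)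
  have k3: "0 \<le> k ^ 3" using k by simp
  have UM: "?U (n + j) I = M j" for j
    by (simp add: exact_torus_def ext_grid[OF I] restrict_grid_def M_def x_def tj)
  note rM = regular_m[OF x k t, folded M_def] and rG = regular_partial[OF x k t, folded G_def]
    and rL = regular_laplacian[OF x k t, folded L_def]
  have UhM: "Uh I = extr (M 2) (M 1) (M 0)" unfolding Uh using UM[of 2] UM[of 1] UM[of 0] by simp
  have dM: "norm (Uh I - M 3) \<le> 54 * K * k ^ 3"
    using extr_consistent[OF rM, of M 0] by (simp add: UhM)
  have M1: "norm (M j) = 1" if "j \<le> 3" for j unfolding M_def by (rule unit[OF st[OF that] x])
  show "norm (Uh I) \<le> 1 + 54 * K * k ^ 3"
    using dM M1[of 3] norm_triangle_ineq[of "Uh I - M 3" "M 3"] by simp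
  define CL where "CL = ?d * (14 * B)"
  have CL: "0 \<le> CL" using B_nonneg by (simp add: CL_def)
  have lU: "norm (tlap N (?U (n + j)) I - L j) \<le> CL * ?h ^ 4" if "j \<le> 3" for j
    using Lap_4_consistent[OF st[OF that] N I] by (simp add: Lap_4_tlap exact_torus_def L_def x_def tj CL_def mult.assoc)
  have Lb: "norm (L j) \<le> ?d * B" if "j \<le> 3" for j unfolding L_def by (rule laplacian_bound[OF st[OF that] x])
  have lUb: "norm (tlap N (?U (n + j)) I) \<le> ?d * B + CL" if "j \<le> 3" for j
  proof -
    have "CL * ?h ^ 4 \<le> CL * 1" using CL h4 by (intro mult_left_mono) auto
    then show ?thesis
      using lU[OF that] Lb[OF that] norm_triangle_ineq[of "tlap N (?U (n + j)) I - L j" "L j"] by simp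
  qed
  have lapUh: "tlap N Uh I = extr (tlap N (?U (n + 2)) I) (tlap N (?U (n + 1)) I) (tlap N (?U (n + 0)) I)"
    unfolding Uh tlap_extr by simp
  have dL: "norm (tlap N Uh I - L 3) \<le> K_lap * k ^ 3 + 7 * (CL * ?h ^ 4)"
    unfolding lapUh by (rule extr_consistent[OF rL, of "\<lambda>j. tlap N (?U (n + j)) I"]) (auto intro: lU)
  have lapUhb: "norm (tlap N Uh I) \<le> 7 * (?d * B + CL)"
    unfolding lapUh by (intro norm_extr_le lUb) auto
  define CG where "CG = 14 * B"
  have CG: "0 \<le> CG" using B_nonneg by (simp add: CG_def)
  have gU: "norm (td1 N i (?U (n + j)) I - G i j) \<le> CG * ?h ^ 4" if "j \<le> 3" for i j
    using D1_4_consistent[OF st[OF that] N I] by (simp add: D1_4_td1 exact_torus_def G_def x_def tj CG_def)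
  have Gb: "norm (G i j) \<le> K" if "j \<le> 3" for i j unfolding G_def by (rule partial_bound[OF st[OF that] x])
  have gUb: "norm (td1 N i (?U (n + j)) I) \<le> K + CG" if "j \<le> 3" for i j
  proof -
    have "CG * ?h ^ 4 \<le> CG * 1" using CG h4 by (intro mult_left_mono) auto
    then show ?thesis
      using gU[OF that, of i] Gb[OF that, of i] norm_triangle_ineq[of "td1 N i (?U (n + j)) I - G i j" "G i j"] by simp
  qed
  have gUh: "td1 N i Uh I = extr (td1 N i (?U (n + 2)) I) (td1 N i (?U (n + 1)) I) (td1 N i (?U (n + 0)) I)" for i
    unfolding Uh td1_extr by simp
  have dG: "norm (G i 3 - td1 N i Uh I) \<le> 54 * K * k ^ 3 + 7 * (CG * ?h ^ 4)" for i
    unfolding gUh norm_minus_commute[of "G i 3"]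
    by (rule extr_consistent[OF rG, of "\<lambda>j. td1 N i (?U (n + j)) I"]) (auto intro: gU)
  have gUhb: "norm (td1 N i Uh I) \<le> 7 * (K + CG)" for i
    unfolding gUh by (intro norm_extr_le gUb) auto
  let ?B = "7 * (K + CG)" and ?\<tau> = "k ^ 3 + ?h ^ 4"
  have \<tau>: "c * k ^ 3 + c' * ?h ^ 4 \<le> (c + c') * ?\<tau>" if "0 \<le> c" "0 \<le> c'" for c c'
  proof -
    have "0 \<le> c * ?h ^ 4" "0 \<le> c' * k ^ 3" using that h4 k3 by auto
    then show ?thesis by (simp add: distrib_left distrib_right)
  qed
  have KL0: "0 \<le> K_lap" using rL by (simp add: regular_def)
  have grad: "norm (grad_sq (m (t + real 3 * k)) x *\<^sub>R M 3 - tgrad_sq N Uh I *\<^sub>R Uh I)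
     \<le> (14 * ?B * (?d * (54 * K + 7 * CG)) + ?d * ?B\<^sup>2 * (54 * K)) * ?\<tau>"
  proof -
    have "norm ((\<Sum>i\<in>UNIV. (norm (G i 3))\<^sup>2) *\<^sub>R M 3 - (\<Sum>i\<in>UNIV. (norm (td1 N i Uh I))\<^sup>2) *\<^sub>R Uh I)
      \<le> 14 * ?B * (\<Sum>i\<in>UNIV. norm (G i 3 - td1 N i Uh I)) + ?d * ?B\<^sup>2 * norm (M 3 - Uh I)"
    proof (rule gradient_term_diff)
      show "norm (G i 3) \<le> ?B" for i using Gb[of 3 i] K_nonneg CG by simp
      show "norm (M 3) \<le> 7" using M1[of 3] by simp
    qed (use gUhb K_nonneg CG in auto)
    also have "\<dots> \<le> 14 * ?B * (?d * ((54 * K + 7 * CG) * ?\<tau>)) + ?d * ?B\<^sup>2 * (54 * K * ?\<tau>)"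
    proof (intro add_mono mult_left_mono)
      have "norm (G i 3 - td1 N i Uh I) \<le> (54 * K + 7 * CG) * ?\<tau>" for i
        using dG[of i] \<tau>[of "54 * K" "7 * CG"] K_nonneg CG by (simp add: mult.assoc)
      then have "(\<Sum>i\<in>(UNIV :: 'd set). norm (G i 3 - td1 N i Uh I)) \<le> of_nat (card (UNIV :: 'd set)) * ((54 * K + 7 * CG) * ?\<tau>)"
        by (intro sum_bounded_above) auto
      then show "(\<Sum>i\<in>UNIV. norm (G i 3 - td1 N i Uh I)) \<le> ?d * ((54 * K + 7 * CG) * ?\<tau>)" by simp
      show "norm (M 3 - Uh I) \<le> 54 * K * ?\<tau>"
        using dM \<tau>[of "54 * K" 0] K_nonneg by (simp add: norm_minus_commute)
    qed (use K_nonneg CG in auto)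
    also have "\<dots> = (14 * ?B * (?d * (54 * K + 7 * CG)) + ?d * ?B\<^sup>2 * (54 * K)) * ?\<tau>"
      by (simp only: distrib_right mult.assoc)
    finally show ?thesis by (simp only: grad_sq_def tgrad_sq_def G_def)
  qed
  have cross: "norm (cross3 (Uh I) (tlap N Uh I) - cross3 (M 3) (L 3))
     \<le> (54 * K * (7 * (?d * B + CL)) + (K_lap + 7 * CL)) * ?\<tau>"
  proof -
    have "cross3 (Uh I) (tlap N Uh I) - cross3 (M 3) (L 3) = cross3 (Uh I - M 3) (tlap N Uh I) + cross3 (M 3) (tlap N Uh I - L 3)"
      by (simp add: Cross3.left_diff_distrib Cross3.right_diff_distrib)
    also have "norm \<dots> \<le> norm (Uh I - M 3) * norm (tlap N Uh I) + norm (M 3) * norm (tlap N Uh I - L 3)"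
      by (intro order_trans[OF norm_triangle_ineq add_mono] norm_cross3_le)
    also have "\<dots> \<le> (54 * K * ?\<tau>) * (7 * (?d * B + CL)) + 1 * ((K_lap + 7 * CL) * ?\<tau>)"
    proof (intro add_mono mult_mono lapUhb)
      show "norm (Uh I - M 3) \<le> 54 * K * ?\<tau>" using dM \<tau>[of "54 * K" 0] K_nonneg by simp
      show "norm (tlap N Uh I - L 3) \<le> (K_lap + 7 * CL) * ?\<tau>"
        using dL \<tau>[of K_lap "7 * CL"] KL0 CL by (simp add: mult.assoc)
    qed (use K_nonneg M1[of 3] k3 h4 in auto)
    also have "\<dots> = (54 * K * (7 * (?d * B + CL)) + (K_lap + 7 * CL)) * ?\<tau>"
    proof -
      have "(a * e) * b + 1 * (c * e) = (a * b + c) * e" for a b c e :: real by (simp add: distrib_right)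
      then show ?thesis .
    qed
    finally show ?thesis .
  qed
  have lap: "norm (L 3 - tlap N (?U (n + 3)) I) \<le> CL * ?\<tau>"
    using lU[of 3] \<tau>[of 0 CL] CL by (simp add: norm_minus_commute)
  have bdf: "norm ((1 / k) *\<^sub>R bdf3 (M 3) (M 2) (M 1) (M 0) - w 1 (t + real 3 * k) x) \<le> 54 * K * ?\<tau>"
    using bdf3_consistent[OF x k t] \<tau>[of "54 * K" 0] K_nonneg by (simp add: M_def)
  have eq: "w 1 (t + real 3 * k) x = - cross3 (M 3) (L 3) + \<alpha> *\<^sub>R (L 3 + grad_sq (m (t + real 3 * k)) x *\<^sub>R M 3)"
    unfolding M_def L_def by (rule equation[OF st x]) simp
  let ?R1 = "(1 / k) *\<^sub>R bdf3 (M 3) (M 2) (M 1) (M 0) - w 1 (t + real 3 * k) x"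
    and ?R2 = "cross3 (Uh I) (tlap N Uh I) - cross3 (M 3) (L 3)"
    and ?R3 = "L 3 - tlap N (?U (n + 3)) I"
    and ?R4 = "grad_sq (m (t + real 3 * k)) x *\<^sub>R M 3 - tgrad_sq N Uh I *\<^sub>R Uh I"
  have "(1 / k) *\<^sub>R bdf3 (?U (n+3) I) (?U (n+2) I) (?U (n+1) I) (?U n I)
         - (- cross3 (Uh I) (tlap N Uh I) + \<alpha> *\<^sub>R tlap N (?U (n+3)) I + \<alpha> *\<^sub>R (tgrad_sq N Uh I *\<^sub>R Uh I))
     = ?R1 + ?R2 + \<alpha> *\<^sub>R ?R3 + \<alpha> *\<^sub>R ?R4"
    unfolding UM[of 3] UM[of 2] UM[of 1] UM[of 0, unfolded add_0_right] eq
    by (simp add: scaleR_diff_right scaleR_add_right del: scaleR_scaleR)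
  also have "norm \<dots> \<le> norm ?R1 + norm ?R2 + norm (\<alpha> *\<^sub>R ?R3) + norm (\<alpha> *\<^sub>R ?R4)"
    by (intro order_trans[OF norm_triangle_ineq] add_mono order_refl)
  also have "\<dots> \<le> 54 * K * ?\<tau> + (54 * K * (7 * (?d * B + CL)) + (K_lap + 7 * CL)) * ?\<tau> + \<alpha> * (CL * ?\<tau>)
     + \<alpha> * ((14 * ?B * (?d * (54 * K + 7 * CG)) + ?d * ?B\<^sup>2 * (54 * K)) * ?\<tau>)"
  proof (intro add_mono bdf cross)
    show "norm (\<alpha> *\<^sub>R ?R3) \<le> \<alpha> * (CL * ?\<tau>)"
      unfolding norm_scaleR using \<alpha> lap by (simp only: abs_of_pos mult_left_mono)
    show "norm (\<alpha> *\<^sub>R ?R4) \<le> \<alpha> * ((14 * ?B * (?d * (54 * K + 7 * CG)) + ?d * ?B\<^sup>2 * (54 * K)) * ?\<tau>)"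
      unfolding norm_scaleR abs_of_pos[OF \<alpha>] using \<alpha> by (intro mult_left_mono grad) auto
  qed
  also have "\<dots> = K_cons * ?\<tau>"
  proof -
    have "a * e + b * e + \<alpha> * (c * e) + \<alpha> * (d * e) = (a + b + \<alpha> * c + \<alpha> * d) * e" for a b c d e :: real
      by (simp add: distrib_right)
    then show ?thesis unfolding K_cons_def CL_def CG_def .
  qed
  finally show "norm ((1 / k) *\<^sub>R bdf3 (?U (n+3) I) (?U (n+2) I) (?U (n+1) I) (?U n I)
         - (- cross3 (Uh I) (tlap N Uh I) + \<alpha> *\<^sub>R tlap N (?U (n+3)) I + \<alpha> *\<^sub>R (tgrad_sq N Uh I *\<^sub>R Uh I)))
        \<le> K_cons * ?\<tau>" .
qed

text \<open>Evenness carries the estimates from the grid to all indices: field, \<open>tlap\<close>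
  and \<open>tgrad_sq\<close> take the same values at I and at its grid representative. Only
  \<open>fwd\<close> does not, and becomes a difference with either the next or the previous cell.
  15 B = 14 B + B: stencil error and Laplacian.\<close>

lemma exact_consistent:
  assumes N: "N \<ge> 2" and k: "k > 0" "k \<le> 1"
  shows "consistent N k T \<alpha> (54 * K + K_cons + real CARD('d) * (15 * B) + K) (exact_torus N k)"
proof -
  have N1: "N \<ge> 1" using N by simp
  let ?U = "exact_torus N k" and ?C = "54 * K + K_cons + real CARD('d) * (15 * B) + K"
  have KL0: "0 \<le> K_lap"
    using K_nonneg by (simp add: K_lap_def K_grad_def)
  have Kc: "0 \<le> K_cons"
    using K_nonneg B_nonneg \<alpha> KL0 unfolding K_cons_def by (intro add_nonneg_nonneg mult_nonneg_nonneg) auto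
  have dB: "0 \<le> real CARD('d) * (15 * B)" using B_nonneg by simp
  have per: "periodic N (?U n)" for n unfolding exact_torus_def by (rule ext_periodic)
  have reflU: "?U n (refl_idx N I) = ?U n I" for n I
    by (simp add: exact_torus_def ext_refl_idx refl_idx_id refl_idx_grid[OF N1])
  have level: "norm (?U n I) = 1 \<and> norm (tlap N (?U n) I) \<le> ?C \<and> (\<forall>i. norm (fwd N i (?U n) I) \<le> ?C)"
    if n: "real n * k \<le> T" for n I
  proof -
    define t J where "t = real n * k" and "J = refl_idx N I"
    have t: "t \<in> {0..T}" using n k by (simp add: t_def)
    have J: "J \<in> grid N" unfolding J_def by (rule refl_idx_grid[OF N1])
    have x: "cell_center N J \<in> unit_cube" by (rule cell_center_cube[OF J])
    have UJ: "?U n I = m t (cell_center N J)"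
      by (simp add: exact_torus_def ext_refl_idx restrict_grid_def t_def J_def)
    have 1: "norm (?U n I) = 1" unfolding UJ by (rule unit[OF t x])
    have h: "0 < mesh N" "mesh N \<le> 1" using N by (auto simp: mesh_def)
    have "tlap N (?U n) I = Lap_4 N (restrict_grid N (m t)) J"
      unfolding Lap_4_tlap J_def exact_torus_def t_def tlap_refl[OF N1] ..
    moreover have "norm (Lap_4 N (restrict_grid N (m t)) J) \<le> real CARD('d) * (15 * B)"
    proof -
      let ?L = "laplacian (m t) (cell_center N J)"
      have "real CARD('d) * (14 * B * mesh N ^ 4) \<le> real CARD('d) * (14 * B * 1)"
        using h B_nonneg by (intro mult_left_mono power_le_one) auto
      moreover have "norm (Lap_4 N (restrict_grid N (m t)) J) \<le> norm (Lap_4 N (restrict_grid N (m t)) J - ?L) + norm ?L"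
        by (rule order_trans[OF _ norm_triangle_ineq]) simp
      moreover have "real CARD('d) * (15 * B) = real CARD('d) * (14 * B * 1) + real CARD('d) * B" by (simp add: algebra_simps)
      ultimately show ?thesis using Lap_4_consistent[OF t N J] laplacian_bound[OF t x] by linarith
    qed
    ultimately have 2: "norm (tlap N (?U n) I) \<le> ?C" using K_nonneg Kc dB by simp
    have 3: "norm (fwd N i (?U n) I) \<le> ?C" for i
    proof -
      have nb: "norm (?U n (J + axis i a) - ?U n I) \<le> K * mesh N" if "\<bar>a\<bar> \<le> 1" for a
        unfolding UJ unfolding exact_torus_def t_def[symmetric]
        by (rule ext_neighbour_diff[OF N J that C_space_mono[OF C2[OF t]] partial_bound[OF t]]) auto
      from ext_axis_cases[OF N1, of "restrict_grid N (m t)" I i]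
      have "?U n (I + axis i 1) = ?U n (J + axis i 1) \<or> ?U n (I + axis i 1) = ?U n (J + axis i (- 1))"
        unfolding exact_torus_def t_def[symmetric] J_def by (elim disjE) (force dest: spec[of _ "1::int"] spec[of _ "-1::int"])+
      then have "norm (?U n (I + axis i 1) - ?U n I) \<le> K * mesh N" using nb[of 1] nb[of "-1"] by auto
      then have "norm (fwd N i (?U n) I) \<le> (1 / mesh N) * (K * mesh N)"
        unfolding fwd_def norm_scaleR using h by (intro mult_mono) auto
      also have "\<dots> = K" using h by simp
      finally show ?thesis using K_nonneg Kc dB by linarith
    qed
    show ?thesis using 1 2 3 by blast
  qed
  have step: "norm (extr (?U (n+2) I) (?U (n+1) I) (?U n I)) \<le> 1 + ?C * k \<and>
       norm ((1 / k) *\<^sub>R bdf3 (?U (n+3) I) (?U (n+2) I) (?U (n+1) I) (?U n I)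
         - (- cross3 (extr (?U (n+2) I) (?U (n+1) I) (?U n I)) (tlap N (\<lambda>I. extr (?U (n+2) I) (?U (n+1) I) (?U n I)) I)
            + \<alpha> *\<^sub>R tlap N (?U (n+3)) I
            + \<alpha> *\<^sub>R (tgrad_sq N (\<lambda>I. extr (?U (n+2) I) (?U (n+1) I) (?U n I)) I *\<^sub>R extr (?U (n+2) I) (?U (n+1) I) (?U n I))))
        \<le> ?C * (k^3 + mesh N ^ 4)" if n: "real (n + 3) * k \<le> T" for n I
  proof -
    define J where "J = refl_idx N I"
    have J: "J \<in> grid N" unfolding J_def by (rule refl_idx_grid[OF N1])
    define Uh where "Uh = (\<lambda>I. extr (?U (n+2) I) (?U (n+1) I) (?U n I))"
    have Uhe: "Uh = ext N (\<lambda>I. extr (restrict_grid N (m (real (n+2) * k)) I) (restrict_grid N (m (real (n+1) * k)) I) (restrict_grid N (m (real n * k)) I))"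
      unfolding Uh_def exact_torus_def ext_extr ..
    have r1: "Uh J = Uh I" unfolding Uh_def J_def reflU ..
    have r2: "tlap N Uh J = tlap N Uh I" unfolding Uhe J_def by (rule tlap_refl[OF N1])
    have r3: "tgrad_sq N Uh J = tgrad_sq N Uh I" unfolding Uhe J_def by (rule tgrad_sq_refl[OF N1])
    have r4: "tlap N (?U (n+3)) J = tlap N (?U (n+3)) I" unfolding exact_torus_def J_def by (rule tlap_refl[OF N1])
    have r5: "?U j J = ?U j I" for j unfolding J_def by (rule reflU)
    note R = residual_grid[OF N k(1) n J Uh_def, unfolded r1 r2 r3 r4 r5]
    have "54 * K * k ^ 3 \<le> ?C * k"
    proof -
      have "k ^ 3 \<le> k ^ 1" using k by (intro power_decreasing) auto
      then have "54 * K * k ^ 3 \<le> 54 * K * k" using K_nonneg by (intro mult_left_mono) auto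
      also have "\<dots> \<le> ?C * k" using K_nonneg Kc dB k by (intro mult_right_mono) auto
      finally show ?thesis .
    qed
    moreover have "K_cons * (k^3 + mesh N ^ 4) \<le> ?C * (k^3 + mesh N ^ 4)"
      using K_nonneg Kc dB k by (intro mult_right_mono) auto
    ultimately show ?thesis using R unfolding Uh_def by linarith
  qed
  show ?thesis unfolding consistent_def using per level step by blast
qed

end

section \<open>From the scheme on the grid to the torus\<close>

lemma scheme_on_torus:
  fixes m mt :: "nat \<Rightarrow> int^'d \<Rightarrow> real^3"
  assumes N: "N \<ge> 1" and sch: "BDF3_solution N k \<alpha> m mt"
    and unit: "\<And>n I. n \<le> 2 \<Longrightarrow> I \<in> grid N \<Longrightarrow> norm (m n I) = 1"
  shows "torus_scheme N k \<alpha> (\<lambda>n. ext N (m n)) (\<lambda>n. ext N (mt n))"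
proof -
  \<comment> \<open>At the starting levels no projection takes place; there the relation holds
    because m = mt has length 1.\<close>
  have M: "m n J = (1 / norm (mt n J)) *\<^sub>R mt n J" if J: "J \<in> grid N" for n J
  proof (cases "n \<le> 2")
    case True
    then have "mt n J = m n J" using sch J by (simp add: BDF3_solution_def)
    then show ?thesis using unit[OF True J] by simp
  next
    case False
    then obtain l where "n = l + 3" using le_Suc_ex[of 3 n] by (auto simp: add.commute)
    then show ?thesis using sch J by (simp add: BDF3_solution_def)
  qed
  have "(1 / k) *\<^sub>R bdf3 (ext N (mt (n+3)) I) (ext N (mt (n+2)) I) (ext N (mt (n+1)) I) (ext N (mt n) I)
         = - cross3 (extr (ext N (m (n+2)) I) (ext N (m (n+1)) I) (ext N (m n) I)) (tlap N (\<lambda>I. extr (ext N (mt (n+2)) I) (ext N (mt (n+1)) I) (ext N (mt n) I)) I)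
            + \<alpha> *\<^sub>R tlap N (ext N (mt (n+3))) I
            + \<alpha> *\<^sub>R (tgrad_sq N (\<lambda>I. extr (ext N (m (n+2)) I) (ext N (m (n+1)) I) (ext N (m n) I)) I *\<^sub>R extr (ext N (m (n+2)) I) (ext N (m (n+1)) I) (ext N (m n) I))"
    for n I
  proof -
    define J where "J = refl_idx N I"
    have J: "J \<in> grid N" unfolding J_def by (rule refl_idx_grid[OF N])
    have ex: "ext N (extrap f n) = (\<lambda>I. extr (ext N (f (n+2)) I) (ext N (f (n+1)) I) (ext N (f n) I))" for f :: "nat \<Rightarrow> int^'d \<Rightarrow> real^3"
      by (simp add: ext_def extrap_def extr_def fun_eq_iff)
    have exJ: "extrap f n J = extr (ext N (f (n+2)) I) (ext N (f (n+1)) I) (ext N (f n) I)" for f :: "nat \<Rightarrow> int^'d \<Rightarrow> real^3"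
      by (simp add: ext_refl_idx extrap_def extr_def J_def)
    have "(1 / k) *\<^sub>R ((11/6) *\<^sub>R mt (n + 3) J - 3 *\<^sub>R mt (n + 2) J + (3/2) *\<^sub>R mt (n + 1) J - (1/3) *\<^sub>R mt n J)
        = - cross3 (extrap m n J) (Lap_4 N (extrap mt n) J) + \<alpha> *\<^sub>R Lap_4 N (mt (n + 3)) J
          + (\<alpha> * grad_sq_4 N (extrap m n) J) *\<^sub>R extrap m n J"
      using sch J by (simp add: BDF3_solution_def)
    moreover have "Lap_4 N f J = tlap N (ext N f) I" for f :: "int^'d \<Rightarrow> real^3"
      unfolding Lap_4_tlap J_def by (rule tlap_refl[OF N])
    moreover have "grad_sq_4 N f J = tgrad_sq N (ext N f) I" for f :: "int^'d \<Rightarrow> real^3"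
      unfolding grad_sq_4_tgrad J_def by (rule tgrad_sq_refl[OF N])
    moreover have "mt j J = ext N (mt j) I" for j by (simp add: ext_refl_idx J_def)
    ultimately show ?thesis by (simp only: bdf3_def exJ ex scaleR_scaleR)
  qed
  moreover have "ext N (m n) I = (1 / norm (ext N (mt n) I)) *\<^sub>R ext N (mt n) I" for n I
    unfolding ext_refl_idx by (rule M[OF refl_idx_grid[OF N]])
  ultimately show ?thesis unfolding torus_scheme_def using ext_periodic by blast
qed

lemma error_le_h1:
  fixes u :: "real \<Rightarrow> real^'d \<Rightarrow> real^3"
  assumes N: "N \<ge> 1"
  shows "error N k u m n \<le> 2 * sqrt (h1 N (\<lambda>I. ext N (restrict_grid N (u (real n * k))) I - ext N (m n) I))"
proof -
  define e where "e = (\<lambda>I. restrict_grid N (u (real n * k)) I - m n I)"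
  have ee: "ext N e = (\<lambda>I. ext N (restrict_grid N (u (real n * k))) I - ext N (m n) I)"
    by (simp add: e_def ext_def fun_eq_iff)
  have "grid_norm N e \<le> sqrt (h1 N (ext N e))"
    using grid_norm_le[OF N, of e] by (rule order_trans) (intro real_sqrt_le_mono tsum_le_h1)
  moreover have "grad_norm N e \<le> sqrt (h1 N (ext N e))"
    using grad_norm_le[OF N, of e] by (rule order_trans) (auto intro!: real_sqrt_le_mono tsum_nonneg simp: h1_def)
  ultimately show ?thesis unfolding error_def ee[symmetric] e_def[symmetric] Let_def by simp
qed

theorem theorem2p1:
  fixes m_e :: "real \<Rightarrow> real^'d \<Rightarrow> real^3" and m_e0 :: "real^'d \<Rightarrow> real^3"
    and T \<alpha> C0 C_init :: real
  assumes dim: "CARD('d) \<in> {1, 2, 3}"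
    and T: "T > 0" and \<alpha>: "\<alpha> > 7" and C0: "C0 > 0" and C_init: "C_init > 0"
    and regularity: "C_time T 4 0 m_e" "C_time T 3 1 m_e" "Linf_time T 6 m_e"
    and unit_length: "\<forall>t\<in>{0..T}. \<forall>x\<in>unit_cube. norm (m_e t x) = 1"
    and exact: "LLG_solution T \<alpha> m_e0 m_e"
  shows "\<exists>C>0. \<exists>h0>0. \<exists>k0>0. \<forall>N\<ge>1. \<forall>k>0. \<forall>m mt.
           mesh N < h0 \<longrightarrow> k < k0 \<longrightarrow> k \<le> C0 * mesh N \<longrightarrow>
           BDF3_solution N k \<alpha> m mt \<longrightarrow>
           (\<forall>l\<le>2. \<forall>I\<in>grid N. m l I = restrict_grid N (m_e (real l * k)) I) \<longrightarrow>
           (\<forall>l\<le>2. error N k m_e m l \<le> C_init * (k ^ 3 + mesh N ^ 4)) \<longrightarrow>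
           (\<forall>n\<ge>3. int n \<le> \<lfloor>T / k\<rfloor> \<longrightarrow> error N k m_e m n \<le> C * (k ^ 3 + mesh N ^ 4))"
proof -
  obtain v Kv where v: "\<forall>t\<in>{0..T}. \<forall>x\<in>unit_cube. v 0 t x = m_e t x"
    "\<forall>q<4. \<forall>is t. length is \<le> 0 \<longrightarrow> t \<in> {0..T} \<longrightarrow> (\<forall>x\<in>unit_cube.
       ((\<lambda>s. partials is (v q s) x) has_vector_derivative partials is (v (Suc q) t) x) (at t within {0..T}))"
    "\<forall>q\<le>4. \<forall>is t. length is \<le> 0 \<longrightarrow> t \<in> {0..T} \<longrightarrow> (\<forall>x\<in>unit_cube. norm (partials is (v q t) x) \<le> Kv)"
    using C_time_chain[OF regularity(1) T] by (elim exE conjE) (rule that)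
  obtain w Kw where w: "\<forall>t\<in>{0..T}. \<forall>x\<in>unit_cube. w 0 t x = m_e t x" "\<forall>q\<le>3. \<forall>t\<in>{0..T}. C_space 1 (w q t)"
    "\<forall>q<3. \<forall>is t. length is \<le> 1 \<longrightarrow> t \<in> {0..T} \<longrightarrow> (\<forall>x\<in>unit_cube.
       ((\<lambda>s. partials is (w q s) x) has_vector_derivative partials is (w (Suc q) t) x) (at t within {0..T}))"
    "\<forall>q\<le>3. \<forall>is t. length is \<le> 1 \<longrightarrow> t \<in> {0..T} \<longrightarrow> (\<forall>x\<in>unit_cube. norm (partials is (w q t) x) \<le> Kw)"
    using C_time_chain[OF regularity(2) T] by (elim exE conjE) (rule that)
  obtain B where B: "AE t in lebesgue. t \<in> {0..T} \<longrightarrow> C_space 6 (m_e t) \<and> C_norm 6 (m_e t) \<le> B"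
    using regularity(3) unfolding Linf_time_def by (elim conjE exE) (rule that)
  interpret S: regular_solution m_e m_e0 T \<alpha> B w v "max Kv Kw"
  proof unfold_locales
    show "\<alpha> > 0" using \<alpha> by simp
    show "((\<lambda>s. v q s x) has_vector_derivative v (Suc q) t x) (at t within {0..T})"
      if "q < 4" "t \<in> {0..T}" "x \<in> unit_cube" for q t x
      using v(2)[rule_format, of q "[]" t x] that by simp
    show "norm (v q t x) \<le> max Kv Kw" if "q \<le> 4" "t \<in> {0..T}" "x \<in> unit_cube" for q t x
      using v(3)[rule_format, of q "[]" t x] that by simp
    show "norm (partials is (w q t) x) \<le> max Kv Kw"
      if "q \<le> 3" "length is \<le> 1" "t \<in> {0..T}" "x \<in> unit_cube" for q "is" t x
      using w(4)[rule_format, of q "is" t x] that by simp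
  qed (use T unit_length exact v(1) w(1-3) B in blast)+
  define K' where "K' = 54 * max Kv Kw + S.K_cons + real CARD('d) * (15 * B) + max Kv Kw"
  have cons: "consistent N k T \<alpha> K' (S.exact_torus N k)" if "N \<ge> 2" "k > 0" "k \<le> 1" for N k
    unfolding K'_def by (rule S.exact_consistent[OF that])
  have "CARD('d) \<le> 3" using dim by auto
  \<comment> \<open>\<open>torus_convergence\<close> asks for a nonnegative constant, and
    \<open>consistent\<close> is monotone in it for k > 0.\<close>
  moreover have "0 \<le> max K' 0" by simp
  ultimately obtain C h0 k0 where C: "C > 0" "h0 > 0" "k0 > 0" and
    conv: "\<forall>N\<ge>1. \<forall>k>0. \<forall>(U :: nat \<Rightarrow> int^'d \<Rightarrow> real^3) M V.
    mesh N < h0 \<longrightarrow> k < k0 \<longrightarrow> k \<le> C0 * mesh N \<longrightarrow> consistent N k T \<alpha> (max K' 0) U \<longrightarrow> torus_scheme N k \<alpha> M V \<longrightarrow>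
    (\<forall>n\<le>2. V n = U n) \<longrightarrow>
    (\<forall>n. real n * k \<le> T \<longrightarrow> h1 N (\<lambda>I. U n I - M n I) \<le> C * (k^3 + mesh N ^ 4)\<^sup>2)"
    using torus_convergence[OF _ \<alpha> _ C0 T, of "max K' 0", where 'd = 'd] by auto
  have cons': "consistent N k T \<alpha> (max K' 0) (S.exact_torus N k)" if "N \<ge> 2" "k > 0" "k \<le> 1" for N k
  proof -
    have le: "K' * a \<le> max K' 0 * a" if "0 \<le> a" for a using that by (intro mult_right_mono) auto
    show ?thesis using cons[OF that] that(2) le[of k] le[of "k^3 + mesh N ^ 4"]
      unfolding consistent_def by (smt (verit) mesh_nonneg zero_le_power)
  qed
  \<comment> \<open>The thresholds are lowered to 1: a mesh size below 1 excludes N = 1, so that the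
    stencil estimates for N >= 2 apply, and \<open>exact_consistent\<close> is stated for k <=
    1.\<close>
  have main: "error N k m_e m n \<le> 2 * sqrt C * (k ^ 3 + mesh N ^ 4)"
    if N: "N \<ge> 1" and k: "k > 0" "k < min k0 1" "k \<le> C0 * mesh N" and h: "mesh N < min h0 1"
      and sch: "BDF3_solution N k \<alpha> m mt" and init: "\<forall>l\<le>2. \<forall>I\<in>grid N. m l I = restrict_grid N (m_e (real l * k)) I"
      and n: "n \<ge> 3" "int n \<le> \<lfloor>T / k\<rfloor>" for N k n and m mt :: "nat \<Rightarrow> int^'d \<Rightarrow> real^3"
  proof -
    have N2: "N \<ge> 2"
    proof (rule ccontr)
      assume "\<not> N \<ge> 2"
      then have "N = 1" using N by simp
      then show False using h by (simp add: mesh_def)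
    qed
    have "real n \<le> T / k" using n(2) by (simp add: le_floor_iff)
    then have nT: "real n * k \<le> T" using k by (simp add: pos_le_divide_eq)
    have lT: "real l * k \<le> T" if "l \<le> 2" for l
    proof -
      have "real l * k \<le> real n * k" using that n k by (intro mult_right_mono) auto
      then show ?thesis using nT by simp
    qed
    have unit2: "norm (m l I) = 1" if "l \<le> 2" "I \<in> grid N" for l I
    proof -
      have "real l * k \<in> {0..T}" using lT[OF that(1)] k by simp
      then show ?thesis using init that unit_length cell_center_cube[OF that(2)] by (simp add: restrict_grid_def)
    qed
    have ts: "torus_scheme N k \<alpha> (\<lambda>n. ext N (m n)) (\<lambda>n. ext N (mt n))"
      by (rule scheme_on_torus[OF N sch unit2])
    have "ext N (mt l) = S.exact_torus N k l" if "l \<le> 2" for l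
    proof
      fix I :: "int^'d"
      have J: "refl_idx N I \<in> grid N" by (rule refl_idx_grid[OF N])
      have "mt l (refl_idx N I) = m l (refl_idx N I)" using sch that J by (simp add: BDF3_solution_def)
      then show "ext N (mt l) I = S.exact_torus N k l I"
        using init that J by (simp add: S.exact_torus_def ext_refl_idx)
    qed
    then have "h1 N (\<lambda>I. S.exact_torus N k n I - ext N (m n) I) \<le> C * (k^3 + mesh N ^ 4)\<^sup>2"
      using conv[rule_format, OF N k(1) _ _ k(3) cons'[OF N2 k(1)] ts _ nT] k(2) h by simp
    then have "sqrt (h1 N (\<lambda>I. S.exact_torus N k n I - ext N (m n) I)) \<le> sqrt (C * (k^3 + mesh N ^ 4)\<^sup>2)"
      by (rule real_sqrt_le_mono)
    also have "\<dots> = sqrt C * (k^3 + mesh N ^ 4)" using k by (simp add: real_sqrt_mult)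
    finally show ?thesis using error_le_h1[OF N, of k m_e m n] unfolding S.exact_torus_def by linarith
  qed
  have "2 * sqrt C > 0" "min h0 1 > 0" "min k0 1 > 0" using C by auto
  with main show ?thesis by (intro exI[of _ "2 * sqrt C"] exI[of _ "min h0 1"] exI[of _ "min k0 1"]) blast
qed

end
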